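(* Let $D$ be a Dedekind domain that is not a field and let $M$ be a finitely generated $D$-module. Put $T=\tau(M)$ and $r=\operatorname{rank}_D M$. For every nonzero prime ideal $\mathfrak p$ in the support of $T$, write $$T_{\mathfrak p}\cong\bigoplus_{j=1}^{m_{\mathfrak p}}D/\mathfrak p^{\lambda_{\mathfrak p j}},\qquad 1\le\lambda_{\mathfrak p1}\le\cdots\le\lambda_{\mathfrak p m_{\mathfrak p}}.$$ Then: (i) $M$ is C4 if and only if $r\le1$ and, for every such $\mathfrak p$, all the exponents $\lambda_{\mathfrak p j}$ are equal; equivalently, $r\le 1$ and every primary component $T_{\mathfrak p}$ is homocyclic. (ii) $M$ is C4$^*$ if and only if $r\le1$ and, for every such $\mathfrak p$, either $m_{\mathfrak p}=1$ or $\lambda_{\mathfrak p1}=\cdots=\lambda_{\mathfrak p m_{\mathfrak p}}=1$; equivalently, $r\le 1$ and every primary component is cyclic or semisimple. (iii) Every finitely generated $D$-module is semi-weak-CS. (iv) $M$ is strongly C4$^*$ if and only if it is C4$^*$, and hence exactly under the criterion in (ii).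
   Context: $\tau(M)=\{x\in M: xd=0\text{ for some }0\ne d\in D\}$ is the torsion submodule, $\operatorname{rank}_D M=\dim_K(K\otimes_D M)$ with $K$ the fraction field of $D$, and $T_{\mathfrak p}$ is the $\mathfrak p$-primary component of the finite-length module $T$. A $\mathfrak p$-primary module is homocyclic if it is a direct sum of copies of $D/\mathfrak p^{\lambda}$ for a single $\lambda$. A module $M$ is a C4-module if, whenever $M=A\oplus B$ (internal direct sum) and $f:A\to B$ is a homomorphism such that $\ker f$ is a direct summand of $A$, the image $\operatorname{Im} f$ is a direct summand of $B$. A module is C4$^*$ if every submodule of it is a C4-module. For a module $M$, $\mathcal S(M)$ is the set of triples $(X,Y,\varphi)$ where $X,Y$ are semisimple direct summands of $M$ with $X\cap Y=0$ and $\varphi:X\to Y$ is an isomorphism. It is partially ordered by $(X,Y,\varphi)\preccurlyeq(X',Y',\varphi')$ iff $X\le X'$, $Y\le Y'$ and $\varphi'|_X=\varphi$. For a chain $\mathcal C\subseteq\mathcal S(M)$, put $X_{\mathcal C}=\bigcup_{(X,Y,\varphi)\in\mathcal C}X$ and $Y_{\mathcal C}=\bigcup_{(X,Y,\varphi)\in\mathcal C}Y$. The module $M$ is semi-weak-CS if for every chain $\mathcal C\subseteq\mathcal S(M)$ there are direct summands $A,B$ of $M$ such that $X_{\mathcal C}$ is an essential submodule of $A$ and $Y_{\mathcal C}$ is an essential submodule of $B$. A module is strongly C4$^*$ if it is both C4$^*$ and semi-weak-CS. *)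

theory Defs
  imports
    "HOL-Algebra.Algebra"
    "Jordan_Normal_Form.Missing_VectorSpace"
begin

text \<open>
  The unqualified name \<open>submodule\<close> is ambiguous between \<open>HOL-Algebra\<close> and the AFP entry
  \<open>VectorSpace\<close>; \<open>Module.submodule H D M\<close> below is the \<open>HOL-Algebra\<close> one. A submodule
  \<open>H\<close>, regarded as a module in its own right, is \<open>M\<lparr>carrier := H\<rparr>\<close>.
\<close>

subsection \<open>Fraction fields and Dedekind domains\<close>

definition frac_class :: "('a, 'm) ring_scheme \<Rightarrow> 'a \<Rightarrow> 'a \<Rightarrow> ('a \<times> 'a) set" where
  "frac_class D a b =
     {(c, d). c \<in> carrier D \<and> d \<in> carrier D - {\<zero>\<^bsub>D\<^esub>} \<and> a \<otimes>\<^bsub>D\<^esub> d = c \<otimes>\<^bsub>D\<^esub> b}"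

definition fraction_field :: "('a, 'm) ring_scheme \<Rightarrow> ('a \<times> 'a) set ring" where
  "fraction_field D = \<lparr>
     carrier = {frac_class D a b | a b. a \<in> carrier D \<and> b \<in> carrier D - {\<zero>\<^bsub>D\<^esub>}},
     monoid.mult = (\<lambda>A B. \<Union>(a, b)\<in>A. \<Union>(c, d)\<in>B. frac_class D (a \<otimes>\<^bsub>D\<^esub> c) (b \<otimes>\<^bsub>D\<^esub> d)),
     monoid.one = frac_class D \<one>\<^bsub>D\<^esub> \<one>\<^bsub>D\<^esub>,
     ring.zero = frac_class D \<zero>\<^bsub>D\<^esub> \<one>\<^bsub>D\<^esub>,
     ring.add = (\<lambda>A B. \<Union>(a, b)\<in>A. \<Union>(c, d)\<in>B.
              frac_class D (a \<otimes>\<^bsub>D\<^esub> d \<oplus>\<^bsub>D\<^esub> c \<otimes>\<^bsub>D\<^esub> b) (b \<otimes>\<^bsub>D\<^esub> d))\<rparr>"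

definition frac_embed :: "('a, 'm) ring_scheme \<Rightarrow> 'a \<Rightarrow> ('a \<times> 'a) set" where
  "frac_embed D a = frac_class D a \<one>\<^bsub>D\<^esub>"

text \<open>
  Polynomials are coefficient lists with the leading coefficient first, so the nonempty \<open>p\<close> with
  \<open>lead_coeff p = \<one>\<close> are the monic ones.
\<close>

definition integral_over :: "('k, 'm) ring_scheme \<Rightarrow> 'k set \<Rightarrow> 'k \<Rightarrow> bool" where
  "integral_over K A x \<longleftrightarrow>
     (\<exists>p. polynomial\<^bsub>K\<^esub> A p \<and> p \<noteq> [] \<and> lead_coeff p = \<one>\<^bsub>K\<^esub> \<and> ring.eval K p x = \<zero>\<^bsub>K\<^esub>)"

definition integrally_closed :: "('a, 'm) ring_scheme \<Rightarrow> bool" where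
  "integrally_closed D \<longleftrightarrow>
     (\<forall>x \<in> carrier (fraction_field D).
        integral_over (fraction_field D) (frac_embed D ` carrier D) x \<longrightarrow>
        x \<in> frac_embed D ` carrier D)"

text \<open>With this convention fields are Dedekind domains.\<close>

definition dedekind_domain :: "('a, 'm) ring_scheme \<Rightarrow> bool" where
  "dedekind_domain D \<longleftrightarrow>
     noetherian_domain D \<and> integrally_closed D \<and>
     (\<forall>P. primeideal P D \<and> P \<noteq> {\<zero>\<^bsub>D\<^esub>} \<longrightarrow> maximalideal P D)"

abbreviation ideal_pow :: "('a, 'm) ring_scheme \<Rightarrow> 'a set \<Rightarrow> nat \<Rightarrow> 'a set" where
  "ideal_pow D P n \<equiv> P [^]\<^bsub>ideals_set D\<^esub> n"


subsection \<open>Modules\<close>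

definition finitely_generated :: "('a, 'm) ring_scheme \<Rightarrow> ('a, 'b, 'n) module_scheme \<Rightarrow> bool" where
  "finitely_generated D M \<longleftrightarrow>
     (\<exists>F. finite F \<and> F \<subseteq> carrier M \<and> module.span D M F = carrier M)"

definition cyclic_module :: "('a, 'm) ring_scheme \<Rightarrow> ('a, 'b, 'n) module_scheme \<Rightarrow> bool" where
  "cyclic_module D M \<longleftrightarrow> (\<exists>x \<in> carrier M. module.span D M {x} = carrier M)"

definition module_iso ::
  "('a, 'm) ring_scheme \<Rightarrow> ('a, 'b, 'n) module_scheme \<Rightarrow> ('a, 'c, 'k) module_scheme \<Rightarrow> ('b \<Rightarrow> 'c) set"
where
  "module_iso D M N = {f \<in> module_hom D M N. bij_betw f (carrier M) (carrier N)}"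

definition internal_direct_sum ::
  "('a, 'm) ring_scheme \<Rightarrow> ('a, 'b, 'n) module_scheme \<Rightarrow> 'b set \<Rightarrow> 'b set \<Rightarrow> bool"
where
  "internal_direct_sum D M A B \<longleftrightarrow>
     Module.submodule A D M \<and> Module.submodule B D M \<and>
     A <+>\<^bsub>M\<^esub> B = carrier M \<and> A \<inter> B = {\<zero>\<^bsub>M\<^esub>}"

definition direct_summand ::
  "('a, 'm) ring_scheme \<Rightarrow> ('a, 'b, 'n) module_scheme \<Rightarrow> 'b set \<Rightarrow> bool"
where
  "direct_summand D M A \<longleftrightarrow> (\<exists>B. internal_direct_sum D M A B)"

definition semisimple_module :: "('a, 'm) ring_scheme \<Rightarrow> ('a, 'b, 'n) module_scheme \<Rightarrow> bool" where
  "semisimple_module D M \<longleftrightarrow> (\<forall>U. Module.submodule U D M \<longrightarrow> direct_summand D M U)"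

definition essential_submodule ::
  "('a, 'm) ring_scheme \<Rightarrow> ('a, 'b, 'n) module_scheme \<Rightarrow> 'b set \<Rightarrow> bool"
where
  "essential_submodule D M S \<longleftrightarrow>
     Module.submodule S D M \<and>
     (\<forall>U. Module.submodule U D M \<and> U \<noteq> {\<zero>\<^bsub>M\<^esub>} \<longrightarrow> S \<inter> U \<noteq> {\<zero>\<^bsub>M\<^esub>})"

text \<open>
  The ring \<open>D Quot I\<close> as a \<open>D\<close>-module: \<open>a\<close> acts as multiplication by the coset \<open>I + a\<close>.
\<close>

definition quotient_module :: "('a, 'm) ring_scheme \<Rightarrow> 'a set \<Rightarrow> ('a, 'a set) module" where
  "quotient_module D I = \<lparr>
     carrier = carrier (D Quot I),
     monoid.mult = monoid.mult (D Quot I),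
     monoid.one = monoid.one (D Quot I),
     ring.zero = ring.zero (D Quot I),
     ring.add = ring.add (D Quot I),
     smult = (\<lambda>a C. (I +>\<^bsub>D\<^esub> a) \<otimes>\<^bsub>D Quot I\<^esub> C)\<rparr>"

text \<open>
  External direct sum over a \<^emph>\<open>finite\<close> index set \<open>J\<close>, where it agrees with the product. The ring
  multiplication inherited by the record type of modules is irrelevant and set to zero here and
  in the later constructions.
\<close>

definition finite_direct_sum :: "'i set \<Rightarrow> ('i \<Rightarrow> ('a, 'b, 'n) module_scheme) \<Rightarrow> ('a, 'i \<Rightarrow> 'b) module"
where
  "finite_direct_sum J N = \<lparr>
     carrier = (\<Pi>\<^sub>E j\<in>J. carrier (N j)),
     monoid.mult = (\<lambda>f g. \<lambda>j\<in>J. \<zero>\<^bsub>N j\<^esub>),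
     monoid.one = (\<lambda>j\<in>J. \<zero>\<^bsub>N j\<^esub>),
     ring.zero = (\<lambda>j\<in>J. \<zero>\<^bsub>N j\<^esub>),
     ring.add = (\<lambda>f g. \<lambda>j\<in>J. f j \<oplus>\<^bsub>N j\<^esub> g j),
     smult = (\<lambda>a f. \<lambda>j\<in>J. a \<odot>\<^bsub>N j\<^esub> f j)\<rparr>"


subsection \<open>Rank\<close>

text \<open>
  \<open>scalar_extension D K \<iota> M\<close> is \<open>K \<otimes>\<^sub>D M\<close> as a \<open>K\<close>-module, for a ring homomorphism
  \<open>\<iota>\<close> from \<open>D\<close> to \<open>K\<close>: the free abelian group on \<open>K \<times> M\<close> modulo the usual relations, on
  which \<open>k\<close> acts by \<open>k (x \<otimes> m) = (k x) \<otimes> m\<close>.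
\<close>

definition tensor_relations ::
  "('a, 'm) ring_scheme \<Rightarrow> ('k, 'p) ring_scheme \<Rightarrow> ('a \<Rightarrow> 'k) \<Rightarrow> ('a, 'b, 'n) module_scheme \<Rightarrow>
     (('k \<times> 'b) \<Rightarrow>\<^sub>0 int) set"
where
  "tensor_relations D K \<iota> M =
     generate (free_Abelian_group (carrier K \<times> carrier M))
       ({frag_of (x \<oplus>\<^bsub>K\<^esub> y, m) - frag_of (x, m) - frag_of (y, m) | x y m.
           x \<in> carrier K \<and> y \<in> carrier K \<and> m \<in> carrier M} \<union>
        {frag_of (x, m \<oplus>\<^bsub>M\<^esub> n) - frag_of (x, m) - frag_of (x, n) | x m n.
           x \<in> carrier K \<and> m \<in> carrier M \<and> n \<in> carrier M} \<union>
        {frag_of (x \<otimes>\<^bsub>K\<^esub> \<iota> a, m) - frag_of (x, a \<odot>\<^bsub>M\<^esub> m) | x a m.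
           x \<in> carrier K \<and> a \<in> carrier D \<and> m \<in> carrier M})"

definition scalar_extension ::
  "('a, 'm) ring_scheme \<Rightarrow> ('k, 'p) ring_scheme \<Rightarrow> ('a \<Rightarrow> 'k) \<Rightarrow> ('a, 'b, 'n) module_scheme \<Rightarrow>
     ('k, (('k \<times> 'b) \<Rightarrow>\<^sub>0 int) set) module"
where
  "scalar_extension D K \<iota> M =
     (let F = free_Abelian_group (carrier K \<times> carrier M); R = tensor_relations D K \<iota> M in \<lparr>
        carrier = carrier (F Mod R),
        monoid.mult = (\<lambda>A B. monoid.one (F Mod R)),
        monoid.one = monoid.one (F Mod R),
        ring.zero = monoid.one (F Mod R),
        ring.add = monoid.mult (F Mod R),
        smult = (\<lambda>k A. \<Union>c\<in>A. R #>\<^bsub>F\<^esub> frag_extend (\<lambda>(x, m). frag_of (k \<otimes>\<^bsub>K\<^esub> x, m)) c)\<rparr>)"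

definition module_rank :: "('a, 'm) ring_scheme \<Rightarrow> ('a, 'b, 'n) module_scheme \<Rightarrow> nat" where
  "module_rank D M =
     vectorspace.dim (fraction_field D)
       (scalar_extension D (fraction_field D) (frac_embed D) M)"


subsection \<open>Torsion, support and primary components\<close>

definition torsion_submodule :: "('a, 'm) ring_scheme \<Rightarrow> ('a, 'b, 'n) module_scheme \<Rightarrow> 'b set" where
  "torsion_submodule D M =
     {x \<in> carrier M. \<exists>d \<in> carrier D. d \<noteq> \<zero>\<^bsub>D\<^esub> \<and> d \<odot>\<^bsub>M\<^esub> x = \<zero>\<^bsub>M\<^esub>}"

abbreviation torsion ::
  "('a, 'm) ring_scheme \<Rightarrow> ('a, 'b, 'n) module_scheme \<Rightarrow> ('a, 'b, 'n) module_scheme"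
where
  "torsion D M \<equiv> M\<lparr>carrier := torsion_submodule D M\<rparr>"

text \<open>The fraction \<open>m/s\<close> in the localization of \<open>M\<close> at the multiplicative set \<open>S\<close>.\<close>

definition localization_class ::
  "('a, 'm) ring_scheme \<Rightarrow> 'a set \<Rightarrow> ('a, 'b, 'n) module_scheme \<Rightarrow> 'b \<Rightarrow> 'a \<Rightarrow> ('b \<times> 'a) set"
where
  "localization_class D S M m s =
     {(n, t). n \<in> carrier M \<and> t \<in> S \<and>
        (\<exists>u \<in> S. u \<odot>\<^bsub>M\<^esub> (t \<odot>\<^bsub>M\<^esub> m) = u \<odot>\<^bsub>M\<^esub> (s \<odot>\<^bsub>M\<^esub> n))}"

definition localization ::
  "('a, 'm) ring_scheme \<Rightarrow> 'a set \<Rightarrow> ('a, 'b, 'n) module_scheme \<Rightarrow> ('a, ('b \<times> 'a) set) module"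
where
  "localization D S M = \<lparr>
     carrier = {localization_class D S M m s | m s. m \<in> carrier M \<and> s \<in> S},
     monoid.mult = (\<lambda>A B. localization_class D S M \<zero>\<^bsub>M\<^esub> \<one>\<^bsub>D\<^esub>),
     monoid.one = localization_class D S M \<zero>\<^bsub>M\<^esub> \<one>\<^bsub>D\<^esub>,
     ring.zero = localization_class D S M \<zero>\<^bsub>M\<^esub> \<one>\<^bsub>D\<^esub>,
     ring.add = (\<lambda>A B. \<Union>(m, s)\<in>A. \<Union>(n, t)\<in>B.
              localization_class D S M (t \<odot>\<^bsub>M\<^esub> m \<oplus>\<^bsub>M\<^esub> s \<odot>\<^bsub>M\<^esub> n) (s \<otimes>\<^bsub>D\<^esub> t)),
     smult = (\<lambda>a A. \<Union>(m, s)\<in>A. localization_class D S M (a \<odot>\<^bsub>M\<^esub> m) s)\<rparr>"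

definition module_support :: "('a, 'm) ring_scheme \<Rightarrow> ('a, 'b, 'n) module_scheme \<Rightarrow> 'a set set" where
  "module_support D M =
     {P. primeideal P D \<and>
         carrier (localization D (carrier D - P) M) \<noteq> {\<zero>\<^bsub>localization D (carrier D - P) M\<^esub>}}"

definition torsion_primes :: "('a, 'm) ring_scheme \<Rightarrow> ('a, 'b, 'n) module_scheme \<Rightarrow> 'a set set" where
  "torsion_primes D M = {P \<in> module_support D (torsion D M). P \<noteq> {\<zero>\<^bsub>D\<^esub>}}"

text \<open>The elements annihilated by some power of \<open>P\<close>.\<close>

definition primary_submodule ::
  "('a, 'm) ring_scheme \<Rightarrow> 'a set \<Rightarrow> ('a, 'b, 'n) module_scheme \<Rightarrow> 'b set"
where
  "primary_submodule D P M =
     {x \<in> carrier M. \<exists>n. \<forall>a \<in> ideal_pow D P n. a \<odot>\<^bsub>M\<^esub> x = \<zero>\<^bsub>M\<^esub>}"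

definition torsion_component ::
  "('a, 'm) ring_scheme \<Rightarrow> 'a set \<Rightarrow> ('a, 'b, 'n) module_scheme \<Rightarrow> ('a, 'b, 'n) module_scheme"
where
  "torsion_component D P M = (torsion D M)\<lparr>carrier := primary_submodule D P (torsion D M)\<rparr>"

text \<open>
  \<open>m P\<close> is the number of cyclic summands at \<open>P\<close>, and \<open>l P j\<close> for \<open>j \<in> {1..m P}\<close> are the
  exponents.
\<close>

definition torsion_decomposition ::
  "('a, 'm) ring_scheme \<Rightarrow> ('a, 'b, 'n) module_scheme \<Rightarrow>
     ('a set \<Rightarrow> nat) \<Rightarrow> ('a set \<Rightarrow> nat \<Rightarrow> nat) \<Rightarrow> bool"
where
  "torsion_decomposition D M m l \<longleftrightarrow>
     (\<forall>P \<in> torsion_primes D M.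
        (\<forall>j \<in> {1..m P}. 1 \<le> l P j) \<and>
        (\<forall>i \<in> {1..m P}. \<forall>j \<in> {1..m P}. i \<le> j \<longrightarrow> l P i \<le> l P j) \<and>
        module_iso D (torsion_component D P M)
          (finite_direct_sum {1..m P} (\<lambda>j. quotient_module D (ideal_pow D P (l P j)))) \<noteq> {})"

text \<open>
  Only used for finitely generated modules, for which the number of copies is necessarily finite.
\<close>

definition homocyclic ::
  "('a, 'm) ring_scheme \<Rightarrow> 'a set \<Rightarrow> ('a, 'b, 'n) module_scheme \<Rightarrow> bool"
where
  "homocyclic D P N \<longleftrightarrow>
     (\<exists>(n::nat) (e::nat).
        module_iso D N
          (finite_direct_sum {1..n} (\<lambda>_. quotient_module D (ideal_pow D P e))) \<noteq> {})"


subsection \<open>C4-modules and semi-weak-CS modules\<close>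

definition C4 :: "('a, 'm) ring_scheme \<Rightarrow> ('a, 'b, 'n) module_scheme \<Rightarrow> bool" where
  "C4 D M \<longleftrightarrow>
     (\<forall>A B f.
        internal_direct_sum D M A B \<and>
        f \<in> module_hom D (M\<lparr>carrier := A\<rparr>) (M\<lparr>carrier := B\<rparr>) \<and>
        direct_summand D (M\<lparr>carrier := A\<rparr>) {x \<in> A. f x = \<zero>\<^bsub>M\<^esub>} \<longrightarrow>
        direct_summand D (M\<lparr>carrier := B\<rparr>) (f ` A))"

definition C4_star :: "('a, 'm) ring_scheme \<Rightarrow> ('a, 'b, 'n) module_scheme \<Rightarrow> bool" where
  "C4_star D M \<longleftrightarrow> (\<forall>N. Module.submodule N D M \<longrightarrow> C4 D (M\<lparr>carrier := N\<rparr>))"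

text \<open>
  HOL functions are total; membership in \<open>extensional S\<close> fixes the values of \<open>\<phi>\<close> outside \<open>S\<close>,
  so that a triple is determined by the submodules \<open>S\<close>, \<open>T\<close> and the map \<open>\<phi>: S \<rightarrow> T\<close>.
\<close>

definition semisimple_triples ::
  "('a, 'm) ring_scheme \<Rightarrow> ('a, 'b, 'n) module_scheme \<Rightarrow> ('b set \<times> 'b set \<times> ('b \<Rightarrow> 'b)) set"
where
  "semisimple_triples D M =
     {(S, T, \<phi>).
        direct_summand D M S \<and> semisimple_module D (M\<lparr>carrier := S\<rparr>) \<and>
        direct_summand D M T \<and> semisimple_module D (M\<lparr>carrier := T\<rparr>) \<and>
        S \<inter> T = {\<zero>\<^bsub>M\<^esub>} \<and>
        \<phi> \<in> module_iso D (M\<lparr>carrier := S\<rparr>) (M\<lparr>carrier := T\<rparr>) \<and> \<phi> \<in> extensional S}"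

fun triple_le ::
  "'b set \<times> 'b set \<times> ('b \<Rightarrow> 'b) \<Rightarrow> 'b set \<times> 'b set \<times> ('b \<Rightarrow> 'b) \<Rightarrow> bool"
where
  "triple_le (S, T, \<phi>) (S', T', \<phi>') \<longleftrightarrow> S \<subseteq> S' \<and> T \<subseteq> T' \<and> (\<forall>x \<in> S. \<phi>' x = \<phi> x)"

definition triple_chain ::
  "('a, 'm) ring_scheme \<Rightarrow> ('a, 'b, 'n) module_scheme \<Rightarrow>
     ('b set \<times> 'b set \<times> ('b \<Rightarrow> 'b)) set \<Rightarrow> bool"
where
  "triple_chain D M C \<longleftrightarrow>
     C \<subseteq> semisimple_triples D M \<and> (\<forall>s \<in> C. \<forall>t \<in> C. triple_le s t \<or> triple_le t s)"

text \<open>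
  Inserting \<open>\<zero>\<close> only matters for the empty chain, whose union is thereby the zero submodule
  instead of the empty set.
\<close>

definition chain_dom ::
  "('a, 'b, 'n) module_scheme \<Rightarrow> ('b set \<times> 'b set \<times> ('b \<Rightarrow> 'b)) set \<Rightarrow> 'b set"
where
  "chain_dom M C = insert \<zero>\<^bsub>M\<^esub> (\<Union>(S, T, \<phi>)\<in>C. S)"

definition chain_ran ::
  "('a, 'b, 'n) module_scheme \<Rightarrow> ('b set \<times> 'b set \<times> ('b \<Rightarrow> 'b)) set \<Rightarrow> 'b set"
where
  "chain_ran M C = insert \<zero>\<^bsub>M\<^esub> (\<Union>(S, T, \<phi>)\<in>C. T)"

definition semi_weak_CS :: "('a, 'm) ring_scheme \<Rightarrow> ('a, 'b, 'n) module_scheme \<Rightarrow> bool" where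
  "semi_weak_CS D M \<longleftrightarrow>
     (\<forall>C. triple_chain D M C \<longrightarrow>
        (\<exists>A B. direct_summand D M A \<and> direct_summand D M B \<and>
           essential_submodule D (M\<lparr>carrier := A\<rparr>) (chain_dom M C) \<and>
           essential_submodule D (M\<lparr>carrier := B\<rparr>) (chain_ran M C)))"

definition strongly_C4_star :: "('a, 'm) ring_scheme \<Rightarrow> ('a, 'b, 'n) module_scheme \<Rightarrow> bool" where
  "strongly_C4_star D M \<longleftrightarrow> C4_star D M \<and> semi_weak_CS D M"

end

theory Submission
  imports Defs
begin

text \<open>
  At a nonzero prime \<open>P\<close> of a Dedekind domain the localization has a uniformizer \<open>t\<close>, and divisibility
  of socle elements by powers of \<open>t\<close> detects the exponents of the \<open>P\<close>-primary component. If the rank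
  exceeds one, a torsion-free summand of rank one embeds into its complement, and scaling the embedding
  by a nonunit makes its image fail to be a summand; if two exponents \<open>a < b\<close> occur at \<open>P\<close>, the
  embedding of \<open>R / P\<^sup>a\<close> into \<open>R / P\<^sup>b\<close> plays the same role. If on the other hand all exponents at
  \<open>P\<close> equal \<open>n + 1\<close>, then every socle element is a multiple by \<open>t\<close> to the power \<open>n\<close>, which makes the
  images in question split off. A primary component that is neither cyclic nor semisimple contains
  a copy of \<open>R / P \<oplus> R / P\<^sup>2\<close>; this decides the case of C4*. Semi-weak-CS needs only the ascending
  chain condition.
\<close>

subsection \<open>The fraction field and integrality\<close>

text \<open>Until the support is computed, no localization is formed: elements outside
  \<open>P\<close> are carried along as explicit denominators. They disappear because such an
  element is invertible modulo every power of \<open>P\<close>, so it acts bijectively on anything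
  killed by such a power. As \<open>R\<close> need not be a principal ideal domain, the torsion-free
  part need not be free: the image of a linear form is only an ideal, and the invertibility of that
  ideal makes the kernel split off. The rank is the dimension of a tensor product; the module
  arguments work instead with \<open>dependent_pairs\<close>, a nontrivial relation between any two
  elements. Linear forms are the bridge, because they detect that \<open>1 \<otimes> m\<close> is
  nonzero. The criteria are first phrased by socles and divisibility by powers of \<open>t\<close>
  (\<open>uniform_at\<close>, \<open>thin_at\<close>), since these can be compared between a module
  and its submodules; decompositions into cyclic modules only translate them into exponents.\<close>

context domain
begin

lemma frac_class_self:
  "\<lbrakk>a \<in> carrier R; b \<in> carrier R - {\<zero>}\<rbrakk> \<Longrightarrow> (a, b) \<in> frac_class R a b"
  by (simp add: frac_class_def)

lemma frac_class_eq_iff: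
  assumes "a \<in> carrier R" "b \<in> carrier R - {\<zero>}" "c \<in> carrier R" "d \<in> carrier R - {\<zero>}"
  shows "frac_class R a b = frac_class R c d \<longleftrightarrow> a \<otimes> d = c \<otimes> b"
proof
  assume "frac_class R a b = frac_class R c d"
  with frac_class_self[OF assms(3,4)] have "(c, d) \<in> frac_class R a b" by simp
  then show "a \<otimes> d = c \<otimes> b" by (simp add: frac_class_def)
next
  \<comment> \<open>Transitivity of cross multiplication: the two products agree after
    multiplication by the nonzero \<open>b\<close>, which cancels in a domain.\<close>
  have sub: "frac_class R a b \<subseteq> frac_class R c d"
    if "a \<in> carrier R" "b \<in> carrier R - {\<zero>}" "c \<in> carrier R" "d \<in> carrier R - {\<zero>}"
      and eq: "a \<otimes> d = c \<otimes> b" for a b c d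
  proof
    fix z assume "z \<in> frac_class R a b"
    then obtain x y where z: "z = (x, y)" and xy: "x \<in> carrier R" "y \<in> carrier R - {\<zero>}"
      and e: "a \<otimes> y = x \<otimes> b" by (auto simp: frac_class_def)
    have "b \<otimes> (c \<otimes> y) = (c \<otimes> b) \<otimes> y" using that xy by (simp add: m_ac)
    also have "\<dots> = (a \<otimes> d) \<otimes> y" by (simp only: eq)
    also have "\<dots> = (a \<otimes> y) \<otimes> d" using that(1-4) xy by (simp add: m_ac)
    also have "\<dots> = b \<otimes> (x \<otimes> d)" unfolding e using that(1-4) xy by (simp add: m_ac)
    finally have "c \<otimes> y = x \<otimes> d" using that xy m_lcancel[of b "c \<otimes> y" "x \<otimes> d"] by auto
    then show "z \<in> frac_class R c d" using xy z by (simp add: frac_class_def)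
  qed
  assume "a \<otimes> d = c \<otimes> b"
  then show "frac_class R a b = frac_class R c d"
    using sub[OF assms] sub[OF assms(3,4,1,2)] by (simp add: subset_antisym)
qed

text \<open>The operations of \<open>fraction_field\<close> are unions over all pairs of
  representatives. They collapse to one class because every pair contributes the same class (facts
  \<open>m\<close> and \<open>s\<close>) and the given pair makes the union nonempty.\<close>

lemma frac_class_add_mult:
  assumes "a \<in> carrier R" "b \<in> carrier R - {\<zero>}" "c \<in> carrier R" "d \<in> carrier R - {\<zero>}"
  shows "frac_class R a b \<otimes>\<^bsub>fraction_field R\<^esub> frac_class R c d = frac_class R (a \<otimes> c) (b \<otimes> d)"
    and "frac_class R a b \<oplus>\<^bsub>fraction_field R\<^esub> frac_class R c d
      = frac_class R (a \<otimes> d \<oplus> c \<otimes> b) (b \<otimes> d)"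
proof -
  have m: "frac_class R (x \<otimes> u) (y \<otimes> v) = frac_class R (a \<otimes> c) (b \<otimes> d)"
   and s: "frac_class R (x \<otimes> v \<oplus> u \<otimes> y) (y \<otimes> v) = frac_class R (a \<otimes> d \<oplus> c \<otimes> b) (b \<otimes> d)"
    if "(x, y) \<in> frac_class R a b" "(u, v) \<in> frac_class R c d" for x y u v
  proof -
    from that have xy: "x \<in> carrier R" "y \<in> carrier R - {\<zero>}" "u \<in> carrier R" "v \<in> carrier R - {\<zero>}"
      and e1: "a \<otimes> y = x \<otimes> b" and e2: "c \<otimes> v = u \<otimes> d" by (auto simp: frac_class_def)
    have nz: "y \<otimes> v \<in> carrier R - {\<zero>}" "b \<otimes> d \<in> carrier R - {\<zero>}"
      using xy assms by (auto simp: integral_iff)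
    have "(x \<otimes> u) \<otimes> (b \<otimes> d) = (x \<otimes> b) \<otimes> (u \<otimes> d)" using xy assms by (simp add: m_ac)
    also have "\<dots> = (a \<otimes> y) \<otimes> (c \<otimes> v)" by (simp add: e1 e2)
    also have "\<dots> = (a \<otimes> c) \<otimes> (y \<otimes> v)" using xy assms by (simp add: m_ac)
    finally show "frac_class R (x \<otimes> u) (y \<otimes> v) = frac_class R (a \<otimes> c) (b \<otimes> d)"
      using xy assms nz by (subst frac_class_eq_iff) auto
    have "(x \<otimes> v \<oplus> u \<otimes> y) \<otimes> (b \<otimes> d) = (x \<otimes> b) \<otimes> (v \<otimes> d) \<oplus> (u \<otimes> d) \<otimes> (y \<otimes> b)"
      using xy assms by (simp add: m_ac l_distr r_distr)
    also have "\<dots> = (a \<otimes> y) \<otimes> (v \<otimes> d) \<oplus> (c \<otimes> v) \<otimes> (y \<otimes> b)" by (simp add: e1 e2)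
    also have "\<dots> = (a \<otimes> d \<oplus> c \<otimes> b) \<otimes> (y \<otimes> v)"
      using xy assms by (simp add: m_ac l_distr r_distr)
    finally show "frac_class R (x \<otimes> v \<oplus> u \<otimes> y) (y \<otimes> v) = frac_class R (a \<otimes> d \<oplus> c \<otimes> b) (b \<otimes> d)"
      using xy assms nz by (subst frac_class_eq_iff) auto
  qed
  have ne: "(a, b) \<in> frac_class R a b" "(c, d) \<in> frac_class R c d"
    using assms by (auto intro: frac_class_self)
  show "frac_class R a b \<otimes>\<^bsub>fraction_field R\<^esub> frac_class R c d = frac_class R (a \<otimes> c) (b \<otimes> d)"
    unfolding fraction_field_def monoid.simps
  proof (rule equalityI)
    show "(\<Union>(a, b)\<in>frac_class R a b. \<Union>(c, d)\<in>frac_class R c d. frac_class R (a \<otimes> c) (b \<otimes> d))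
      \<subseteq> frac_class R (a \<otimes> c) (b \<otimes> d)" using m by fastforce
  qed (use ne in blast)
  show "frac_class R a b \<oplus>\<^bsub>fraction_field R\<^esub> frac_class R c d
      = frac_class R (a \<otimes> d \<oplus> c \<otimes> b) (b \<otimes> d)"
    unfolding fraction_field_def ring.simps
  proof (rule equalityI)
    show "(\<Union>(a, b)\<in>frac_class R a b. \<Union>(c, d)\<in>frac_class R c d.
        frac_class R (a \<otimes> d \<oplus> c \<otimes> b) (b \<otimes> d))
      \<subseteq> frac_class R (a \<otimes> d \<oplus> c \<otimes> b) (b \<otimes> d)" using s by fastforce
  qed (use ne in blast)
qed

lemma fraction_field_carrier:
  "carrier (fraction_field R) =
    {frac_class R a b | a b. a \<in> carrier R \<and> b \<in> carrier R - {\<zero>}}"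
  by (simp add: fraction_field_def)

lemma frac_class_closed:
  "\<lbrakk>a \<in> carrier R; b \<in> carrier R - {\<zero>}\<rbrakk> \<Longrightarrow> frac_class R a b \<in> carrier (fraction_field R)"
  by (auto simp: fraction_field_carrier)

lemma fraction_field_zero_one:
  "\<zero>\<^bsub>fraction_field R\<^esub> = frac_class R \<zero> \<one>" "\<one>\<^bsub>fraction_field R\<^esub> = frac_class R \<one> \<one>"
  by (simp_all add: fraction_field_def)

lemma nonzero_mult: "\<lbrakk>a \<in> carrier R - {\<zero>}; b \<in> carrier R - {\<zero>}\<rbrakk> \<Longrightarrow> a \<otimes> b \<in> carrier R - {\<zero>}"
  by (auto simp: integral_iff)

lemma one_nonzero: "\<one> \<in> carrier R - {\<zero>}" by simp

lemma fraction_field_is_field: "field (fraction_field R)"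
proof -
  let ?K = "fraction_field R"
  note ar = frac_class_add_mult frac_class_closed fraction_field_zero_one nonzero_mult one_nonzero
  have E: "\<exists>a b. a \<in> carrier R \<and> b \<in> carrier R - {\<zero>} \<and> x = frac_class R a b"
    if "x \<in> carrier ?K" for x using that by (auto simp: fraction_field_carrier)
  have c: "cring ?K"
  proof (rule cringI)
    show "abelian_group ?K"
    proof (rule abelian_groupI)
      show "\<zero>\<^bsub>?K\<^esub> \<in> carrier ?K" by (simp add: ar)
      fix x assume "x \<in> carrier ?K"
      then obtain a b where x: "a \<in> carrier R" "b \<in> carrier R - {\<zero>}" "x = frac_class R a b"
        using E by blast
      have bb: "b \<otimes> b \<in> carrier R - {\<zero>}" using x nonzero_mult by blast
      show "\<zero>\<^bsub>?K\<^esub> \<oplus>\<^bsub>?K\<^esub> x = x" using x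
        by (simp add: ar frac_class_add_mult(2)[OF zero_closed one_nonzero])
      have "frac_class R (\<ominus> a) b \<oplus>\<^bsub>?K\<^esub> x = \<zero>\<^bsub>?K\<^esub>"
        unfolding x(3) fraction_field_zero_one
        using x bb by (simp add: frac_class_add_mult frac_class_eq_iff l_minus l_neg)
      then show "\<exists>y\<in>carrier ?K. y \<oplus>\<^bsub>?K\<^esub> x = \<zero>\<^bsub>?K\<^esub>"
        using x by (intro bexI[of _ "frac_class R (\<ominus> a) b"] frac_class_closed) auto
      fix y assume "y \<in> carrier ?K"
      then obtain c d where y: "c \<in> carrier R" "d \<in> carrier R - {\<zero>}" "y = frac_class R c d"
        using E by blast
      have bd: "b \<otimes> d \<in> carrier R - {\<zero>}" using x y nonzero_mult by blast
      show "x \<oplus>\<^bsub>?K\<^esub> y \<in> carrier ?K"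
        unfolding x y using x y bd by (simp add: frac_class_add_mult frac_class_closed)
      show "x \<oplus>\<^bsub>?K\<^esub> y = y \<oplus>\<^bsub>?K\<^esub> x"
        unfolding x y using x y bd by (simp add: frac_class_add_mult m_ac a_ac)
      fix z assume "z \<in> carrier ?K"
      then obtain e f where z: "e \<in> carrier R" "f \<in> carrier R - {\<zero>}" "z = frac_class R e f"
        using E by blast
      have df: "d \<otimes> f \<in> carrier R - {\<zero>}" using z y nonzero_mult by blast
      have "(a \<otimes> d \<oplus> c \<otimes> b) \<otimes> f \<oplus> e \<otimes> (b \<otimes> d) = a \<otimes> (d \<otimes> f) \<oplus> (c \<otimes> f \<oplus> e \<otimes> d) \<otimes> b"
        using x y z by (simp add: l_distr r_distr m_ac a_ac)
      then show "x \<oplus>\<^bsub>?K\<^esub> y \<oplus>\<^bsub>?K\<^esub> z = x \<oplus>\<^bsub>?K\<^esub> (y \<oplus>\<^bsub>?K\<^esub> z)"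
        unfolding x y z using x y z bd df by (simp add: frac_class_add_mult m_assoc)
    qed
    show "comm_monoid ?K"
    proof (rule comm_monoidI)
      show "\<one>\<^bsub>?K\<^esub> \<in> carrier ?K" by (simp add: ar)
      fix x assume "x \<in> carrier ?K"
      then obtain a b where x: "a \<in> carrier R" "b \<in> carrier R - {\<zero>}" "x = frac_class R a b"
        using E by blast
      show "\<one>\<^bsub>?K\<^esub> \<otimes>\<^bsub>?K\<^esub> x = x" using x
        by (simp add: ar frac_class_add_mult(1)[OF one_closed one_nonzero])
      fix y assume "y \<in> carrier ?K"
      then obtain c d where y: "c \<in> carrier R" "d \<in> carrier R - {\<zero>}" "y = frac_class R c d"
        using E by blast
      have bd: "b \<otimes> d \<in> carrier R - {\<zero>}" using x y nonzero_mult by blast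
      show "x \<otimes>\<^bsub>?K\<^esub> y \<in> carrier ?K"
        unfolding x y using x y bd by (simp add: frac_class_add_mult frac_class_closed)
      show "x \<otimes>\<^bsub>?K\<^esub> y = y \<otimes>\<^bsub>?K\<^esub> x"
        unfolding x y using x y bd by (simp add: frac_class_add_mult m_ac)
      fix z assume "z \<in> carrier ?K"
      then obtain e f where z: "e \<in> carrier R" "f \<in> carrier R - {\<zero>}" "z = frac_class R e f"
        using E by blast
      have df: "d \<otimes> f \<in> carrier R - {\<zero>}" using z y nonzero_mult by blast
      show "x \<otimes>\<^bsub>?K\<^esub> y \<otimes>\<^bsub>?K\<^esub> z = x \<otimes>\<^bsub>?K\<^esub> (y \<otimes>\<^bsub>?K\<^esub> z)"
        unfolding x y z using x y z bd df by (simp add: frac_class_add_mult m_assoc)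
    qed
    fix x y z assume "x \<in> carrier ?K" "y \<in> carrier ?K" "z \<in> carrier ?K"
    then obtain a b c d e f where x: "a \<in> carrier R" "b \<in> carrier R - {\<zero>}" "x = frac_class R a b"
      and y: "c \<in> carrier R" "d \<in> carrier R - {\<zero>}" "y = frac_class R c d"
      and z: "e \<in> carrier R" "f \<in> carrier R - {\<zero>}" "z = frac_class R e f"
      using E[of x] E[of y] E[of z] by metis
    have nz: "b \<otimes> d \<in> carrier R - {\<zero>}" "b \<otimes> f \<in> carrier R - {\<zero>}" "d \<otimes> f \<in> carrier R - {\<zero>}"
      "b \<otimes> d \<otimes> f \<in> carrier R - {\<zero>}" "b \<otimes> f \<otimes> (d \<otimes> f) \<in> carrier R - {\<zero>}"
      using x y z by (simp_all add: integral_iff)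
    have "(a \<otimes> d \<oplus> c \<otimes> b) \<otimes> e \<otimes> (b \<otimes> f \<otimes> (d \<otimes> f))
      = (a \<otimes> e \<otimes> (d \<otimes> f) \<oplus> c \<otimes> e \<otimes> (b \<otimes> f)) \<otimes> (b \<otimes> d \<otimes> f)"
      using x y z by (simp add: l_distr r_distr m_ac)
    then show "(x \<oplus>\<^bsub>?K\<^esub> y) \<otimes>\<^bsub>?K\<^esub> z = x \<otimes>\<^bsub>?K\<^esub> z \<oplus>\<^bsub>?K\<^esub> y \<otimes>\<^bsub>?K\<^esub> z"
      unfolding x y z using x y z nz by (simp add: frac_class_add_mult frac_class_eq_iff)
  qed
  interpret K: cring ?K by (rule c)
  show ?thesis
  proof (rule K.cring_fieldI2)
    show "\<zero>\<^bsub>?K\<^esub> \<noteq> \<one>\<^bsub>?K\<^esub>" by (simp add: ar frac_class_eq_iff)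
    fix x assume "x \<in> carrier ?K" "x \<noteq> \<zero>\<^bsub>?K\<^esub>"
    then obtain a b where x: "a \<in> carrier R" "b \<in> carrier R - {\<zero>}" "x = frac_class R a b"
      using E by blast
    have a: "a \<in> carrier R - {\<zero>}" using x \<open>x \<noteq> \<zero>\<^bsub>?K\<^esub>\<close>
      by (auto simp: fraction_field_zero_one frac_class_eq_iff)
    have "a \<otimes> b \<in> carrier R - {\<zero>}" "b \<otimes> a \<in> carrier R - {\<zero>}" using a x nonzero_mult by blast+
    then have "x \<otimes>\<^bsub>?K\<^esub> frac_class R b a = \<one>\<^bsub>?K\<^esub>"
      using x a by (simp add: ar frac_class_eq_iff m_comm)
    then show "\<exists>y\<in>carrier ?K. x \<otimes>\<^bsub>?K\<^esub> y = \<one>\<^bsub>?K\<^esub>"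
      using x a by (intro bexI[of _ "frac_class R b a"] frac_class_closed) auto
  qed
qed

lemma frac_embed_ring_hom: "ring_hom_ring R (fraction_field R) (frac_embed R)"
proof -
  interpret K: field "fraction_field R" by (rule fraction_field_is_field)
  show ?thesis
    by (rule ring_hom_ringI[OF ring_axioms K.ring_axioms])
      (auto simp: frac_embed_def frac_class_closed frac_class_add_mult frac_class_eq_iff
        fraction_field_zero_one)
qed

lemma frac_embed_inj: "inj_on (frac_embed R) (carrier R)"
  by (rule inj_onI) (simp add: frac_embed_def frac_class_eq_iff)

lemma frac_class_embed:
  assumes "a \<in> carrier R" "b \<in> carrier R - {\<zero>}"
  shows "frac_embed R b \<otimes>\<^bsub>fraction_field R\<^esub> frac_class R a b = frac_embed R a"
  using assms by (simp add: frac_embed_def frac_class_add_mult frac_class_eq_iff m_comm)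

end

text \<open>Zorn's lemma applies because in a Noetherian ring a nonempty chain of ideals contains
  its own union, which therefore stays in \<open>S\<close>.\<close>

lemma (in noetherian_ring) maximal_ideal_in_family:
  assumes "S \<subseteq> {I. ideal I R}" "S \<noteq> {}"
  shows "\<exists>M\<in>S. \<forall>I\<in>S. M \<subseteq> I \<longrightarrow> I = M"
proof (rule subset_Zorn_nonempty)
  show "S \<noteq> {}" by (rule assms)
  fix C assume "C \<noteq> {}" and C: "subset.chain S C"
  then have "subset.chain {I. ideal I R} C"
    using assms(1) by (auto simp: subset_chain_def)
  then show "\<Union>C \<in> S"
    using ideal_chain_is_trivial[OF \<open>C \<noteq> {}\<close>] C by (auto simp: subset_chain_def)
qed

lemma (in ring) eval_replicate_zero:
  "x \<in> carrier R \<Longrightarrow> eval (replicate n \<zero>) x = \<zero>"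
  by (induction n) simp_all

lemma (in cring) eval_map_mult:
  "\<lbrakk>set cs \<subseteq> carrier R; x \<in> carrier R; r \<in> carrier R\<rbrakk> \<Longrightarrow>
    eval (map ((\<otimes>) r) cs) x = r \<otimes> eval cs x"
  by (induction cs) (auto simp: eval_in_carrier r_distr m_assoc)

lemma (in cring) eval_map2_add:
  "\<lbrakk>length cs = length ds; set cs \<subseteq> carrier R; set ds \<subseteq> carrier R; x \<in> carrier R\<rbrakk> \<Longrightarrow>
    eval (map2 (\<oplus>) cs ds) x = eval cs x \<oplus> eval ds x"
  by (induction cs ds rule: list_induct2) (auto simp: eval_in_carrier l_distr a_ac)

text \<open>
  The determinant trick of integral dependence, with the Noetherian property replacing the
  determinant: the ideals \<open>J k\<close> of all \<open>z\<close> with \<open>z / y\<close> a polynomial of degree less than \<open>k\<close> in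
  \<open>b / a\<close> become stationary.
\<close>

lemma (in noetherian_domain) integral_over_if_stable_ideal:
  fixes K (structure)
  assumes K: "field K" and i: "ring_hom_ring R K i" and i_inj: "inj_on i (carrier R)"
    and a: "a \<in> carrier R" "a \<noteq> \<zero>\<^bsub>R\<^esub>" and b: "b \<in> carrier R"
    and x: "x \<in> carrier K" and ax: "i a \<otimes>\<^bsub>K\<^esub> x = i b"
    and I: "ideal I R" "I \<noteq> {\<zero>\<^bsub>R\<^esub>}" and st: "\<And>z. z \<in> I \<Longrightarrow> \<exists>w\<in>I. b \<otimes>\<^bsub>R\<^esub> z = a \<otimes>\<^bsub>R\<^esub> w"
  shows "integral_over K (i ` carrier R) x"
proof -
  interpret K: field K by (rule K)
  interpret i: ring_hom_ring R K i by (rule i)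
  interpret I: ideal I R by (rule I)
  have inj: "u = v" if "i u = i v" "u \<in> carrier R" "v \<in> carrier R" for u v
    using that i_inj by (auto dest: inj_onD)
  obtain y where y: "y \<in> I" "y \<noteq> \<zero>\<^bsub>R\<^esub>" using I I.zero_closed by blast
  have yc: "y \<in> carrier R" using y I.a_subset by blast
  have i0: "i u \<noteq> \<zero>\<^bsub>K\<^esub>" if "u \<in> carrier R" "u \<noteq> \<zero>\<^bsub>R\<^esub>" for u
    using that inj[of u "\<zero>\<^bsub>R\<^esub>"] by auto
  \<comment> \<open>Multiplication by \<open>x = b / a\<close> maps \<open>I\<close> into itself, so
    all \<open>x ^ k y\<close> remain images of elements of \<open>I\<close>.\<close>
  have pw: "\<exists>w\<in>I. i w = x [^]\<^bsub>K\<^esub> k \<otimes>\<^bsub>K\<^esub> i y" for k :: nat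
  proof (induction k)
    case 0 then show ?case using y yc by auto
  next
    case (Suc k)
    then obtain w where w: "w \<in> I" "i w = x [^]\<^bsub>K\<^esub> k \<otimes>\<^bsub>K\<^esub> i y" by blast
    obtain w' where w': "w' \<in> I" "b \<otimes>\<^bsub>R\<^esub> w = a \<otimes>\<^bsub>R\<^esub> w'" using st w by blast
    have wc: "w \<in> carrier R" "w' \<in> carrier R" using w w' I.a_subset by blast+
    have "i a \<otimes>\<^bsub>K\<^esub> i w' = i b \<otimes>\<^bsub>K\<^esub> i w"
      using a b wc w' by (metis i.hom_mult)
    also have "\<dots> = i a \<otimes>\<^bsub>K\<^esub> (x [^]\<^bsub>K\<^esub> Suc k \<otimes>\<^bsub>K\<^esub> i y)"
      unfolding ax[symmetric] w(2) using a x yc by (simp add: K.m_ac)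
    finally have "i w' = x [^]\<^bsub>K\<^esub> Suc k \<otimes>\<^bsub>K\<^esub> i y"
      using a x yc wc i0 K.m_lcancel by (meson K.m_closed K.nat_pow_closed i.hom_closed)
    then show ?case using w' by blast
  qed
  define A where "A = i ` carrier R"
  have Ac: "A \<subseteq> carrier K" unfolding A_def by auto
  have A0: "\<zero>\<^bsub>K\<^esub> \<in> A" "\<one>\<^bsub>K\<^esub> \<in> A" unfolding A_def
    using i.hom_zero i.hom_one by (metis imageI zero_closed one_closed)+
  have Aadd: "u \<oplus>\<^bsub>K\<^esub> v \<in> A" if "u \<in> A" "v \<in> A" for u v
    using that unfolding A_def by (auto simp: i.hom_add[symmetric] simp del: i.hom_add)
  have Amult: "u \<otimes>\<^bsub>K\<^esub> v \<in> A" if "u \<in> A" "v \<in> A" for u v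
    using that unfolding A_def by (auto simp: i.hom_mult[symmetric] simp del: i.hom_mult)
  \<comment> \<open>Lists of length exactly \<open>k\<close> with leading zeros allowed: sums are
    then formed entrywise, and prepending a zero embeds \<open>J k\<close> into
    \<open>J (Suc k)\<close>.\<close>
  define J where "J k = {z \<in> carrier R. \<exists>cs. length cs = k \<and> set cs \<subseteq> A \<and>
    i z = K.eval cs x \<otimes>\<^bsub>K\<^esub> i y}" for k :: nat
  have Jid: "ideal (J k) R" for k
  proof (rule idealI)
    have Jmul: "r \<otimes>\<^bsub>R\<^esub> u \<in> J k" if "u \<in> J k" "r \<in> carrier R" for u r
    proof -
      from that obtain cs where cs: "length cs = k" "set cs \<subseteq> A" "i u = K.eval cs x \<otimes>\<^bsub>K\<^esub> i y"
        and u: "u \<in> carrier R" by (auto simp: J_def)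
      have ec: "K.eval cs x \<in> carrier K" using cs Ac x by (intro K.eval_in_carrier) auto
      have "i (r \<otimes>\<^bsub>R\<^esub> u) = K.eval (map ((\<otimes>\<^bsub>K\<^esub>) (i r)) cs) x \<otimes>\<^bsub>K\<^esub> i y"
        using cs Ac x that u yc ec by (subst K.eval_map_mult) (auto simp: K.m_assoc)
      moreover have "set (map ((\<otimes>\<^bsub>K\<^esub>) (i r)) cs) \<subseteq> A"
        using cs that Amult by (auto simp: A_def)
      ultimately show ?thesis using cs u that
        by (auto simp: J_def intro!: exI[of _ "map ((\<otimes>\<^bsub>K\<^esub>) (i r)) cs"])
    qed
    have Jadd: "u \<oplus>\<^bsub>R\<^esub> v \<in> J k" if "u \<in> J k" "v \<in> J k" for u v
    proof -
      from that obtain cs ds where cs: "length cs = k" "set cs \<subseteq> A" "i u = K.eval cs x \<otimes>\<^bsub>K\<^esub> i y"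
        and ds: "length ds = k" "set ds \<subseteq> A" "i v = K.eval ds x \<otimes>\<^bsub>K\<^esub> i y"
        and u: "u \<in> carrier R" "v \<in> carrier R" by (auto simp: J_def)
      have ec: "K.eval cs x \<in> carrier K" "K.eval ds x \<in> carrier K"
        using cs ds Ac x by (auto intro!: K.eval_in_carrier)
      have "i (u \<oplus>\<^bsub>R\<^esub> v) = K.eval (map2 (\<oplus>\<^bsub>K\<^esub>) cs ds) x \<otimes>\<^bsub>K\<^esub> i y"
        using cs ds Ac x that u yc ec by (subst K.eval_map2_add) (auto simp: K.l_distr)
      moreover have "set (map2 (\<oplus>\<^bsub>K\<^esub>) cs ds) \<subseteq> A"
        using cs ds by (auto intro!: Aadd dest: set_zip_leftD set_zip_rightD)
      ultimately show ?thesis using cs ds u that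
        by (auto simp: J_def intro!: exI[of _ "map2 (\<oplus>\<^bsub>K\<^esub>) cs ds"])
    qed
    have J0: "\<zero>\<^bsub>R\<^esub> \<in> J k"
      unfolding J_def using A0 x yc
      by (auto simp: K.eval_replicate_zero intro!: exI[of _ "replicate k \<zero>\<^bsub>K\<^esub>"])
    show "subgroup (J k) (add_monoid R)"
    proof (rule add.subgroupI)
      show "J k \<subseteq> carrier R" by (auto simp: J_def)
      show "J k \<noteq> {}" using J0 by blast
      show "\<ominus>\<^bsub>R\<^esub> u \<in> J k" if "u \<in> J k" for u
        using Jmul[OF that, of "\<ominus>\<^bsub>R\<^esub> \<one>\<^bsub>R\<^esub>"] that by (simp add: J_def l_minus)
      show "u \<oplus>\<^bsub>R\<^esub> v \<in> J k" if "u \<in> J k" "v \<in> J k" for u v using Jadd that .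
    qed
    show "r \<otimes>\<^bsub>R\<^esub> u \<in> J k" if "u \<in> J k" "r \<in> carrier R" for u r using Jmul that .
    show "u \<otimes>\<^bsub>R\<^esub> r \<in> J k" if "u \<in> J k" "r \<in> carrier R" for u r
      using Jmul[OF that] that by (simp add: m_comm J_def)
    show "ring R" by (rule ring_axioms)
  qed
  obtain n where "\<forall>I\<in>range J. J n \<subseteq> I \<longrightarrow> I = J n"
    using maximal_ideal_in_family[of "range J"] Jid by auto
  moreover have "J n \<subseteq> J (Suc n)"
  proof
    fix z assume "z \<in> J n"
    then obtain cs where cs: "length cs = n" "set cs \<subseteq> A" "i z = K.eval cs x \<otimes>\<^bsub>K\<^esub> i y"
      and z: "z \<in> carrier R" by (auto simp: J_def)
    have "K.eval cs x \<in> carrier K" using cs Ac x by (intro K.eval_in_carrier) auto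
    then show "z \<in> J (Suc n)" unfolding J_def using cs z x A0
      by (auto intro!: exI[of _ "\<zero>\<^bsub>K\<^esub> # cs"])
  qed
  ultimately have stat: "J (Suc n) = J n" by blast
  \<comment> \<open>\<open>x ^ n y\<close> comes from a list of length \<open>n + 1\<close>, so it
    lies in \<open>J (Suc n) = J n\<close> and also comes from a list of length \<open>n\<close>.
    Cancelling \<open>y\<close> leaves the monic equation \<open>p\<close>.\<close>
  obtain w where w: "w \<in> I" "i w = x [^]\<^bsub>K\<^esub> n \<otimes>\<^bsub>K\<^esub> i y" using pw by blast
  have "w \<in> J (Suc n)" unfolding J_def using w I.a_subset A0 x
    by (auto simp: K.eval_replicate_zero intro!: exI[of _ "\<one>\<^bsub>K\<^esub> # replicate n \<zero>\<^bsub>K\<^esub>"])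
  then obtain cs where cs: "length cs = n" "set cs \<subseteq> A" "i w = K.eval cs x \<otimes>\<^bsub>K\<^esub> i y"
    unfolding stat by (auto simp: J_def)
  have ec: "K.eval cs x \<in> carrier K" using cs Ac x by (intro K.eval_in_carrier) auto
  have "K.eval cs x = x [^]\<^bsub>K\<^esub> n"
    using cs(3) w(2) x ec yc y i0[of y] K.m_rcancel[of "i y" "K.eval cs x" "x [^]\<^bsub>K\<^esub> n"] by simp
  moreover define p where "p = \<one>\<^bsub>K\<^esub> # map ((\<otimes>\<^bsub>K\<^esub>) (\<ominus>\<^bsub>K\<^esub> \<one>\<^bsub>K\<^esub>)) cs"
  have mA: "\<ominus>\<^bsub>K\<^esub> \<one>\<^bsub>K\<^esub> \<in> A" unfolding A_def
    using i.hom_a_inv[of "\<one>\<^bsub>R\<^esub>"] i.hom_one by (metis imageI a_inv_closed one_closed)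
  ultimately have "K.eval p x = \<zero>\<^bsub>K\<^esub>"
    using cs Ac x by (simp add: p_def K.eval_map_mult K.l_minus K.r_neg)
  moreover have "polynomial\<^bsub>K\<^esub> A p"
    unfolding polynomial_def p_def using cs(2) A0 Amult mA by auto
  ultimately have "integral_over K A x"
    unfolding integral_over_def using p_def by (intro exI[of _ p]) simp
  then show ?thesis by (simp add: A_def)
qed

text \<open>By \<open>st\<close> the fraction \<open>b / a\<close> maps a nonzero ideal into itself,
  so it is integral over \<open>R\<close> and lies in \<open>R\<close>. Integral closure acts only
  through this fact: in the existence of uniformizers, and in showing that \<open>a I = I\<close>
  makes \<open>a\<close> a unit.\<close>

lemma (in noetherian_domain) integrally_closed_dvd:
  assumes ic: "integrally_closed R" and a: "a \<in> carrier R" "a \<noteq> \<zero>" and b: "b \<in> carrier R"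
    and I: "ideal I R" "I \<noteq> {\<zero>}" and st: "\<And>z. z \<in> I \<Longrightarrow> \<exists>w\<in>I. b \<otimes> z = a \<otimes> w"
  shows "\<exists>c\<in>carrier R. b = a \<otimes> c"
proof -
  interpret i: ring_hom_ring R "fraction_field R" "frac_embed R" by (rule frac_embed_ring_hom)
  define x where "x = frac_class R b a"
  have x: "x \<in> carrier (fraction_field R)"
    and ax: "frac_embed R a \<otimes>\<^bsub>fraction_field R\<^esub> x = frac_embed R b"
    unfolding x_def using a b by (auto simp: frac_class_closed frac_class_embed)
  have "integral_over (fraction_field R) (frac_embed R ` carrier R) x"
    by (rule integral_over_if_stable_ideal[OF fraction_field_is_field frac_embed_ring_hom
          frac_embed_inj a b x ax I st])
  then have "x \<in> frac_embed R ` carrier R" using ic x unfolding integrally_closed_def by simp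
  then obtain c where c: "c \<in> carrier R" "x = frac_embed R c" by blast
  then have "frac_embed R (a \<otimes> c) = frac_embed R b" using ax a by simp
  then have "a \<otimes> c = b" using c a b inj_onD[OF frac_embed_inj] by simp
  then show ?thesis using c by blast
qed

subsection \<open>Uniformizers\<close>

text \<open>This is the colon ideal \<open>((a) : b)\<close>, the annihilator of \<open>b\<close>
  modulo \<open>a\<close>, described by elements so that no quotient ring appears.\<close>

lemma (in cring) colon_ideal:
  assumes a: "a \<in> carrier R" and b: "b \<in> carrier R"
  shows "ideal {z \<in> carrier R. \<exists>c\<in>carrier R. z \<otimes> b = a \<otimes> c} R" (is "ideal ?L R")
proof (rule idealI)
  have mul: "r \<otimes> u \<in> ?L" if "u \<in> ?L" "r \<in> carrier R" for u r
  proof -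
    from that obtain c where c: "u \<in> carrier R" "c \<in> carrier R" "u \<otimes> b = a \<otimes> c"
      by auto
    have "r \<otimes> u \<otimes> b = r \<otimes> (u \<otimes> b)" using c(1,2) that b by (simp add: m_assoc)
    also have "\<dots> = a \<otimes> (r \<otimes> c)" unfolding c(3) using c(1,2) that(2) a by (simp add: m_lcomm)
    finally show ?thesis using c that by auto
  qed
  show "ring R" by (rule ring_axioms)
  show "r \<otimes> u \<in> ?L" if "u \<in> ?L" "r \<in> carrier R" for u r using mul that .
  show "u \<otimes> r \<in> ?L" if "u \<in> ?L" "r \<in> carrier R" for u r
    using mul[OF that] that by (simp add: m_comm)
  show "subgroup (?L) (add_monoid R)"
  proof (rule add.subgroupI)
    show "?L \<subseteq> carrier R" by auto
    show "?L \<noteq> {}" using b a by (auto intro!: exI[of _ \<zero>] bexI[of _ \<zero>])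
    show "\<ominus> u \<in> ?L" if "u \<in> ?L" for u
      using mul[OF that, of "\<ominus> \<one>"] that by (simp add: l_minus)
    show "u \<oplus> v \<in> ?L" if uv: "u \<in> ?L" "v \<in> ?L" for u v
    proof -
      from uv obtain c d where c: "u \<in> carrier R" "c \<in> carrier R" "u \<otimes> b = a \<otimes> c"
        and d: "v \<in> carrier R" "d \<in> carrier R" "v \<otimes> b = a \<otimes> d" by auto
      have "(u \<oplus> v) \<otimes> b = a \<otimes> (c \<oplus> d)" using c d b a by (simp add: l_distr r_distr)
      then show ?thesis using c d by auto
    qed
  qed
qed

text \<open>Fix a nonzero \<open>a\<close> in \<open>P\<close>. Among the colon ideals
  \<open>L b = ((a) : b)\<close> inside \<open>P\<close> a maximal one is prime, as for associated
  primes of \<open>R / (a)\<close>; it contains \<open>a\<close>, so it is a maximal ideal and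
  equals \<open>P\<close>. Now \<open>b / a\<close> is not in \<open>R\<close>, so it cannot map
  \<open>P\<close> into itself: some \<open>t\<close> in \<open>P\<close> has
  \<open>t b = a s\<close> with \<open>s\<close> outside \<open>P\<close>. If
  \<open>z b = a w\<close>, this gives \<open>s z = t w\<close>.\<close>

lemma (in noetherian_domain) uniformizer_exists:
  assumes ic: "integrally_closed R" and max: "\<And>I. \<lbrakk>primeideal I R; I \<noteq> {\<zero>}\<rbrakk> \<Longrightarrow> maximalideal I R"
    and P: "primeideal P R" "P \<noteq> {\<zero>}"
  shows "\<exists>t\<in>P. \<exists>s\<in>carrier R - P. \<forall>z\<in>P. \<exists>w\<in>carrier R. s \<otimes> z = t \<otimes> w"
proof -
  interpret P: primeideal P R by (rule P)
  obtain a where a: "a \<in> P" "a \<noteq> \<zero>" using P P.zero_closed by blast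
  have ac: "a \<in> carrier R" using a P.a_subset by blast
  define L where "L b = {z \<in> carrier R. \<exists>c\<in>carrier R. z \<otimes> b = a \<otimes> c}" for b
  have Lid: "ideal (L b) R" if b: "b \<in> carrier R" for b
    unfolding L_def by (rule colon_ideal[OF ac b])
  have "L \<one> \<subseteq> P"
  proof
    fix z assume "z \<in> L \<one>"
    then obtain c where "c \<in> carrier R" "z = a \<otimes> c" by (auto simp: L_def)
    then show "z \<in> P" using P.I_r_closed[OF a(1)] by simp
  qed
  then have ne: "{L b | b. b \<in> carrier R \<and> L b \<subseteq> P} \<noteq> {}" by blast
  obtain b where b: "b \<in> carrier R" "L b \<subseteq> P"
    and bmax: "\<And>c. \<lbrakk>c \<in> carrier R; L c \<subseteq> P; L b \<subseteq> L c\<rbrakk> \<Longrightarrow> L c = L b"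
  proof -
    have "{L b | b. b \<in> carrier R \<and> L b \<subseteq> P} \<subseteq> {I. ideal I R}" using Lid by auto
    from maximal_ideal_in_family[OF this ne] obtain b where "b \<in> carrier R" "L b \<subseteq> P"
      "\<forall>I\<in>{L b | b. b \<in> carrier R \<and> L b \<subseteq> P}. L b \<subseteq> I \<longrightarrow> I = L b" by auto
    then show thesis by (intro that[of b]) auto
  qed
  have Lmul: "L b \<subseteq> L (b \<otimes> x)" if x: "x \<in> carrier R" for x
  proof
    fix z assume "z \<in> L b"
    then obtain c where c: "z \<in> carrier R" "c \<in> carrier R" "z \<otimes> b = a \<otimes> c" by (auto simp: L_def)
    have "z \<otimes> (b \<otimes> x) = (z \<otimes> b) \<otimes> x" using c(1,2) b(1) x by (simp add: m_assoc)
    also have "\<dots> = a \<otimes> (c \<otimes> x)" unfolding c(3) using c(1,2) x ac by (simp add: m_assoc)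
    finally show "z \<in> L (b \<otimes> x)" using c x by (auto simp: L_def)
  qed
  have Lmem: "z \<in> L (b \<otimes> x) \<longleftrightarrow> z \<otimes> x \<in> L b" if "x \<in> carrier R" "z \<in> carrier R" for x z
  proof -
    have "z \<otimes> (b \<otimes> x) = z \<otimes> x \<otimes> b" using that b by (simp add: m_ac)
    then show ?thesis using that by (simp add: L_def)
  qed
  have pr: "primeideal (L b) R"
  proof (rule primeidealI)
    show "ideal (L b) R" by (rule Lid[OF b(1)])
    show "cring R" by (rule cring_axioms)
    show "carrier R \<noteq> L b" using b(2) P.I_notcarr P.a_subset by auto
    fix x y assume xy: "x \<in> carrier R" "y \<in> carrier R" "x \<otimes> y \<in> L b"
    show "x \<in> L b \<or> y \<in> L b"
    proof (cases "L (b \<otimes> y) \<subseteq> P")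
      case True
      then have "L (b \<otimes> y) = L b" using bmax[of "b \<otimes> y"] Lmul[of y] b xy by simp
      then show ?thesis using Lmem[of y x] xy by simp
    next
      \<comment> \<open>Some \<open>s\<close> outside \<open>P\<close> lies in
        \<open>L (b y)\<close>. As \<open>P\<close> is prime, \<open>L (b s)\<close> still lies in
        \<open>P\<close>, so it equals \<open>L b\<close> by maximality; and \<open>s y\<close> in
        \<open>L b\<close> means that \<open>y\<close> is in \<open>L (b s)\<close>.\<close>
      case False
      then obtain s where s': "s \<notin> P" "s \<in> L (b \<otimes> y)" by blast
      then have s: "s \<in> carrier R" "s \<notin> P" "s \<in> L (b \<otimes> y)" by (simp_all add: L_def)
      have "L (b \<otimes> s) \<subseteq> P"
      proof
        fix z assume z: "z \<in> L (b \<otimes> s)"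
        then have zc: "z \<in> carrier R" by (simp add: L_def)
        then have "z \<otimes> s \<in> P" using Lmem[of s z] z s(1) b(2) by auto
        then show "z \<in> P" using P.I_prime[of z s] zc s(1,2) by simp
      qed
      then have "L (b \<otimes> s) = L b" using bmax[of "b \<otimes> s"] Lmul[of s] b s by simp
      moreover have "y \<otimes> s \<in> L b" using Lmem[of y s] s xy m_comm[of s y] by simp
      ultimately show ?thesis using Lmem[of s y] s xy by simp
    qed
  qed
  have "a \<in> L b" unfolding L_def using ac b(1) by blast
  then have "L b \<noteq> {\<zero>}" using a by blast
  then have Lb: "maximalideal (L b) R" by (rule max[OF pr])
  have LP: "L b = P" using maximalideal.I_maximal[OF Lb P.is_ideal b(2) P.a_subset] P.I_notcarr by simp
  have "\<one> \<notin> L b" unfolding LP using P.I_notcarr P.one_imp_carrier by auto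
  then have nd: "\<not> (\<exists>c\<in>carrier R. b = a \<otimes> c)" using b(1) by (simp add: L_def)
  \<comment> \<open>If \<open>b t\<close> were in \<open>a P\<close> for every \<open>t\<close> in
    \<open>P\<close>, then \<open>b / a\<close> would be integral over \<open>R\<close>,
    contradicting \<open>nd\<close>.\<close>
  obtain t where t: "t \<in> P" "\<not> (\<exists>w\<in>P. b \<otimes> t = a \<otimes> w)"
    using integrally_closed_dvd[OF ic ac a(2) b(1) P.is_ideal P(2)] nd by blast
  have tc: "t \<in> carrier R" using t P.a_subset by blast
  obtain s where s: "s \<in> carrier R" "t \<otimes> b = a \<otimes> s" using t(1) unfolding LP[symmetric] L_def by blast
  have "s \<notin> P" using t(2) s m_comm[OF b(1) tc] by metis
  moreover have "\<exists>w\<in>carrier R. s \<otimes> z = t \<otimes> w" if z: "z \<in> P" for z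
  proof -
    obtain w where w: "w \<in> carrier R" "z \<in> carrier R" "z \<otimes> b = a \<otimes> w"
      using z unfolding LP[symmetric] L_def by blast
    have "a \<otimes> (s \<otimes> z) = (t \<otimes> b) \<otimes> z" unfolding s(2) using s(1) w(1,2) ac by (simp add: m_assoc)
    also have "\<dots> = t \<otimes> (z \<otimes> b)" using tc b(1) w(1,2) by (simp add: m_ac)
    also have "\<dots> = a \<otimes> (t \<otimes> w)" unfolding w(3) using tc ac w(1,2) by (simp add: m_lcomm)
    finally have "s \<otimes> z = t \<otimes> w" using ac a(2) tc s(1) w(1,2) m_lcancel[of a "s \<otimes> z" "t \<otimes> w"] by simp
    then show ?thesis using w by blast
  qed
  ultimately show ?thesis using t s by blast
qed

text \<open>
  The condition on \<open>t\<close> and \<open>s0\<close> says that \<open>t\<close> generates the maximal ideal of the localization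
  at \<open>P\<close>.
\<close>

locale uniformized_prime = noetherian_domain R for R (structure) +
  fixes P t s0
  assumes P_maximal: "maximalideal P R" and P_nonzero: "P \<noteq> {\<zero>}"
    and t_in: "t \<in> P" and s0: "s0 \<in> carrier R - P"
    and uniform: "\<And>z. z \<in> P \<Longrightarrow> \<exists>w\<in>carrier R. s0 \<otimes> z = t \<otimes> w"
begin

lemma P_ideal: "ideal P R" using P_maximal by (rule maximalideal.axioms)

lemma P_closed: "z \<in> P \<Longrightarrow> z \<in> carrier R"
  by (rule ideal.Icarr[OF P_ideal])

lemma zero_in_P: "\<zero> \<in> P"
  by (rule additive_subgroup.zero_closed[OF ideal.axioms(1)[OF P_ideal]])

definition Q :: "nat \<Rightarrow> 'a set" where "Q n = ideal_pow R P n"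

lemma P_prime: "primeideal P R"
  by (rule maximalideal_prime[OF P_maximal])

lemma t_closed [simp]: "t \<in> carrier R" by (rule P_closed[OF t_in])

lemma s0_closed [simp]: "s0 \<in> carrier R" using s0 by blast

lemma t_nonzero: "t \<noteq> \<zero>"
proof
  assume t: "t = \<zero>"
  obtain z where z: "z \<in> P" "z \<noteq> \<zero>" using P_nonzero zero_in_P by blast
  then have zc: "z \<in> carrier R" by (intro P_closed)
  obtain w where "w \<in> carrier R" "s0 \<otimes> z = t \<otimes> w" using uniform z by blast
  then have "s0 \<otimes> z = \<zero>" by (simp add: t)
  then show False using integral[of s0 z] z zc s0 zero_in_P by (metis DiffD1 DiffD2)
qed

lemma t_pow_nonzero: "t [^] (n::nat) \<noteq> \<zero>"
  using t_nonzero by (induction n) (simp_all add: integral_iff)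

lemma one_notin: "\<one> \<notin> P" using maximalideal.I_notcarr[OF P_maximal] ideal.one_imp_carrier[OF P_ideal] by auto

lemma unit_mult: "\<lbrakk>a \<in> carrier R - P; b \<in> carrier R - P\<rbrakk> \<Longrightarrow> a \<otimes> b \<in> carrier R - P"
  using primeideal.I_prime[OF P_prime, of a b] by auto

lemma unit_pow: "a \<in> carrier R - P \<Longrightarrow> a [^] (n::nat) \<in> carrier R - P"
proof (induction n)
  case 0 then show ?case using one_notin by simp
next
  case (Suc n) then show ?case using unit_mult[of "a [^] n" a] by simp
qed

lemma unit_nonzero: "a \<in> carrier R - P \<Longrightarrow> a \<noteq> \<zero>" using zero_in_P by blast

lemma Q_0 [simp]: "Q 0 = carrier R"
  unfolding Q_def nat_pow_def by (simp only: nat.rec monoid.simps ideals_set_def)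

lemma Q_Suc: "Q (Suc n) = ideal_prod R (Q n) P"
  unfolding Q_def nat_pow_def by (simp only: nat.rec monoid.simps ideals_set_def)

lemma Q_ideal: "ideal (Q n) R"
proof (induction n)
  case 0 then show ?case by (simp add: oneideal)
next
  case (Suc n) then show ?case unfolding Q_Suc by (rule ideal_prod_is_ideal[OF _ P_ideal])
qed

lemma Q_closed: "z \<in> Q n \<Longrightarrow> z \<in> carrier R"
  by (rule ideal.Icarr[OF Q_ideal])

lemma Q_zero: "\<zero> \<in> Q n"
  by (rule additive_subgroup.zero_closed[OF ideal.axioms(1)[OF Q_ideal]])

lemma Q_add: "\<lbrakk>a \<in> Q n; b \<in> Q n\<rbrakk> \<Longrightarrow> a \<oplus> b \<in> Q n"
  by (rule additive_subgroup.a_closed[OF ideal.axioms(1)[OF Q_ideal]])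

lemma Q_uminus: "a \<in> Q n \<Longrightarrow> \<ominus> a \<in> Q n"
  by (rule additive_subgroup.a_inv_closed[OF ideal.axioms(1)[OF Q_ideal]])

lemma Q_mult_left: "\<lbrakk>a \<in> Q n; r \<in> carrier R\<rbrakk> \<Longrightarrow> r \<otimes> a \<in> Q n"
  by (rule ideal.I_l_closed[OF Q_ideal])

lemma Q_mult_right: "\<lbrakk>a \<in> Q n; r \<in> carrier R\<rbrakk> \<Longrightarrow> a \<otimes> r \<in> Q n"
  by (rule ideal.I_r_closed[OF Q_ideal])

lemma Q_mult_P: "\<lbrakk>a \<in> Q n; p \<in> P\<rbrakk> \<Longrightarrow> a \<otimes> p \<in> Q (Suc n)"
  unfolding Q_Suc by (rule ideal_prod.prod)

lemma Q_1: "Q (Suc 0) = P"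
proof
  show "Q (Suc 0) \<subseteq> P" unfolding Q_Suc using ideal_prod_inter[OF Q_ideal P_ideal] by blast
  show "P \<subseteq> Q (Suc 0)"
  proof
    fix z assume "z \<in> P"
    then show "z \<in> Q (Suc 0)" using Q_mult_P[of \<one> 0 z] P_closed by simp
  qed
qed

lemma t_pow_in_Q: "t [^] n \<in> Q n"
proof (induction n)
  case (Suc n) then show ?case using Q_mult_P[OF Suc t_in] by simp
qed simp

lemma Q_Suc_subset: "Q (Suc n) \<subseteq> Q n"
  unfolding Q_Suc using ideal_prod_inter[OF Q_ideal P_ideal] by blast

lemma Q_antimono: "m \<le> n \<Longrightarrow> Q n \<subseteq> Q m"
  by (rule lift_Suc_antimono_le[of Q, OF Q_Suc_subset])

lemma P_comaximal:
  assumes "s \<in> carrier R - P"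
  shows "\<exists>u\<in>carrier R. \<exists>q\<in>P. s \<otimes> u \<oplus> q = \<one>"
proof -
  have sc: "s \<in> carrier R" using assms by simp
  let ?J = "P <+>\<^bsub>R\<^esub> PIdl s"
  have Jid: "ideal ?J R" by (rule add_ideals[OF P_ideal cgenideal_ideal[OF sc]])
  have PJ: "P \<subseteq> ?J"
  proof
    fix p assume "p \<in> P"
    moreover have "\<zero> \<in> PIdl s" using sc by (auto simp: cgenideal_def intro!: exI[of _ \<zero>])
    moreover have "p = p \<oplus> \<zero>" using P_closed[OF calculation(1)] by simp
    ultimately show "p \<in> ?J" unfolding set_add_def' by blast
  qed
  have sJ: "s \<in> ?J"
  proof -
    have "s = \<zero> \<oplus> s" using sc by simp
    then show ?thesis using cgenideal_self[OF sc] zero_in_P unfolding set_add_def' by blast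
  qed
  have "?J \<subseteq> carrier R" using ideal.Icarr[OF Jid] by blast
  from maximalideal.I_maximal[OF P_maximal Jid PJ this]
  have "?J = P \<or> ?J = carrier R" .
  moreover have "?J \<noteq> P" using sJ assms by blast
  ultimately have "?J = carrier R" by blast
  then have "\<one> \<in> ?J" by simp
  then obtain p y where p: "p \<in> P" "y \<in> PIdl s" "\<one> = p \<oplus> y" unfolding set_add_def' by blast
  then obtain x where x: "x \<in> carrier R" "y = x \<otimes> s" unfolding cgenideal_def by blast
  have "s \<otimes> x \<oplus> p = \<one>" using p(3) x sc P_closed[OF p(1)] by (simp add: m_comm a_comm)
  then show ?thesis using x(1) p(1) by blast
qed

text \<open>Writing \<open>q = q (s v + p)\<close> in \<open>s u + q = 1\<close> raises the power of
  \<open>P\<close> in the remainder by one. The result takes the place of localization: elements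
  outside \<open>P\<close> are invertible modulo every power of \<open>P\<close>.\<close>

lemma unit_inverse:
  assumes s: "s \<in> carrier R - P"
  shows "\<exists>u\<in>carrier R. \<exists>q\<in>Q n. s \<otimes> u \<oplus> q = \<one>"
proof (induction n)
  case 0
  then show ?case using s by (intro bexI[of _ \<zero>] bexI[of _ \<one>]) auto
next
  case (Suc n)
  obtain u q where u: "u \<in> carrier R" "q \<in> Q n" "s \<otimes> u \<oplus> q = \<one>" using Suc by blast
  obtain v p where v: "v \<in> carrier R" "p \<in> P" "s \<otimes> v \<oplus> p = \<one>" using P_comaximal[OF s] by blast
  have c: "q \<in> carrier R" "p \<in> carrier R" "s \<in> carrier R" using u v s Q_closed P_closed by auto
  have "s \<otimes> (u \<oplus> q \<otimes> v) \<oplus> q \<otimes> p = s \<otimes> u \<oplus> q \<otimes> (s \<otimes> v \<oplus> p)"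
    using c u(1) v(1) by (simp add: r_distr m_ac a_ac)
  then have "s \<otimes> (u \<oplus> q \<otimes> v) \<oplus> q \<otimes> p = \<one>" using u(3) v(3) c by simp
  then show ?case using Q_mult_P[OF u(2) v(2)] c u(1) v(1)
    by (intro bexI[of _ "u \<oplus> q \<otimes> v"] bexI[of _ "q \<otimes> p"]) auto
qed

text \<open>Locally \<open>t ^ n\<close> generates \<open>P ^ n\<close>, with the same denominator
  \<open>s0 ^ n\<close> for all elements. The inner induction runs over the products and sums that
  make up the product ideal.\<close>

lemma Q_uniform: "z \<in> Q n \<Longrightarrow> \<exists>w\<in>carrier R. s0 [^] n \<otimes> z = t [^] n \<otimes> w"
proof (induction n arbitrary: z)
  case 0 then show ?case by auto
next
  case (Suc n)
  from Suc.prems have "z \<in> ideal_prod R (Q n) P" unfolding Q_Suc .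
  then show ?case
  proof (induction rule: ideal_prod.induct)
    case (prod i j)
    obtain w where w: "w \<in> carrier R" "s0 [^] n \<otimes> i = t [^] n \<otimes> w" using Suc.IH prod by blast
    obtain v where v: "v \<in> carrier R" "s0 \<otimes> j = t \<otimes> v" using uniform prod by blast
    have c: "i \<in> carrier R" "j \<in> carrier R" using prod Q_closed P_closed by auto
    have "s0 [^] Suc n \<otimes> (i \<otimes> j) = (s0 [^] n \<otimes> i) \<otimes> (s0 \<otimes> j)" using c by (simp add: m_ac)
    also have "\<dots> = t [^] Suc n \<otimes> (w \<otimes> v)"
      unfolding w(2) v(2) using w(1) v(1) by (simp add: m_ac)
    finally show ?case using w(1) v(1) by blast
  next
    case (sum a b)
    then obtain w v where w: "w \<in> carrier R" "s0 [^] Suc n \<otimes> a = t [^] Suc n \<otimes> w"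
      and v: "v \<in> carrier R" "s0 [^] Suc n \<otimes> b = t [^] Suc n \<otimes> v" by blast
    have "a \<in> carrier R" "b \<in> carrier R" using sum Q_closed[of _ "Suc n"] unfolding Q_Suc by auto
    then have "s0 [^] Suc n \<otimes> (a \<oplus> b) = t [^] Suc n \<otimes> (w \<oplus> v)"
      using w v by (simp add: r_distr del: nat_pow_Suc)
    then show ?case using w(1) v(1) by blast
  qed
qed

text \<open>The denominator \<open>s0 ^ k\<close> of \<open>Q_uniform\<close> is invertible modulo
  \<open>P ^ n\<close>, so elements of \<open>P ^ k\<close> are multiples of \<open>t ^ k\<close> up
  to an error in an arbitrarily high power. On anything killed by \<open>P ^ n\<close> the error
  vanishes.\<close>

lemma Q_decomp:
  assumes "z \<in> Q k"
  shows "\<exists>d\<in>carrier R. \<exists>q\<in>Q n. z = t [^] k \<otimes> d \<oplus> q"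
proof -
  have zc: "z \<in> carrier R" using assms Q_closed by blast
  obtain w where w: "w \<in> carrier R" "s0 [^] k \<otimes> z = t [^] k \<otimes> w" using Q_uniform[OF assms] by blast
  obtain u q where u: "u \<in> carrier R" "q \<in> Q n" "s0 [^] k \<otimes> u \<oplus> q = \<one>"
    using unit_inverse[OF unit_pow[OF s0, of k], of n] by auto
  have qc: "q \<in> carrier R" using u Q_closed by blast
  have "z = (s0 [^] k \<otimes> u \<oplus> q) \<otimes> z" using u(3) zc by simp
  also have "\<dots> = (s0 [^] k \<otimes> z) \<otimes> u \<oplus> q \<otimes> z" using u(1) qc zc by (simp add: l_distr r_distr m_ac)
  also have "\<dots> = t [^] k \<otimes> (w \<otimes> u) \<oplus> q \<otimes> z" unfolding w(2) using w(1) u(1) by (simp add: m_assoc)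
  finally show ?thesis using Q_mult_right[OF u(2) zc] w(1) u(1) by blast
qed

lemma Q_cancel_unit:
  assumes s: "s \<in> carrier R - P" and a: "a \<in> carrier R" and sa: "s \<otimes> a \<in> Q k"
  shows "a \<in> Q k"
proof -
  obtain u q where u: "u \<in> carrier R" "q \<in> Q k" "s \<otimes> u \<oplus> q = \<one>" using unit_inverse[OF s, of k] by auto
  have c: "q \<in> carrier R" "s \<in> carrier R" using u Q_closed s by auto
  have "a = (s \<otimes> u \<oplus> q) \<otimes> a" using u(3) a by simp
  also have "\<dots> = (s \<otimes> a) \<otimes> u \<oplus> q \<otimes> a" using u(1) c a by (simp add: l_distr r_distr m_ac)
  finally show ?thesis using Q_add[OF Q_mult_right[OF sa u(1)] Q_mult_right[OF u(2) a]] by simp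
qed

text \<open>In a domain \<open>t ^ j\<close> cancels from
  \<open>s0 ^ (j + k) t ^ j a = t ^ (j + k) w\<close>, and \<open>Q_cancel_unit\<close> removes
  \<open>s0 ^ (j + k)\<close>. Thus \<open>t\<close> has valuation exactly one.\<close>

lemma Q_cancel_t:
  assumes a: "a \<in> carrier R" and ta: "t [^] j \<otimes> a \<in> Q (j + k)"
  shows "a \<in> Q k"
proof -
  obtain w where w: "w \<in> carrier R" "s0 [^] (j + k) \<otimes> (t [^] j \<otimes> a) = t [^] (j + k) \<otimes> w"
    using Q_uniform[OF ta] by (elim bexE) (rule that)
  have "t [^] j \<otimes> (s0 [^] (j + k) \<otimes> a) = t [^] j \<otimes> (t [^] k \<otimes> w)"
  proof -
    have "t [^] j \<otimes> (s0 [^] (j + k) \<otimes> a) = s0 [^] (j + k) \<otimes> (t [^] j \<otimes> a)" using a by (simp add: m_lcomm)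
    also have "\<dots> = (t [^] j \<otimes> t [^] k) \<otimes> w" unfolding w(2) by (simp add: nat_pow_mult)
    finally show ?thesis using w(1) by (simp add: m_assoc)
  qed
  moreover have "t [^] j \<noteq> \<zero>" by (rule t_pow_nonzero)
  ultimately have "s0 [^] (j + k) \<otimes> a = t [^] k \<otimes> w"
    using m_lcancel[of "t [^] j" "s0 [^] (j + k) \<otimes> a" "t [^] k \<otimes> w"] w(1) a by simp
  then have "s0 [^] (j + k) \<otimes> a \<in> Q k" using Q_mult_right[OF t_pow_in_Q w(1)] by simp
  then show ?thesis by (rule Q_cancel_unit[OF unit_pow[OF s0] a])
qed

end

section \<open>Normal forms modulo powers of the prime, and the valuation\<close>

context uniformized_prime
begin

text \<open>The exponent \<open>j\<close> is the valuation of \<open>d\<close>: membership in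
  \<open>P ^ j\<close> gives the factor \<open>t ^ j\<close>, and a cofactor in \<open>P\<close>
  would put \<open>d\<close> into \<open>P ^ (j + 1)\<close>.\<close>

lemma Q_form:
  assumes d: "d \<in> carrier R" "d \<notin> Q n"
  shows "\<exists>j<n. \<exists>c\<in>carrier R - P. \<exists>q\<in>Q n. d = t [^] j \<otimes> c \<oplus> q"
proof -
  \<comment> \<open>One more than the valuation of \<open>d\<close>; it is positive because
    \<open>Q 0\<close> is all of \<open>R\<close>.\<close>
  define k where "k = (LEAST k. d \<notin> Q k)"
  have k: "d \<notin> Q k" "k \<le> n" unfolding k_def
    using LeastI[of "\<lambda>k. d \<notin> Q k" n] Least_le[of "\<lambda>k. d \<notin> Q k" n] d(2) by auto
  have "k \<noteq> 0" using k(1) d(1) by (cases k) auto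
  then obtain j where j: "k = Suc j" by (cases k) auto
  have dj: "d \<in> Q j" using not_less_Least[of j "\<lambda>k. d \<notin> Q k"] j unfolding k_def[symmetric] by simp
  obtain c q where c: "c \<in> carrier R" "q \<in> Q n" "d = t [^] j \<otimes> c \<oplus> q" using Q_decomp[OF dj, of n] by blast
  have "c \<notin> P"
  proof
    assume "c \<in> P"
    then have "t [^] j \<otimes> c \<in> Q k" using Q_mult_P[OF t_pow_in_Q] j by simp
    moreover have "q \<in> Q k" using Q_antimono[OF k(2)] c(2) by blast
    ultimately show False using k(1) c(3) Q_add by blast
  qed
  then show ?thesis using c j k(2) by (intro exI[of _ j]) auto
qed

text \<open>Multiply the form in \<open>Q_form\<close> by an inverse of \<open>c\<close> modulo
  \<open>P ^ n\<close>. Applied to an \<open>x\<close> killed by \<open>P ^ n\<close>, this finds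
  some \<open>t ^ j x\<close> among the multiples of any nonzero \<open>d x\<close>.\<close>

lemma Q_unform:
  assumes d: "d \<in> carrier R" "d \<notin> Q n"
  shows "\<exists>j<n. \<exists>e\<in>carrier R. \<exists>q\<in>Q n. e \<otimes> d = t [^] j \<oplus> q"
proof -
  obtain j c q where j: "j < n" "c \<in> carrier R - P" "q \<in> Q n" "d = t [^] j \<otimes> c \<oplus> q"
    using Q_form[OF d] by (elim exE conjE bexE)
  obtain u p where u: "u \<in> carrier R" "p \<in> Q n" "c \<otimes> u \<oplus> p = \<one>" using unit_inverse[OF j(2), of n] by blast
  have cc: "q \<in> carrier R" "p \<in> carrier R" "c \<in> carrier R" using j u Q_closed by auto
  have cu: "c \<otimes> u = \<one> \<ominus> p" using u(3) cc u(1) by (metis add.inv_solve_right' m_closed minus_eq one_closed)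
  have "u \<otimes> d = t [^] j \<otimes> (c \<otimes> u) \<oplus> u \<otimes> q"
    unfolding j(4) using u(1) cc by (simp add: r_distr m_ac)
  also have "\<dots> = t [^] j \<oplus> (\<ominus> (t [^] j \<otimes> p) \<oplus> u \<otimes> q)"
    unfolding cu using u(1) cc by (simp add: minus_eq r_distr r_minus a_assoc)
  finally have "u \<otimes> d = t [^] j \<oplus> (\<ominus> (t [^] j \<otimes> p) \<oplus> u \<otimes> q)" .
  moreover have "\<ominus> (t [^] j \<otimes> p) \<oplus> u \<otimes> q \<in> Q n"
    using u(1,2) j(3) by (intro Q_add Q_uminus Q_mult_left) auto
  ultimately show ?thesis using j(1) u(1) by blast
qed

text \<open>This is the contraction to \<open>R\<close> of the ideal that \<open>z\<close> generates
  in the localization at \<open>P\<close>.\<close>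

lemma local_multiples_ideal:
  assumes z: "z \<in> carrier R"
  shows "ideal {y \<in> carrier R. \<exists>s\<in>carrier R - P. \<exists>c\<in>carrier R. s \<otimes> y = z \<otimes> c} R"
    (is "ideal ?L R")
proof (rule idealI)
  have mul: "r \<otimes> u \<in> ?L" if u: "u \<in> ?L" and r: "r \<in> carrier R" for u r
  proof -
    obtain s c where s: "s \<in> carrier R - P" "c \<in> carrier R" "s \<otimes> u = z \<otimes> c" "u \<in> carrier R"
      using u by blast
    have sc: "s \<in> carrier R" using s by blast
    have "s \<otimes> (r \<otimes> u) = r \<otimes> (s \<otimes> u)" using sc r s(4) by (simp add: m_lcomm)
    also have "\<dots> = z \<otimes> (r \<otimes> c)" unfolding s(3) using r z s(2) by (simp add: m_lcomm)
    finally have "s \<otimes> (r \<otimes> u) = z \<otimes> (r \<otimes> c)" .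
    then show ?thesis using s(1,2,4) r by blast
  qed
  show "ring R" by (rule ring_axioms)
  show "r \<otimes> u \<in> ?L" if "u \<in> ?L" "r \<in> carrier R" for u r using mul that .
  show "u \<otimes> r \<in> ?L" if "u \<in> ?L" "r \<in> carrier R" for u r
  proof -
    have "r \<otimes> u = u \<otimes> r" using that by (simp add: m_comm)
    then show ?thesis using mul[OF that] by simp
  qed
  show "subgroup ?L (add_monoid R)"
  proof (rule add.subgroupI)
    show "?L \<subseteq> carrier R" by blast
    have "\<one> \<otimes> \<zero> = z \<otimes> \<zero>" using z by simp
    then show "?L \<noteq> {}" using one_notin by blast
    show "\<ominus> u \<in> ?L" if u: "u \<in> ?L" for u
    proof -
      have "\<ominus> u = \<ominus> \<one> \<otimes> u" using u by (simp add: l_minus)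
      then show ?thesis using mul[OF u, of "\<ominus> \<one>"] by simp
    qed
    show "u \<oplus> v \<in> ?L" if uv: "u \<in> ?L" "v \<in> ?L" for u v
    proof -
      obtain s c where s: "s \<in> carrier R - P" "c \<in> carrier R" "s \<otimes> u = z \<otimes> c" "u \<in> carrier R"
        using uv(1) by blast
      obtain r d where r: "r \<in> carrier R - P" "d \<in> carrier R" "r \<otimes> v = z \<otimes> d" "v \<in> carrier R"
        using uv(2) by blast
      have c: "s \<in> carrier R" "r \<in> carrier R" using s r by blast+
      have "s \<otimes> r \<otimes> (u \<oplus> v) = r \<otimes> (s \<otimes> u) \<oplus> s \<otimes> (r \<otimes> v)"
        using c s(4) r(4) by (simp add: r_distr m_ac)
      also have "\<dots> = z \<otimes> (r \<otimes> c \<oplus> s \<otimes> d)"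
        unfolding s(3) r(3) using c s(2) r(2) z by (simp add: r_distr m_lcomm)
      finally have "s \<otimes> r \<otimes> (u \<oplus> v) = z \<otimes> (r \<otimes> c \<oplus> s \<otimes> d)" .
      moreover have "r \<otimes> c \<oplus> s \<otimes> d \<in> carrier R" using c s(2) r(2) by simp
      ultimately show ?thesis using unit_mult[OF s(1) r(1)] s(4) r(4) by blast
    qed
  qed
qed

text \<open>Noetherian descent on the contracted ideals \<open>L z\<close>. A \<open>z\<close>
  without such a form lies in \<open>P\<close>, and locally dividing it by \<open>t\<close> gives
  another such element \<open>w\<close> with \<open>L z\<close> inside \<open>L w\<close>. Equality
  would make a product of elements outside \<open>P\<close> a multiple of \<open>t\<close>.\<close>

lemma valuation:
  assumes "z \<in> carrier R" "z \<noteq> \<zero>"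
  shows "\<exists>n. \<exists>s\<in>carrier R - P. \<exists>w\<in>carrier R - P. s \<otimes> z = t [^] (n::nat) \<otimes> w"
proof (rule ccontr)
  define L where "L z = {y \<in> carrier R. \<exists>s\<in>carrier R - P. \<exists>c\<in>carrier R. s \<otimes> y = z \<otimes> c}" for z
  define good where
    "good z \<longleftrightarrow> (\<exists>n. \<exists>s\<in>carrier R - P. \<exists>w\<in>carrier R - P. s \<otimes> z = t [^] (n::nat) \<otimes> w)" for z
  define B where "B = {z \<in> carrier R. z \<noteq> \<zero> \<and> \<not> good z}"
  assume "\<not> ?thesis"
  then have "z \<in> B" using assms by (simp add: B_def good_def)
  then have "L ` B \<noteq> {}" by blast
  moreover have "L ` B \<subseteq> {I. ideal I R}"
    using local_multiples_ideal by (auto simp: L_def B_def)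
  ultimately obtain z where z: "z \<in> B" "\<forall>I\<in>L ` B. L z \<subseteq> I \<longrightarrow> I = L z"
    using maximal_ideal_in_family[of "L ` B"] by auto
  then have zc: "z \<in> carrier R" "z \<noteq> \<zero>" "\<not> good z" by (auto simp: B_def)
  have "z \<in> P"
  proof (rule ccontr)
    assume "z \<notin> P"
    then have "\<one> \<in> carrier R - P" "z \<in> carrier R - P" "\<one> \<otimes> z = t [^] (0::nat) \<otimes> z"
      using zc one_notin by auto
    then show False using zc(3) unfolding good_def by blast
  qed
  then obtain w where w: "w \<in> carrier R" "s0 \<otimes> z = t \<otimes> w" using uniform by blast
  have w0: "w \<noteq> \<zero>"
  proof
    assume "w = \<zero>"
    then have "s0 \<otimes> z = \<zero>" using w by simp
    then show False using integral[of s0 z] zc(1,2) unit_nonzero[OF s0] by auto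
  qed
  have "\<not> good w"
  proof
    assume "good w"
    then obtain n s v where v: "s \<in> carrier R - P" "v \<in> carrier R - P" "s \<otimes> w = t [^] (n::nat) \<otimes> v"
      unfolding good_def by blast
    have c: "s \<in> carrier R" "v \<in> carrier R" using v by blast+
    have "s \<otimes> s0 \<otimes> z = s \<otimes> (s0 \<otimes> z)" using c zc(1) by (simp add: m_assoc)
    also have "\<dots> = (s \<otimes> w) \<otimes> t" unfolding w(2) using c w(1) by (simp add: m_ac)
    also have "\<dots> = t [^] Suc n \<otimes> v" unfolding v(3) using c by (simp add: m_ac)
    finally show False using zc(3) unit_mult[OF v(1) s0] v(2) unfolding good_def by blast
  qed
  then have "L w \<in> L ` B" using w(1) w0 by (simp add: B_def)
  moreover have "L z \<subseteq> L w"
  proof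
    fix y assume "y \<in> L z"
    then obtain s c where s: "s \<in> carrier R - P" "c \<in> carrier R" "s \<otimes> y = z \<otimes> c" "y \<in> carrier R"
      unfolding L_def by blast
    have sc: "s \<in> carrier R" using s by blast
    have "s0 \<otimes> s \<otimes> y = s0 \<otimes> (s \<otimes> y)" using sc s(4) by (simp add: m_assoc)
    also have "\<dots> = (s0 \<otimes> z) \<otimes> c" unfolding s(3) using s(2) zc(1) by (simp add: m_assoc)
    also have "\<dots> = w \<otimes> (t \<otimes> c)" unfolding w(2) using w(1) s(2) by (simp add: m_ac)
    finally have "s0 \<otimes> s \<otimes> y = w \<otimes> (t \<otimes> c)" .
    moreover have "t \<otimes> c \<in> carrier R" using s(2) by simp
    ultimately show "y \<in> L w" unfolding L_def using unit_mult[OF s0 s(1)] s(4) by blast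
  qed
  ultimately have "L w = L z" using z(2) by blast
  moreover have "\<one> \<otimes> w = w \<otimes> \<one>" using w(1) by simp
  then have "w \<in> L w" unfolding L_def using w(1) one_notin by blast
  ultimately obtain s c where s: "s \<in> carrier R - P" "c \<in> carrier R" "s \<otimes> w = z \<otimes> c"
    unfolding L_def by blast
  have sc: "s \<in> carrier R" using s by blast
  have "z \<otimes> (s \<otimes> s0) = s \<otimes> (s0 \<otimes> z)" using sc zc(1) by (simp add: m_ac)
  also have "\<dots> = t \<otimes> (s \<otimes> w)" unfolding w(2) using sc w(1) by (simp add: m_lcomm)
  also have "\<dots> = z \<otimes> (t \<otimes> c)" unfolding s(3) using zc(1) s(2) by (simp add: m_lcomm)
  finally have "s \<otimes> s0 = t \<otimes> c" using m_lcancel[of z "s \<otimes> s0" "t \<otimes> c"] zc(1,2) sc s(2) by simp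
  moreover have "t \<otimes> c \<in> P" by (rule ideal.I_r_closed[OF P_ideal t_in s(2)])
  ultimately show False using unit_mult[OF s(1) s0] by simp
qed

text \<open>For \<open>n\<close> the valuation of \<open>z\<close>, locally \<open>P ^ n\<close>
  lies in \<open>z R\<close>, and one denominator \<open>s\<close> serves all of
  \<open>P ^ n\<close>. This separates the \<open>P\<close>-part of an element killed by
  \<open>z\<close> from the rest.\<close>

lemma nonzero_ideal_contains_Q:
  assumes z: "z \<in> carrier R" "z \<noteq> \<zero>"
  shows "\<exists>n. \<exists>s\<in>carrier R - P. \<forall>p\<in>Q n. \<exists>d\<in>carrier R. s \<otimes> p = d \<otimes> z"
proof -
  obtain n s w where v: "s \<in> carrier R - P" "w \<in> carrier R - P" "s \<otimes> z = t [^] (n::nat) \<otimes> w"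
    using valuation[OF z] by blast
  have c: "s \<in> carrier R" "w \<in> carrier R" using v by blast+
  have "\<exists>d\<in>carrier R. w \<otimes> s0 [^] n \<otimes> p = d \<otimes> z" if p: "p \<in> Q n" for p
  proof -
    obtain x where x: "x \<in> carrier R" "s0 [^] n \<otimes> p = t [^] n \<otimes> x" using Q_uniform[OF p] by blast
    have "w \<otimes> s0 [^] n \<otimes> p = w \<otimes> (s0 [^] n \<otimes> p)" using c Q_closed[OF p] by (simp add: m_assoc)
    also have "\<dots> = x \<otimes> (t [^] n \<otimes> w)" unfolding x(2) using c x(1) by (simp add: m_ac)
    also have "\<dots> = x \<otimes> s \<otimes> z" unfolding v(3)[symmetric] using c x(1) z by (simp add: m_assoc)
    finally show ?thesis using x(1) c by blast
  qed
  then show ?thesis using unit_mult[OF v(2) unit_pow[OF s0]] by blast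
qed

text \<open>An element of least valuation in \<open>I\<close> divides every element of
  \<open>I\<close> locally. As \<open>I\<close> is finitely generated, the denominators of the
  generators multiply to a common \<open>s\<close>.\<close>

lemma ideal_locally_principal:
  assumes I: "ideal I R" "I \<noteq> {\<zero>}"
  shows "\<exists>x\<in>I. x \<noteq> \<zero> \<and> (\<exists>s\<in>carrier R - P. \<forall>z\<in>I. \<exists>w\<in>carrier R. s \<otimes> z = x \<otimes> w)"
proof -
  have Ic: "z \<in> carrier R" if "z \<in> I" for z by (rule ideal.Icarr[OF I(1) that])
  have zI: "\<zero> \<in> I" by (rule additive_subgroup.zero_closed[OF ideal.axioms(1)[OF I(1)]])
  define v where "v n \<longleftrightarrow> (\<exists>x\<in>I. x \<noteq> \<zero> \<and>
    (\<exists>s\<in>carrier R - P. \<exists>w\<in>carrier R - P. s \<otimes> x = t [^] n \<otimes> w))" for n :: nat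
  obtain z0 where "z0 \<in> I" "z0 \<noteq> \<zero>" using I zI by blast
  then have "\<exists>n. v n" using valuation[OF Ic] unfolding v_def by blast
  then have "v (LEAST n. v n)" by (rule LeastI_ex)
  then obtain n where n: "v n" "\<And>m. v m \<Longrightarrow> n \<le> m" using Least_le[of v] by blast
  then obtain x s w where x: "x \<in> I" "x \<noteq> \<zero>" "s \<in> carrier R - P" "w \<in> carrier R - P"
    "s \<otimes> x = t [^] n \<otimes> w" unfolding v_def by blast
  have c: "x \<in> carrier R" "s \<in> carrier R" "w \<in> carrier R" using x Ic by blast+
  have loc: "\<exists>r\<in>carrier R - P. \<exists>y\<in>carrier R. r \<otimes> z = x \<otimes> y" if z: "z \<in> I" for z
  proof (cases "z = \<zero>")
    case True
    then have "\<one> \<otimes> z = x \<otimes> \<zero>" using c by simp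
    then show ?thesis using one_notin by blast
  next
    case False
    obtain m r y where r: "r \<in> carrier R - P" "y \<in> carrier R - P" "r \<otimes> z = t [^] (m::nat) \<otimes> y"
      using valuation[OF Ic[OF z] False] by blast
    have rc: "r \<in> carrier R" "y \<in> carrier R" using r by blast+
    have "v m" unfolding v_def using z False r by blast
    then obtain k where k: "m = n + k" using n(2) le_Suc_ex by blast
    have "w \<otimes> r \<otimes> z = w \<otimes> (r \<otimes> z)" using c rc Ic[OF z] by (simp add: m_assoc)
    also have "\<dots> = t [^] k \<otimes> y \<otimes> (t [^] n \<otimes> w)"
      unfolding r(3) k nat_pow_mult[symmetric, OF t_closed] using c rc by (simp add: m_ac)
    also have "\<dots> = x \<otimes> (t [^] k \<otimes> y \<otimes> s)" unfolding x(5)[symmetric] using c rc by (simp add: m_ac)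
    finally have "w \<otimes> r \<otimes> z = x \<otimes> (t [^] k \<otimes> y \<otimes> s)" .
    moreover have "t [^] k \<otimes> y \<otimes> s \<in> carrier R" using c rc by simp
    ultimately show ?thesis using unit_mult[OF x(4) r(1)] by blast
  qed
  obtain A where A: "A \<subseteq> carrier R" "finite A" "I = Idl A" using finetely_gen[OF I(1)] by blast
  have AI: "A \<subseteq> I" unfolding A(3) by (rule genideal_self[OF A(1)])
  have "\<exists>r\<in>carrier R - P. \<forall>z\<in>B. \<exists>y\<in>carrier R. r \<otimes> z = x \<otimes> y" if "finite B" "B \<subseteq> I" for B
    using that
  proof (induction B rule: finite_induct)
    case empty then show ?case using one_notin by blast
  next
    case (insert a B)
    then obtain r where r: "r \<in> carrier R - P" "\<forall>z\<in>B. \<exists>y\<in>carrier R. r \<otimes> z = x \<otimes> y" by blast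
    have aI: "a \<in> I" using insert by blast
    obtain q b where q: "q \<in> carrier R - P" "b \<in> carrier R" "q \<otimes> a = x \<otimes> b" using loc[OF aI] by blast
    have rc: "r \<in> carrier R" "q \<in> carrier R" "a \<in> carrier R" using r q Ic[OF aI] by blast+
    have "\<exists>y\<in>carrier R. q \<otimes> r \<otimes> z = x \<otimes> y" if z: "z \<in> insert a B" for z
    proof (cases "z = a")
      case True
      have "q \<otimes> r \<otimes> a = r \<otimes> (q \<otimes> a)" using rc by (simp add: m_ac)
      also have "\<dots> = x \<otimes> (r \<otimes> b)" unfolding q(3) using rc c q(2) by (simp add: m_lcomm)
      finally show ?thesis using True rc q(2) by blast
    next
      case False
      then obtain y where y: "y \<in> carrier R" "r \<otimes> z = x \<otimes> y" using r z by blast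
      have zc: "z \<in> carrier R" using z insert.prems Ic by blast
      have "q \<otimes> r \<otimes> z = q \<otimes> (r \<otimes> z)" using rc zc by (simp add: m_assoc)
      also have "\<dots> = x \<otimes> (q \<otimes> y)" unfolding y(2) using rc c y(1) by (simp add: m_lcomm)
      finally show ?thesis using rc y(1) by blast
    qed
    then show ?case using unit_mult[OF q(1) r(1)] by blast
  qed
  from this[OF A(2) AI] obtain r where r: "r \<in> carrier R - P"
    "\<forall>z\<in>A. \<exists>y\<in>carrier R. r \<otimes> z = x \<otimes> y" by blast
  have rc: "r \<in> carrier R" using r by blast
  \<comment> \<open>The elements that \<open>r\<close> multiplies into \<open>x R\<close> form the
    colon ideal \<open>((x) : r)\<close>, so it suffices to test the generators.\<close>
  have "A \<subseteq> {z \<in> carrier R. \<exists>y\<in>carrier R. z \<otimes> r = x \<otimes> y}"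
  proof
    fix z assume z: "z \<in> A"
    then have "z \<in> carrier R" using A(1) by blast
    then show "z \<in> {z \<in> carrier R. \<exists>y\<in>carrier R. z \<otimes> r = x \<otimes> y}"
      using r(2) z m_comm[OF _ rc] by simp
  qed
  then have "I \<subseteq> {z \<in> carrier R. \<exists>y\<in>carrier R. z \<otimes> r = x \<otimes> y}"
    unfolding A(3) by (rule genideal_minimal[OF colon_ideal[OF c(1) rc]])
  then have "\<forall>z\<in>I. \<exists>y\<in>carrier R. r \<otimes> z = x \<otimes> y"
  proof (intro ballI)
    fix z assume I: "I \<subseteq> {z \<in> carrier R. \<exists>y\<in>carrier R. z \<otimes> r = x \<otimes> y}" and z: "z \<in> I"
    then have "\<exists>y\<in>carrier R. z \<otimes> r = x \<otimes> y" by blast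
    then show "\<exists>y\<in>carrier R. r \<otimes> z = x \<otimes> y" using m_comm[OF Ic[OF z] rc] by simp
  qed
  then show ?thesis using x(1,2) r(1) by blast
qed

end

section \<open>Ideals of a Dedekind domain and their invertibility\<close>

locale dedekind = noetherian_domain R for R (structure) +
  assumes integrally_closed: "integrally_closed R"
    and primes_maximal: "\<lbrakk>primeideal I R; I \<noteq> {\<zero>}\<rbrakk> \<Longrightarrow> maximalideal I R"
begin

lemma uniformized_prime_exists:
  assumes "primeideal P R" "P \<noteq> {\<zero>}"
  shows "\<exists>t s. uniformized_prime R P t s"
proof -
  have "\<exists>t\<in>P. \<exists>s\<in>carrier R - P. \<forall>z\<in>P. \<exists>w\<in>carrier R. s \<otimes> z = t \<otimes> w"
    by (rule uniformizer_exists[OF integrally_closed _ assms]) (rule primes_maximal)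
  then obtain t s where t: "t \<in> P" "s \<in> carrier R - P" "\<forall>z\<in>P. \<exists>w\<in>carrier R. s \<otimes> z = t \<otimes> w"
    by blast
  have "uniformized_prime R P t s"
    by (rule uniformized_prime.intro[OF noetherian_domain_axioms], rule uniformized_prime_axioms.intro)
      (use t primes_maximal[OF assms] assms in blast)+
  then show ?thesis by blast
qed

lemma maximal_ideal_above:
  assumes "ideal A R" "A \<noteq> carrier R"
  shows "\<exists>P. maximalideal P R \<and> A \<subseteq> P"
proof -
  let ?S = "{I. ideal I R \<and> A \<subseteq> I \<and> I \<noteq> carrier R}"
  have sub: "?S \<subseteq> {I. ideal I R}" by (rule subsetI) simp
  have "A \<in> ?S" using assms by simp
  then have ne: "?S \<noteq> {}" by (rule ex_in_conv[THEN iffD1, OF exI])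
  from maximal_ideal_in_family[OF sub ne]
  obtain P where P: "P \<in> ?S" and max: "\<forall>I\<in>?S. P \<subseteq> I \<longrightarrow> I = P" by (elim bexE) (rule that)
  have P': "ideal P R" "A \<subseteq> P" "P \<noteq> carrier R" using P by simp_all
  have "maximalideal P R"
  proof (rule maximalidealI)
    show "ideal P R" "carrier R \<noteq> P" using P' by simp_all
    show "J = P \<or> J = carrier R" if J: "ideal J R" "P \<subseteq> J" for J
    proof (cases "J = carrier R")
      case False
      have "A \<subseteq> J" using P'(2) J(2) by (rule subset_trans)
      then have "J \<in> ?S" using False J(1) by simp
      then have "J = P" using max J(2) by simp
      then show ?thesis by simp
    qed simp
  qed
  then show ?thesis using P'(2) by (intro exI[of _ P]) simp
qed

text \<open>
  With \<open>J = (c : I)\<close> this says \<open>I J = (c)\<close>: a nonzero ideal is invertible. The conductor of \<open>c\<close>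
  into \<open>I J\<close> lies in no maximal ideal because \<open>I\<close> is locally principal.
\<close>

lemma ideal_invertible:
  assumes I: "ideal I R" and c: "c \<in> I" "c \<noteq> \<zero>"
  shows "c \<in> ideal_prod R I {a \<in> carrier R. \<forall>z\<in>I. \<exists>w\<in>carrier R. a \<otimes> z = c \<otimes> w}"
proof -
  have Ic: "z \<in> carrier R" if "z \<in> I" for z by (rule ideal.Icarr[OF I that])
  have cc: "c \<in> carrier R" using c Ic by blast
  define J where "J = {a \<in> carrier R. \<forall>z\<in>I. \<exists>w\<in>carrier R. a \<otimes> z = c \<otimes> w}"
  have J: "ideal J R"
  proof -
    \<comment> \<open>An intersection of colon ideals; inserting \<open>carrier R\<close> makes the
      family visibly nonempty, as \<open>i_Intersect\<close> requires.\<close>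
    have "J = \<Inter> (insert (carrier R) ((\<lambda>z. {a \<in> carrier R. \<exists>w\<in>carrier R. a \<otimes> z = c \<otimes> w}) ` I))"
      unfolding J_def by auto
    moreover have "ideal (\<Inter> (insert (carrier R) ((\<lambda>z. {a \<in> carrier R. \<exists>w\<in>carrier R. a \<otimes> z = c \<otimes> w}) ` I))) R"
    proof (rule i_Intersect)
      show "ideal K R" if "K \<in> insert (carrier R)
          ((\<lambda>z. {a \<in> carrier R. \<exists>w\<in>carrier R. a \<otimes> z = c \<otimes> w}) ` I)" for K
        using that oneideal colon_ideal[OF cc Ic] by blast
    qed simp
    ultimately show ?thesis by simp
  qed
  define A where "A = {d \<in> carrier R. d \<otimes> c \<in> ideal_prod R I J}"
  have IJ: "ideal (ideal_prod R I J) R" by (rule ideal_prod_is_ideal[OF I J])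
  have A: "ideal A R"
  proof (rule idealI)
    show "ring R" by (rule ring_axioms)
    show "subgroup A (add_monoid R)"
    proof (rule add.subgroupI)
      show "A \<subseteq> carrier R" unfolding A_def by blast
      have "\<zero> \<in> A" unfolding A_def using cc
        additive_subgroup.zero_closed[OF ideal.axioms(1)[OF IJ]] by simp
      then show "A \<noteq> {}" by blast
      show "\<ominus> u \<in> A" if "u \<in> A" for u
        using that cc additive_subgroup.a_inv_closed[OF ideal.axioms(1)[OF IJ]]
        unfolding A_def by (simp add: l_minus)
      show "u \<oplus> v \<in> A" if "u \<in> A" "v \<in> A" for u v
        using that cc additive_subgroup.a_closed[OF ideal.axioms(1)[OF IJ]]
        unfolding A_def by (simp add: l_distr)
    qed
    show mul: "r \<otimes> u \<in> A" if "u \<in> A" "r \<in> carrier R" for u r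
      using that cc ideal.I_l_closed[OF IJ, of "u \<otimes> c" r] unfolding A_def by (simp add: m_assoc)
    show "u \<otimes> r \<in> A" if "u \<in> A" "r \<in> carrier R" for u r
    proof -
      have "u \<otimes> r = r \<otimes> u" using that unfolding A_def by (simp add: m_comm)
      then show ?thesis using mul[OF that] by simp
    qed
  qed
  have "A = carrier R"
  proof (rule ccontr)
    assume "A \<noteq> carrier R"
    then obtain P where P: "maximalideal P R" "A \<subseteq> P" using maximal_ideal_above[OF A] by blast
    \<comment> \<open>Since \<open>c c\<close> lies in \<open>I J\<close>, the element
      \<open>c\<close> is in \<open>A\<close>; hence \<open>P\<close> is nonzero and has a
      uniformizer.\<close>
    have "c \<in> J" unfolding J_def using cc Ic by blast
    then have "c \<in> A" unfolding A_def using cc ideal_prod.prod[OF c(1) \<open>c \<in> J\<close>, of R] by simp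
    then have "P \<noteq> {\<zero>}" using P c(2) by blast
    then obtain t s0 where "uniformized_prime R P t s0"
      using uniformized_prime_exists[OF maximalideal_prime[OF P(1)]] by blast
    then interpret u: uniformized_prime R P t s0 .
    have "I \<noteq> {\<zero>}" using c by blast
    then obtain x s where x: "x \<in> I" "x \<noteq> \<zero>" "s \<in> carrier R - P"
      "\<forall>z\<in>I. \<exists>w\<in>carrier R. s \<otimes> z = x \<otimes> w"
      using u.ideal_locally_principal[OF I] by blast
    have xc: "x \<in> carrier R" "s \<in> carrier R" using x Ic by blast+
    \<comment> \<open>Here \<open>y\<close> is \<open>s c / x\<close>. From
      \<open>y z = c (s z / x)\<close> it lies in \<open>J\<close>, so \<open>s c = x y\<close> is
      in \<open>I J\<close> and \<open>s\<close> is in \<open>A\<close>, although \<open>s\<close>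
      is outside \<open>P\<close>.\<close>
    obtain y where y: "y \<in> carrier R" "s \<otimes> c = x \<otimes> y" using x(4) c by blast
    have "\<exists>w\<in>carrier R. y \<otimes> z = c \<otimes> w" if z: "z \<in> I" for z
    proof -
      obtain w where w: "w \<in> carrier R" "s \<otimes> z = x \<otimes> w" using x(4) z by blast
      have "x \<otimes> (y \<otimes> z) = (s \<otimes> c) \<otimes> z" unfolding y(2) using xc y(1) Ic[OF z] by (simp add: m_assoc)
      also have "\<dots> = c \<otimes> (s \<otimes> z)" using xc cc Ic[OF z] by (simp add: m_ac)
      also have "\<dots> = x \<otimes> (c \<otimes> w)" unfolding w(2) using xc cc w(1) by (simp add: m_lcomm)
      finally have "y \<otimes> z = c \<otimes> w"
        using m_lcancel[of x "y \<otimes> z" "c \<otimes> w"] xc x(2) y(1) Ic[OF z] cc w(1) by simp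
      then show ?thesis using w(1) by blast
    qed
    then have "y \<in> J" unfolding J_def using y(1) by blast
    then have "s \<otimes> c \<in> ideal_prod R I J" unfolding y(2) by (intro ideal_prod.prod x(1))
    then have "s \<in> A" unfolding A_def using xc by blast
    then show False using P(2) x(3) by blast
  qed
  then have "\<one> \<in> A" by simp
  then show ?thesis unfolding A_def J_def using cc by simp
qed

end

subsection \<open>Submodules and direct sums\<close>

context module
begin

abbreviation sm :: "'c set \<Rightarrow> bool" where "sm N \<equiv> Module.submodule N R M"

lemma sm_intro:
  assumes "N \<subseteq> carrier M" "\<zero>\<^bsub>M\<^esub> \<in> N" "\<And>x y. \<lbrakk>x \<in> N; y \<in> N\<rbrakk> \<Longrightarrow> x \<oplus>\<^bsub>M\<^esub> y \<in> N"
    and smult: "\<And>a x. \<lbrakk>a \<in> carrier R; x \<in> N\<rbrakk> \<Longrightarrow> a \<odot>\<^bsub>M\<^esub> x \<in> N"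
  shows "sm N"
proof (rule submoduleI)
  fix x assume x: "x \<in> N"
  then have "\<ominus>\<^bsub>M\<^esub> x = (\<ominus> \<one>) \<odot>\<^bsub>M\<^esub> x" using assms(1) smult_l_minus[of \<one> x] by auto
  then show "\<ominus>\<^bsub>M\<^esub> x \<in> N" using smult[OF _ x] by simp
qed (use assms in auto)

lemma
  assumes N: "sm N"
  shows sm_closed: "x \<in> N \<Longrightarrow> x \<in> carrier M"
    and sm_zero: "\<zero>\<^bsub>M\<^esub> \<in> N"
    and sm_add: "\<lbrakk>x \<in> N; y \<in> N\<rbrakk> \<Longrightarrow> x \<oplus>\<^bsub>M\<^esub> y \<in> N"
    and sm_smult: "\<lbrakk>a \<in> carrier R; x \<in> N\<rbrakk> \<Longrightarrow> a \<odot>\<^bsub>M\<^esub> x \<in> N"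
    and sm_neg: "x \<in> N \<Longrightarrow> \<ominus>\<^bsub>M\<^esub> x \<in> N"
    and sm_minus: "\<lbrakk>x \<in> N; y \<in> N\<rbrakk> \<Longrightarrow> x \<ominus>\<^bsub>M\<^esub> y \<in> N"
proof -
  note E = submoduleE[OF N]
  show c: "x \<in> N \<Longrightarrow> x \<in> carrier M" for x using E(1) by (rule subsetD)
  show "\<lbrakk>x \<in> N; y \<in> N\<rbrakk> \<Longrightarrow> x \<oplus>\<^bsub>M\<^esub> y \<in> N" for x y by (rule E(5))
  show "\<lbrakk>a \<in> carrier R; x \<in> N\<rbrakk> \<Longrightarrow> a \<odot>\<^bsub>M\<^esub> x \<in> N" by (rule E(4))
  show n: "x \<in> N \<Longrightarrow> \<ominus>\<^bsub>M\<^esub> x \<in> N" for x by (rule E(3))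
  show "\<lbrakk>x \<in> N; y \<in> N\<rbrakk> \<Longrightarrow> x \<ominus>\<^bsub>M\<^esub> y \<in> N" unfolding a_minus_def by (intro E(5) n)
  obtain x where x: "x \<in> N" using E(2) by (metis ex_in_conv)
  show "\<zero>\<^bsub>M\<^esub> \<in> N" using E(5)[OF x n[OF x]] M.r_neg[OF c[OF x]] by simp
qed

lemma sm_subset: "sm N \<Longrightarrow> N \<subseteq> carrier M"
  by (rule submoduleE(1))

lemma sm_carrier: "sm (carrier M)"
  by (rule carrier_is_submodule)

lemma sm_singleton_zero: "sm {\<zero>\<^bsub>M\<^esub>}"
  by (rule sm_intro) auto

lemma sm_Int: "\<lbrakk>sm A; sm B\<rbrakk> \<Longrightarrow> sm (A \<inter> B)"
  by (rule sm_intro) (simp_all add: sm_zero sm_add sm_smult le_infI1 sm_subset)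

text \<open>A bridge between two notions of submodule: \<open>span\<close> and its facts use
  \<open>LinearCombinations.submodule\<close>, everything else uses
  \<open>Module.submodule\<close>.\<close>

lemma afp_submodule: "sm N \<Longrightarrow> LinearCombinations.submodule R N M"
  unfolding LinearCombinations.submodule_def
  by (simp add: module_axioms sm_subset sm_zero sm_add sm_smult)

lemma sm_of_afp:
  assumes "LinearCombinations.submodule R N M"
  shows "sm N"
  using assms unfolding LinearCombinations.submodule_def by (intro sm_intro) simp_all

lemma sm_is_module: "sm N \<Longrightarrow> module R (M\<lparr>carrier := N\<rparr>)"
  by (rule submodule.submodule_is_module[OF _ module_axioms])

text \<open>Lets every statement about a submodule as a module in its own right be read inside the
  ambient \<open>M\<close>.\<close>

lemma sm_restrict:
  assumes N: "sm N"
  shows "Module.submodule A R (M\<lparr>carrier := N\<rparr>) \<longleftrightarrow> sm A \<and> A \<subseteq> N"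
proof -
  interpret N: module R "M\<lparr>carrier := N\<rparr>" by (rule sm_is_module[OF N])
  show ?thesis
  proof (intro iffI conjI)
    assume A: "Module.submodule A R (M\<lparr>carrier := N\<rparr>)"
    show AN: "A \<subseteq> N" using N.sm_subset[OF A] by simp
    show "sm A" using AN sm_subset[OF N] N.sm_zero[OF A] N.sm_add[OF A] N.sm_smult[OF A]
      by (intro sm_intro) auto
  next
    assume A: "sm A \<and> A \<subseteq> N"
    then show "Module.submodule A R (M\<lparr>carrier := N\<rparr>)"
      by (intro N.sm_intro) (simp_all add: sm_zero sm_add sm_smult)
  qed
qed

abbreviation msum :: "'c set \<Rightarrow> 'c set \<Rightarrow> 'c set" where "msum A B \<equiv> A <+>\<^bsub>M\<^esub> B"

lemma msum_iff: "x \<in> msum A B \<longleftrightarrow> (\<exists>a\<in>A. \<exists>b\<in>B. x = a \<oplus>\<^bsub>M\<^esub> b)"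
  by (auto simp: set_add_def')

lemma msumI: "\<lbrakk>a \<in> A; b \<in> B\<rbrakk> \<Longrightarrow> a \<oplus>\<^bsub>M\<^esub> b \<in> msum A B"
  by (auto simp: msum_iff)

lemma msumE:
  assumes "x \<in> msum A B"
  obtains a b where "a \<in> A" "b \<in> B" "x = a \<oplus>\<^bsub>M\<^esub> b"
  using assms by (auto simp: msum_iff)

lemma sm_msum:
  assumes A: "sm A" and B: "sm B"
  shows "sm (msum A B)"
proof (rule sm_intro)
  note c = sm_closed[OF A] sm_closed[OF B]
  show "msum A B \<subseteq> carrier M" using c by (auto elim!: msumE)
  show "\<zero>\<^bsub>M\<^esub> \<in> msum A B" using msumI[OF sm_zero[OF A] sm_zero[OF B]] by simp
  fix x assume "x \<in> msum A B"
  then obtain a b where x: "a \<in> A" "b \<in> B" "x = a \<oplus>\<^bsub>M\<^esub> b" by (rule msumE)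
  show "r \<odot>\<^bsub>M\<^esub> x \<in> msum A B" if r: "r \<in> carrier R" for r
    using msumI[OF sm_smult[OF A r x(1)] sm_smult[OF B r x(2)]] x c r by (simp add: smult_r_distr)
  fix y assume "y \<in> msum A B"
  then obtain a' b' where y: "a' \<in> A" "b' \<in> B" "y = a' \<oplus>\<^bsub>M\<^esub> b'" by (rule msumE)
  have "x \<oplus>\<^bsub>M\<^esub> y = (a \<oplus>\<^bsub>M\<^esub> a') \<oplus>\<^bsub>M\<^esub> (b \<oplus>\<^bsub>M\<^esub> b')"
    unfolding x y using c x(1,2) y(1,2) by (simp add: M.a_ac)
  then show "x \<oplus>\<^bsub>M\<^esub> y \<in> msum A B"
    using msumI[OF sm_add[OF A x(1) y(1)] sm_add[OF B x(2) y(2)]] by simp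
qed

lemma
  assumes A: "sm A" and B: "sm B"
  shows msum_upper1: "A \<subseteq> msum A B" and msum_upper2: "B \<subseteq> msum A B"
proof -
  show "A \<subseteq> msum A B"
  proof
    fix x assume x: "x \<in> A"
    from msumI[OF x sm_zero[OF B]] show "x \<in> msum A B" using sm_closed[OF A x] by simp
  qed
  show "B \<subseteq> msum A B"
  proof
    fix x assume x: "x \<in> B"
    from msumI[OF sm_zero[OF A] x] show "x \<in> msum A B" using sm_closed[OF B x] by simp
  qed
qed

lemma msum_least: "\<lbrakk>sm C; A \<subseteq> C; B \<subseteq> C\<rbrakk> \<Longrightarrow> msum A B \<subseteq> C"
  by (rule subsetI, erule msumE) (simp add: sm_add subset_iff)

lemma msum_commute:
  assumes "sm A" "sm B" shows "msum A B = msum B A"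
  by (intro subset_antisym msum_least sm_msum msum_upper1 msum_upper2 assms)

definition cyc :: "'c \<Rightarrow> 'c set" where "cyc x = {a \<odot>\<^bsub>M\<^esub> x | a. a \<in> carrier R}"

lemma cycI: "a \<in> carrier R \<Longrightarrow> a \<odot>\<^bsub>M\<^esub> x \<in> cyc x"
  by (auto simp: cyc_def)

lemma cycE:
  assumes "y \<in> cyc x" obtains a where "a \<in> carrier R" "y = a \<odot>\<^bsub>M\<^esub> x"
  using assms by (auto simp: cyc_def)

lemma sm_cyc:
  assumes x: "x \<in> carrier M" shows "sm (cyc x)"
proof (rule sm_intro)
  show "cyc x \<subseteq> carrier M" using x by (auto elim!: cycE)
  show "\<zero>\<^bsub>M\<^esub> \<in> cyc x" using cycI[of \<zero> x] x by simp
  fix y assume "y \<in> cyc x"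
  then obtain a where a: "a \<in> carrier R" "y = a \<odot>\<^bsub>M\<^esub> x" by (rule cycE)
  show "r \<odot>\<^bsub>M\<^esub> y \<in> cyc x" if "r \<in> carrier R" for r
    using cycI[of "r \<otimes> a" x] a x that by (simp add: smult_assoc1)
  fix z assume "z \<in> cyc x"
  then obtain b where b: "b \<in> carrier R" "z = b \<odot>\<^bsub>M\<^esub> x" by (rule cycE)
  show "y \<oplus>\<^bsub>M\<^esub> z \<in> cyc x"
    using cycI[of "a \<oplus> b" x] a b x by (simp add: smult_l_distr)
qed

lemma cyc_self: "x \<in> carrier M \<Longrightarrow> x \<in> cyc x"
  using cycI[of \<one> x] by simp

lemma cyc_least: "\<lbrakk>sm N; x \<in> N\<rbrakk> \<Longrightarrow> cyc x \<subseteq> N"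
  by (auto elim!: cycE simp: sm_smult)

lemma span_singleton:
  assumes x: "x \<in> carrier M" shows "span {x} = cyc x"
proof
  show "span {x} \<subseteq> cyc x"
    by (rule span_is_subset[OF _ afp_submodule[OF sm_cyc[OF x]]]) (simp add: cyc_self x)
  have s: "sm (span {x})" by (rule sm_of_afp[OF span_is_submodule]) (simp add: x)
  have "{x} \<subseteq> span {x}" by (rule in_own_span) (simp add: x)
  then show "cyc x \<subseteq> span {x}" by (intro cyc_least s) simp
qed

text \<open>The total \<open>C\<close> is an explicit argument, so summands of summands stay inside
  one ambient module instead of nested restricted records.\<close>

definition dsum :: "'c set \<Rightarrow> 'c set \<Rightarrow> 'c set \<Rightarrow> bool" where
  "dsum A B C \<longleftrightarrow> sm A \<and> sm B \<and> msum A B = C \<and> A \<inter> B = {\<zero>\<^bsub>M\<^esub>}"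

lemma dsumI:
  "\<lbrakk>sm A; sm B; msum A B = C; \<And>x. \<lbrakk>x \<in> A; x \<in> B\<rbrakk> \<Longrightarrow> x = \<zero>\<^bsub>M\<^esub>\<rbrakk> \<Longrightarrow> dsum A B C"
  unfolding dsum_def by (auto simp: sm_zero)

lemma
  assumes "dsum A B C"
  shows dsum_sm1: "sm A" and dsum_sm2: "sm B" and dsum_eq: "msum A B = C"
    and dsum_disjoint: "\<lbrakk>x \<in> A; x \<in> B\<rbrakk> \<Longrightarrow> x = \<zero>\<^bsub>M\<^esub>" and dsum_sm: "sm C"
    and dsum_subset1: "A \<subseteq> C" and dsum_subset2: "B \<subseteq> C"
proof -
  show A: "sm A" and B: "sm B" and C: "msum A B = C" using assms by (simp_all add: dsum_def)
  show "\<lbrakk>x \<in> A; x \<in> B\<rbrakk> \<Longrightarrow> x = \<zero>\<^bsub>M\<^esub>" using assms unfolding dsum_def by blast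
  show "sm C" "A \<subseteq> C" "B \<subseteq> C"
    unfolding C[symmetric] by (rule sm_msum msum_upper1 msum_upper2, rule A, rule B)+
qed

lemma dsum_sym: "dsum A B C \<Longrightarrow> dsum B A C"
  unfolding dsum_def using msum_commute[of A B] by (simp add: Int_commute)

lemma dsumE:
  assumes "dsum A B C" "x \<in> C"
  obtains a b where "a \<in> A" "b \<in> B" "x = a \<oplus>\<^bsub>M\<^esub> b" "a \<in> carrier M" "b \<in> carrier M"
proof -
  have "x \<in> msum A B" using assms dsum_eq by simp
  then obtain a b where "a \<in> A" "b \<in> B" "x = a \<oplus>\<^bsub>M\<^esub> b" by (rule msumE)
  then show thesis
    using that[of a b] sm_closed[OF dsum_sm1[OF assms(1)]] sm_closed[OF dsum_sm2[OF assms(1)]] by simp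
qed

lemma add_minus_cancel:
  assumes "a \<in> carrier M" "b \<in> carrier M"
  shows "(b \<oplus>\<^bsub>M\<^esub> a) \<ominus>\<^bsub>M\<^esub> a = b" "(a \<oplus>\<^bsub>M\<^esub> b) \<ominus>\<^bsub>M\<^esub> a = b" "(b \<ominus>\<^bsub>M\<^esub> a) \<oplus>\<^bsub>M\<^esub> a = b"
    "a \<oplus>\<^bsub>M\<^esub> (b \<ominus>\<^bsub>M\<^esub> a) = b"
proof -
  show 1: "(b \<oplus>\<^bsub>M\<^esub> a) \<ominus>\<^bsub>M\<^esub> a = b" using assms by (simp add: a_minus_def M.a_assoc M.r_neg)
  show "(a \<oplus>\<^bsub>M\<^esub> b) \<ominus>\<^bsub>M\<^esub> a = b" using 1 assms by (simp add: M.a_comm)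
  show 3: "(b \<ominus>\<^bsub>M\<^esub> a) \<oplus>\<^bsub>M\<^esub> a = b" using assms by (simp add: a_minus_def M.a_assoc M.l_neg)
  show "a \<oplus>\<^bsub>M\<^esub> (b \<ominus>\<^bsub>M\<^esub> a) = b" using 3 assms M.minus_closed[of b a] by (simp add: M.a_comm)
qed

lemma minus_eq_zero_iff:
  assumes "a \<in> carrier M" "b \<in> carrier M"
  shows "a \<ominus>\<^bsub>M\<^esub> b = \<zero>\<^bsub>M\<^esub> \<longleftrightarrow> a = b"
proof
  assume "a \<ominus>\<^bsub>M\<^esub> b = \<zero>\<^bsub>M\<^esub>"
  then have "\<zero>\<^bsub>M\<^esub> \<oplus>\<^bsub>M\<^esub> b = a" using add_minus_cancel(3)[OF assms(2,1)] by simp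
  then show "a = b" using assms by simp
qed (use assms in \<open>simp add: a_minus_def M.r_neg\<close>)

lemma diff_swap:
  assumes c: "a \<in> carrier M" "b \<in> carrier M" "a' \<in> carrier M" "b' \<in> carrier M"
    and eq: "a \<oplus>\<^bsub>M\<^esub> b = a' \<oplus>\<^bsub>M\<^esub> b'"
  shows "a \<ominus>\<^bsub>M\<^esub> a' = b' \<ominus>\<^bsub>M\<^esub> b"
proof -
  have "a = (a' \<oplus>\<^bsub>M\<^esub> b') \<ominus>\<^bsub>M\<^esub> b" unfolding eq[symmetric] using c by (simp add: add_minus_cancel)
  also have "\<dots> = a' \<oplus>\<^bsub>M\<^esub> (b' \<ominus>\<^bsub>M\<^esub> b)" using c by (simp add: a_minus_def M.a_assoc)
  finally show ?thesis using add_minus_cancel(2)[of a' "b' \<ominus>\<^bsub>M\<^esub> b"] c by simp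
qed

lemma dsum_unique:
  assumes d: "dsum A B C" and ab: "a \<in> A" "b \<in> B" "a' \<in> A" "b' \<in> B"
    and eq: "a \<oplus>\<^bsub>M\<^esub> b = a' \<oplus>\<^bsub>M\<^esub> b'"
  shows "a = a'" "b = b'"
proof -
  note A = dsum_sm1[OF d] and B = dsum_sm2[OF d]
  have c: "a \<in> carrier M" "b \<in> carrier M" "a' \<in> carrier M" "b' \<in> carrier M"
    using ab sm_closed[OF A] sm_closed[OF B] by auto
  have e: "a \<ominus>\<^bsub>M\<^esub> a' = b' \<ominus>\<^bsub>M\<^esub> b" by (rule diff_swap[OF c eq])
  have "a \<ominus>\<^bsub>M\<^esub> a' \<in> A" by (rule sm_minus[OF A ab(1,3)])
  moreover have "a \<ominus>\<^bsub>M\<^esub> a' \<in> B" unfolding e by (rule sm_minus[OF B ab(4,2)])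
  ultimately have z: "a \<ominus>\<^bsub>M\<^esub> a' = \<zero>\<^bsub>M\<^esub>" by (rule dsum_disjoint[OF d])
  then show a: "a = a'" by (rule minus_eq_zero_iff[OF c(1,3), THEN iffD1])
  have "b = (a \<oplus>\<^bsub>M\<^esub> b) \<ominus>\<^bsub>M\<^esub> a" by (rule add_minus_cancel(2)[OF c(1,2), symmetric])
  also have "\<dots> = b'" unfolding eq unfolding a by (rule add_minus_cancel(2)[OF c(3,4)])
  finally show "b = b'" .
qed

lemma dsum_zero_right:
  assumes A: "sm A" shows "dsum A {\<zero>\<^bsub>M\<^esub>} A"
proof (rule dsumI[OF A sm_singleton_zero])
  show "msum A {\<zero>\<^bsub>M\<^esub>} = A"
    by (rule subset_antisym[OF msum_least[OF A] msum_upper1[OF A sm_singleton_zero]])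
      (simp_all add: sm_zero A)
qed simp

text \<open>The modular law: the \<open>A\<close>-component of an element of \<open>U\<close> is in
  \<open>U\<close>, hence so is its \<open>B\<close>-component.\<close>

lemma dsum_modular:
  assumes d: "dsum A B C" and U: "sm U" "A \<subseteq> U" "U \<subseteq> C"
  shows "dsum A (B \<inter> U) U"
proof (rule dsumI)
  show A: "sm A" by (rule dsum_sm1[OF d])
  show BX: "sm (B \<inter> U)" by (rule sm_Int[OF dsum_sm2[OF d] U(1)])
  show "x = \<zero>\<^bsub>M\<^esub>" if "x \<in> A" "x \<in> B \<inter> U" for x using dsum_disjoint[OF d that(1)] that(2) by simp
  show "msum A (B \<inter> U) = U"
  proof
    show "msum A (B \<inter> U) \<subseteq> U" by (rule msum_least[OF U(1,2)]) simp
    show "U \<subseteq> msum A (B \<inter> U)"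
    proof
      fix x assume x: "x \<in> U"
      then have "x \<in> C" using U(3) by (rule subsetD[rotated])
      then obtain a b where ab: "a \<in> A" "b \<in> B" "x = a \<oplus>\<^bsub>M\<^esub> b" "a \<in> carrier M" "b \<in> carrier M"
        by (rule dsumE[OF d])
      have "x \<ominus>\<^bsub>M\<^esub> a \<in> U" by (rule sm_minus[OF U(1) x]) (use U(2) ab(1) in auto)
      moreover have "x \<ominus>\<^bsub>M\<^esub> a = b" unfolding ab(3) using ab(4,5) by (simp add: add_minus_cancel)
      ultimately show "x \<in> msum A (B \<inter> U)" unfolding ab(3) using ab by (intro msumI) auto
    qed
  qed
qed

text \<open>Associativity of direct sums; it is what enlarges a summand by a piece split off from
  its complement.\<close>

lemma dsum_regroup:
  assumes d: "dsum A B C" and e: "dsum B1 B2 B"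
  shows "dsum A B1 (msum A B1)" "dsum (msum A B1) B2 C"
proof -
  note sA = dsum_sm1[OF d] and sB1 = dsum_sm1[OF e] and sB2 = dsum_sm2[OF e]
  note cl = sm_closed[OF sA] sm_closed[OF sB1] sm_closed[OF sB2]
  have B1: "B1 \<subseteq> B" and B2: "B2 \<subseteq> B" using dsum_subset1[OF e] dsum_subset2[OF e] by auto
  show AB1: "dsum A B1 (msum A B1)"
    by (rule dsumI[OF sA sB1 refl]) (use dsum_disjoint[OF d] B1 in auto)
  show "dsum (msum A B1) B2 C"
  proof (rule dsumI[OF dsum_sm[OF AB1] sB2])
    show "msum (msum A B1) B2 = C"
    proof
      show "msum (msum A B1) B2 \<subseteq> C"
        using dsum_subset1[OF d] dsum_subset2[OF d] B1 B2
        by (intro msum_least dsum_sm[OF d]) auto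
      show "C \<subseteq> msum (msum A B1) B2"
      proof
        fix x assume "x \<in> C"
        then obtain a b where ab: "a \<in> A" "b \<in> B" "x = a \<oplus>\<^bsub>M\<^esub> b" by (rule dsumE[OF d])
        from ab(2) obtain u v where uv: "u \<in> B1" "v \<in> B2" "b = u \<oplus>\<^bsub>M\<^esub> v" by (rule dsumE[OF e])
        have "x = (a \<oplus>\<^bsub>M\<^esub> u) \<oplus>\<^bsub>M\<^esub> v" unfolding ab(3) uv(3) using cl ab(1) uv(1,2) by (simp add: M.a_assoc)
        then show "x \<in> msum (msum A B1) B2" using ab(1) uv(1,2) by (auto intro: msumI)
      qed
    qed
    fix x assume x: "x \<in> msum A B1" "x \<in> B2"
    then obtain a b where ab: "a \<in> A" "b \<in> B1" "x = a \<oplus>\<^bsub>M\<^esub> b" by (elim msumE)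
    have "a \<oplus>\<^bsub>M\<^esub> b = \<zero>\<^bsub>M\<^esub> \<oplus>\<^bsub>M\<^esub> x" using ab(3) cl(3)[OF x(2)] by simp
    moreover have "b \<in> B" "x \<in> B" using ab(2) x(2) B1 B2 by auto
    ultimately have "b = x" using dsum_unique(2)[OF d ab(1) _ sm_zero[OF sA]] by simp
    then show "x = \<zero>\<^bsub>M\<^esub>" using dsum_disjoint[OF e] ab(2) x(2) by simp
  qed
qed

lemma internal_direct_sum_iff:
  assumes C: "sm C"
  shows "internal_direct_sum R (M\<lparr>carrier := C\<rparr>) A B \<longleftrightarrow> dsum A B C"
proof -
  have e: "A <+>\<^bsub>M\<lparr>carrier := C\<rparr>\<^esub> B = msum A B" by (simp add: set_add_def')
  show ?thesis
  proof
    assume "internal_direct_sum R (M\<lparr>carrier := C\<rparr>) A B"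
    then show "dsum A B C"
      unfolding internal_direct_sum_def e sm_restrict[OF C] dsum_def by simp
  next
    assume d: "dsum A B C"
    show "internal_direct_sum R (M\<lparr>carrier := C\<rparr>) A B"
      unfolding internal_direct_sum_def e sm_restrict[OF C]
      using d dsum_subset1[OF d] dsum_subset2[OF d] unfolding dsum_def by simp
  qed
qed

lemma internal_direct_sum_carrier_iff:
  "internal_direct_sum R M A B \<longleftrightarrow> dsum A B (carrier M)"
  using internal_direct_sum_iff[OF sm_carrier] by simp

lemma direct_summand_iff:
  "sm C \<Longrightarrow> direct_summand R (M\<lparr>carrier := C\<rparr>) A \<longleftrightarrow> (\<exists>B. dsum A B C)"
  by (simp add: direct_summand_def internal_direct_sum_iff)

lemma direct_summand_carrier_iff:
  "direct_summand R M A \<longleftrightarrow> (\<exists>B. dsum A B (carrier M))"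
  by (simp add: direct_summand_def internal_direct_sum_carrier_iff)

end

subsection \<open>Noetherian modules\<close>

text \<open>The maximal condition on submodules is the form in which the constructions below consume
  finite generation: complements and summands are obtained as maximal members of families.\<close>

locale noetherian_module = module R M for R (structure) and M +
  assumes maximal_submodule_in_family:
    "\<lbrakk>\<And>N. N \<in> S \<Longrightarrow> sm N; S \<noteq> {}\<rbrakk> \<Longrightarrow> \<exists>N\<in>S. \<forall>N'\<in>S. N \<subseteq> N' \<longrightarrow> N' = N"

lemma (in noetherian_module) noetherian_restrict:
  assumes N: "sm N"
  shows "noetherian_module R (M\<lparr>carrier := N\<rparr>)"
proof (rule noetherian_module.intro[OF sm_is_module[OF N]], rule noetherian_module_axioms.intro)
  fix S assume "\<And>N'. N' \<in> S \<Longrightarrow> Module.submodule N' R (M\<lparr>carrier := N\<rparr>)" "S \<noteq> {}"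
  then show "\<exists>N\<in>S. \<forall>N'\<in>S. N \<subseteq> N' \<longrightarrow> N' = N"
    by (intro maximal_submodule_in_family) (simp_all add: sm_restrict[OF N])
qed

lemma (in module) span_insert_subset:
  assumes "x \<in> carrier M" "F \<subseteq> carrier M"
  shows "span (insert x F) \<subseteq> msum (cyc x) (span F)"
proof (rule span_is_subset)
  have F: "sm (span F)" by (rule sm_of_afp[OF span_is_submodule[OF assms(2)]])
  have x: "sm (cyc x)" by (rule sm_cyc[OF assms(1)])
  show "LinearCombinations.submodule R (msum (cyc x) (span F)) M"
    by (rule afp_submodule[OF sm_msum[OF x F]])
  show "insert x F \<subseteq> msum (cyc x) (span F)"
    using msum_upper1[OF x F] msum_upper2[OF x F] cyc_self[OF assms(1)] in_own_span[OF assms(2)]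
    by auto
qed

text \<open>
  Noetherian induction along \<open>0 \<rightarrow> span F \<rightarrow> span (insert x F) \<rightarrow> R / I\<close>: a submodule is determined
  among its overmodules by its leading ideal at \<open>x\<close> and its intersection with \<open>span F\<close>.
\<close>

lemma (in module) span_finite_noetherian:
  assumes R: "noetherian_ring R" and "finite F" "F \<subseteq> carrier M"
    and "\<And>N. N \<in> S \<Longrightarrow> sm N" "\<And>N. N \<in> S \<Longrightarrow> N \<subseteq> span F" "S \<noteq> {}"
  shows "\<exists>N\<in>S. \<forall>N'\<in>S. N \<subseteq> N' \<longrightarrow> N' = N"
  using assms(2-)
proof (induction F arbitrary: S rule: finite_induct)
  case empty
  have z: "N = {\<zero>\<^bsub>M\<^esub>}" if "N \<in> S" for N
  proof -
    have "span {} \<subseteq> {\<zero>\<^bsub>M\<^esub>}" unfolding span_def lincomb_def by auto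
    with empty.prems(3)[OF that] have "N \<subseteq> {\<zero>\<^bsub>M\<^esub>}" by (rule subset_trans)
    then show ?thesis using sm_zero[OF empty.prems(2)[OF that]] by (intro subset_antisym) simp_all
  qed
  obtain N where N: "N \<in> S" using empty.prems(4) by (rule ex_in_conv[THEN iffD2, THEN exE])
  have "N' = N" if "N' \<in> S" for N' using z[OF N] z[OF that] by simp
  then show ?case by (intro bexI[OF _ N] ballI impI)
next
  case (insert x F)
  have xF: "x \<in> carrier M" "F \<subseteq> carrier M" using insert.prems(1) by auto
  have F: "sm (span F)" by (rule sm_of_afp[OF span_is_submodule[OF xF(2)]])
  define I where "I N = {a \<in> carrier R. \<exists>n\<in>N. \<exists>y\<in>span F. n = a \<odot>\<^bsub>M\<^esub> x \<oplus>\<^bsub>M\<^esub> y}" for N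
  have Fc: "y \<in> carrier M" if "y \<in> span F" for y by (rule sm_closed[OF F that])
  have Iid: "ideal (I N) R" if "N \<in> S" for N
  proof -
    note N = insert.prems(2)[OF that]
    have Nc: "n \<in> carrier M" if "n \<in> N" for n by (rule sm_closed[OF N that])
    have mul: "r \<otimes> a \<in> I N" if a: "a \<in> I N" and r: "r \<in> carrier R" for a r
    proof -
      obtain n y where n: "n \<in> N" "y \<in> span F" "n = a \<odot>\<^bsub>M\<^esub> x \<oplus>\<^bsub>M\<^esub> y" "a \<in> carrier R"
        using a unfolding I_def by auto
      have "r \<odot>\<^bsub>M\<^esub> n = (r \<otimes> a) \<odot>\<^bsub>M\<^esub> x \<oplus>\<^bsub>M\<^esub> r \<odot>\<^bsub>M\<^esub> y"
        unfolding n(3) using n(2,4) r xF Fc by (simp add: smult_r_distr smult_assoc1)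
      then show ?thesis unfolding I_def using n(4) r sm_smult[OF N r n(1)] sm_smult[OF F r n(2)]
        by (intro CollectI conjI bexI[of _ "r \<odot>\<^bsub>M\<^esub> n"] bexI[of _ "r \<odot>\<^bsub>M\<^esub> y"]) simp_all
    qed
    show ?thesis
    proof (rule idealI)
      show "ring R" by (rule R.ring_axioms)
      show "r \<otimes> a \<in> I N" if "a \<in> I N" "r \<in> carrier R" for a r by (rule mul[OF that])
      show "a \<otimes> r \<in> I N" if "a \<in> I N" "r \<in> carrier R" for a r
      proof -
        have "a \<in> carrier R" using that(1) by (simp add: I_def)
        then have e: "a \<otimes> r = r \<otimes> a" using that(2) by (rule R.m_comm)
        show ?thesis unfolding e by (rule mul[OF that])
      qed
      show "subgroup (I N) (add_monoid R)"
      proof (rule R.add.subgroupI)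
        show "I N \<subseteq> carrier R" unfolding I_def by auto
        have "\<zero>\<^bsub>M\<^esub> = \<zero> \<odot>\<^bsub>M\<^esub> x \<oplus>\<^bsub>M\<^esub> \<zero>\<^bsub>M\<^esub>" using xF by simp
        then have "\<exists>n\<in>N. \<exists>y\<in>span F. n = \<zero> \<odot>\<^bsub>M\<^esub> x \<oplus>\<^bsub>M\<^esub> y"
          by (rule bexI[OF bexI[OF _ sm_zero[OF F]] sm_zero[OF N]])
        then have "\<zero> \<in> I N" unfolding I_def by simp
        then show "I N \<noteq> {}" by auto
        show "\<ominus> a \<in> I N" if "a \<in> I N" for a
        proof -
          have "a \<in> carrier R" using that by (simp add: I_def)
          then have e: "\<ominus> a = \<ominus> \<one> \<otimes> a" by (simp add: R.l_minus)
          show ?thesis unfolding e by (rule mul[OF that]) simp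
        qed
        show "a \<oplus> b \<in> I N" if a: "a \<in> I N" and b: "b \<in> I N" for a b
        proof -
          obtain n y where n: "n \<in> N" "y \<in> span F" "n = a \<odot>\<^bsub>M\<^esub> x \<oplus>\<^bsub>M\<^esub> y" "a \<in> carrier R"
            using a unfolding I_def by auto
          obtain m z where m: "m \<in> N" "z \<in> span F" "m = b \<odot>\<^bsub>M\<^esub> x \<oplus>\<^bsub>M\<^esub> z" "b \<in> carrier R"
            using b unfolding I_def by auto
          have "n \<oplus>\<^bsub>M\<^esub> m = (a \<oplus> b) \<odot>\<^bsub>M\<^esub> x \<oplus>\<^bsub>M\<^esub> (y \<oplus>\<^bsub>M\<^esub> z)"
            unfolding n(3) m(3) using n(2,4) m(2,4) xF Fc by (simp add: smult_l_distr M.a_ac)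
          then show ?thesis unfolding I_def
            using n(4) m(4) sm_add[OF N n(1) m(1)] sm_add[OF F n(2) m(2)]
            by (intro CollectI conjI bexI[of _ "n \<oplus>\<^bsub>M\<^esub> m"] bexI[of _ "y \<oplus>\<^bsub>M\<^esub> z"]) simp_all
        qed
      qed
    qed
  qed
  have "I ` S \<subseteq> {J. ideal J R}" by (rule image_subsetI) (rule CollectI, rule Iid)
  moreover have "I ` S \<noteq> {}" using insert.prems(4) by (simp only: image_is_empty not_False_eq_True)
  ultimately have "\<exists>J\<in>I ` S. \<forall>K\<in>I ` S. J \<subseteq> K \<longrightarrow> K = J"
    by (rule noetherian_ring.maximal_ideal_in_family[OF R])
  then obtain N0 where N0: "N0 \<in> S" "\<forall>N\<in>S. I N0 \<subseteq> I N \<longrightarrow> I N = I N0" by auto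
  have Imono: "I N \<subseteq> I N'" if "N \<subseteq> N'" for N N'
    using that unfolding I_def by (intro Collect_mono) blast
  \<comment> \<open>After maximizing the leading ideal, maximize the part in \<open>span F\<close>,
    but only among members above \<open>N0\<close>, so that the leading ideal can no longer
    grow.\<close>
  define S' where "S' = (\<lambda>N. N \<inter> span F) ` {N \<in> S. N0 \<subseteq> N}"
  have "\<exists>L\<in>S'. \<forall>L'\<in>S'. L \<subseteq> L' \<longrightarrow> L' = L"
  proof (rule insert.IH[OF xF(2)])
    fix N assume "N \<in> S'"
    then obtain N' where N': "N' \<in> S" "N = N' \<inter> span F" unfolding S'_def by (elim imageE CollectE conjE)
    show "sm N" unfolding N'(2) by (rule sm_Int[OF insert.prems(2)[OF N'(1)] F])
    show "N \<subseteq> span F" unfolding N'(2) by simp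
  next
    show "S' \<noteq> {}" unfolding S'_def using N0(1) by (simp, intro exI[of _ N0]) simp
  qed
  then obtain L where L: "L \<in> S'" "\<forall>L'\<in>S'. L \<subseteq> L' \<longrightarrow> L' = L" by (elim bexE) (rule that)
  from L(1) obtain N where N: "N \<in> S" "N0 \<subseteq> N" "L = N \<inter> span F" unfolding S'_def by auto
  have Nmax: "N' \<inter> span F = N \<inter> span F" if "N' \<in> S" "N0 \<subseteq> N'" "N \<subseteq> N'" for N'
  proof -
    have "N' \<inter> span F \<in> S'"
      unfolding S'_def using that(1,2) by (intro image_eqI[OF refl] CollectI conjI)
    moreover have "L \<subseteq> N' \<inter> span F" unfolding N(3) by (rule Int_mono[OF that(3) subset_refl])
    ultimately have "N' \<inter> span F = L" by (rule L(2)[rule_format])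
    then show ?thesis by (simp only: N(3))
  qed
  have "N' \<subseteq> N" if N': "N' \<in> S" "N \<subseteq> N'" for N'
  proof
    fix n assume n: "n \<in> N'"
    note sN = insert.prems(2)[OF N(1)] and sN' = insert.prems(2)[OF N'(1)]
    have "n \<in> msum (cyc x) (span F)"
      using insert.prems(3)[OF N'(1)] n span_insert_subset[OF xF] by auto
    then obtain u y where uy: "u \<in> cyc x" "y \<in> span F" "n = u \<oplus>\<^bsub>M\<^esub> y" by (rule msumE)
    obtain a where a: "a \<in> carrier R" "u = a \<odot>\<^bsub>M\<^esub> x" using uy(1) by (rule cycE)
    \<comment> \<open>\<open>N\<close> and \<open>N'\<close> have the same leading ideal, so some
      \<open>m\<close> in \<open>N\<close> has the same coefficient \<open>a\<close> at
      \<open>x\<close> as \<open>n\<close>. Then \<open>n - m\<close> lies in \<open>N'\<close> and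
      in \<open>span F\<close>, hence in \<open>N\<close>.\<close>
    have "a \<in> I N'" unfolding I_def using a(1) uy(3)[unfolded a(2)] uy(2) n
      by (intro CollectI conjI bexI[of _ n] bexI[of _ y])
    moreover have e1: "I N' = I N0"
      by (rule N0(2)[rule_format, OF N'(1) Imono[OF subset_trans[OF N(2) N'(2)]]])
    have e2: "I N = I N0" by (rule N0(2)[rule_format, OF N(1) Imono[OF N(2)]])
    ultimately have "a \<in> I N" by (simp only: e1 e2)
    then obtain m z where m: "m \<in> N" "z \<in> span F" "m = a \<odot>\<^bsub>M\<^esub> x \<oplus>\<^bsub>M\<^esub> z" unfolding I_def by auto
    have c: "m \<in> carrier M" "n \<in> carrier M" "y \<in> carrier M" "z \<in> carrier M"
      using sm_closed[OF sN m(1)] sm_closed[OF sN' n] Fc uy(2) m(2) by auto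
    have "n \<oplus>\<^bsub>M\<^esub> z = m \<oplus>\<^bsub>M\<^esub> y"
      unfolding uy(3) m(3) a(2) using a(1) xF(1) c(3,4) by (simp add: M.a_ac)
    then have "n \<ominus>\<^bsub>M\<^esub> m = y \<ominus>\<^bsub>M\<^esub> z" by (rule diff_swap[OF c(2,4,1,3)])
    then have "n \<ominus>\<^bsub>M\<^esub> m \<in> span F" using sm_minus[OF F uy(2) m(2)] by simp
    moreover have "n \<ominus>\<^bsub>M\<^esub> m \<in> N'" by (rule sm_minus[OF sN' n]) (use m(1) N'(2) in auto)
    moreover have "N' \<inter> span F = N \<inter> span F"
      by (rule Nmax[OF N'(1) subset_trans[OF N(2) N'(2)] N'(2)])
    ultimately have "n \<ominus>\<^bsub>M\<^esub> m \<in> N" by auto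
    then have "(n \<ominus>\<^bsub>M\<^esub> m) \<oplus>\<^bsub>M\<^esub> m \<in> N" by (rule sm_add[OF sN _ m(1)])
    moreover have "(n \<ominus>\<^bsub>M\<^esub> m) \<oplus>\<^bsub>M\<^esub> m = n" using c by (simp add: a_minus_def M.a_assoc M.l_neg)
    ultimately show "n \<in> N" by simp
  qed
  then show ?case using N(1) by (intro bexI[of _ N]) auto
qed

lemma (in module) finitely_generated_noetherian:
  assumes "noetherian_ring R" "finitely_generated R M"
  shows "noetherian_module R M"
proof (rule noetherian_module.intro[OF module_axioms], rule noetherian_module_axioms.intro)
  obtain F where F: "finite F" "F \<subseteq> carrier M" "span F = carrier M"
    using assms(2) unfolding finitely_generated_def by auto
  fix S assume "\<And>N. N \<in> S \<Longrightarrow> sm N" "S \<noteq> {}"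
  then show "\<exists>N\<in>S. \<forall>N'\<in>S. N \<subseteq> N' \<longrightarrow> N' = N"
    using F(3) sm_subset by (intro span_finite_noetherian[OF assms(1) F(1,2)]) simp_all
qed

text \<open>A maximal member among the spans of finite subsets of \<open>N\<close> cannot grow when
  a further \<open>x\<close> of \<open>N\<close> is added, so it contains all of
  \<open>N\<close>.\<close>

lemma (in noetherian_module) finite_span:
  assumes N: "sm N"
  shows "\<exists>F. finite F \<and> F \<subseteq> N \<and> span F = N"
proof -
  let ?S = "span ` {F. finite F \<and> F \<subseteq> N}"
  have s: "sm (span F)" if "F \<subseteq> N" for F
    by (rule sm_of_afp[OF span_is_submodule[OF subset_trans[OF that sm_subset[OF N]]]])
  have "\<exists>L\<in>?S. \<forall>L'\<in>?S. L \<subseteq> L' \<longrightarrow> L' = L"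
  proof (rule maximal_submodule_in_family)
    show "sm L" if "L \<in> ?S" for L using that by (elim imageE CollectE conjE) (simp only: s)
    have "finite {} \<and> {} \<subseteq> N" by simp
    then show "?S \<noteq> {}" by (simp only: image_is_empty) (rule ex_in_conv[THEN iffD1], rule exI, rule CollectI)
  qed
  then obtain F where F: "finite F" "F \<subseteq> N" and max: "\<And>F'. \<lbrakk>finite F'; F' \<subseteq> N; span F \<subseteq> span F'\<rbrakk> \<Longrightarrow> span F' = span F"
    by auto
  have "N \<subseteq> span F"
  proof
    fix x assume x: "x \<in> N"
    have "span (insert x F) = span F"
      by (rule max) (use F x span_is_monotone[OF subset_insertI] in auto)
    moreover have "insert x F \<subseteq> span (insert x F)"
      by (rule in_own_span) (use F x sm_subset[OF N] in auto)
    ultimately show "x \<in> span F" by auto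
  qed
  moreover have "span F \<subseteq> N" by (rule span_is_subset[OF F(2) afp_submodule[OF N]])
  ultimately show ?thesis using F by auto
qed

subsection \<open>Functionals and the rank condition\<close>

locale dedekind_module = R?: dedekind R + noetherian_module R M for R (structure) and M

context module
begin

text \<open>The codomain is all of \<open>M\<close>; a smaller target is imposed separately as a
  condition on the image. This keeps domain and target out of the record types.\<close>

definition linear_on :: "'c set \<Rightarrow> ('c \<Rightarrow> 'c) \<Rightarrow> bool" where
  "linear_on A f \<longleftrightarrow> (\<forall>x\<in>A. f x \<in> carrier M) \<and>
    (\<forall>x\<in>A. \<forall>y\<in>A. f (x \<oplus>\<^bsub>M\<^esub> y) = f x \<oplus>\<^bsub>M\<^esub> f y) \<and>
    (\<forall>a\<in>carrier R. \<forall>x\<in>A. f (a \<odot>\<^bsub>M\<^esub> x) = a \<odot>\<^bsub>M\<^esub> f x)"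

lemma
  assumes "linear_on A f"
  shows linear_closed: "x \<in> A \<Longrightarrow> f x \<in> carrier M"
    and linear_add: "\<lbrakk>x \<in> A; y \<in> A\<rbrakk> \<Longrightarrow> f (x \<oplus>\<^bsub>M\<^esub> y) = f x \<oplus>\<^bsub>M\<^esub> f y"
    and linear_smult: "\<lbrakk>a \<in> carrier R; x \<in> A\<rbrakk> \<Longrightarrow> f (a \<odot>\<^bsub>M\<^esub> x) = a \<odot>\<^bsub>M\<^esub> f x"
  using assms by (simp_all add: linear_on_def)

lemma linear_zero:
  assumes "linear_on A f" "sm A" shows "f \<zero>\<^bsub>M\<^esub> = \<zero>\<^bsub>M\<^esub>"
  using linear_smult[OF assms(1) R.zero_closed sm_zero[OF assms(2)]]
    linear_closed[OF assms(1) sm_zero[OF assms(2)]] by simp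

lemma module_hom_iff:
  "f \<in> module_hom R (M\<lparr>carrier := A\<rparr>) (M\<lparr>carrier := B\<rparr>) \<longleftrightarrow>
    f ` A \<subseteq> B \<and> (\<forall>x\<in>A. \<forall>y\<in>A. f (x \<oplus>\<^bsub>M\<^esub> y) = f x \<oplus>\<^bsub>M\<^esub> f y) \<and>
    (\<forall>a\<in>carrier R. \<forall>x\<in>A. f (a \<odot>\<^bsub>M\<^esub> x) = a \<odot>\<^bsub>M\<^esub> f x)"
  unfolding module_hom_def by auto

lemma C4D:
  assumes C4: "C4 R M" and d: "dsum A B (carrier M)" and f: "linear_on A f" "f ` A \<subseteq> B"
    and k: "dsum {x \<in> A. f x = \<zero>\<^bsub>M\<^esub>} A' A"
  shows "\<exists>C. dsum (f ` A) C B"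
proof -
  have A: "sm A" and B: "sm B" by (rule dsum_sm1[OF d], rule dsum_sm2[OF d])
  have "internal_direct_sum R M A B" using d by (simp only: internal_direct_sum_carrier_iff)
  moreover have "f \<in> module_hom R (M\<lparr>carrier := A\<rparr>) (M\<lparr>carrier := B\<rparr>)"
    using f by (simp add: module_hom_iff linear_on_def)
  moreover have "direct_summand R (M\<lparr>carrier := A\<rparr>) {x \<in> A. f x = \<zero>\<^bsub>M\<^esub>}"
    unfolding direct_summand_iff[OF A] using k by auto
  ultimately have "direct_summand R (M\<lparr>carrier := B\<rparr>) (f ` A)"
    using C4[unfolded C4_def, rule_format, of A B f] by simp
  then show ?thesis by (simp only: direct_summand_iff[OF B])
qed

lemma C4I:
  assumes "\<And>A B f A'. \<lbrakk>dsum A B (carrier M); linear_on A f; f ` A \<subseteq> B;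
    dsum {x \<in> A. f x = \<zero>\<^bsub>M\<^esub>} A' A\<rbrakk> \<Longrightarrow> \<exists>C. dsum (f ` A) C B"
  shows "C4 R M"
  unfolding C4_def
proof (intro allI impI, elim conjE)
  fix A B f
  assume d: "internal_direct_sum R M A B"
    and f: "f \<in> module_hom R (M\<lparr>carrier := A\<rparr>) (M\<lparr>carrier := B\<rparr>)"
    and k: "direct_summand R (M\<lparr>carrier := A\<rparr>) {x \<in> A. f x = \<zero>\<^bsub>M\<^esub>}"
  have d': "dsum A B (carrier M)" using d by (simp only: internal_direct_sum_carrier_iff)
  have A: "sm A" and B: "sm B" by (rule dsum_sm1[OF d'], rule dsum_sm2[OF d'])
  obtain A' where A': "dsum {x \<in> A. f x = \<zero>\<^bsub>M\<^esub>} A' A"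
    using k unfolding direct_summand_iff[OF A] by (elim exE)
  have fB: "f ` A \<subseteq> B" using f by (simp only: module_hom_iff)
  have "linear_on A f" unfolding linear_on_def
    using f fB sm_subset[OF B] by (simp add: module_hom_iff subset_iff image_subset_iff)
  from assms[OF d' this fB A'] show "direct_summand R (M\<lparr>carrier := B\<rparr>) (f ` A)"
    by (simp only: direct_summand_iff[OF B])
qed

definition functional :: "('c \<Rightarrow> 'a) \<Rightarrow> bool" where
  "functional g \<longleftrightarrow> (\<forall>x\<in>carrier M. g x \<in> carrier R) \<and>
    (\<forall>x\<in>carrier M. \<forall>y\<in>carrier M. g (x \<oplus>\<^bsub>M\<^esub> y) = g x \<oplus> g y) \<and>
    (\<forall>a\<in>carrier R. \<forall>x\<in>carrier M. g (a \<odot>\<^bsub>M\<^esub> x) = a \<otimes> g x)"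

lemma
  assumes "functional g"
  shows functional_closed: "x \<in> carrier M \<Longrightarrow> g x \<in> carrier R"
    and functional_add: "\<lbrakk>x \<in> carrier M; y \<in> carrier M\<rbrakk> \<Longrightarrow> g (x \<oplus>\<^bsub>M\<^esub> y) = g x \<oplus> g y"
    and functional_smult: "\<lbrakk>a \<in> carrier R; x \<in> carrier M\<rbrakk> \<Longrightarrow> g (a \<odot>\<^bsub>M\<^esub> x) = a \<otimes> g x"
  using assms by (simp_all add: functional_def)

lemma functional_zero: "functional g \<Longrightarrow> g \<zero>\<^bsub>M\<^esub> = \<zero>"
  using functional_smult[of g \<zero> "\<zero>\<^bsub>M\<^esub>"] functional_closed[of g "\<zero>\<^bsub>M\<^esub>"] by simp

lemma sm_kernel: "functional g \<Longrightarrow> sm {y \<in> carrier M. g y = \<zero>}"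
  by (rule sm_intro) (auto simp: functional_zero functional_add functional_smult)

definition torsion_elt :: "'c \<Rightarrow> bool" where
  "torsion_elt x \<longleftrightarrow> (\<exists>d\<in>carrier R. d \<noteq> \<zero> \<and> d \<odot>\<^bsub>M\<^esub> x = \<zero>\<^bsub>M\<^esub>)"

lemma nontorsionD: "\<lbrakk>\<not> torsion_elt x; d \<in> carrier R; d \<odot>\<^bsub>M\<^esub> x = \<zero>\<^bsub>M\<^esub>\<rbrakk> \<Longrightarrow> d = \<zero>"
  unfolding torsion_elt_def by metis

lemma torsion_submodule_eq: "torsion_submodule R M = {x \<in> carrier M. torsion_elt x}"
  by (simp add: torsion_submodule_def torsion_elt_def)

text \<open>Rank at most one, expressed without the tensor product. The relation has the form
  \<open>a x = b y\<close> so that no signs occur; the equivalence is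
  \<open>module_rank_le_1_iff\<close>.\<close>

definition dependent_pairs :: bool where
  "dependent_pairs \<longleftrightarrow> (\<forall>x\<in>carrier M. \<forall>y\<in>carrier M.
    \<exists>a\<in>carrier R. \<exists>b\<in>carrier R. (a \<noteq> \<zero> \<or> b \<noteq> \<zero>) \<and> a \<odot>\<^bsub>M\<^esub> x = b \<odot>\<^bsub>M\<^esub> y)"

lemma smult_minus_distr:
  assumes "a \<in> carrier R" "b \<in> carrier R" "x \<in> carrier M" "y \<in> carrier M"
  shows "(a \<ominus> b) \<odot>\<^bsub>M\<^esub> x = a \<odot>\<^bsub>M\<^esub> x \<ominus>\<^bsub>M\<^esub> b \<odot>\<^bsub>M\<^esub> x"
    and "a \<odot>\<^bsub>M\<^esub> (x \<ominus>\<^bsub>M\<^esub> y) = a \<odot>\<^bsub>M\<^esub> x \<ominus>\<^bsub>M\<^esub> a \<odot>\<^bsub>M\<^esub> y"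
  using assms by (simp_all add: a_minus_def smult_l_distr smult_r_distr smult_l_minus smult_r_minus)

end

section \<open>Linear forms and the splitting of the torsion submodule\<close>

context dedekind_module
begin

lemma sm_torsion: "sm (torsion_submodule R M)"
proof (rule sm_intro)
  show "torsion_submodule R M \<subseteq> carrier M" by (auto simp: torsion_submodule_def)
  show "\<zero>\<^bsub>M\<^esub> \<in> torsion_submodule R M"
    unfolding torsion_submodule_def by (simp, intro bexI[of _ \<one>] conjI) simp_all
  fix x assume "x \<in> torsion_submodule R M"
  then obtain d where d: "x \<in> carrier M" "d \<in> carrier R" "d \<noteq> \<zero>" "d \<odot>\<^bsub>M\<^esub> x = \<zero>\<^bsub>M\<^esub>"
    unfolding torsion_submodule_def by auto
  show "a \<odot>\<^bsub>M\<^esub> x \<in> torsion_submodule R M" if a: "a \<in> carrier R" for a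
  proof -
    have "d \<odot>\<^bsub>M\<^esub> (a \<odot>\<^bsub>M\<^esub> x) = a \<odot>\<^bsub>M\<^esub> (d \<odot>\<^bsub>M\<^esub> x)"
      using a d(1,2) by (simp add: smult_assoc1[symmetric] R.m_comm)
    then show ?thesis unfolding torsion_submodule_def using a d by auto
  qed
  fix y assume "y \<in> torsion_submodule R M"
  then obtain e where e: "y \<in> carrier M" "e \<in> carrier R" "e \<noteq> \<zero>" "e \<odot>\<^bsub>M\<^esub> y = \<zero>\<^bsub>M\<^esub>"
    unfolding torsion_submodule_def by auto
  have "(d \<otimes> e) \<odot>\<^bsub>M\<^esub> (x \<oplus>\<^bsub>M\<^esub> y) = e \<odot>\<^bsub>M\<^esub> (d \<odot>\<^bsub>M\<^esub> x) \<oplus>\<^bsub>M\<^esub> d \<odot>\<^bsub>M\<^esub> (e \<odot>\<^bsub>M\<^esub> y)"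
    using d(1,2) e(1,2) by (simp add: smult_r_distr smult_assoc1[symmetric] R.m_comm)
  then have "(d \<otimes> e) \<odot>\<^bsub>M\<^esub> (x \<oplus>\<^bsub>M\<^esub> y) = \<zero>\<^bsub>M\<^esub>" unfolding d(4) e(4) using d(2) e(2) by simp
  moreover have "d \<otimes> e \<noteq> \<zero>" using R.integral_iff d e by simp
  ultimately show "x \<oplus>\<^bsub>M\<^esub> y \<in> torsion_submodule R M"
    unfolding torsion_submodule_def using d(1,2) e(1,2) by (simp, intro bexI[of _ "d \<otimes> e"]) simp_all
qed

text \<open>
  For \<open>N\<close> maximal with \<open>N \<inter> R x = 0\<close>, the quotient \<open>M / N\<close> has rank one, so a single nonzero \<open>s\<close>
  maps it into the image of \<open>R x\<close>.
\<close>

lemma functional_exists: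
  assumes x: "x \<in> carrier M" "\<not> torsion_elt x"
  shows "\<exists>g. functional g \<and> g x \<noteq> \<zero>"
proof -
  let ?S = "{N. sm N \<and> (\<forall>z\<in>N. z \<in> cyc x \<longrightarrow> z = \<zero>\<^bsub>M\<^esub>)}"
  have "\<exists>N\<in>?S. \<forall>N'\<in>?S. N \<subseteq> N' \<longrightarrow> N' = N"
  proof (rule maximal_submodule_in_family)
    show "sm N" if "N \<in> ?S" for N using that by simp
    have "{\<zero>\<^bsub>M\<^esub>} \<in> ?S" using sm_singleton_zero by simp
    then show "?S \<noteq> {}" by (rule ex_in_conv[THEN iffD1, OF exI])
  qed
  then obtain N where NS: "N \<in> ?S" and max: "\<forall>N'\<in>?S. N \<subseteq> N' \<longrightarrow> N' = N" by (elim bexE) (rule that)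
  have N: "sm N" and disj: "\<And>z. \<lbrakk>z \<in> N; z \<in> cyc x\<rbrakk> \<Longrightarrow> z = \<zero>\<^bsub>M\<^esub>" using NS by simp_all
  have Nc: "n \<in> carrier M" if "n \<in> N" for n by (rule sm_closed[OF N that])
  \<comment> \<open>For \<open>y\<close> outside \<open>N\<close>, maximality forces
    \<open>N + R y\<close> to meet \<open>R x\<close> nontrivially; the coefficient of
    \<open>y\<close> in such an element is nonzero because \<open>N\<close> itself does not meet
    \<open>R x\<close>.\<close>
  have dep: "\<exists>s\<in>carrier R. s \<noteq> \<zero> \<and> (\<exists>d\<in>carrier R. \<exists>n\<in>N. s \<odot>\<^bsub>M\<^esub> y = d \<odot>\<^bsub>M\<^esub> x \<oplus>\<^bsub>M\<^esub> n)"
    if y: "y \<in> carrier M" for y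
  proof (cases "y \<in> N")
    case True
    have "\<one> \<odot>\<^bsub>M\<^esub> y = \<zero> \<odot>\<^bsub>M\<^esub> x \<oplus>\<^bsub>M\<^esub> y" using x y by simp
    then show ?thesis using True by (intro bexI[of _ \<one>] conjI bexI[of _ \<zero>] bexI[of _ y]) simp_all
  next
    case False
    have sN': "sm (msum N (cyc y))" by (rule sm_msum[OF N sm_cyc[OF y]])
    have NN': "N \<subseteq> msum N (cyc y)" by (rule msum_upper1[OF N sm_cyc[OF y]])
    have "y \<in> msum N (cyc y)" using msum_upper2[OF N sm_cyc[OF y]] cyc_self[OF y] by (rule subsetD)
    then have "msum N (cyc y) \<noteq> N" using False by auto
    then have "msum N (cyc y) \<notin> ?S" using max NN' by auto
    then obtain z where z: "z \<in> msum N (cyc y)" "z \<in> cyc x" "z \<noteq> \<zero>\<^bsub>M\<^esub>" using sN' by auto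
    from z(1) obtain n u where nu: "n \<in> N" "u \<in> cyc y" "z = n \<oplus>\<^bsub>M\<^esub> u" by (rule msumE)
    from nu(2) obtain s where s: "s \<in> carrier R" "u = s \<odot>\<^bsub>M\<^esub> y" by (rule cycE)
    from z(2) obtain d where d: "d \<in> carrier R" "z = d \<odot>\<^bsub>M\<^esub> x" by (rule cycE)
    have "s \<noteq> \<zero>"
    proof
      assume "s = \<zero>"
      then have "z = n" using nu(3) s y Nc[OF nu(1)] by simp
      then show False using disj[OF _ z(2)] nu(1) z(3) by simp
    qed
    moreover have "s \<odot>\<^bsub>M\<^esub> y = d \<odot>\<^bsub>M\<^esub> x \<oplus>\<^bsub>M\<^esub> (\<ominus>\<^bsub>M\<^esub> n)"
    proof -
      have "u = z \<ominus>\<^bsub>M\<^esub> n" unfolding nu(3) using add_minus_cancel(2)[OF Nc[OF nu(1)], of u] s y by simp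
      then show ?thesis unfolding s(2) d(2) a_minus_def .
    qed
    ultimately show ?thesis using s(1) d(1) sm_neg[OF N nu(1)]
      by (intro bexI[of _ s] conjI bexI[of _ d] bexI[of _ "\<ominus>\<^bsub>M\<^esub> n"])
  qed
  have mul: "\<exists>d\<in>carrier R. \<exists>n\<in>N. (r \<otimes> s) \<odot>\<^bsub>M\<^esub> y = d \<odot>\<^bsub>M\<^esub> x \<oplus>\<^bsub>M\<^esub> n"
    if exd: "\<exists>d\<in>carrier R. \<exists>n\<in>N. s \<odot>\<^bsub>M\<^esub> y = d \<odot>\<^bsub>M\<^esub> x \<oplus>\<^bsub>M\<^esub> n"
      and rs: "r \<in> carrier R" "s \<in> carrier R" "y \<in> carrier M" for r s y
  proof -
    obtain d n where d: "d \<in> carrier R" "n \<in> N" "s \<odot>\<^bsub>M\<^esub> y = d \<odot>\<^bsub>M\<^esub> x \<oplus>\<^bsub>M\<^esub> n" using exd by auto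
    have "(r \<otimes> s) \<odot>\<^bsub>M\<^esub> y = r \<odot>\<^bsub>M\<^esub> (s \<odot>\<^bsub>M\<^esub> y)" by (rule smult_assoc1[OF rs])
    also have "\<dots> = (r \<otimes> d) \<odot>\<^bsub>M\<^esub> x \<oplus>\<^bsub>M\<^esub> r \<odot>\<^bsub>M\<^esub> n"
      unfolding d(3) using rs d(1) x(1) Nc[OF d(2)] by (simp add: smult_r_distr smult_assoc1)
    finally show ?thesis using rs(1) d(1) sm_smult[OF N rs(1) d(2)]
      by (intro bexI[of _ "r \<otimes> d"] bexI[of _ "r \<odot>\<^bsub>M\<^esub> n"]) simp_all
  qed
  obtain F where F: "finite F" "F \<subseteq> carrier M" "span F = carrier M"
    using finite_span[OF sm_carrier] by (elim exE conjE)
  \<comment> \<open>The multipliers of finitely many generators are combined into one nonzero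
    product, which is then a common denominator for all of \<open>M\<close>.\<close>
  have "\<exists>s\<in>carrier R. s \<noteq> \<zero> \<and> (\<forall>y\<in>G. \<exists>d\<in>carrier R. \<exists>n\<in>N. s \<odot>\<^bsub>M\<^esub> y = d \<odot>\<^bsub>M\<^esub> x \<oplus>\<^bsub>M\<^esub> n)"
    if "finite G" "G \<subseteq> carrier M" for G using that
  proof (induction G rule: finite_induct)
    case empty show ?case by (intro bexI[of _ \<one>]) simp_all
  next
    case (insert y G)
    then obtain s where s: "s \<in> carrier R" "s \<noteq> \<zero>"
      "\<forall>y\<in>G. \<exists>d\<in>carrier R. \<exists>n\<in>N. s \<odot>\<^bsub>M\<^esub> y = d \<odot>\<^bsub>M\<^esub> x \<oplus>\<^bsub>M\<^esub> n" by auto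
    have yc: "y \<in> carrier M" using insert.prems by simp
    obtain r where r: "r \<in> carrier R" "r \<noteq> \<zero>"
      "\<exists>d\<in>carrier R. \<exists>n\<in>N. r \<odot>\<^bsub>M\<^esub> y = d \<odot>\<^bsub>M\<^esub> x \<oplus>\<^bsub>M\<^esub> n" using dep[OF yc] by auto
    have "\<exists>d\<in>carrier R. \<exists>n\<in>N. (r \<otimes> s) \<odot>\<^bsub>M\<^esub> z = d \<odot>\<^bsub>M\<^esub> x \<oplus>\<^bsub>M\<^esub> n" if z: "z \<in> insert y G" for z
    proof (cases "z = y")
      case True
      then show ?thesis using mul[OF r(3) s(1) r(1) yc] R.m_comm[OF r(1) s(1)] by simp
    next
      case False
      then have zG: "z \<in> G" using z by simp
      then have "z \<in> carrier M" using insert.prems by auto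
      then show ?thesis by (rule mul[OF bspec[OF s(3) zG] r(1) s(1)])
    qed
    moreover have "r \<otimes> s \<noteq> \<zero>" "r \<otimes> s \<in> carrier R" using R.integral_iff r s by simp_all
    ultimately show ?case by auto
  qed
  from this[OF F(1,2)] obtain s where s: "s \<in> carrier R" "s \<noteq> \<zero>"
    "\<forall>y\<in>F. \<exists>d\<in>carrier R. \<exists>n\<in>N. s \<odot>\<^bsub>M\<^esub> y = d \<odot>\<^bsub>M\<^esub> x \<oplus>\<^bsub>M\<^esub> n" by auto
  define Y where "Y = {y \<in> carrier M. \<exists>d\<in>carrier R. \<exists>n\<in>N. s \<odot>\<^bsub>M\<^esub> y = d \<odot>\<^bsub>M\<^esub> x \<oplus>\<^bsub>M\<^esub> n}"
  have add: "s \<odot>\<^bsub>M\<^esub> (y \<oplus>\<^bsub>M\<^esub> z) = (d \<oplus> e) \<odot>\<^bsub>M\<^esub> x \<oplus>\<^bsub>M\<^esub> (n \<oplus>\<^bsub>M\<^esub> m)"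
    if "y \<in> carrier M" "z \<in> carrier M" "d \<in> carrier R" "e \<in> carrier R" "n \<in> N" "m \<in> N"
      and e1: "s \<odot>\<^bsub>M\<^esub> y = d \<odot>\<^bsub>M\<^esub> x \<oplus>\<^bsub>M\<^esub> n" and e2: "s \<odot>\<^bsub>M\<^esub> z = e \<odot>\<^bsub>M\<^esub> x \<oplus>\<^bsub>M\<^esub> m" for y z d e n m
  proof -
    have "s \<odot>\<^bsub>M\<^esub> (y \<oplus>\<^bsub>M\<^esub> z) = s \<odot>\<^bsub>M\<^esub> y \<oplus>\<^bsub>M\<^esub> s \<odot>\<^bsub>M\<^esub> z" by (rule smult_r_distr[OF s(1) that(1,2)])
    also have "\<dots> = (d \<oplus> e) \<odot>\<^bsub>M\<^esub> x \<oplus>\<^bsub>M\<^esub> (n \<oplus>\<^bsub>M\<^esub> m)"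
      unfolding e1 e2 using that(3,4) x(1) Nc[OF that(5)] Nc[OF that(6)]
      by (simp add: smult_l_distr M.a_ac)
    finally show ?thesis .
  qed
  have sml: "s \<odot>\<^bsub>M\<^esub> (r \<odot>\<^bsub>M\<^esub> y) = (r \<otimes> d) \<odot>\<^bsub>M\<^esub> x \<oplus>\<^bsub>M\<^esub> r \<odot>\<^bsub>M\<^esub> n"
    if "y \<in> carrier M" "d \<in> carrier R" "n \<in> N" "r \<in> carrier R"
      and e: "s \<odot>\<^bsub>M\<^esub> y = d \<odot>\<^bsub>M\<^esub> x \<oplus>\<^bsub>M\<^esub> n" for y d n r
  proof -
    have "s \<odot>\<^bsub>M\<^esub> (r \<odot>\<^bsub>M\<^esub> y) = r \<odot>\<^bsub>M\<^esub> (s \<odot>\<^bsub>M\<^esub> y)"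
      using s(1) that(1,4) by (simp add: smult_assoc1[symmetric] R.m_comm)
    then show ?thesis unfolding e using that(2,4) x(1) Nc[OF that(3)]
      by (simp add: smult_r_distr smult_assoc1)
  qed
  have sY: "sm Y"
  proof (rule sm_intro)
    show "Y \<subseteq> carrier M" unfolding Y_def by (rule subsetI) simp
    have "s \<odot>\<^bsub>M\<^esub> \<zero>\<^bsub>M\<^esub> = \<zero> \<odot>\<^bsub>M\<^esub> x \<oplus>\<^bsub>M\<^esub> \<zero>\<^bsub>M\<^esub>" using s x by simp
    then show "\<zero>\<^bsub>M\<^esub> \<in> Y" unfolding Y_def using sm_zero[OF N]
      by (intro CollectI conjI bexI[of _ \<zero>] bexI[of _ "\<zero>\<^bsub>M\<^esub>"]) simp_all
    fix y assume "y \<in> Y"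
    then obtain d n where y: "y \<in> carrier M" "d \<in> carrier R" "n \<in> N" "s \<odot>\<^bsub>M\<^esub> y = d \<odot>\<^bsub>M\<^esub> x \<oplus>\<^bsub>M\<^esub> n"
      unfolding Y_def by auto
    show "r \<odot>\<^bsub>M\<^esub> y \<in> Y" if r: "r \<in> carrier R" for r
      unfolding Y_def using sml[OF y(1-3) r y(4)] r y(1,2) sm_smult[OF N r y(3)]
      by (intro CollectI conjI bexI[of _ "r \<otimes> d"] bexI[of _ "r \<odot>\<^bsub>M\<^esub> n"]) simp_all
    fix z assume "z \<in> Y"
    then obtain e m where z: "z \<in> carrier M" "e \<in> carrier R" "m \<in> N" "s \<odot>\<^bsub>M\<^esub> z = e \<odot>\<^bsub>M\<^esub> x \<oplus>\<^bsub>M\<^esub> m"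
      unfolding Y_def by auto
    show "y \<oplus>\<^bsub>M\<^esub> z \<in> Y"
      unfolding Y_def using add[OF y(1) z(1) y(2) z(2) y(3) z(3) y(4) z(4)] y(1,2) z(1,2) sm_add[OF N y(3) z(3)]
      by (intro CollectI conjI bexI[of _ "d \<oplus> e"] bexI[of _ "n \<oplus>\<^bsub>M\<^esub> m"]) simp_all
  qed
  have "F \<subseteq> Y" unfolding Y_def using F(2) s(3) by (intro subsetI CollectI conjI) auto
  then have "carrier M \<subseteq> Y" using span_is_subset[OF _ afp_submodule[OF sY], of F] F(3) by simp
  then have ex: "\<exists>d\<in>carrier R. \<exists>n\<in>N. s \<odot>\<^bsub>M\<^esub> y = d \<odot>\<^bsub>M\<^esub> x \<oplus>\<^bsub>M\<^esub> n" if "y \<in> carrier M" for y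
    using that unfolding Y_def by auto
  \<comment> \<open>The coefficient is well defined because \<open>N\<close> meets
    \<open>R x\<close> only in zero and \<open>x\<close> is not torsion.\<close>
  have uniq: "d = e" if "d \<in> carrier R" "e \<in> carrier R" "n \<in> N" "m \<in> N"
      and eq: "d \<odot>\<^bsub>M\<^esub> x \<oplus>\<^bsub>M\<^esub> n = e \<odot>\<^bsub>M\<^esub> x \<oplus>\<^bsub>M\<^esub> m" for d e n m
  proof -
    have e1: "d \<odot>\<^bsub>M\<^esub> x \<ominus>\<^bsub>M\<^esub> e \<odot>\<^bsub>M\<^esub> x = m \<ominus>\<^bsub>M\<^esub> n"
      by (rule diff_swap[OF _ _ _ _ eq]) (use that x Nc in simp_all)
    have "(d \<ominus> e) \<odot>\<^bsub>M\<^esub> x \<in> N"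
      unfolding smult_minus_distr(1)[OF that(1,2) x(1) x(1)] e1 by (rule sm_minus[OF N that(4,3)])
    moreover have dec: "d \<ominus> e \<in> carrier R" using that(1,2) by simp
    then have "(d \<ominus> e) \<odot>\<^bsub>M\<^esub> x \<in> cyc x" by (rule cycI)
    ultimately have "(d \<ominus> e) \<odot>\<^bsub>M\<^esub> x = \<zero>\<^bsub>M\<^esub>" by (rule disj)
    then have "d \<ominus> e = \<zero>" by (rule nontorsionD[OF x(2) dec])
    then show "d = e" using that(1,2) R.r_right_minus_eq by simp
  qed
  define g where "g y = (SOME d. d \<in> carrier R \<and> (\<exists>n\<in>N. s \<odot>\<^bsub>M\<^esub> y = d \<odot>\<^bsub>M\<^esub> x \<oplus>\<^bsub>M\<^esub> n))" for y
  have g: "g y \<in> carrier R \<and> (\<exists>n\<in>N. s \<odot>\<^bsub>M\<^esub> y = g y \<odot>\<^bsub>M\<^esub> x \<oplus>\<^bsub>M\<^esub> n)" if "y \<in> carrier M" for y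
    unfolding g_def by (rule someI_ex) (use ex[OF that] in auto)
  have gI: "g y = d" if y: "y \<in> carrier M" and d: "d \<in> carrier R" "n \<in> N"
      and e: "s \<odot>\<^bsub>M\<^esub> y = d \<odot>\<^bsub>M\<^esub> x \<oplus>\<^bsub>M\<^esub> n" for y d n
  proof -
    obtain m where m: "m \<in> N" "s \<odot>\<^bsub>M\<^esub> y = g y \<odot>\<^bsub>M\<^esub> x \<oplus>\<^bsub>M\<^esub> m" using g[OF y] by auto
    show ?thesis
      by (rule uniq[OF conjunct1[OF g[OF y]] d(1) m(1) d(2)]) (simp only: m(2)[symmetric] e)
  qed
  have "functional g" unfolding functional_def
  proof (intro conjI ballI)
    show "g y \<in> carrier R" if "y \<in> carrier M" for y using g[OF that] by simp
    fix y assume y: "y \<in> carrier M"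
    obtain n where n: "n \<in> N" "s \<odot>\<^bsub>M\<^esub> y = g y \<odot>\<^bsub>M\<^esub> x \<oplus>\<^bsub>M\<^esub> n" using g[OF y] by auto
    have gy: "g y \<in> carrier R" using g[OF y] by simp
    show "g (r \<odot>\<^bsub>M\<^esub> y) = r \<otimes> g y" if r: "r \<in> carrier R" for r
      by (rule gI[OF smult_closed[OF r y] R.m_closed[OF r gy] sm_smult[OF N r n(1)] sml[OF y gy n(1) r n(2)]])
    fix z assume z: "z \<in> carrier M"
    obtain m where m: "m \<in> N" "s \<odot>\<^bsub>M\<^esub> z = g z \<odot>\<^bsub>M\<^esub> x \<oplus>\<^bsub>M\<^esub> m" using g[OF z] by auto
    have gz: "g z \<in> carrier R" using g[OF z] by simp
    show "g (y \<oplus>\<^bsub>M\<^esub> z) = g y \<oplus> g z"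
      by (rule gI[OF M.add.m_closed[OF y z] R.add.m_closed[OF gy gz] sm_add[OF N n(1) m(1)]
            add[OF y z gy gz n(1) m(1) n(2) m(2)]])
  qed
  moreover have "g x = s" by (rule gI[OF x(1) s(1) sm_zero[OF N]]) (use x s in simp)
  ultimately show ?thesis using s(2) by auto
qed

lemma ideal_functional_image:
  assumes g: "functional g" shows "ideal (g ` carrier M) R"
proof (rule idealI)
  have mul: "a \<otimes> u \<in> g ` carrier M" if "u \<in> g ` carrier M" "a \<in> carrier R" for a u
  proof -
    obtain x where "x \<in> carrier M" "u = g x" using \<open>u \<in> g ` carrier M\<close> by auto
    then show ?thesis using that(2) functional_smult[OF g that(2), of x]
      by (intro image_eqI[of _ _ "a \<odot>\<^bsub>M\<^esub> x"]) simp_all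
  qed
  show "ring R" by (rule R.ring_axioms)
  show "a \<otimes> u \<in> g ` carrier M" if "u \<in> g ` carrier M" "a \<in> carrier R" for a u by (rule mul[OF that])
  show "u \<otimes> a \<in> g ` carrier M" if u: "u \<in> g ` carrier M" and a: "a \<in> carrier R" for a u
  proof -
    have "u \<in> carrier R" using u functional_closed[OF g] by auto
    then have e: "u \<otimes> a = a \<otimes> u" using a by (rule R.m_comm)
    show ?thesis unfolding e by (rule mul[OF u a])
  qed
  show "subgroup (g ` carrier M) (add_monoid R)"
  proof (rule R.add.subgroupI)
    show "g ` carrier M \<subseteq> carrier R" using functional_closed[OF g] by auto
    have "g \<zero>\<^bsub>M\<^esub> \<in> g ` carrier M" by simp
    then show "g ` carrier M \<noteq> {}" by auto
    show "\<ominus> u \<in> g ` carrier M" if u: "u \<in> g ` carrier M" for u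
    proof -
      have "u \<in> carrier R" using u functional_closed[OF g] by auto
      then have e: "\<ominus> u = \<ominus> \<one> \<otimes> u" by (simp add: R.l_minus)
      show ?thesis unfolding e by (rule mul[OF u]) simp
    qed
    show "u \<oplus> v \<in> g ` carrier M" if uv: "u \<in> g ` carrier M" "v \<in> g ` carrier M" for u v
    proof -
      obtain x y where "x \<in> carrier M" "y \<in> carrier M" "u = g x" "v = g y" using uv by auto
      then show ?thesis using functional_add[OF g, of x y] by (intro image_eqI[of _ _ "x \<oplus>\<^bsub>M\<^esub> y"]) simp_all
    qed
  qed
qed

definition lin_from_ideal :: "'a set \<Rightarrow> ('a \<Rightarrow> 'c) \<Rightarrow> bool" where
  "lin_from_ideal I h \<longleftrightarrow> (\<forall>i\<in>I. h i \<in> carrier M) \<and> (\<forall>i\<in>I. \<forall>j\<in>I. h (i \<oplus> j) = h i \<oplus>\<^bsub>M\<^esub> h j) \<and>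
    (\<forall>a\<in>carrier R. \<forall>i\<in>I. h (a \<otimes> i) = a \<odot>\<^bsub>M\<^esub> h i)"

lemma
  assumes "lin_from_ideal I h"
  shows lin_from_ideal_closed: "i \<in> I \<Longrightarrow> h i \<in> carrier M"
    and lin_from_ideal_add: "\<lbrakk>i \<in> I; j \<in> I\<rbrakk> \<Longrightarrow> h (i \<oplus> j) = h i \<oplus>\<^bsub>M\<^esub> h j"
    and lin_from_ideal_smult: "\<lbrakk>a \<in> carrier R; i \<in> I\<rbrakk> \<Longrightarrow> h (a \<otimes> i) = a \<odot>\<^bsub>M\<^esub> h i"
  using assms unfolding lin_from_ideal_def by simp_all

text \<open>The image ideal \<open>I\<close> is invertible, hence projective. Explicitly, write
  \<open>c\<close> as a sum of products \<open>i j\<close> with \<open>j I\<close> inside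
  \<open>c R\<close>, and choose \<open>m\<close> with \<open>g m = i\<close>; the sum of the maps
  that send \<open>z\<close> to \<open>(j z / c) m\<close> is a section of \<open>g\<close>.\<close>

lemma functional_splits:
  assumes g: "functional g" and c: "c \<in> g ` carrier M" "c \<noteq> \<zero>"
  shows "\<exists>h. lin_from_ideal (g ` carrier M) h \<and> (\<forall>i\<in>g ` carrier M. g (h i) = i)"
proof -
  define I where "I = g ` carrier M"
  define J where "J = {a \<in> carrier R. \<forall>z\<in>I. \<exists>w\<in>carrier R. a \<otimes> z = c \<otimes> w}"
  have I: "ideal I R" unfolding I_def by (rule ideal_functional_image[OF g])
  have Ic: "z \<in> carrier R" if "z \<in> I" for z by (rule ideal.Icarr[OF I that])
  have cc: "c \<in> carrier R" using c(1) Ic unfolding I_def by simp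
  have Iadd: "z \<oplus> z' \<in> I" if "z \<in> I" "z' \<in> I" for z z'
    by (rule additive_subgroup.a_closed[OF ideal.axioms(1)[OF I] that])
  have Imul: "a \<otimes> z \<in> I" if "z \<in> I" "a \<in> carrier R" for z a
    by (rule ideal.I_l_closed[OF I that])
  have "c \<in> ideal_prod R I J"
    unfolding J_def by (rule R.ideal_invertible[OF I c[folded I_def]])
  \<comment> \<open>The invariant for a partial sum \<open>e\<close> of the products:
    \<open>g (h z)\<close> is \<open>e z / c\<close>. At \<open>e = c\<close> this says that
    \<open>h\<close> is a section.\<close>
  moreover have "\<exists>h. lin_from_ideal I h \<and> (\<forall>z\<in>I. c \<otimes> g (h z) = e \<otimes> z) \<and> e \<in> carrier R"
    if "e \<in> ideal_prod R I J" for e using that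
  proof (induction rule: ideal_prod.induct)
    case (prod i j)
    obtain m where m: "m \<in> carrier M" "i = g m" using prod(1) unfolding I_def by auto
    have j: "j \<in> carrier R" "\<forall>z\<in>I. \<exists>w\<in>carrier R. j \<otimes> z = c \<otimes> w" using prod(2) unfolding J_def by simp_all
    \<comment> \<open>\<open>w z\<close> is the quotient \<open>j z / c\<close>; it exists because
      \<open>j\<close> is in \<open>J\<close> and is unique because \<open>R\<close> is a domain,
      which makes \<open>w\<close> linear.\<close>
    define w where "w z = (SOME w. w \<in> carrier R \<and> j \<otimes> z = c \<otimes> w)" for z
    have w: "w z \<in> carrier R \<and> j \<otimes> z = c \<otimes> w z" if "z \<in> I" for z
      unfolding w_def by (rule someI_ex) (use j(2) that in auto)
    have wI: "w z = v" if "z \<in> I" "v \<in> carrier R" "j \<otimes> z = c \<otimes> v" for z v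
    proof -
      have "c \<otimes> w z = c \<otimes> v" using w[OF that(1)] that(3) by simp
      then show ?thesis using R.m_lcancel[of c "w z" v] c(2) cc w[OF that(1)] that(2) by simp
    qed
    have wadd: "w (z \<oplus> z') = w z \<oplus> w z'" if z: "z \<in> I" "z' \<in> I" for z z'
    proof (rule wI[OF Iadd[OF z]])
      show "w z \<oplus> w z' \<in> carrier R" using w[OF z(1)] w[OF z(2)] by simp
      have "j \<otimes> (z \<oplus> z') = j \<otimes> z \<oplus> j \<otimes> z'" by (rule R.r_distr[OF Ic[OF z(1)] Ic[OF z(2)] j(1)])
      also have "\<dots> = c \<otimes> w z \<oplus> c \<otimes> w z'" using w[OF z(1)] w[OF z(2)] by simp
      also have "\<dots> = c \<otimes> (w z \<oplus> w z')" by (rule R.r_distr[symmetric]) (use w[OF z(1)] w[OF z(2)] cc in simp_all)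
      finally show "j \<otimes> (z \<oplus> z') = c \<otimes> (w z \<oplus> w z')" .
    qed
    have wmul: "w (a \<otimes> z) = a \<otimes> w z" if z: "z \<in> I" and a: "a \<in> carrier R" for z a
    proof (rule wI[OF Imul[OF z a]])
      show "a \<otimes> w z \<in> carrier R" using w[OF z] a by simp
      have "j \<otimes> (a \<otimes> z) = a \<otimes> (j \<otimes> z)" by (rule R.m_lcomm[OF j(1) a Ic[OF z]])
      also have "\<dots> = a \<otimes> (c \<otimes> w z)" using w[OF z] by simp
      also have "\<dots> = c \<otimes> (a \<otimes> w z)" by (rule R.m_lcomm) (use w[OF z] cc a in simp_all)
      finally show "j \<otimes> (a \<otimes> z) = c \<otimes> (a \<otimes> w z)" .
    qed
    have "lin_from_ideal I (\<lambda>z. w z \<odot>\<^bsub>M\<^esub> m)"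
      unfolding lin_from_ideal_def using w m(1) by (simp add: wadd wmul smult_l_distr smult_assoc1)
    moreover have "c \<otimes> g (w z \<odot>\<^bsub>M\<^esub> m) = i \<otimes> j \<otimes> z" if z: "z \<in> I" for z
    proof -
      have wc: "w z \<in> carrier R" using w[OF z] by simp
      have ic: "i \<in> carrier R" by (rule Ic[OF prod(1)])
      have "c \<otimes> g (w z \<odot>\<^bsub>M\<^esub> m) = c \<otimes> (w z \<otimes> i)" using functional_smult[OF g wc m(1)] m(2) by simp
      also have "\<dots> = i \<otimes> (c \<otimes> w z)" using cc wc ic by (simp add: R.m_ac)
      also have "\<dots> = i \<otimes> (j \<otimes> z)" using w[OF z] by simp
      also have "\<dots> = i \<otimes> j \<otimes> z" by (rule R.m_assoc[symmetric, OF ic j(1) Ic[OF z]])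
      finally show ?thesis .
    qed
    ultimately show ?case using Ic[OF prod(1)] j(1) by (intro exI[of _ "\<lambda>z. w z \<odot>\<^bsub>M\<^esub> m"]) simp
  next
    case (sum a b)
    then obtain h k where h: "lin_from_ideal I h" "\<forall>z\<in>I. c \<otimes> g (h z) = a \<otimes> z" "a \<in> carrier R"
      and k: "lin_from_ideal I k" "\<forall>z\<in>I. c \<otimes> g (k z) = b \<otimes> z" "b \<in> carrier R" by auto
    have hc: "h z \<in> carrier M" "k z \<in> carrier M" if "z \<in> I" for z
      using h(1) k(1) that by (simp_all add: lin_from_ideal_def)
    have "lin_from_ideal I (\<lambda>z. h z \<oplus>\<^bsub>M\<^esub> k z)"
      unfolding lin_from_ideal_def
    proof (intro conjI ballI)
      fix z assume z: "z \<in> I"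
      show "h z \<oplus>\<^bsub>M\<^esub> k z \<in> carrier M" using hc[OF z] by simp
      show "h (r \<otimes> z) \<oplus>\<^bsub>M\<^esub> k (r \<otimes> z) = r \<odot>\<^bsub>M\<^esub> (h z \<oplus>\<^bsub>M\<^esub> k z)" if "r \<in> carrier R" for r
        using h(1) k(1) hc[OF z] z that by (simp add: lin_from_ideal_def smult_r_distr)
      fix z' assume z': "z' \<in> I"
      have "h (z \<oplus> z') = h z \<oplus>\<^bsub>M\<^esub> h z'" "k (z \<oplus> z') = k z \<oplus>\<^bsub>M\<^esub> k z'"
        using h(1) k(1) z z' by (simp_all add: lin_from_ideal_def)
      then show "h (z \<oplus> z') \<oplus>\<^bsub>M\<^esub> k (z \<oplus> z') = h z \<oplus>\<^bsub>M\<^esub> k z \<oplus>\<^bsub>M\<^esub> (h z' \<oplus>\<^bsub>M\<^esub> k z')"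
        using hc[OF z] hc[OF z'] by (simp add: M.a_ac)
    qed
    moreover have "c \<otimes> g (h z \<oplus>\<^bsub>M\<^esub> k z) = (a \<oplus> b) \<otimes> z" if z: "z \<in> I" for z
    proof -
      have "c \<otimes> g (h z \<oplus>\<^bsub>M\<^esub> k z) = c \<otimes> g (h z) \<oplus> c \<otimes> g (k z)"
        using functional_add[OF g hc[OF z]] functional_closed[OF g] hc[OF z] cc by (simp add: R.r_distr)
      then show ?thesis using h(2,3) k(2,3) z Ic[OF z] by (simp add: R.l_distr)
    qed
    ultimately show ?case using h(3) k(3) by (intro exI[of _ "\<lambda>z. h z \<oplus>\<^bsub>M\<^esub> k z"]) simp
  qed
  ultimately obtain h where h: "lin_from_ideal I h" "\<forall>z\<in>I. c \<otimes> g (h z) = c \<otimes> z" by auto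
  have "g (h z) = z" if z: "z \<in> I" for z
  proof -
    have "g (h z) \<in> carrier R" using h(1) z by (simp add: lin_from_ideal_def functional_closed[OF g])
    then show ?thesis using R.m_lcancel[of c "g (h z)" z] c(2) cc Ic[OF z] h(2) z by simp
  qed
  then show ?thesis using h(1) unfolding I_def by auto
qed

lemma functional_decomposition:
  assumes g: "functional g" and x: "x \<in> carrier M" "g x \<noteq> \<zero>"
  shows "\<exists>h. lin_from_ideal (g ` carrier M) h \<and> (\<forall>i\<in>g ` carrier M. g (h i) = i) \<and>
    dsum {y \<in> carrier M. g y = \<zero>} (h ` g ` carrier M) (carrier M)"
proof -
  have I: "ideal (g ` carrier M) R" by (rule ideal_functional_image[OF g])
  obtain h where h: "lin_from_ideal (g ` carrier M) h" "\<forall>i\<in>g ` carrier M. g (h i) = i"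
    using functional_splits[OF g imageI[OF x(1)] x(2)] by auto
  have hc: "h i \<in> carrier M" if "i \<in> g ` carrier M" for i by (rule lin_from_ideal_closed[OF h(1) that])
  have zI: "\<zero> \<in> g ` carrier M" by (rule additive_subgroup.zero_closed[OF ideal.axioms(1)[OF I]])
  have h0: "h \<zero> = \<zero>\<^bsub>M\<^esub>"
  proof -
    have "h (\<zero> \<otimes> \<zero>) = \<zero> \<odot>\<^bsub>M\<^esub> h \<zero>" by (rule lin_from_ideal_smult[OF h(1) R.zero_closed zI])
    then show ?thesis using hc[OF zI] by simp
  qed
  let ?F = "h ` g ` carrier M"
  have K: "sm {y \<in> carrier M. g y = \<zero>}" by (rule sm_kernel[OF g])
  have F: "sm ?F"
  proof (rule sm_intro)
    show "?F \<subseteq> carrier M" using hc by auto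
    show "\<zero>\<^bsub>M\<^esub> \<in> ?F" using imageI[OF zI, of h] by (simp only: h0)
    fix u assume "u \<in> ?F"
    then obtain i where i: "i \<in> g ` carrier M" "u = h i" by (rule imageE)
    show "a \<odot>\<^bsub>M\<^esub> u \<in> ?F" if a: "a \<in> carrier R" for a
    proof -
      have "h (a \<otimes> i) = a \<odot>\<^bsub>M\<^esub> u" unfolding i(2) by (rule lin_from_ideal_smult[OF h(1) a i(1)])
      then show ?thesis using imageI[OF ideal.I_l_closed[OF I i(1) a], of h] by simp
    qed
    fix v assume "v \<in> ?F"
    then obtain j where j: "j \<in> g ` carrier M" "v = h j" by (rule imageE)
    have "h (i \<oplus> j) = u \<oplus>\<^bsub>M\<^esub> v" unfolding i(2) j(2) by (rule lin_from_ideal_add[OF h(1) i(1) j(1)])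
    then show "u \<oplus>\<^bsub>M\<^esub> v \<in> ?F"
      using imageI[OF additive_subgroup.a_closed[OF ideal.axioms(1)[OF I] i(1) j(1)], of h] by simp
  qed
  have "dsum {y \<in> carrier M. g y = \<zero>} ?F (carrier M)"
  proof (rule dsumI[OF K F])
    show "msum {y \<in> carrier M. g y = \<zero>} ?F = carrier M"
    proof
      show "msum {y \<in> carrier M. g y = \<zero>} ?F \<subseteq> carrier M"
        by (rule msum_least[OF sm_carrier sm_subset[OF K] sm_subset[OF F]])
      show "carrier M \<subseteq> msum {y \<in> carrier M. g y = \<zero>} ?F"
      proof
        fix y assume y: "y \<in> carrier M"
        have hy: "h (g y) \<in> carrier M" using hc y by simp
        have "y \<ominus>\<^bsub>M\<^esub> h (g y) = y \<oplus>\<^bsub>M\<^esub> (\<ominus> \<one>) \<odot>\<^bsub>M\<^esub> h (g y)"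
          using hy smult_l_minus[of \<one> "h (g y)"] by (simp add: a_minus_def)
        then have "g (y \<ominus>\<^bsub>M\<^esub> h (g y)) = g y \<oplus> (\<ominus> \<one>) \<otimes> g (h (g y))"
          using y hy functional_add[OF g y, of "(\<ominus> \<one>) \<odot>\<^bsub>M\<^esub> h (g y)"]
            functional_smult[OF g, of "\<ominus> \<one>" "h (g y)"] by simp
        also have "\<dots> = \<zero>" using h(2) y functional_closed[OF g y] by (simp add: R.l_minus R.r_neg)
        finally have "y \<ominus>\<^bsub>M\<^esub> h (g y) \<in> {y \<in> carrier M. g y = \<zero>}" using y hy by simp
        then have "(y \<ominus>\<^bsub>M\<^esub> h (g y)) \<oplus>\<^bsub>M\<^esub> h (g y) \<in> msum {y \<in> carrier M. g y = \<zero>} ?F"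
          by (rule msumI) (intro imageI y)
        then show "y \<in> msum {y \<in> carrier M. g y = \<zero>} ?F" using add_minus_cancel(3)[OF hy y] by simp
      qed
    qed
    fix u assume u: "u \<in> {y \<in> carrier M. g y = \<zero>}" "u \<in> ?F"
    from u(2) obtain i where i: "i \<in> g ` carrier M" "u = h i" by (rule imageE)
    have "g (h i) = i" by (rule bspec[OF h(2) i(1)])
    then have "i = \<zero>" using u(1) i(2) by simp
    then show "u = \<zero>\<^bsub>M\<^esub>" using i(2) h0 by simp
  qed
  then show ?thesis using h by auto
qed

text \<open>A linear form that is nonzero at some nontorsion \<open>x\<close> has exactly the
  torsion as its kernel: if \<open>g y = 0\<close>, a relation \<open>a x = b y\<close> forces
  \<open>a = 0\<close>, so \<open>b\<close> kills \<open>y\<close>. Kernels of nonzero forms split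
  off.\<close>

lemma torsion_summand:
  assumes r: dependent_pairs
  shows "\<exists>F. dsum (torsion_submodule R M) F (carrier M)"
proof (cases "\<forall>x\<in>carrier M. torsion_elt x")
  case True
  then have e: "torsion_submodule R M = carrier M" unfolding torsion_submodule_eq by auto
  show ?thesis unfolding e by (rule exI, rule dsum_zero_right[OF sm_carrier])
next
  case False
  then obtain x where x: "x \<in> carrier M" "\<not> torsion_elt x" by auto
  obtain g where g: "functional g" "g x \<noteq> \<zero>" using functional_exists[OF x] by auto
  obtain h where h: "dsum {y \<in> carrier M. g y = \<zero>} (h ` g ` carrier M) (carrier M)"
    using functional_decomposition[OF g(1) x(1) g(2)] by auto
  have "{y \<in> carrier M. g y = \<zero>} = torsion_submodule R M"
  proof (intro subset_antisym subsetI)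
    fix y assume "y \<in> {y \<in> carrier M. g y = \<zero>}"
    then have y: "y \<in> carrier M" "g y = \<zero>" by simp_all
    obtain a b where ab: "a \<in> carrier R" "b \<in> carrier R" "a \<noteq> \<zero> \<or> b \<noteq> \<zero>" "a \<odot>\<^bsub>M\<^esub> x = b \<odot>\<^bsub>M\<^esub> y"
      using r[unfolded dependent_pairs_def] x(1) y(1) by metis
    have "a \<otimes> g x = b \<otimes> g y"
      using functional_smult[OF g(1) ab(1) x(1)] functional_smult[OF g(1) ab(2) y(1)] ab(4) by simp
    then have "a \<otimes> g x = \<zero>" using y(2) ab(2) by simp
    then have a0: "a = \<zero>" using R.integral_iff[OF ab(1) functional_closed[OF g(1) x(1)]] g(2) by simp
    then have "b \<noteq> \<zero>" "b \<odot>\<^bsub>M\<^esub> y = \<zero>\<^bsub>M\<^esub>" using ab(3,4) x(1) by simp_all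
    then show "y \<in> torsion_submodule R M" unfolding torsion_submodule_def using y(1) ab(2) by auto
  next
    fix y assume "y \<in> torsion_submodule R M"
    then obtain d where d: "y \<in> carrier M" "d \<in> carrier R" "d \<noteq> \<zero>" "d \<odot>\<^bsub>M\<^esub> y = \<zero>\<^bsub>M\<^esub>"
      unfolding torsion_submodule_def by auto
    have "d \<otimes> g y = \<zero>" using functional_smult[OF g(1) d(2,1)] d(4) functional_zero[OF g(1)] by simp
    then show "y \<in> {y \<in> carrier M. g y = \<zero>}"
      using R.integral_iff[OF d(2) functional_closed[OF g(1) d(1)]] d(1,3) by simp
  qed
  then show ?thesis using h by auto
qed

text \<open>
  If \<open>M = ker g \<oplus> h I\<close> and \<open>z \<in> ker g\<close> is not torsion, then \<open>h i \<mapsto> a i z\<close> is injective, and a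
  complement of its image forces \<open>I = a I\<close>; as \<open>R\<close> is integrally closed, \<open>a\<close> is a unit.
\<close>

lemma C4_imp_dependent_pairs:
  assumes C4: "C4 R M" and a: "a \<in> carrier R" "a \<noteq> \<zero>" "\<not> (\<exists>c\<in>carrier R. \<one> = a \<otimes> c)"
  shows dependent_pairs
proof (rule ccontr)
  assume "\<not> dependent_pairs"
  then obtain x y where x: "x \<in> carrier M" and y: "y \<in> carrier M"
    and ind: "\<And>b c. \<lbrakk>b \<in> carrier R; c \<in> carrier R; b \<odot>\<^bsub>M\<^esub> x = c \<odot>\<^bsub>M\<^esub> y\<rbrakk> \<Longrightarrow> b = \<zero> \<and> c = \<zero>"
    unfolding dependent_pairs_def by metis
  have nx: "\<not> torsion_elt x"
    unfolding torsion_elt_def using ind[of _ \<zero>] y by auto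
  obtain g where g: "functional g" "g x \<noteq> \<zero>" using functional_exists[OF x nx] by auto
  define I where "I = g ` carrier M"
  define K where "K = {y \<in> carrier M. g y = \<zero>}"
  obtain h where h: "lin_from_ideal I h" "\<forall>i\<in>I. g (h i) = i" and d: "dsum K (h ` I) (carrier M)"
    using functional_decomposition[OF g(1) x g(2)] unfolding I_def K_def by auto
  have I: "ideal I R" unfolding I_def by (rule ideal_functional_image[OF g(1)])
  have Ic: "i \<in> carrier R" if "i \<in> I" for i by (rule ideal.Icarr[OF I that])
  have gI: "g m \<in> I" if "m \<in> carrier M" for m unfolding I_def by (rule imageI[OF that])
  note K = dsum_sm1[OF d] and F = dsum_sm2[OF d]
  \<comment> \<open>This combination of the independent \<open>x\<close> and \<open>y\<close> lies
    in the kernel of \<open>g\<close> and inherits from independence that it is not torsion.\<close>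
  define z where "z = g x \<odot>\<^bsub>M\<^esub> y \<ominus>\<^bsub>M\<^esub> g y \<odot>\<^bsub>M\<^esub> x"
  have gx: "g x \<in> carrier R" and gy: "g y \<in> carrier R" using functional_closed[OF g(1)] x y by simp_all
  have zc: "z \<in> carrier M" unfolding z_def using gx gy x y by simp
  have "z = g x \<odot>\<^bsub>M\<^esub> y \<oplus>\<^bsub>M\<^esub> (\<ominus> (g y)) \<odot>\<^bsub>M\<^esub> x"
    unfolding z_def using gy x smult_l_minus[OF gy x] by (simp add: a_minus_def)
  then have "g z = g x \<otimes> g y \<oplus> (\<ominus> (g y)) \<otimes> g x"
    using functional_add[OF g(1)] functional_smult[OF g(1)] gx gy x y by simp
  also have "\<dots> = \<zero>" using R.l_minus[OF gy gx] R.m_comm[OF gy gx] gx gy by (simp add: R.r_neg)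
  finally have zK: "z \<in> K" unfolding K_def using zc by simp
  have nz: "b = \<zero>" if b: "b \<in> carrier R" "b \<odot>\<^bsub>M\<^esub> z = \<zero>\<^bsub>M\<^esub>" for b
  proof -
    have "b \<odot>\<^bsub>M\<^esub> (g x \<odot>\<^bsub>M\<^esub> y) \<ominus>\<^bsub>M\<^esub> b \<odot>\<^bsub>M\<^esub> (g y \<odot>\<^bsub>M\<^esub> x) = \<zero>\<^bsub>M\<^esub>"
      using b(2) unfolding z_def using smult_minus_distr(2)[OF b(1) b(1), of "g x \<odot>\<^bsub>M\<^esub> y" "g y \<odot>\<^bsub>M\<^esub> x"] gx gy x y by simp
    then have "b \<odot>\<^bsub>M\<^esub> (g x \<odot>\<^bsub>M\<^esub> y) = b \<odot>\<^bsub>M\<^esub> (g y \<odot>\<^bsub>M\<^esub> x)"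
      using minus_eq_zero_iff[of "b \<odot>\<^bsub>M\<^esub> (g x \<odot>\<^bsub>M\<^esub> y)" "b \<odot>\<^bsub>M\<^esub> (g y \<odot>\<^bsub>M\<^esub> x)"] b(1) gx gy x y by simp
    then have "(b \<otimes> g y) \<odot>\<^bsub>M\<^esub> x = (b \<otimes> g x) \<odot>\<^bsub>M\<^esub> y"
      using smult_assoc1[OF b(1) gx y] smult_assoc1[OF b(1) gy x] by simp
    then have "b \<otimes> g x = \<zero>" using ind[of "b \<otimes> g y" "b \<otimes> g x"] b(1) gx gy by simp
    then show ?thesis using R.integral_iff[OF b(1) gx] g(2) by simp
  qed
  define f where "f m = (a \<otimes> g m) \<odot>\<^bsub>M\<^esub> z" for m
  have Fc: "u \<in> carrier M" if "u \<in> h ` I" for u by (rule sm_closed[OF F that])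
  have f: "linear_on (h ` I) f"
    unfolding linear_on_def f_def
    using Fc zc a(1) functional_closed[OF g(1)]
    by (simp add: functional_add[OF g(1)] functional_smult[OF g(1)] R.r_distr smult_l_distr R.m_lcomm
        smult_assoc1[symmetric])
  have fK: "f ` h ` I \<subseteq> K"
  proof (rule image_subsetI)
    fix u assume "u \<in> h ` I"
    then have "g u \<in> carrier R" using Fc functional_closed[OF g(1)] by simp
    then show "f u \<in> K" unfolding f_def using a(1) by (intro sm_smult[OF K _ zK]) simp
  qed
  have ker: "{u \<in> h ` I. f u = \<zero>\<^bsub>M\<^esub>} = {\<zero>\<^bsub>M\<^esub>}"
  proof (intro subset_antisym subsetI)
    fix u assume "u \<in> {u \<in> h ` I. f u = \<zero>\<^bsub>M\<^esub>}"
    then have u: "u \<in> h ` I" "f u = \<zero>\<^bsub>M\<^esub>" by simp_all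
    have gu: "g u \<in> carrier R" using Fc[OF u(1)] functional_closed[OF g(1)] by simp
    have "a \<otimes> g u = \<zero>" using nz[of "a \<otimes> g u"] u(2) gu a(1) unfolding f_def by simp
    then have "g u = \<zero>" using R.integral_iff[OF a(1) gu] a(2) by simp
    then have "u \<in> K" unfolding K_def using Fc[OF u(1)] by simp
    then show "u \<in> {\<zero>\<^bsub>M\<^esub>}" using dsum_disjoint[OF d _ u(1)] by simp
  next
    fix u assume "u \<in> {\<zero>\<^bsub>M\<^esub>}"
    then show "u \<in> {u \<in> h ` I. f u = \<zero>\<^bsub>M\<^esub>}" using sm_zero[OF F] linear_zero[OF f F] by simp
  qed
  have kd: "dsum {u \<in> h ` I. f u = \<zero>\<^bsub>M\<^esub>} (h ` I) (h ` I)"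
    unfolding ker by (rule dsum_sym[OF dsum_zero_right[OF F]])
  obtain C where C: "dsum (f ` h ` I) C K" using C4D[OF C4 dsum_sym[OF d] f fK kd] by auto
  have fim: "(a \<otimes> i) \<odot>\<^bsub>M\<^esub> z \<in> f ` h ` I" if i: "i \<in> I" for i
  proof -
    have "f (h i) = (a \<otimes> i) \<odot>\<^bsub>M\<^esub> z" unfolding f_def using h(2) i by simp
    then show ?thesis using imageI[OF imageI[OF i, of h], of f] by simp
  qed
  have "\<exists>j\<in>I. \<one> \<otimes> i = a \<otimes> j" if i: "i \<in> I" for i
  proof -
    have "i \<odot>\<^bsub>M\<^esub> z \<in> K" by (rule sm_smult[OF K Ic[OF i] zK])
    then obtain u c where uc: "u \<in> f ` h ` I" "c \<in> C" "i \<odot>\<^bsub>M\<^esub> z = u \<oplus>\<^bsub>M\<^esub> c" "u \<in> carrier M" "c \<in> carrier M"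
      by (rule dsumE[OF C])
    obtain j where j: "j \<in> I" "u = (a \<otimes> j) \<odot>\<^bsub>M\<^esub> z"
      using uc(1) h(2) unfolding f_def by auto
    have jc: "j \<in> carrier R" and ic: "i \<in> carrier R" by (rule Ic[OF j(1)], rule Ic[OF i])
    have dI: "i \<ominus> a \<otimes> j \<in> I" unfolding a_minus_def
      by (rule additive_subgroup.a_closed[OF ideal.axioms(1)[OF I] i
            additive_subgroup.a_inv_closed[OF ideal.axioms(1)[OF I] ideal.I_l_closed[OF I j(1) a(1)]]])
    have "c = i \<odot>\<^bsub>M\<^esub> z \<ominus>\<^bsub>M\<^esub> u" unfolding uc(3) by (rule add_minus_cancel(2)[OF uc(4,5), symmetric])
    also have "\<dots> = (i \<ominus> a \<otimes> j) \<odot>\<^bsub>M\<^esub> z"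
      unfolding j(2) using smult_minus_distr(1)[OF ic _ zc zc, of "a \<otimes> j"] a(1) jc by simp
    finally have c: "c = (i \<ominus> a \<otimes> j) \<odot>\<^bsub>M\<^esub> z" .
    \<comment> \<open>The component \<open>c = (i - a j) z\<close> in \<open>C\<close> becomes an
      element of the image after multiplication by \<open>a\<close>, because \<open>i - a j\<close>
      is in \<open>I\<close>. Hence \<open>a c = 0\<close> and \<open>i = a j\<close>.\<close>
    have ac: "a \<odot>\<^bsub>M\<^esub> c = (a \<otimes> (i \<ominus> a \<otimes> j)) \<odot>\<^bsub>M\<^esub> z"
      unfolding c by (rule smult_assoc1[symmetric, OF a(1) Ic[OF dI] zc])
    have "a \<odot>\<^bsub>M\<^esub> c \<in> f ` h ` I" unfolding ac by (rule fim[OF dI])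
    moreover have "a \<odot>\<^bsub>M\<^esub> c \<in> C" by (rule sm_smult[OF dsum_sm2[OF C] a(1) uc(2)])
    ultimately have "a \<odot>\<^bsub>M\<^esub> c = \<zero>\<^bsub>M\<^esub>" by (rule dsum_disjoint[OF C])
    then have "a \<otimes> (i \<ominus> a \<otimes> j) = \<zero>" using nz[of "a \<otimes> (i \<ominus> a \<otimes> j)"] ac a(1) Ic[OF dI] by simp
    then have "i \<ominus> a \<otimes> j = \<zero>" using R.integral_iff[OF a(1) Ic[OF dI]] a(2) by simp
    then have "i = a \<otimes> j" using R.r_right_minus_eq[of i "a \<otimes> j"] ic a(1) jc by simp
    then show ?thesis using j(1) ic by auto
  qed
  moreover have "I \<noteq> {\<zero>}" using gI[OF x] g(2) by auto
  ultimately show False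
    using R.integrally_closed_dvd[OF R.integrally_closed a(1,2) R.one_closed I] a(3) by simp
qed

end

subsection \<open>Primary components\<close>

context module
begin

definition kills :: "'a set \<Rightarrow> nat \<Rightarrow> 'c \<Rightarrow> bool" where
  "kills P n x \<longleftrightarrow> (\<forall>a\<in>ideal_pow R P n. a \<odot>\<^bsub>M\<^esub> x = \<zero>\<^bsub>M\<^esub>)"

definition primary :: "'a set \<Rightarrow> 'c set" where
  "primary P = {x \<in> carrier M. \<exists>n. kills P n x}"

text \<open>
  With \<open>t\<close> a uniformizer at \<open>P\<close>, this says that the primary component is killed by \<open>P\<close> to the
  power \<open>n + 1\<close> and that its socle is the image of \<open>t\<close> to the power \<open>n\<close>; equivalently it is a sum of
  copies of \<open>R / P\<^bsup>n+1\<^esup>\<close>.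
\<close>

definition uniform_at :: "'a set \<Rightarrow> 'a \<Rightarrow> nat \<Rightarrow> bool" where
  "uniform_at P t n \<longleftrightarrow> (\<forall>x\<in>primary P. kills P (Suc n) x) \<and>
    (\<forall>z\<in>primary P. kills P 1 z \<longrightarrow> (\<exists>x\<in>primary P. z = t [^] n \<odot>\<^bsub>M\<^esub> x))"

lemma primary_closed: "x \<in> primary P \<Longrightarrow> x \<in> carrier M"
  by (simp add: primary_def)

lemma dsum_smult_eq:
  assumes d: "dsum A B C" and ab: "a \<in> A" "b \<in> B" "r \<in> carrier R" "a0 \<in> A"
    and e: "r \<odot>\<^bsub>M\<^esub> (a \<oplus>\<^bsub>M\<^esub> b) = a0"
  shows "r \<odot>\<^bsub>M\<^esub> a = a0" "r \<odot>\<^bsub>M\<^esub> b = \<zero>\<^bsub>M\<^esub>"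
proof -
  note A = dsum_sm1[OF d] and B = dsum_sm2[OF d]
  have c: "a \<in> carrier M" "b \<in> carrier M" "a0 \<in> carrier M"
    using sm_closed[OF A] sm_closed[OF B] ab by simp_all
  have "r \<odot>\<^bsub>M\<^esub> a \<oplus>\<^bsub>M\<^esub> r \<odot>\<^bsub>M\<^esub> b = a0 \<oplus>\<^bsub>M\<^esub> \<zero>\<^bsub>M\<^esub>"
    using e smult_r_distr[OF ab(3) c(1,2)] c(3) by simp
  from dsum_unique[OF d sm_smult[OF A ab(3,1)] sm_smult[OF B ab(3,2)] ab(4) sm_zero[OF B] this]
  show "r \<odot>\<^bsub>M\<^esub> a = a0" "r \<odot>\<^bsub>M\<^esub> b = \<zero>\<^bsub>M\<^esub>" .
qed

end

section \<open>The primary component at a fixed prime\<close>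

locale dedekind_prime_module = dedekind_module R M + R?: uniformized_prime R P t s0
  for R (structure) and M and P t s0
begin

lemma kills_iff: "kills P n x \<longleftrightarrow> (\<forall>a\<in>Q n. a \<odot>\<^bsub>M\<^esub> x = \<zero>\<^bsub>M\<^esub>)"
  by (simp add: kills_def Q_def)

lemma kills_Q: "\<lbrakk>kills P n x; a \<in> Q n\<rbrakk> \<Longrightarrow> a \<odot>\<^bsub>M\<^esub> x = \<zero>\<^bsub>M\<^esub>"
  by (simp add: kills_iff)

lemma kills_mono: "\<lbrakk>kills P m x; m \<le> n\<rbrakk> \<Longrightarrow> kills P n x"
  using Q_antimono[of m n] by (auto simp: kills_iff)

lemma kills_0: "\<lbrakk>kills P 0 x; x \<in> carrier M\<rbrakk> \<Longrightarrow> x = \<zero>\<^bsub>M\<^esub>"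
  using kills_Q[of 0 x \<one>] by simp

lemma kills_zero: "kills P n \<zero>\<^bsub>M\<^esub>"
  unfolding kills_iff using Q_closed by auto

text \<open>On an element killed by \<open>P ^ n\<close>, the inverse of \<open>s\<close> modulo
  \<open>P ^ n\<close> undoes multiplication by \<open>s\<close>.\<close>

lemma kills_unit:
  assumes x: "x \<in> carrier M" "kills P n x" and s: "s \<in> carrier R - P"
  shows "\<exists>u\<in>carrier R. u \<odot>\<^bsub>M\<^esub> (s \<odot>\<^bsub>M\<^esub> x) = x"
proof -
  obtain u q where u: "u \<in> carrier R" "q \<in> Q n" "s \<otimes> u \<oplus> q = \<one>"
    using unit_inverse[OF s, of n] by auto
  have c: "s \<in> carrier R" "q \<in> carrier R" using s Q_closed[OF u(2)] by simp_all
  have "x = (s \<otimes> u \<oplus> q) \<odot>\<^bsub>M\<^esub> x" using u(3) x(1) by simp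
  also have "\<dots> = (s \<otimes> u) \<odot>\<^bsub>M\<^esub> x \<oplus>\<^bsub>M\<^esub> q \<odot>\<^bsub>M\<^esub> x" using c u(1) x(1) by (simp add: smult_l_distr)
  also have "\<dots> = u \<odot>\<^bsub>M\<^esub> (s \<odot>\<^bsub>M\<^esub> x)"
    using kills_Q[OF x(2) u(2)] c u(1) x(1) by (simp add: smult_assoc1[symmetric] R.m_comm)
  finally have e: "x = u \<odot>\<^bsub>M\<^esub> (s \<odot>\<^bsub>M\<^esub> x)" .
  show ?thesis using u(1) e[symmetric] by (rule rev_bexI)
qed

lemma Q_mult_t: "a \<in> Q k \<Longrightarrow> t [^] (j::nat) \<otimes> a \<in> Q (j + k)"
proof (induction j)
  case 0 then show ?case using Q_closed[OF 0] by simp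
next
  case (Suc j)
  have "t [^] Suc j \<otimes> a = (t [^] j \<otimes> a) \<otimes> t" using Q_closed[OF Suc.prems] by (simp add: R.m_ac)
  then show ?case using Q_mult_P[OF Suc.IH[OF Suc.prems] t_in] by (simp del: nat_pow_Suc)
qed

text \<open>For an element killed by some \<open>P ^ N\<close>, the single power
  \<open>t ^ n\<close> tests annihilation by \<open>P ^ n\<close>, since \<open>P ^ n\<close> is
  contained in \<open>t ^ n R + P ^ N\<close>.\<close>

lemma kills_t:
  assumes x: "x \<in> carrier M" "kills P N x" and tx: "t [^] n \<odot>\<^bsub>M\<^esub> x = \<zero>\<^bsub>M\<^esub>"
  shows "kills P n x"
  unfolding kills_iff
proof
  fix a assume a: "a \<in> Q n"
  obtain d q where d: "d \<in> carrier R" "q \<in> Q N" "a = t [^] n \<otimes> d \<oplus> q" using Q_decomp[OF a, of N] by auto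
  have qc: "q \<in> carrier R" by (rule Q_closed[OF d(2)])
  have "a \<odot>\<^bsub>M\<^esub> x = (d \<otimes> t [^] n) \<odot>\<^bsub>M\<^esub> x \<oplus>\<^bsub>M\<^esub> q \<odot>\<^bsub>M\<^esub> x"
    unfolding d(3) using d(1) qc x(1) by (simp add: smult_l_distr R.m_comm)
  then show "a \<odot>\<^bsub>M\<^esub> x = \<zero>\<^bsub>M\<^esub>" using kills_Q[OF x(2) d(2)] tx d(1) x(1) by (simp add: smult_assoc1)
qed

lemma kills_add: "\<lbrakk>kills P n x; kills P n y; x \<in> carrier M; y \<in> carrier M\<rbrakk> \<Longrightarrow> kills P n (x \<oplus>\<^bsub>M\<^esub> y)"
  unfolding kills_iff using Q_closed by (simp add: smult_r_distr)

lemma kills_smult: 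
  assumes "kills P n x" "x \<in> carrier M" "r \<in> carrier R" shows "kills P n (r \<odot>\<^bsub>M\<^esub> x)"
  unfolding kills_iff
proof
  fix a assume a: "a \<in> Q n"
  have "a \<odot>\<^bsub>M\<^esub> (r \<odot>\<^bsub>M\<^esub> x) = r \<odot>\<^bsub>M\<^esub> (a \<odot>\<^bsub>M\<^esub> x)"
    using Q_closed[OF a] assms(2,3) by (simp add: smult_assoc1[symmetric] R.m_comm)
  then show "a \<odot>\<^bsub>M\<^esub> (r \<odot>\<^bsub>M\<^esub> x) = \<zero>\<^bsub>M\<^esub>" using kills_Q[OF assms(1) a] assms(3) by simp
qed

lemma sm_killed: "sm {x \<in> carrier M. kills P n x}"
  by (rule sm_intro) (simp_all add: kills_zero kills_add kills_smult subset_iff)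

lemma sm_primary: "sm (primary P)"
proof (rule sm_intro)
  show "primary P \<subseteq> carrier M" by (auto simp: primary_def)
  show "\<zero>\<^bsub>M\<^esub> \<in> primary P" using kills_zero by (simp add: primary_def)
  fix x assume "x \<in> primary P"
  then obtain n where n: "x \<in> carrier M" "kills P n x" by (auto simp: primary_def)
  show "a \<odot>\<^bsub>M\<^esub> x \<in> primary P" if "a \<in> carrier R" for a
    using kills_smult[OF n(2,1) that] n that by (auto simp: primary_def)
  fix y assume "y \<in> primary P"
  then obtain m where m: "y \<in> carrier M" "kills P m y" by (auto simp: primary_def)
  have "kills P (max n m) (x \<oplus>\<^bsub>M\<^esub> y)"
    by (rule kills_add[OF kills_mono[OF n(2)] kills_mono[OF m(2)] n(1) m(1)]) simp_all
  then show "x \<oplus>\<^bsub>M\<^esub> y \<in> primary P" using n m by (auto simp: primary_def)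
qed

lemma primary_bounded: "\<exists>N. \<forall>x\<in>primary P. kills P N x"
proof -
  obtain F where F: "finite F" "F \<subseteq> primary P" "span F = primary P"
    using finite_span[OF sm_primary] by (elim exE conjE)
  have "\<exists>N. \<forall>x\<in>F. kills P N x" using F(1,2)
  proof (induction F rule: finite_induct)
    case (insert x F)
    then obtain N where N: "\<forall>x\<in>F. kills P N x" by auto
    obtain n where n: "kills P n x" using insert.prems by (auto simp: primary_def)
    have "\<forall>y\<in>insert x F. kills P (max N n) y"
    proof
      fix y assume "y \<in> insert x F"
      then consider "y = x" | "y \<in> F" by auto
      then show "kills P (max N n) y"
        by cases (use N n kills_mono[of n x "max N n"] kills_mono[of N y "max N n"] in simp_all)
    qed
    then show ?case by (rule exI)
  qed simp
  then obtain N where N: "\<forall>x\<in>F. kills P N x" by auto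
  have "F \<subseteq> {x \<in> carrier M. kills P N x}" using F(2) N by (auto dest: primary_closed)
  then have "span F \<subseteq> {x \<in> carrier M. kills P N x}" by (rule span_is_subset[OF _ afp_submodule[OF sm_killed]])
  then show ?thesis unfolding F(3) by (intro exI[of _ N]) auto
qed

text \<open>Up to elements outside \<open>P\<close>, every coefficient acts on \<open>x\<close> like
  a power of \<open>t\<close>. Hence any nonzero submodule of \<open>R x\<close> contains some
  \<open>t ^ j x\<close> with \<open>j\<close> less than \<open>n\<close>.\<close>

lemma kills_unform:
  assumes x: "x \<in> carrier M" "kills P n x" and d: "d \<in> carrier R" "d \<odot>\<^bsub>M\<^esub> x \<noteq> \<zero>\<^bsub>M\<^esub>"
  shows "\<exists>j<n. \<exists>e\<in>carrier R. e \<odot>\<^bsub>M\<^esub> (d \<odot>\<^bsub>M\<^esub> x) = t [^] j \<odot>\<^bsub>M\<^esub> x"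
proof -
  have "d \<notin> Q n" using d kills_Q[OF x(2)] by auto
  then obtain j e q where j: "j < n" "e \<in> carrier R" "q \<in> Q n" "e \<otimes> d = t [^] j \<oplus> q"
    using Q_unform[OF d(1), of n] by auto
  have "e \<odot>\<^bsub>M\<^esub> (d \<odot>\<^bsub>M\<^esub> x) = (t [^] j \<oplus> q) \<odot>\<^bsub>M\<^esub> x"
    using smult_assoc1[OF j(2) d(1) x(1)] j(4) by simp
  also have "\<dots> = t [^] j \<odot>\<^bsub>M\<^esub> x"
    using kills_Q[OF x(2) j(3)] Q_closed[OF j(3)] x(1) by (simp add: smult_l_distr)
  finally show ?thesis using j(1,2) by auto
qed

lemma t_pow_smult:
  "x \<in> carrier M \<Longrightarrow> t [^] (j::nat) \<odot>\<^bsub>M\<^esub> (t [^] (k::nat) \<odot>\<^bsub>M\<^esub> x) = t [^] (j + k) \<odot>\<^bsub>M\<^esub> x"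
  by (simp add: smult_assoc1[symmetric] R.nat_pow_mult)

text \<open>
  A cyclic submodule \<open>R x\<close> killed by \<open>P\<^bsup>n+1\<^esup>\<close> splits off as soon as its socle generator survives modulo
  a submodule containing \<open>P\<^bsup>n+1\<^esup> Y\<close>; the complement is a maximal submodule avoiding that generator.
\<close>

lemma cyclic_summand:
  assumes Y: "sm Y" "x \<in> Y" and k: "kills P (Suc n) x"
    and W0: "sm W0" "W0 \<subseteq> Y" "\<And>a y. \<lbrakk>a \<in> Q (Suc n); y \<in> Y\<rbrakk> \<Longrightarrow> a \<odot>\<^bsub>M\<^esub> y \<in> W0"
    and u0: "t [^] n \<odot>\<^bsub>M\<^esub> x \<notin> W0"
  shows "\<exists>W. W0 \<subseteq> W \<and> dsum (cyc x) W Y"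
proof -
  define u where "u = t [^] n \<odot>\<^bsub>M\<^esub> x"
  have Yc: "y \<in> carrier M" if "y \<in> Y" for y by (rule sm_closed[OF Y(1) that])
  have xc: "x \<in> carrier M" by (rule Yc[OF Y(2)])
  let ?S = "{W. sm W \<and> W0 \<subseteq> W \<and> W \<subseteq> Y \<and> u \<notin> W}"
  have "\<exists>W\<in>?S. \<forall>W'\<in>?S. W \<subseteq> W' \<longrightarrow> W' = W"
  proof (rule maximal_submodule_in_family)
    show "sm N" if "N \<in> ?S" for N using that by simp
    have "W0 \<in> ?S" using W0(1,2) u0 by (simp add: u_def)
    then show "?S \<noteq> {}" by (rule ex_in_conv[THEN iffD1, OF exI])
  qed
  then obtain W where WS: "W \<in> ?S" and max: "\<forall>W'\<in>?S. W \<subseteq> W' \<longrightarrow> W' = W" by (elim bexE) (rule that)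
  have W: "sm W" "W0 \<subseteq> W" "W \<subseteq> Y" "u \<notin> W" using WS by simp_all
  have Wc: "w \<in> carrier M" if "w \<in> W" for w by (rule sm_closed[OF W(1) that])
  have Cx: "sm (cyc x)" by (rule sm_cyc[OF xc])
  define U where "U = msum (cyc x) W"
  have U: "sm U" unfolding U_def by (rule sm_msum[OF Cx W(1)])
  have WU: "W \<subseteq> U" unfolding U_def by (rule msum_upper2[OF Cx W(1)])
  have xU: "cyc x \<subseteq> U" unfolding U_def by (rule msum_upper1[OF Cx W(1)])
  have UY: "U \<subseteq> Y" unfolding U_def by (rule msum_least[OF Y(1) cyc_least[OF Y] W(3)])
  have QW: "a \<odot>\<^bsub>M\<^esub> y \<in> W" if "a \<in> Q (Suc n)" "y \<in> Y" for a y using W0(3)[OF that] W(2) by auto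
  have "Y \<subseteq> U"
  proof (rule ccontr)
    assume "\<not> Y \<subseteq> U"
    then obtain y where y: "y \<in> Y" "y \<notin> U" by auto
    \<comment> \<open>With the least such \<open>j\<close>, the element
      \<open>y0 = t ^ (j - 1) y\<close> is outside \<open>U\<close> while \<open>t y0\<close> is
      inside.\<close>
    define j where "j = (LEAST j::nat. t [^] j \<odot>\<^bsub>M\<^esub> y \<in> U)"
    have "t [^] Suc n \<odot>\<^bsub>M\<^esub> y \<in> U" using QW[OF t_pow_in_Q y(1)] WU by auto
    then have j: "t [^] j \<odot>\<^bsub>M\<^esub> y \<in> U" unfolding j_def by (rule LeastI)
    have "j \<noteq> 0"
    proof
      assume "j = 0"
      then show False using j y Yc by simp
    qed
    then obtain i where i: "j = Suc i" using not0_implies_Suc by auto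
    define y0 where "y0 = t [^] i \<odot>\<^bsub>M\<^esub> y"
    have y0U: "y0 \<notin> U" unfolding y0_def using not_less_Least[of i "\<lambda>j::nat. t [^] j \<odot>\<^bsub>M\<^esub> y \<in> U"] i
      unfolding j_def[symmetric] by simp
    have y0: "y0 \<in> Y" unfolding y0_def by (rule sm_smult[OF Y(1) _ y(1)]) simp
    have y0c: "y0 \<in> carrier M" by (rule Yc[OF y0])
    have "t \<odot>\<^bsub>M\<^esub> y0 = t [^] j \<odot>\<^bsub>M\<^esub> y"
      unfolding y0_def i using t_pow_smult[OF Yc[OF y(1)], of 1 i] by simp
    then have "t \<odot>\<^bsub>M\<^esub> y0 \<in> msum (cyc x) W" using j U_def by simp
    then obtain v w where vw: "v \<in> cyc x" "w \<in> W" "t \<odot>\<^bsub>M\<^esub> y0 = v \<oplus>\<^bsub>M\<^esub> w" by (rule msumE)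
    obtain d where d: "d \<in> carrier R" "v = d \<odot>\<^bsub>M\<^esub> x" using vw(1) by (rule cycE)
    have wc: "w \<in> carrier M" by (rule Wc[OF vw(2)])
    show False
    proof (cases "d \<in> P")
      \<comment> \<open>Here \<open>d x = t d' x\<close>, because the error term kills
        \<open>x\<close>. Replacing \<open>y0\<close> by \<open>y1 = y0 - d' x\<close> gives
        \<open>t y1 = w\<close> in \<open>W\<close>, and \<open>y1\<close> is still outside
        \<open>U\<close>.\<close>
      case True
      then have "d \<in> Q (Suc 0)" by (simp only: Q_1)
      then obtain d' q where d': "d' \<in> carrier R" "q \<in> Q (Suc n)" "d = t [^] Suc 0 \<otimes> d' \<oplus> q"
        using Q_decomp[of d "Suc 0" "Suc n"] by auto
      have qc: "q \<in> carrier R" by (rule Q_closed[OF d'(2)])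
      define y1 where "y1 = y0 \<ominus>\<^bsub>M\<^esub> d' \<odot>\<^bsub>M\<^esub> x"
      have dx: "d' \<odot>\<^bsub>M\<^esub> x \<in> cyc x" by (rule cycI[OF d'(1)])
      have y1: "y1 \<in> Y" unfolding y1_def by (rule sm_minus[OF Y(1) y0 sm_smult[OF Y(1) d'(1) Y(2)]])
      have y1c: "y1 \<in> carrier M" by (rule Yc[OF y1])
      have y01: "y0 = y1 \<oplus>\<^bsub>M\<^esub> d' \<odot>\<^bsub>M\<^esub> x"
        unfolding y1_def using add_minus_cancel(3)[of "d' \<odot>\<^bsub>M\<^esub> x" y0] d'(1) xc y0c by simp
      have y1U: "y1 \<notin> U"
      proof
        assume "y1 \<in> U"
        from sm_add[OF U this subsetD[OF xU dx]] show False using y0U y01 by simp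
      qed
      have "v = (t \<otimes> d') \<odot>\<^bsub>M\<^esub> x"
        unfolding d(2) d'(3) using d'(1) qc xc kills_Q[OF k d'(2)] by (simp add: smult_l_distr)
      then have "t \<odot>\<^bsub>M\<^esub> y1 \<oplus>\<^bsub>M\<^esub> (t \<otimes> d') \<odot>\<^bsub>M\<^esub> x = w \<oplus>\<^bsub>M\<^esub> (t \<otimes> d') \<odot>\<^bsub>M\<^esub> x"
        using vw(3) d'(1) xc y1c wc unfolding y01
        by (simp add: smult_r_distr smult_assoc1 M.a_comm)
      then have ty1: "t \<odot>\<^bsub>M\<^esub> y1 = w"
        using add_minus_cancel(1)[of "(t \<otimes> d') \<odot>\<^bsub>M\<^esub> x" w]
          add_minus_cancel(1)[of "(t \<otimes> d') \<odot>\<^bsub>M\<^esub> x" "t \<odot>\<^bsub>M\<^esub> y1"] d'(1) xc y1c wc by simp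
      have Cy1: "sm (cyc y1)" by (rule sm_cyc[OF y1c])
      have "y1 \<in> msum W (cyc y1)" using msum_upper2[OF W(1) Cy1] cyc_self[OF y1c] by (rule subsetD)
      moreover have "y1 \<notin> W" using y1U WU by auto
      ultimately have ne: "msum W (cyc y1) \<noteq> W" by auto
      have up: "W \<subseteq> msum W (cyc y1)" by (rule msum_upper1[OF W(1) Cy1])
      \<comment> \<open>\<open>W\<close> is maximal among the submodules avoiding \<open>u\<close>,
        so \<open>W + R y1\<close> contains \<open>u = w' + c y1\<close>. For \<open>c\<close> in
        \<open>P\<close> the term \<open>c y1\<close> is already in \<open>W\<close>; otherwise
        \<open>c\<close> can be inverted and \<open>y1\<close> would be in \<open>U\<close>.\<close>
      have "u \<in> msum W (cyc y1)"
      proof (rule ccontr)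
        assume "u \<notin> msum W (cyc y1)"
        then have "msum W (cyc y1) \<in> ?S"
          using sm_msum[OF W(1) Cy1] subset_trans[OF W(2) up] msum_least[OF Y(1) W(3) cyc_least[OF Y(1) y1]]
          by simp
        then show False using max up ne by simp
      qed
      then obtain w' v' where w': "w' \<in> W" "v' \<in> cyc y1" "u = w' \<oplus>\<^bsub>M\<^esub> v'" by (rule msumE)
      obtain c where c: "c \<in> carrier R" "v' = c \<odot>\<^bsub>M\<^esub> y1" using w'(2) by (rule cycE)
      show False
      proof (cases "c \<in> P")
        case True
        then have "c \<in> Q (Suc 0)" by (simp only: Q_1)
        then obtain c' p where c': "c' \<in> carrier R" "p \<in> Q (Suc n)" "c = t [^] Suc 0 \<otimes> c' \<oplus> p"
          using Q_decomp[of c "Suc 0" "Suc n"] by auto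
        have pc: "p \<in> carrier R" by (rule Q_closed[OF c'(2)])
        have "v' = c' \<odot>\<^bsub>M\<^esub> w \<oplus>\<^bsub>M\<^esub> p \<odot>\<^bsub>M\<^esub> y1"
          unfolding c(2) c'(3) ty1[symmetric] using c'(1) pc y1c
          by (simp add: smult_l_distr smult_assoc1[symmetric] R.m_comm)
        then have "v' \<in> W" using sm_add[OF W(1) sm_smult[OF W(1) c'(1) vw(2)] QW[OF c'(2) y1]] by simp
        then show False using sm_add[OF W(1) w'(1)] w'(3) W(4) by simp
      next
        case False
        then obtain r p where r: "r \<in> carrier R" "p \<in> Q (Suc n)" "c \<otimes> r \<oplus> p = \<one>"
          using unit_inverse[of c "Suc n"] c(1) by auto
        have pc: "p \<in> carrier R" by (rule Q_closed[OF r(2)])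
        have "y1 = (c \<otimes> r \<oplus> p) \<odot>\<^bsub>M\<^esub> y1" using r(3) y1c by simp
        also have "\<dots> = r \<odot>\<^bsub>M\<^esub> v' \<oplus>\<^bsub>M\<^esub> p \<odot>\<^bsub>M\<^esub> y1"
          unfolding c(2) using c(1) r(1) pc y1c by (simp add: smult_l_distr smult_assoc1[symmetric] R.m_comm)
        finally have e: "y1 = r \<odot>\<^bsub>M\<^esub> v' \<oplus>\<^bsub>M\<^esub> p \<odot>\<^bsub>M\<^esub> y1" .
        have v'c: "v' \<in> carrier M" unfolding c(2) using c(1) y1c by simp
        have "v' = u \<ominus>\<^bsub>M\<^esub> w'" unfolding w'(3) using add_minus_cancel(2)[OF Wc[OF w'(1)] v'c] by simp
        moreover have "u \<in> U" unfolding u_def using xU cycI[of "t [^] n" x] by auto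
        ultimately have "v' \<in> U" using sm_minus[OF U _ subsetD[OF WU w'(1)]] by simp
        then have "r \<odot>\<^bsub>M\<^esub> v' \<oplus>\<^bsub>M\<^esub> p \<odot>\<^bsub>M\<^esub> y1 \<in> U"
          by (rule sm_add[OF U sm_smult[OF U r(1)] subsetD[OF WU QW[OF r(2) y1]]])
        then show False using y1U e by simp
      qed
    next
      \<comment> \<open>Multiplying \<open>t y0 = d x + w\<close> by \<open>t ^ n\<close> puts
        \<open>d u\<close> into \<open>W\<close>, since \<open>t ^ (n + 1) y0\<close> is there. As
        \<open>d\<close> is invertible on \<open>u\<close>, this contradicts that \<open>W\<close>
        avoids \<open>u\<close>.\<close>
      case False
      then have dP: "d \<in> carrier R - P" using d(1) by simp
      have "t [^] Suc n \<odot>\<^bsub>M\<^esub> y0 = t [^] n \<odot>\<^bsub>M\<^esub> (t \<odot>\<^bsub>M\<^esub> y0)" using y0c by (simp add: smult_assoc1)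
      also have "\<dots> = t [^] n \<odot>\<^bsub>M\<^esub> (d \<odot>\<^bsub>M\<^esub> x) \<oplus>\<^bsub>M\<^esub> t [^] n \<odot>\<^bsub>M\<^esub> w"
        unfolding vw(3) d(2) using d(1) xc wc by (simp add: smult_r_distr)
      also have "t [^] n \<odot>\<^bsub>M\<^esub> (d \<odot>\<^bsub>M\<^esub> x) = d \<odot>\<^bsub>M\<^esub> u"
        unfolding u_def using d(1) xc by (simp add: smult_assoc1[symmetric] R.m_comm)
      finally have e: "t [^] Suc n \<odot>\<^bsub>M\<^esub> y0 = d \<odot>\<^bsub>M\<^esub> u \<oplus>\<^bsub>M\<^esub> t [^] n \<odot>\<^bsub>M\<^esub> w" .
      have uc: "u \<in> carrier M" unfolding u_def using xc by simp
      have "t [^] Suc n \<odot>\<^bsub>M\<^esub> y0 \<ominus>\<^bsub>M\<^esub> t [^] n \<odot>\<^bsub>M\<^esub> w \<in> W"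
        by (rule sm_minus[OF W(1) QW[OF t_pow_in_Q y0] sm_smult[OF W(1) _ vw(2)]]) simp
      then have "d \<odot>\<^bsub>M\<^esub> u \<in> W"
        unfolding e using add_minus_cancel(1)[of "t [^] n \<odot>\<^bsub>M\<^esub> w" "d \<odot>\<^bsub>M\<^esub> u"] d(1) uc wc by simp
      moreover have "kills P (Suc n) u" unfolding u_def by (rule kills_smult[OF k xc]) simp
      then obtain r where r: "r \<in> carrier R" "r \<odot>\<^bsub>M\<^esub> (d \<odot>\<^bsub>M\<^esub> u) = u" using kills_unit[OF uc _ dP] by auto
      ultimately show False using sm_smult[OF W(1) r(1)] r(2) W(4) by metis
    qed
  qed
  \<comment> \<open>Any nonzero element of \<open>R x\<close> has the socle generator
    \<open>u\<close> among its multiples, but \<open>u\<close> is not in \<open>W\<close>.\<close>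
  moreover have "z = \<zero>\<^bsub>M\<^esub>" if z: "z \<in> cyc x" "z \<in> W" for z
  proof (rule ccontr)
    assume z0: "z \<noteq> \<zero>\<^bsub>M\<^esub>"
    obtain d where d: "d \<in> carrier R" "z = d \<odot>\<^bsub>M\<^esub> x" using z(1) by (rule cycE)
    obtain j e where j: "j < Suc n" "e \<in> carrier R" "e \<odot>\<^bsub>M\<^esub> z = t [^] j \<odot>\<^bsub>M\<^esub> x"
      using kills_unform[OF xc k d(1)] z0 unfolding d(2) by auto
    have "t [^] (n - j) \<odot>\<^bsub>M\<^esub> (e \<odot>\<^bsub>M\<^esub> z) = u"
      unfolding j(3) u_def using t_pow_smult[OF xc, of "n - j" j] j(1) by simp
    then show False using sm_smult[OF W(1) _ sm_smult[OF W(1) j(2) z(2)], of "t [^] (n - j)"] W(4) by simp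
  qed
  ultimately have "dsum (cyc x) W Y"
    using dsumI[OF Cx W(1), of Y] UY U_def by simp
  then show ?thesis using W(2) by auto
qed

text \<open>The kernel of the map from \<open>M\<close> to its localization at
  \<open>P\<close>.\<close>

definition prime_to :: "'c set" where
  "prime_to = {x \<in> carrier M. \<exists>s\<in>carrier R - P. s \<odot>\<^bsub>M\<^esub> x = \<zero>\<^bsub>M\<^esub>}"

lemma sm_prime_to: "sm prime_to"
proof (rule sm_intro)
  show "prime_to \<subseteq> carrier M" by (auto simp: prime_to_def)
  have "\<one> \<in> carrier R - P" using one_notin by simp
  then show "\<zero>\<^bsub>M\<^esub> \<in> prime_to" unfolding prime_to_def by (intro CollectI conjI bexI[of _ \<one>]) simp_all
  fix x assume "x \<in> prime_to"
  then obtain s where s: "x \<in> carrier M" "s \<in> carrier R - P" "s \<odot>\<^bsub>M\<^esub> x = \<zero>\<^bsub>M\<^esub>" by (auto simp: prime_to_def)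
  have sc: "s \<in> carrier R" using s(2) by simp
  show "a \<odot>\<^bsub>M\<^esub> x \<in> prime_to" if a: "a \<in> carrier R" for a
  proof -
    have "s \<odot>\<^bsub>M\<^esub> (a \<odot>\<^bsub>M\<^esub> x) = a \<odot>\<^bsub>M\<^esub> (s \<odot>\<^bsub>M\<^esub> x)" using sc a s(1) by (simp add: smult_assoc1[symmetric] R.m_comm)
    then show ?thesis unfolding prime_to_def using s a by (intro CollectI conjI bexI[of _ s]) simp_all
  qed
  fix y assume "y \<in> prime_to"
  then obtain r where r: "y \<in> carrier M" "r \<in> carrier R - P" "r \<odot>\<^bsub>M\<^esub> y = \<zero>\<^bsub>M\<^esub>" by (auto simp: prime_to_def)
  have rc: "r \<in> carrier R" using r(2) by simp
  have "(s \<otimes> r) \<odot>\<^bsub>M\<^esub> (x \<oplus>\<^bsub>M\<^esub> y) = r \<odot>\<^bsub>M\<^esub> (s \<odot>\<^bsub>M\<^esub> x) \<oplus>\<^bsub>M\<^esub> s \<odot>\<^bsub>M\<^esub> (r \<odot>\<^bsub>M\<^esub> y)"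
    using sc rc s(1) r(1) by (simp add: smult_r_distr smult_assoc1[symmetric] R.m_comm)
  then have "(s \<otimes> r) \<odot>\<^bsub>M\<^esub> (x \<oplus>\<^bsub>M\<^esub> y) = \<zero>\<^bsub>M\<^esub>" using s(3) r(3) sc rc by simp
  then show "x \<oplus>\<^bsub>M\<^esub> y \<in> prime_to"
    unfolding prime_to_def using s(1) r(1) unit_mult[OF s(2) r(2)] by (intro CollectI conjI bexI[of _ "s \<otimes> r"]) simp_all
qed

lemma primary_subset_torsion: "primary P \<subseteq> torsion_submodule R M"
proof
  fix x assume "x \<in> primary P"
  then obtain n where n: "x \<in> carrier M" "kills P n x" by (auto simp: primary_def)
  have "t [^] n \<odot>\<^bsub>M\<^esub> x = \<zero>\<^bsub>M\<^esub>" by (rule kills_Q[OF n(2) t_pow_in_Q])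
  then show "x \<in> torsion_submodule R M"
    unfolding torsion_submodule_def using n(1) t_pow_nonzero[of n] by (intro CollectI conjI bexI[of _ "t [^] n"]) simp_all
qed

text \<open>If \<open>d x = 0\<close> with \<open>d\<close> nonzero, choose \<open>n\<close> and
  \<open>s\<close> outside \<open>P\<close> with \<open>s P ^ n\<close> inside \<open>d R\<close>.
  Then \<open>P ^ n\<close> kills \<open>s x\<close> and \<open>s\<close> kills
  \<open>P ^ n x\<close>, so \<open>s u + q = 1\<close> splits \<open>x\<close> as
  \<open>u s x + q x\<close>.\<close>

lemma torsion_primary_dsum: "dsum (primary P) prime_to (torsion_submodule R M)"
proof (rule dsumI[OF sm_primary sm_prime_to])
  show "msum (primary P) prime_to = torsion_submodule R M"
  proof
    show "msum (primary P) prime_to \<subseteq> torsion_submodule R M"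
    proof (rule msum_least[OF sm_torsion primary_subset_torsion])
      show "prime_to \<subseteq> torsion_submodule R M"
        unfolding prime_to_def torsion_submodule_def using unit_nonzero by auto
    qed
    show "torsion_submodule R M \<subseteq> msum (primary P) prime_to"
    proof
      fix x assume "x \<in> torsion_submodule R M"
      then obtain d where d: "x \<in> carrier M" "d \<in> carrier R" "d \<noteq> \<zero>" "d \<odot>\<^bsub>M\<^esub> x = \<zero>\<^bsub>M\<^esub>"
        unfolding torsion_submodule_def by auto
      obtain n s where s: "s \<in> carrier R - P" "\<forall>p\<in>Q n. \<exists>c\<in>carrier R. s \<otimes> p = c \<otimes> d"
        using nonzero_ideal_contains_Q[OF d(2,3)] by auto
      obtain u q where u: "u \<in> carrier R" "q \<in> Q n" "s \<otimes> u \<oplus> q = \<one>" using unit_inverse[OF s(1), of n] by auto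
      have c: "s \<in> carrier R" "q \<in> carrier R" using s(1) Q_closed[OF u(2)] by simp_all
      have sp: "s \<odot>\<^bsub>M\<^esub> (p \<odot>\<^bsub>M\<^esub> x) = \<zero>\<^bsub>M\<^esub>" if p: "p \<in> Q n" for p
      proof -
        obtain e where e: "e \<in> carrier R" "s \<otimes> p = e \<otimes> d" using s(2) p by auto
        have "s \<odot>\<^bsub>M\<^esub> (p \<odot>\<^bsub>M\<^esub> x) = (e \<otimes> d) \<odot>\<^bsub>M\<^esub> x"
          using smult_assoc1[OF c(1) Q_closed[OF p] d(1)] e(2) by simp
        then show ?thesis using smult_assoc1[OF e(1) d(2) d(1)] d(4) e(1) by simp
      qed
      have "kills P n (s \<odot>\<^bsub>M\<^esub> x)" unfolding kills_iff
      proof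
        fix p assume p: "p \<in> Q n"
        have "p \<odot>\<^bsub>M\<^esub> (s \<odot>\<^bsub>M\<^esub> x) = s \<odot>\<^bsub>M\<^esub> (p \<odot>\<^bsub>M\<^esub> x)"
          using c(1) Q_closed[OF p] d(1) by (simp add: smult_assoc1[symmetric] R.m_comm)
        then show "p \<odot>\<^bsub>M\<^esub> (s \<odot>\<^bsub>M\<^esub> x) = \<zero>\<^bsub>M\<^esub>" using sp[OF p] by simp
      qed
      then have "s \<odot>\<^bsub>M\<^esub> x \<in> primary P" unfolding primary_def using c(1) d(1) by auto
      then have 1: "u \<odot>\<^bsub>M\<^esub> (s \<odot>\<^bsub>M\<^esub> x) \<in> primary P" by (rule sm_smult[OF sm_primary u(1)])
      have 2: "q \<odot>\<^bsub>M\<^esub> x \<in> prime_to" unfolding prime_to_def using sp[OF u(2)] s(1) c(2) d(1) by auto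
      have "x = (s \<otimes> u \<oplus> q) \<odot>\<^bsub>M\<^esub> x" using u(3) d(1) by simp
      also have "\<dots> = u \<odot>\<^bsub>M\<^esub> (s \<odot>\<^bsub>M\<^esub> x) \<oplus>\<^bsub>M\<^esub> q \<odot>\<^bsub>M\<^esub> x"
        using c u(1) d(1) by (simp add: smult_l_distr smult_assoc1[symmetric] R.m_comm)
      finally show "x \<in> msum (primary P) prime_to" using msumI[OF 1 2] by simp
    qed
  qed
  fix x assume x: "x \<in> primary P" "x \<in> prime_to"
  from x(1) obtain n where n: "x \<in> carrier M" "kills P n x" by (auto simp: primary_def)
  from x(2) obtain s where s: "s \<in> carrier R - P" "s \<odot>\<^bsub>M\<^esub> x = \<zero>\<^bsub>M\<^esub>" by (auto simp: prime_to_def)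
  obtain u where "u \<in> carrier R" "u \<odot>\<^bsub>M\<^esub> (s \<odot>\<^bsub>M\<^esub> x) = x" using kills_unit[OF n s(1)] by auto
  then show "x = \<zero>\<^bsub>M\<^esub>" using s(2) by simp
qed

text \<open>Under the rank bound the torsion splits off from \<open>M\<close>, and the primary
  component splits off from the torsion.\<close>

lemma primary_complement:
  assumes dependent_pairs shows "\<exists>L. dsum (primary P) L (carrier M)"
proof -
  obtain F where F: "dsum (torsion_submodule R M) F (carrier M)" using torsion_summand[OF assms] by auto
  from dsum_regroup(2)[OF dsum_sym[OF F] dsum_sym[OF torsion_primary_dsum]]
  have "dsum (msum F prime_to) (primary P) (carrier M)" .
  then show ?thesis by (intro exI, rule dsum_sym)
qed

lemma primary_submodule_torsion:
  "primary_submodule R P (torsion R M) = primary P"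
  unfolding primary_submodule_def primary_def kills_def using primary_subset_torsion
  unfolding primary_def kills_def by (auto simp: torsion_submodule_def)

text \<open>\<open>Suc n\<close> is the least exponent that kills the whole component, so some
  \<open>y\<close> survives \<open>P ^ n\<close>; by \<open>kills_t\<close> already
  \<open>t ^ n\<close> does not kill it.\<close>

lemma primary_top:
  assumes False: "\<not> (\<forall>x\<in>primary P. x = \<zero>\<^bsub>M\<^esub>)"
  shows "\<exists>n y. y \<in> primary P \<and> t [^] n \<odot>\<^bsub>M\<^esub> y \<noteq> \<zero>\<^bsub>M\<^esub> \<and> (\<forall>x\<in>primary P. kills P (Suc n) x)"
proof -
  have Tc: "x \<in> carrier M" if "x \<in> primary P" for x by (rule primary_closed[OF that])
  define N where "N = (LEAST N. \<forall>x\<in>primary P. kills P N x)"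
  have N: "\<forall>x\<in>primary P. kills P N x" unfolding N_def by (rule LeastI_ex[OF primary_bounded])
  have "N \<noteq> 0"
  proof
    assume "N = 0"
    then show False using N False kills_0[OF _ Tc] by auto
  qed
  then obtain n where n: "N = Suc n" using not0_implies_Suc by auto
  have "\<not> (\<forall>x\<in>primary P. kills P n x)"
    using not_less_Least[of n "\<lambda>N. \<forall>x\<in>primary P. kills P N x"] n unfolding N_def[symmetric] by simp
  then obtain y where y: "y \<in> primary P" "\<not> kills P n y" by auto
  have kN: "kills P (Suc n) x" if "x \<in> primary P" for x using N n that by simp
  have ty: "t [^] n \<odot>\<^bsub>M\<^esub> y \<noteq> \<zero>\<^bsub>M\<^esub>" using kills_t[OF Tc[OF y(1)] kN[OF y(1)]] y(2) by auto
  show ?thesis using y(1) ty kN by (intro exI[of _ n] exI[of _ y]) simp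
qed

text \<open>The last nonzero multiple of \<open>v\<close> by a power of \<open>t\<close> is killed
  by \<open>t\<close>, hence by \<open>P\<close>; \<open>Suc m\<close> is the exact exponent of
  \<open>v\<close>.\<close>

lemma socle_exists:
  assumes v: "v \<in> primary P" "v \<noteq> \<zero>\<^bsub>M\<^esub>"
  shows "\<exists>m. t [^] (m::nat) \<odot>\<^bsub>M\<^esub> v \<noteq> \<zero>\<^bsub>M\<^esub> \<and> kills P (Suc m) v \<and> kills P 1 (t [^] m \<odot>\<^bsub>M\<^esub> v)"
proof -
  have vc: "v \<in> carrier M" by (rule primary_closed[OF v(1)])
  define N where "N = (LEAST N. kills P N v)"
  have "\<exists>N. kills P N v" using v(1) by (auto simp: primary_def)
  then have N: "kills P N v" unfolding N_def by (rule LeastI_ex)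
  have "N \<noteq> 0"
  proof
    assume "N = 0"
    then show False using kills_0[OF _ vc] N v(2) by simp
  qed
  then obtain m where m: "N = Suc m" using not0_implies_Suc by auto
  have nk: "\<not> kills P m v" using not_less_Least[of m "\<lambda>N. kills P N v"] m unfolding N_def[symmetric] by simp
  have 1: "t [^] m \<odot>\<^bsub>M\<^esub> v \<noteq> \<zero>\<^bsub>M\<^esub>" using kills_t[OF vc N, of m] nk by auto
  have "t [^] (1::nat) \<odot>\<^bsub>M\<^esub> (t [^] m \<odot>\<^bsub>M\<^esub> v) = t [^] Suc m \<odot>\<^bsub>M\<^esub> v" using t_pow_smult[OF vc, of 1 m] by simp
  also have "\<dots> = \<zero>\<^bsub>M\<^esub>" using kills_Q[OF N t_pow_in_Q[of N]] m by simp
  finally have "kills P 1 (t [^] m \<odot>\<^bsub>M\<^esub> v)"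
    by (intro kills_t[OF _ kills_smult[OF N vc]]) (simp_all add: vc)
  then show ?thesis using 1 N m by auto
qed

text \<open>Let \<open>n + 1\<close> be the exponent of the component \<open>T\<close>. A socle
  element \<open>z\<close> outside \<open>t ^ n T\<close> is \<open>t ^ k x\<close> with
  \<open>k < n\<close> maximal, and then \<open>R x\<close> is a summand isomorphic to
  \<open>R / P ^ (k + 1)\<close>. Its complement still contains some \<open>w\<close> of exponent
  \<open>n + 1\<close>. Sending \<open>x\<close> to \<open>t ^ (n - k) w\<close> is injective, and
  C4 would split off the submodule generated by a proper \<open>t\<close>-multiple of
  \<open>w\<close>.\<close>

lemma C4_imp_uniform:
  assumes C4: "C4 R M" and dp: dependent_pairs
  shows "\<exists>n. uniform_at P t n"
proof (cases "\<forall>x\<in>primary P. x = \<zero>\<^bsub>M\<^esub>")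
  case True
  have "uniform_at P t 0" unfolding uniform_at_def
  proof (intro conjI ballI impI)
    fix x assume x: "x \<in> primary P"
    then have x0: "x = \<zero>\<^bsub>M\<^esub>" using True by simp
    show "kills P (Suc 0) x" unfolding x0 by (rule kills_zero)
    show "\<exists>y\<in>primary P. x = t [^] (0::nat) \<odot>\<^bsub>M\<^esub> y" using x primary_closed[OF x] by (intro bexI[of _ x]) simp_all
  qed
  then show ?thesis by (rule exI)
next
  case False
  obtain L where L: "dsum (primary P) L (carrier M)" using primary_complement[OF dp] by auto
  note T = sm_primary
  have Tc: "x \<in> carrier M" if "x \<in> primary P" for x by (rule primary_closed[OF that])
  obtain n y where y: "y \<in> primary P" and ty: "t [^] n \<odot>\<^bsub>M\<^esub> y \<noteq> \<zero>\<^bsub>M\<^esub>"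
    and kN: "\<And>x. x \<in> primary P \<Longrightarrow> kills P (Suc n) x" using primary_top[OF False] by auto
  have "uniform_at P t n" unfolding uniform_at_def
  proof (intro conjI ballI impI)
    show "kills P (Suc n) x" if "x \<in> primary P" for x by (rule kN[OF that])
    fix z assume z: "z \<in> primary P" "kills P 1 z"
    show "\<exists>x\<in>primary P. z = t [^] n \<odot>\<^bsub>M\<^esub> x"
    proof (rule ccontr)
      assume neg: "\<not> ?thesis"
      have z0: "z \<noteq> \<zero>\<^bsub>M\<^esub>"
      proof
        assume "z = \<zero>\<^bsub>M\<^esub>"
        then have "z = t [^] n \<odot>\<^bsub>M\<^esub> \<zero>\<^bsub>M\<^esub>" by simp
        then show False using neg sm_zero[OF T] by blast
      qed
      define D where "D k \<longleftrightarrow> (\<exists>x\<in>primary P. z = t [^] k \<odot>\<^bsub>M\<^esub> x)" for k :: nat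
      have D0: "D 0" unfolding D_def using z(1) Tc[OF z(1)] by (intro bexI[of _ z]) simp_all
      have Dn: "\<not> D n" using neg unfolding D_def by simp
      have "\<exists>k<n. D k \<and> \<not> D (Suc k)"
      proof (rule ccontr)
        assume H: "\<not> (\<exists>k<n. D k \<and> \<not> D (Suc k))"
        have "k \<le> n \<Longrightarrow> D k" for k by (induction k) (use D0 H in auto)
        then show False using Dn by simp
      qed
      then obtain k where k: "k < n" "D k" "\<not> D (Suc k)" by auto
      obtain x where x: "x \<in> primary P" "z = t [^] k \<odot>\<^bsub>M\<^esub> x" using k(2) unfolding D_def by auto
      have xc: "x \<in> carrier M" by (rule Tc[OF x(1)])
      have "t [^] Suc k \<odot>\<^bsub>M\<^esub> x = t \<odot>\<^bsub>M\<^esub> z" unfolding x(2) using t_pow_smult[OF xc, of 1 k] by simp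
      also have "\<dots> = \<zero>\<^bsub>M\<^esub>" using kills_Q[of 1 z t] z(2) t_in Q_1 by simp
      finally have kx: "kills P (Suc k) x" by (rule kills_t[OF xc kN[OF x(1)]])
      define T1 where "T1 = (\<lambda>y. t [^] Suc k \<odot>\<^bsub>M\<^esub> y) ` primary P"
      have T1T: "T1 \<subseteq> primary P" unfolding T1_def by (rule image_subsetI) (rule sm_smult[OF T], simp)
      have T1: "sm T1"
      proof (rule sm_intro)
        show "T1 \<subseteq> carrier M" using T1T sm_subset[OF T] by (rule subset_trans)
        show "\<zero>\<^bsub>M\<^esub> \<in> T1" unfolding T1_def using sm_zero[OF T] by (intro image_eqI[of _ _ "\<zero>\<^bsub>M\<^esub>"]) simp_all
        fix v assume "v \<in> T1"
        then obtain v' where v: "v' \<in> primary P" "v = t [^] Suc k \<odot>\<^bsub>M\<^esub> v'" unfolding T1_def by (elim imageE)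
        have "a \<odot>\<^bsub>M\<^esub> v = t [^] Suc k \<odot>\<^bsub>M\<^esub> (a \<odot>\<^bsub>M\<^esub> v')" if "a \<in> carrier R" for a
          unfolding v(2) using that Tc[OF v(1)] by (simp add: smult_assoc1[symmetric] R.m_comm del: nat_pow_Suc)
        then show "a \<odot>\<^bsub>M\<^esub> v \<in> T1" if "a \<in> carrier R" for a
          unfolding T1_def using that sm_smult[OF T that v(1)] by (intro image_eqI) simp_all
        fix w assume "w \<in> T1"
        then obtain w' where w: "w' \<in> primary P" "w = t [^] Suc k \<odot>\<^bsub>M\<^esub> w'" unfolding T1_def by (elim imageE)
        have "v \<oplus>\<^bsub>M\<^esub> w = t [^] Suc k \<odot>\<^bsub>M\<^esub> (v' \<oplus>\<^bsub>M\<^esub> w')"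
          unfolding v(2) w(2) by (rule smult_r_distr[symmetric]) (simp_all add: Tc v(1) w(1))
        then show "v \<oplus>\<^bsub>M\<^esub> w \<in> T1" unfolding T1_def using sm_add[OF T v(1) w(1)] by (intro image_eqI) simp_all
      qed
      note sL = dsum_sm2[OF L]
      have W0: "sm (msum T1 L)" by (rule sm_msum[OF T1 sL])
      \<comment> \<open>The complement \<open>L\<close> of the component is included in the
        submodule to be avoided, so that \<open>R x\<close> becomes a summand of all of
        \<open>M\<close>. Membership of \<open>z\<close> in \<open>T1 + L\<close> would mean
        membership in \<open>T1\<close>, against the maximality of \<open>k\<close>.\<close>
      have "\<exists>W. msum T1 L \<subseteq> W \<and> dsum (cyc x) W (carrier M)"
      proof (rule cyclic_summand[OF sm_carrier xc kx W0 sm_subset[OF W0]])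
        fix a m assume a: "a \<in> Q (Suc k)" and m: "m \<in> carrier M"
        obtain p l where pl: "p \<in> primary P" "l \<in> L" "m = p \<oplus>\<^bsub>M\<^esub> l" "p \<in> carrier M" "l \<in> carrier M"
          using m by (rule dsumE[OF L])
        obtain d q where d: "d \<in> carrier R" "q \<in> Q (Suc n)" "a = t [^] Suc k \<otimes> d \<oplus> q"
          using Q_decomp[OF a, of "Suc n"] by auto
        have qc: "q \<in> carrier R" and ac: "a \<in> carrier R" by (rule Q_closed[OF d(2)], rule Q_closed[OF a])
        have "a \<odot>\<^bsub>M\<^esub> p = t [^] Suc k \<odot>\<^bsub>M\<^esub> (d \<odot>\<^bsub>M\<^esub> p)"
          unfolding d(3) using d(1) qc pl(4) kills_Q[OF kN[OF pl(1)] d(2)]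
          by (simp add: smult_l_distr smult_assoc1 del: nat_pow_Suc)
        then have "a \<odot>\<^bsub>M\<^esub> p \<in> T1" unfolding T1_def using sm_smult[OF T d(1) pl(1)] by (intro image_eqI) simp_all
        then show "a \<odot>\<^bsub>M\<^esub> m \<in> msum T1 L"
          unfolding pl(3) smult_r_distr[OF ac pl(4,5)] by (rule msumI) (rule sm_smult[OF sL ac pl(2)])
      next
        show "t [^] k \<odot>\<^bsub>M\<^esub> x \<notin> msum T1 L"
        proof
          assume "t [^] k \<odot>\<^bsub>M\<^esub> x \<in> msum T1 L"
          then obtain v l where vl: "v \<in> T1" "l \<in> L" "t [^] k \<odot>\<^bsub>M\<^esub> x = v \<oplus>\<^bsub>M\<^esub> l" by (rule msumE)
          have vT: "v \<in> primary P" using T1T vl(1) by auto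
          have "z \<oplus>\<^bsub>M\<^esub> \<zero>\<^bsub>M\<^esub> = v \<oplus>\<^bsub>M\<^esub> l" using vl(3) x(2) Tc[OF z(1)] by simp
          then have "z = v" by (rule dsum_unique(1)[OF L z(1) sm_zero[OF sL] vT vl(2)])
          then have "z \<in> T1" using vl(1) by simp
          then show False using k(3) unfolding D_def T1_def by auto
        qed
      qed
      then obtain W where W: "dsum (cyc x) W (carrier M)" by auto
      note sW = dsum_sm2[OF W]
      obtain v w where vw: "v \<in> cyc x" "w \<in> W" "y = v \<oplus>\<^bsub>M\<^esub> w" "v \<in> carrier M" "w \<in> carrier M"
        using Tc[OF y] by (rule dsumE[OF W])
      have vT: "v \<in> primary P" using cyc_least[OF T x(1)] vw(1) by auto
      have "w = y \<ominus>\<^bsub>M\<^esub> v" unfolding vw(3) using add_minus_cancel(2)[OF vw(4,5)] by simp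
      then have wT: "w \<in> primary P" using sm_minus[OF T y vT] by simp
      \<comment> \<open>The component of \<open>y\<close> in \<open>R x\<close> has exponent at most
        \<open>k + 1\<close>, hence at most \<open>n\<close>; so \<open>t ^ n y\<close> comes
        entirely from \<open>w\<close>.\<close>
      have "kills P n v"
      proof -
        obtain d where "d \<in> carrier R" "v = d \<odot>\<^bsub>M\<^esub> x" using vw(1) by (rule cycE)
        then have "kills P (Suc k) v" using kills_smult[OF kx xc] by simp
        then show ?thesis by (rule kills_mono) (use k(1) in simp)
      qed
      then have "t [^] n \<odot>\<^bsub>M\<^esub> v = \<zero>\<^bsub>M\<^esub>" by (rule kills_Q[OF _ t_pow_in_Q])
      then have tw: "t [^] n \<odot>\<^bsub>M\<^esub> w \<noteq> \<zero>\<^bsub>M\<^esub>" using ty vw(4,5) unfolding vw(3) by (simp add: smult_r_distr)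
      \<comment> \<open>The factor \<open>t ^ (n - k)\<close> lowers the exponent
        \<open>n + 1\<close> of \<open>w\<close> to \<open>k + 1\<close>, the exponent of
        \<open>x\<close>.\<close>
      define w1 where "w1 = t [^] (n - k) \<odot>\<^bsub>M\<^esub> w"
      have w1: "w1 \<in> W" unfolding w1_def by (rule sm_smult[OF sW _ vw(2)]) simp
      have w1c: "w1 \<in> carrier M" by (rule sm_closed[OF sW w1])
      have tw1: "t [^] k \<odot>\<^bsub>M\<^esub> w1 \<noteq> \<zero>\<^bsub>M\<^esub>"
        unfolding w1_def using t_pow_smult[OF vw(5), of k "n - k"] k(1) tw by simp
      have kw1: "kills P (Suc k) w1" unfolding kills_iff
      proof
        fix a assume a: "a \<in> Q (Suc k)"
        have ac: "a \<in> carrier R" by (rule Q_closed[OF a])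
        have "t [^] (n - k) \<otimes> a \<in> Q (Suc n)" using Q_mult_t[OF a, of "n - k"] k(1) by simp
        then have "(t [^] (n - k) \<otimes> a) \<odot>\<^bsub>M\<^esub> w = \<zero>\<^bsub>M\<^esub>" by (rule kills_Q[OF kN[OF wT]])
        then show "a \<odot>\<^bsub>M\<^esub> w1 = \<zero>\<^bsub>M\<^esub>"
          unfolding w1_def using ac vw(5) by (simp add: smult_assoc1[symmetric] R.m_comm)
      qed
      \<comment> \<open>An element killed by \<open>P ^ (k + 1)\<close> but not by
        \<open>t ^ k\<close> has annihilator exactly \<open>P ^ (k + 1)\<close>. From
        \<open>x\<close> to \<open>w1\<close> this gives well-definedness of \<open>f\<close>, from
        \<open>w1\<close> to \<open>x\<close> its injectivity.\<close>
      have cmp: "d \<odot>\<^bsub>M\<^esub> m2 = \<zero>\<^bsub>M\<^esub>" if d: "d \<in> carrier R" "d \<odot>\<^bsub>M\<^esub> m1 = \<zero>\<^bsub>M\<^esub>"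
        and m1: "m1 \<in> carrier M" "kills P (Suc k) m1" "t [^] k \<odot>\<^bsub>M\<^esub> m1 \<noteq> \<zero>\<^bsub>M\<^esub>"
        and m2: "m2 \<in> carrier M" "kills P (Suc k) m2" for d m1 m2
      proof -
        have "d \<in> Q (Suc k)"
        proof (rule ccontr)
          assume "d \<notin> Q (Suc k)"
          then obtain j e q where j: "j < Suc k" "e \<in> carrier R" "q \<in> Q (Suc k)" "e \<otimes> d = t [^] j \<oplus> q"
            using Q_unform[OF d(1), of "Suc k"] by auto
          have "(t [^] j \<oplus> q) \<odot>\<^bsub>M\<^esub> m1 = \<zero>\<^bsub>M\<^esub>" using smult_assoc1[OF j(2) d(1) m1(1)] j(4) d(2) j(2) by simp
          then have "t [^] j \<odot>\<^bsub>M\<^esub> m1 = \<zero>\<^bsub>M\<^esub>"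
            using kills_Q[OF m1(2) j(3)] Q_closed[OF j(3)] m1(1) by (simp add: smult_l_distr)
          then have "t [^] (k - j) \<odot>\<^bsub>M\<^esub> (t [^] j \<odot>\<^bsub>M\<^esub> m1) = \<zero>\<^bsub>M\<^esub>" by simp
          then show False using t_pow_smult[OF m1(1), of "k - j" j] j(1) m1(3) by simp
        qed
        then show ?thesis by (rule kills_Q[OF m2(2)])
      qed
      define f where "f m = (SOME d. d \<in> carrier R \<and> m = d \<odot>\<^bsub>M\<^esub> x) \<odot>\<^bsub>M\<^esub> w1" for m
      have fd: "f (d \<odot>\<^bsub>M\<^esub> x) = d \<odot>\<^bsub>M\<^esub> w1" if d: "d \<in> carrier R" for d
      proof -
        define e where "e = (SOME e. e \<in> carrier R \<and> d \<odot>\<^bsub>M\<^esub> x = e \<odot>\<^bsub>M\<^esub> x)"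
        have e: "e \<in> carrier R \<and> d \<odot>\<^bsub>M\<^esub> x = e \<odot>\<^bsub>M\<^esub> x" unfolding e_def by (rule someI[of _ d]) (use d in simp)
        have ec: "e \<in> carrier R" using e by simp
        have dec: "d \<ominus> e \<in> carrier R" using d ec by simp
        have "(d \<ominus> e) \<odot>\<^bsub>M\<^esub> x = \<zero>\<^bsub>M\<^esub>"
          unfolding smult_minus_distr(1)[OF d ec xc xc] using e minus_eq_zero_iff[of "d \<odot>\<^bsub>M\<^esub> x" "e \<odot>\<^bsub>M\<^esub> x"] d xc by simp
        moreover have "t [^] k \<odot>\<^bsub>M\<^esub> x \<noteq> \<zero>\<^bsub>M\<^esub>" using z0 x(2) by simp
        ultimately have "(d \<ominus> e) \<odot>\<^bsub>M\<^esub> w1 = \<zero>\<^bsub>M\<^esub>" using cmp[OF dec _ xc kx _ w1c kw1] by simp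
        then have "d \<odot>\<^bsub>M\<^esub> w1 = e \<odot>\<^bsub>M\<^esub> w1"
          unfolding smult_minus_distr(1)[OF d ec w1c w1c] using minus_eq_zero_iff[of "d \<odot>\<^bsub>M\<^esub> w1" "e \<odot>\<^bsub>M\<^esub> w1"] d ec w1c by simp
        then show ?thesis unfolding f_def e_def[symmetric] by simp
      qed
      have Cx: "sm (cyc x)" by (rule sm_cyc[OF xc])
      have flin: "linear_on (cyc x) f" unfolding linear_on_def
      proof (intro conjI ballI)
        fix m assume "m \<in> cyc x"
        then obtain d where d: "d \<in> carrier R" "m = d \<odot>\<^bsub>M\<^esub> x" by (rule cycE)
        show "f m \<in> carrier M" unfolding d(2) fd[OF d(1)] using d(1) w1c by simp
        show "f (a \<odot>\<^bsub>M\<^esub> m) = a \<odot>\<^bsub>M\<^esub> f m" if a: "a \<in> carrier R" for a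
          unfolding d(2) fd[OF d(1)] using fd[of "a \<otimes> d"] a d(1) xc w1c by (simp add: smult_assoc1)
        fix m' assume "m' \<in> cyc x"
        then obtain d' where d': "d' \<in> carrier R" "m' = d' \<odot>\<^bsub>M\<^esub> x" by (rule cycE)
        show "f (m \<oplus>\<^bsub>M\<^esub> m') = f m \<oplus>\<^bsub>M\<^esub> f m'"
          unfolding d(2) d'(2) fd[OF d(1)] fd[OF d'(1)] using fd[of "d \<oplus> d'"] d(1) d'(1) xc w1c
          by (simp add: smult_l_distr)
      qed
      have fim: "f ` cyc x = cyc w1"
      proof (intro subset_antisym subsetI)
        fix m assume "m \<in> f ` cyc x"
        then obtain m' where m': "m' \<in> cyc x" "m = f m'" by auto
        obtain d where d: "d \<in> carrier R" "m' = d \<odot>\<^bsub>M\<^esub> x" using m'(1) by (rule cycE)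
        show "m \<in> cyc w1" unfolding m'(2) d(2) fd[OF d(1)] by (rule cycI[OF d(1)])
      next
        fix m assume "m \<in> cyc w1"
        then obtain d where d: "d \<in> carrier R" "m = d \<odot>\<^bsub>M\<^esub> w1" by (rule cycE)
        show "m \<in> f ` cyc x" unfolding d(2) fd[OF d(1), symmetric] by (rule imageI[OF cycI[OF d(1)]])
      qed
      have ker: "{m \<in> cyc x. f m = \<zero>\<^bsub>M\<^esub>} = {\<zero>\<^bsub>M\<^esub>}"
      proof (intro subset_antisym subsetI)
        fix m assume "m \<in> {m \<in> cyc x. f m = \<zero>\<^bsub>M\<^esub>}"
        then have m: "m \<in> cyc x" "f m = \<zero>\<^bsub>M\<^esub>" by simp_all
        obtain d where d: "d \<in> carrier R" "m = d \<odot>\<^bsub>M\<^esub> x" using m(1) by (rule cycE)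
        have "d \<odot>\<^bsub>M\<^esub> w1 = \<zero>\<^bsub>M\<^esub>" using m(2) unfolding d(2) fd[OF d(1)] .
        then show "m \<in> {\<zero>\<^bsub>M\<^esub>}" unfolding d(2) using cmp[OF d(1) _ w1c kw1 tw1 xc kx] by simp
      next
        fix m assume "m \<in> {\<zero>\<^bsub>M\<^esub>}"
        then show "m \<in> {m \<in> cyc x. f m = \<zero>\<^bsub>M\<^esub>}" using sm_zero[OF Cx] linear_zero[OF flin Cx] by simp
      qed
      have fW: "f ` cyc x \<subseteq> W" unfolding fim by (rule cyc_least[OF sW w1])
      have kd: "dsum {m \<in> cyc x. f m = \<zero>\<^bsub>M\<^esub>} (cyc x) (cyc x)"
        unfolding ker by (rule dsum_sym[OF dsum_zero_right[OF Cx]])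
      obtain C where C: "dsum (cyc w1) C W" using C4D[OF C4 W flin fW kd] unfolding fim by auto
      obtain c0 c' where c: "c0 \<in> cyc w1" "c' \<in> C" "w = c0 \<oplus>\<^bsub>M\<^esub> c'" "c0 \<in> carrier M" "c' \<in> carrier M"
        using vw(2) by (rule dsumE[OF C])
      obtain e where e: "e \<in> carrier R" "c0 = e \<odot>\<^bsub>M\<^esub> w1" using c(1) by (rule cycE)
      \<comment> \<open>If \<open>w = e w1 + c'\<close> along \<open>R w1\<close> and
        \<open>C\<close>, then \<open>s w = c'\<close>. As \<open>k < n\<close>, the term
        \<open>e t ^ (n - k)\<close> is in \<open>P\<close>, so \<open>s\<close> is invertible on
        \<open>w\<close>; hence \<open>w\<close> and \<open>w1\<close> lie in \<open>C\<close>,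
        which meets \<open>R w1\<close> only in zero.\<close>
      define s where "s = \<one> \<ominus> e \<otimes> t [^] (n - k)"
      have etP: "e \<otimes> t [^] (n - k) \<in> P"
      proof -
        have "t [^] (n - k) \<in> Q (Suc 0)" using subsetD[OF Q_antimono[of "Suc 0" "n - k"] t_pow_in_Q] k(1) by simp
        then show ?thesis unfolding Q_1 by (rule ideal.I_l_closed[OF P_ideal _ e(1)])
      qed
      have etc: "e \<otimes> t [^] (n - k) \<in> carrier R" using e(1) by simp
      have s: "s \<in> carrier R - P"
      proof
        show "s \<in> carrier R" unfolding s_def using etc by simp
        show "s \<notin> P"
        proof
          assume "s \<in> P"
          then have "s \<oplus> e \<otimes> t [^] (n - k) \<in> P"
            by (rule additive_subgroup.a_closed[OF ideal.axioms(1)[OF P_ideal] _ etP])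
          moreover have "s \<oplus> e \<otimes> t [^] (n - k) = \<one>"
            unfolding s_def a_minus_def using etc by (simp add: R.a_assoc R.l_neg)
          ultimately show False using one_notin by simp
        qed
      qed
      have "s \<odot>\<^bsub>M\<^esub> w = \<one> \<odot>\<^bsub>M\<^esub> w \<ominus>\<^bsub>M\<^esub> (e \<otimes> t [^] (n - k)) \<odot>\<^bsub>M\<^esub> w"
        unfolding s_def by (rule smult_minus_distr(1)[OF R.one_closed etc vw(5) vw(5)])
      also have "\<dots> = w \<ominus>\<^bsub>M\<^esub> c0" unfolding e(2) w1_def using e(1) vw(5) by (simp add: smult_assoc1)
      also have "\<dots> = c'" unfolding c(3) by (rule add_minus_cancel(2)[OF c(4,5)])
      finally have sw: "s \<odot>\<^bsub>M\<^esub> w = c'" .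
      obtain r where r: "r \<in> carrier R" "r \<odot>\<^bsub>M\<^esub> (s \<odot>\<^bsub>M\<^esub> w) = w" using kills_unit[OF vw(5) kN[OF wT] s] by auto
      have "w \<in> C" using sm_smult[OF dsum_sm2[OF C] r(1) c(2)] r(2) sw by simp
      then have "w1 \<in> C" unfolding w1_def by (rule sm_smult[OF dsum_sm2[OF C], rotated]) simp
      then have "w1 = \<zero>\<^bsub>M\<^esub>" by (rule dsum_disjoint[OF C cyc_self[OF w1c]])
      then show False using tw1 by simp
    qed
  qed
  then show ?thesis by (rule exI)
qed

end

subsection \<open>Criteria in terms of socles\<close>

context dedekind_module
begin

lemma prime_moduleI: "uniformized_prime R P t s0 \<Longrightarrow> dedekind_prime_module R M P t s0"
  by (rule dedekind_prime_module.intro[OF dedekind_module_axioms])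

lemma dedekind_restrict: "sm N \<Longrightarrow> dedekind_module R (M\<lparr>carrier := N\<rparr>)"
  by (rule dedekind_module.intro[OF R.dedekind_axioms noetherian_restrict])

text \<open>
  A maximal summand of \<open>B\<close> inside \<open>f A\<close> is all of \<open>f A\<close>: otherwise a socle element of the remainder
  is divisible by the full power of \<open>t\<close>, and \<open>cyclic_summand\<close> splits off a larger summand.
\<close>

lemma uniform_imp_C4:
  assumes dp: dependent_pairs
    and H: "\<And>P t s0. uniformized_prime R P t s0 \<Longrightarrow> \<exists>n. uniform_at P t n"
  shows "C4 R M"
proof (rule C4I)
  fix A B f A'
  assume AB: "dsum A B (carrier M)" and f: "linear_on A f" and fB: "f ` A \<subseteq> B"
    and k: "dsum {x \<in> A. f x = \<zero>\<^bsub>M\<^esub>} A' A"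
  define K where "K = {x \<in> A. f x = \<zero>\<^bsub>M\<^esub>}"
  define E where "E = f ` A"
  have K: "dsum K A' A" using k unfolding K_def .
  note sA = dsum_sm1[OF AB] and sB = dsum_sm2[OF AB] and sA' = dsum_sm2[OF K]
  have Ac: "a \<in> carrier M" if "a \<in> A" for a by (rule sm_closed[OF sA that])
  have Bc: "b \<in> carrier M" if "b \<in> B" for b by (rule sm_closed[OF sB that])
  have A'A: "a \<in> A" if "a \<in> A'" for a using dsum_subset2[OF K] that by auto
  have E: "sm E" unfolding E_def
  proof (rule sm_intro)
    show "f ` A \<subseteq> carrier M" using fB sm_subset[OF sB] by (rule subset_trans)
    show "\<zero>\<^bsub>M\<^esub> \<in> f ` A" using linear_zero[OF f sA] imageI[OF sm_zero[OF sA], of f] by simp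
    fix u assume "u \<in> f ` A"
    then obtain a where a: "a \<in> A" "u = f a" by auto
    show "r \<odot>\<^bsub>M\<^esub> u \<in> f ` A" if r: "r \<in> carrier R" for r
      unfolding a(2) linear_smult[OF f r a(1), symmetric] by (rule imageI[OF sm_smult[OF sA r a(1)]])
    fix v assume "v \<in> f ` A"
    then obtain b where b: "b \<in> A" "v = f b" by auto
    show "u \<oplus>\<^bsub>M\<^esub> v \<in> f ` A"
      unfolding a(2) b(2) linear_add[OF f a(1) b(1), symmetric] by (rule imageI[OF sm_add[OF sA a(1) b(1)]])
  qed
  have EB: "E \<subseteq> B" unfolding E_def by (rule fB)
  \<comment> \<open>This is where the rank bound enters: a relation \<open>b a = c v\<close> takes
    place in both \<open>A\<close> and \<open>B\<close>, so both sides vanish, and \<open>b\<close>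
    also kills \<open>v = f a\<close>.\<close>
  have tors: "torsion_elt v" if vE: "v \<in> E" for v
  proof -
    obtain a where a: "a \<in> A" "v = f a" using vE unfolding E_def by auto
    have vB: "v \<in> B" using EB vE by auto
    obtain b c where bc: "b \<in> carrier R" "c \<in> carrier R" "b \<noteq> \<zero> \<or> c \<noteq> \<zero>" "b \<odot>\<^bsub>M\<^esub> a = c \<odot>\<^bsub>M\<^esub> v"
      using dp[unfolded dependent_pairs_def] Ac[OF a(1)] Bc[OF vB] by metis
    have "b \<odot>\<^bsub>M\<^esub> a \<in> A" by (rule sm_smult[OF sA bc(1) a(1)])
    moreover have "b \<odot>\<^bsub>M\<^esub> a \<in> B" unfolding bc(4) by (rule sm_smult[OF sB bc(2) vB])
    ultimately have z: "b \<odot>\<^bsub>M\<^esub> a = \<zero>\<^bsub>M\<^esub>" by (rule dsum_disjoint[OF AB])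
    have "b \<odot>\<^bsub>M\<^esub> v = \<zero>\<^bsub>M\<^esub>"
      unfolding a(2) linear_smult[OF f bc(1) a(1), symmetric] z by (rule linear_zero[OF f sA])
    moreover have "c \<odot>\<^bsub>M\<^esub> v = \<zero>\<^bsub>M\<^esub>" using z bc(4) by simp
    ultimately show ?thesis unfolding torsion_elt_def using bc(1-3) by auto
  qed
  let ?S = "{U. sm U \<and> U \<subseteq> E \<and> (\<exists>Y. dsum U Y B)}"
  have "\<exists>U\<in>?S. \<forall>U'\<in>?S. U \<subseteq> U' \<longrightarrow> U' = U"
  proof (rule maximal_submodule_in_family)
    show "sm N" if "N \<in> ?S" for N using that by simp
    have "dsum {\<zero>\<^bsub>M\<^esub>} B B" by (rule dsum_sym[OF dsum_zero_right[OF sB]])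
    then have "{\<zero>\<^bsub>M\<^esub>} \<in> ?S" using sm_singleton_zero sm_zero[OF E] by auto
    then show "?S \<noteq> {}" by (rule ex_in_conv[THEN iffD1, OF exI])
  qed
  then obtain U where US: "U \<in> ?S" and max: "\<forall>U'\<in>?S. U \<subseteq> U' \<longrightarrow> U' = U" by (elim bexE) (rule that)
  obtain Y where U: "sm U" "U \<subseteq> E" and Y: "dsum U Y B" using US by auto
  note sY = dsum_sm2[OF Y]
  have YE: "dsum U (Y \<inter> E) E" by (rule dsum_modular[OF Y E U(2) EB])
  note sYE = dsum_sm2[OF YE]
  have "v = \<zero>\<^bsub>M\<^esub>" if v: "v \<in> Y \<inter> E" for v
  proof (rule ccontr)
    assume v0: "v \<noteq> \<zero>\<^bsub>M\<^esub>"
    have vc: "v \<in> carrier M" by (rule sm_closed[OF sYE v])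
    obtain d where d: "d \<in> carrier R" "d \<noteq> \<zero>" "d \<odot>\<^bsub>M\<^esub> v = \<zero>\<^bsub>M\<^esub>"
      using tors[of v] v unfolding torsion_elt_def by auto
    \<comment> \<open>A maximal ideal above the annihilator of \<open>v\<close> is a prime at which
      \<open>v\<close> does not vanish locally.\<close>
    define An where "An = {a \<in> carrier R. a \<odot>\<^bsub>M\<^esub> v = \<zero>\<^bsub>M\<^esub>}"
    have An: "ideal An R"
    proof (rule idealI)
      show "ring R" by (rule R.ring_axioms)
      show mul: "a \<otimes> u \<in> An" if "u \<in> An" "a \<in> carrier R" for a u
        using that vc unfolding An_def by (simp add: smult_assoc1)
      show "u \<otimes> a \<in> An" if u: "u \<in> An" and a: "a \<in> carrier R" for a u
      proof -
        have "u \<in> carrier R" using u unfolding An_def by simp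
        then have e: "u \<otimes> a = a \<otimes> u" using a by (rule R.m_comm)
        show ?thesis unfolding e by (rule mul[OF u a])
      qed
      show "subgroup An (add_monoid R)"
      proof (rule R.add.subgroupI)
        show "An \<subseteq> carrier R" unfolding An_def by auto
        have "\<zero> \<in> An" unfolding An_def using vc by simp
        then show "An \<noteq> {}" by auto
        show "\<ominus> u \<in> An" if "u \<in> An" for u
          using that vc unfolding An_def by (simp add: smult_l_minus)
        show "u \<oplus> w \<in> An" if "u \<in> An" "w \<in> An" for u w
          using that vc unfolding An_def by (simp add: smult_l_distr)
      qed
    qed
    have "An \<noteq> carrier R"
    proof
      assume "An = carrier R"
      then have "\<one> \<in> An" by simp
      then show False unfolding An_def using vc v0 by simp
    qed
    then obtain P where P: "maximalideal P R" "An \<subseteq> P" using R.maximal_ideal_above[OF An] by auto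
    have "d \<in> P" using P(2) d unfolding An_def by auto
    then have "P \<noteq> {\<zero>}" using d(2) by auto
    then obtain t s0 where up: "uniformized_prime R P t s0"
      using R.uniformized_prime_exists[OF R.maximalideal_prime[OF P(1)]] by auto
    interpret p: dedekind_prime_module R M P t s0 by (rule prime_moduleI[OF up])
    obtain n where n: "uniform_at P t n" using H[OF up] by auto
    have kn: "kills P (Suc n) x" if "x \<in> primary P" for x using n that unfolding uniform_at_def by simp
    have "v \<in> torsion_submodule R M" unfolding torsion_submodule_def using vc d by auto
    then obtain v1 v2 where v12: "v1 \<in> primary P" "v2 \<in> p.prime_to" "v = v1 \<oplus>\<^bsub>M\<^esub> v2"
      "v1 \<in> carrier M" "v2 \<in> carrier M" by (rule dsumE[OF p.torsion_primary_dsum])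
    obtain s where s: "s \<in> carrier R - P" "s \<odot>\<^bsub>M\<^esub> v2 = \<zero>\<^bsub>M\<^esub>" using v12(2) unfolding p.prime_to_def by auto
    have sc: "s \<in> carrier R" using s(1) by simp
    \<comment> \<open>Multiplication by \<open>s\<close> removes the part of \<open>v\<close> prime
      to \<open>P\<close>; the result is nonzero because \<open>s\<close>, being outside
      \<open>P\<close>, does not annihilate \<open>v\<close>.\<close>
    define v' where "v' = s \<odot>\<^bsub>M\<^esub> v"
    have "v' = s \<odot>\<^bsub>M\<^esub> v1" unfolding v'_def v12(3) using s(2) sc v12(4,5) by (simp add: smult_r_distr)
    then have v'T: "v' \<in> primary P" using sm_smult[OF p.sm_primary sc v12(1)] by simp
    have v'0: "v' \<noteq> \<zero>\<^bsub>M\<^esub>"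
    proof
      assume "v' = \<zero>\<^bsub>M\<^esub>"
      then have "s \<in> An" unfolding An_def v'_def using sc by simp
      then show False using P(2) s(1) by auto
    qed
    obtain m where m: "t [^] (m::nat) \<odot>\<^bsub>M\<^esub> v' \<noteq> \<zero>\<^bsub>M\<^esub>" "kills P 1 (t [^] m \<odot>\<^bsub>M\<^esub> v')"
      using p.socle_exists[OF v'T v'0] by auto
    define z where "z = t [^] m \<odot>\<^bsub>M\<^esub> v'"
    have z0: "z \<noteq> \<zero>\<^bsub>M\<^esub>" and kz: "kills P 1 z" unfolding z_def by (rule m)+
    have v'YE: "v' \<in> Y \<inter> E" unfolding v'_def by (rule sm_smult[OF sYE sc v])
    have zYE: "z \<in> Y \<inter> E" unfolding z_def by (rule sm_smult[OF sYE _ v'YE]) simp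
    have zT: "z \<in> primary P" unfolding z_def by (rule sm_smult[OF p.sm_primary _ v'T]) simp
    have tc: "t [^] n \<in> carrier R" by simp
    obtain a0 where a0: "a0 \<in> A" "z = f a0" using zYE unfolding E_def by auto
    obtain k0 a where ka: "k0 \<in> K" "a \<in> A'" "a0 = k0 \<oplus>\<^bsub>M\<^esub> a" "k0 \<in> carrier M" "a \<in> carrier M"
      using a0(1) by (rule dsumE[OF K])
    have ac: "a \<in> A" by (rule A'A[OF ka(2)])
    have k0: "k0 \<in> A" "f k0 = \<zero>\<^bsub>M\<^esub>" using ka(1) unfolding K_def by simp_all
    have fa: "f a = z" unfolding a0(2) ka(3) linear_add[OF f k0(1) ac] k0(2)
      using linear_closed[OF f ac] by simp
    \<comment> \<open>\<open>f\<close> is injective on the complement \<open>A'\<close> of its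
      kernel, so the preimage \<open>a\<close> of the socle element \<open>z\<close> is again in the
      socle and can be divided by \<open>t ^ n\<close>.\<close>
    have "kills P 1 a" unfolding p.kills_iff
    proof
      fix q assume q: "q \<in> p.Q 1"
      have qc: "q \<in> carrier R" by (rule p.Q_closed[OF q])
      have qa: "q \<odot>\<^bsub>M\<^esub> a \<in> A'" by (rule sm_smult[OF sA' qc ka(2)])
      have "f (q \<odot>\<^bsub>M\<^esub> a) = \<zero>\<^bsub>M\<^esub>" unfolding linear_smult[OF f qc ac] fa by (rule p.kills_Q[OF kz q])
      then have "q \<odot>\<^bsub>M\<^esub> a \<in> K" unfolding K_def using A'A[OF qa] by simp
      then show "q \<odot>\<^bsub>M\<^esub> a = \<zero>\<^bsub>M\<^esub>" using dsum_disjoint[OF K _ qa] by simp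
    qed
    moreover then have "a \<in> primary P" unfolding primary_def using ka(5) by auto
    ultimately obtain x where x: "x \<in> primary P" "a = t [^] n \<odot>\<^bsub>M\<^esub> x"
      using n unfolding uniform_at_def by auto
    \<comment> \<open>The divisor \<open>x\<close> need not lie in \<open>A'\<close>. Projecting to
      \<open>A\<close> and then to \<open>A'\<close> preserves both \<open>t ^ n x = a\<close> and
      annihilation by \<open>P ^ (n + 1)\<close>.\<close>
    obtain x1 b where xb: "x1 \<in> A" "b \<in> B" "x = x1 \<oplus>\<^bsub>M\<^esub> b" using primary_closed[OF x(1)] by (rule dsumE[OF AB])
    obtain k1 x' where kx: "k1 \<in> K" "x' \<in> A'" "x1 = k1 \<oplus>\<^bsub>M\<^esub> x'" "k1 \<in> carrier M" "x' \<in> carrier M"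
      using xb(1) by (rule dsumE[OF K])
    have k1x': "x1 = x' \<oplus>\<^bsub>M\<^esub> k1" unfolding kx(3) by (rule M.a_comm[OF kx(4,5)])
    have "t [^] n \<odot>\<^bsub>M\<^esub> x1 = a"
      by (rule dsum_smult_eq(1)[OF AB xb(1,2) tc ac]) (simp only: xb(3)[symmetric] x(2))
    then have tx': "t [^] n \<odot>\<^bsub>M\<^esub> x' = a"
      by (intro dsum_smult_eq(1)[OF dsum_sym[OF K] kx(2,1) tc ka(2)]) (simp only: k1x'[symmetric])
    have kx': "q \<odot>\<^bsub>M\<^esub> x' = \<zero>\<^bsub>M\<^esub>" if q: "q \<in> p.Q (Suc n)" for q
    proof -
      have qc: "q \<in> carrier R" by (rule p.Q_closed[OF q])
      have "q \<odot>\<^bsub>M\<^esub> x = \<zero>\<^bsub>M\<^esub>" by (rule p.kills_Q[OF kn[OF x(1)] q])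
      then have "q \<odot>\<^bsub>M\<^esub> x1 = \<zero>\<^bsub>M\<^esub>"
        by (intro dsum_smult_eq(1)[OF AB xb(1,2) qc sm_zero[OF sA]]) (simp only: xb(3)[symmetric])
      then show ?thesis
        by (intro dsum_smult_eq(1)[OF dsum_sym[OF K] kx(2,1) qc sm_zero[OF sA']]) (simp only: k1x'[symmetric])
    qed
    have x'A: "x' \<in> A" by (rule A'A[OF kx(2)])
    have "f x' \<in> E" unfolding E_def by (rule imageI[OF x'A])
    \<comment> \<open>The component of \<open>f x'\<close> in \<open>Y\<close> divides
      \<open>z\<close> by \<open>t ^ n\<close> inside \<open>Y\<close>, since \<open>z\<close>
      itself lies in \<open>Y\<close>.\<close>
    then obtain x2 y1 where xy: "x2 \<in> U" "y1 \<in> Y \<inter> E" "f x' = x2 \<oplus>\<^bsub>M\<^esub> y1" "x2 \<in> carrier M" "y1 \<in> carrier M"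
      by (rule dsumE[OF YE])
    have xy': "f x' = y1 \<oplus>\<^bsub>M\<^esub> x2" unfolding xy(3) by (rule M.a_comm[OF xy(4,5)])
    have "t [^] n \<odot>\<^bsub>M\<^esub> f x' = z" unfolding linear_smult[OF f tc x'A, symmetric] tx' by (rule fa)
    then have ty1: "t [^] n \<odot>\<^bsub>M\<^esub> y1 = z"
      by (intro dsum_smult_eq(1)[OF dsum_sym[OF YE] xy(2,1) tc zYE]) (simp only: xy'[symmetric])
    have ky1: "kills P (Suc n) y1" unfolding p.kills_iff
    proof
      fix q assume q: "q \<in> p.Q (Suc n)"
      have qc: "q \<in> carrier R" by (rule p.Q_closed[OF q])
      have "q \<odot>\<^bsub>M\<^esub> f x' = \<zero>\<^bsub>M\<^esub>"
        unfolding linear_smult[OF f qc x'A, symmetric] kx'[OF q] by (rule linear_zero[OF f sA])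
      then show "q \<odot>\<^bsub>M\<^esub> y1 = \<zero>\<^bsub>M\<^esub>"
        by (intro dsum_smult_eq(1)[OF dsum_sym[OF YE] xy(2,1) qc sm_zero[OF sYE]]) (simp only: xy'[symmetric])
    qed
    have y1Y: "y1 \<in> Y" and y1E: "y1 \<in> E" using xy(2) by simp_all
    obtain L where L: "dsum (primary P) L (carrier M)" using p.primary_complement[OF dp] by auto
    note sL = dsum_sm2[OF L]
    \<comment> \<open>Only the part along \<open>L\<close> survives multiplication by
      \<open>P ^ (n + 1)\<close>, whereas the socle element \<open>z\<close> of the component is not
      in \<open>L\<close>. So \<open>R y1\<close> splits off from \<open>Y\<close> and enlarges
      \<open>U\<close>.\<close>
    have "\<exists>W. L \<inter> Y \<subseteq> W \<and> dsum (cyc y1) W Y"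
    proof (rule p.cyclic_summand[OF sY y1Y ky1 sm_Int[OF sL sY]])
      show "L \<inter> Y \<subseteq> Y" by simp
      fix q y assume q: "q \<in> p.Q (Suc n)" and y: "y \<in> Y"
      have qc: "q \<in> carrier R" by (rule p.Q_closed[OF q])
      obtain p' l where pl: "p' \<in> primary P" "l \<in> L" "y = p' \<oplus>\<^bsub>M\<^esub> l" "p' \<in> carrier M" "l \<in> carrier M"
        using sm_closed[OF sY y] by (rule dsumE[OF L])
      have "q \<odot>\<^bsub>M\<^esub> y = q \<odot>\<^bsub>M\<^esub> l"
        unfolding pl(3) smult_r_distr[OF qc pl(4,5)] p.kills_Q[OF kn[OF pl(1)] q] using qc pl(5) by simp
      then have "q \<odot>\<^bsub>M\<^esub> y \<in> L" using sm_smult[OF sL qc pl(2)] by simp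
      then show "q \<odot>\<^bsub>M\<^esub> y \<in> L \<inter> Y" using sm_smult[OF sY qc y] by simp
    next
      show "t [^] n \<odot>\<^bsub>M\<^esub> y1 \<notin> L \<inter> Y" unfolding ty1 using dsum_disjoint[OF L zT] z0 by auto
    qed
    then obtain W where W: "dsum (cyc y1) W Y" by auto
    from dsum_regroup[OF Y W]
    have r1: "dsum U (cyc y1) (msum U (cyc y1))" and r2: "dsum (msum U (cyc y1)) W B" .
    have "msum U (cyc y1) \<in> ?S"
      using dsum_sm[OF r1] msum_least[OF E U(2) cyc_least[OF E y1E]] r2 by auto
    then have "msum U (cyc y1) = U" using max dsum_subset1[OF r1] by simp
    then have "y1 \<in> U" using dsum_subset2[OF r1] cyc_self[OF xy(5)] by auto
    then have "y1 = \<zero>\<^bsub>M\<^esub>" by (rule dsum_disjoint[OF Y _ y1Y])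
    then show False using ty1 z0 by simp
  qed
  then have YE0: "Y \<inter> E = {\<zero>\<^bsub>M\<^esub>}" using sm_zero[OF sYE] by blast
  have "E = U" using dsum_eq[OF YE] dsum_eq[OF dsum_zero_right[OF U(1)]] unfolding YE0 by simp
  then show "\<exists>C. dsum (f ` A) C B" using Y unfolding E_def by auto
qed

lemma nonunit_exists:
  assumes "\<not> Ring.field R"
  shows "\<exists>a\<in>carrier R. a \<noteq> \<zero> \<and> \<not> (\<exists>c\<in>carrier R. \<one> = a \<otimes> c)"
proof (rule ccontr)
  assume H: "\<not> ?thesis"
  have "Ring.field R"
  proof (rule R.cring_fieldI2)
    show "\<zero> \<noteq> \<one>" using R.one_not_zero by simp
    show "\<exists>b\<in>carrier R. a \<otimes> b = \<one>" if "a \<in> carrier R" "a \<noteq> \<zero>" for a using H that by metis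
  qed
  then show False using assms by simp
qed

text \<open>The rank bound is obtained by scaling with a nonzero nonunit, which exists because
  \<open>R\<close> is not a field.\<close>

lemma C4_iff_uniform:
  assumes nf: "\<not> Ring.field R"
  shows "C4 R M \<longleftrightarrow> dependent_pairs \<and>
    (\<forall>P t s0. uniformized_prime R P t s0 \<longrightarrow> (\<exists>n. uniform_at P t n))"
proof
  assume C4: "C4 R M"
  obtain a where a: "a \<in> carrier R" "a \<noteq> \<zero>" "\<not> (\<exists>c\<in>carrier R. \<one> = a \<otimes> c)"
    using nonunit_exists[OF nf] by auto
  have dp: dependent_pairs by (rule C4_imp_dependent_pairs[OF C4 a])
  have "\<exists>n. uniform_at P t n" if "uniformized_prime R P t s0" for P t s0
    by (rule dedekind_prime_module.C4_imp_uniform[OF prime_moduleI[OF that] C4 dp])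
  then show "dependent_pairs \<and> (\<forall>P t s0. uniformized_prime R P t s0 \<longrightarrow> (\<exists>n. uniform_at P t n))"
    using dp by simp
next
  assume H: "dependent_pairs \<and> (\<forall>P t s0. uniformized_prime R P t s0 \<longrightarrow> (\<exists>n. uniform_at P t n))"
  show "C4 R M"
  proof (rule uniform_imp_C4)
    show dependent_pairs using H by simp
    show "\<exists>n. uniform_at P t n" if "uniformized_prime R P t s0" for P t s0 using H that by auto
  qed
qed

end

section \<open>The condition at a prime that passes to all submodules\<close>

context module
begin

text \<open>The second alternative says that the socle has dimension at most one over
  \<open>R / P\<close>, which for the components here means cyclic. Phrased by elements of the
  socle, both alternatives are visibly inherited by submodules.\<close>

definition thin_at :: "'a set \<Rightarrow> bool" where
  "thin_at P \<longleftrightarrow> (\<forall>x\<in>primary P. kills P 1 x) \<or>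
    (\<forall>z\<in>primary P. \<forall>z'\<in>primary P. kills P 1 z \<longrightarrow> kills P 1 z' \<longrightarrow> z \<noteq> \<zero>\<^bsub>M\<^esub> \<longrightarrow> z' \<in> cyc z)"

lemma restrict_simps:
  assumes N: "sm N"
  shows "module.kills R (M\<lparr>carrier := N\<rparr>) P n x = kills P n x"
    and "module.primary R (M\<lparr>carrier := N\<rparr>) P = primary P \<inter> N"
proof -
  interpret N: module R "M\<lparr>carrier := N\<rparr>" by (rule sm_is_module[OF N])
  show k: "N.kills P n x = kills P n x" for n x unfolding N.kills_def kills_def by simp
  show "N.primary P = primary P \<inter> N"
    unfolding N.primary_def primary_def k using sm_subset[OF N] by auto
qed

lemma dependent_pairs_restrict:
  assumes N: "sm N" and dp: dependent_pairs
  shows "module.dependent_pairs R (M\<lparr>carrier := N\<rparr>)"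
proof -
  interpret N: module R "M\<lparr>carrier := N\<rparr>" by (rule sm_is_module[OF N])
  show ?thesis unfolding N.dependent_pairs_def
    using dp sm_closed[OF N] unfolding dependent_pairs_def by simp
qed

lemma uniform_at_restrict:
  assumes N: "sm N"
  shows "module.uniform_at R (M\<lparr>carrier := N\<rparr>) P t n \<longleftrightarrow>
    (\<forall>x\<in>primary P \<inter> N. kills P (Suc n) x) \<and>
    (\<forall>z\<in>primary P \<inter> N. kills P 1 z \<longrightarrow> (\<exists>x\<in>primary P \<inter> N. z = t [^] n \<odot>\<^bsub>M\<^esub> x))"
proof -
  interpret N: module R "M\<lparr>carrier := N\<rparr>" by (rule sm_is_module[OF N])
  show ?thesis unfolding N.uniform_at_def restrict_simps[OF N] by simp
qed

end

context dedekind_prime_module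
begin

text \<open>A nonzero socle element generates a simple module: a coefficient that does not kill it
  is outside \<open>P\<close>, hence invertible on it.\<close>

lemma socle_multiple:
  assumes z: "z \<in> carrier M" "kills P 1 z" and c: "c \<in> carrier R" "c \<odot>\<^bsub>M\<^esub> z \<noteq> \<zero>\<^bsub>M\<^esub>"
  shows "z \<in> cyc (c \<odot>\<^bsub>M\<^esub> z)"
proof -
  have "c \<notin> P"
  proof
    assume "c \<in> P"
    then have "c \<in> Q 1" using Q_1 by simp
    then show False using kills_Q[OF z(2)] c(2) by simp
  qed
  then obtain u where "u \<in> carrier R" "u \<odot>\<^bsub>M\<^esub> (c \<odot>\<^bsub>M\<^esub> z) = z" using kills_unit[OF z, of c] c(1) by auto
  then show ?thesis using cycI[of u "c \<odot>\<^bsub>M\<^esub> z"] by simp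
qed

text \<open>If some element is not killed by \<open>P\<close>, there is an \<open>x\<close> with
  \<open>z1 = t x\<close> a nonzero socle element. For a socle element \<open>z\<close>, the
  submodule \<open>R x + R z\<close> is uniform with \<open>n > 0\<close>, so
  \<open>z = t ^ n v\<close> for some \<open>v\<close> in it; \<open>t ^ n\<close> kills the part of
  \<open>v\<close> in \<open>R z\<close>, hence \<open>z\<close> is a multiple of
  \<open>z1\<close>.\<close>

lemma thin_at_if_submodules_uniform:
  assumes H: "\<And>N. sm N \<Longrightarrow> \<exists>n. module.uniform_at R (M\<lparr>carrier := N\<rparr>) P t n"
  shows "thin_at P"
proof (cases "\<forall>x\<in>primary P. kills P 1 x")
  case True then show ?thesis by (simp add: thin_at_def)
next
  case False
  then obtain x0 where x0: "x0 \<in> primary P" "\<not> kills P 1 x0" by auto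
  have x0c: "x0 \<in> carrier M" by (rule primary_closed[OF x0(1)])
  have "x0 \<noteq> \<zero>\<^bsub>M\<^esub>" using x0(2) kills_zero by auto
  then obtain m where m: "t [^] m \<odot>\<^bsub>M\<^esub> x0 \<noteq> \<zero>\<^bsub>M\<^esub>" "kills P (Suc m) x0" "kills P 1 (t [^] m \<odot>\<^bsub>M\<^esub> x0)"
    using socle_exists[OF x0(1)] by auto
  have "m \<noteq> 0"
  proof
    assume "m = 0"
    then show False using m(2) x0(2) by simp
  qed
  then obtain i where i: "m = Suc i" using not0_implies_Suc by auto
  \<comment> \<open>One power of \<open>t\<close> short of the socle, so \<open>R x\<close> is a
    copy of \<open>R / P ^ 2\<close>.\<close>
  define x where "x = t [^] i \<odot>\<^bsub>M\<^esub> x0"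
  define z1 where "z1 = t \<odot>\<^bsub>M\<^esub> x"
  have xT: "x \<in> primary P" unfolding x_def by (rule sm_smult[OF sm_primary _ x0(1)]) simp
  have xc: "x \<in> carrier M" by (rule primary_closed[OF xT])
  have z1: "z1 = t [^] m \<odot>\<^bsub>M\<^esub> x0" unfolding z1_def x_def i using t_pow_smult[OF x0c, of 1 i] by simp
  have z1c: "z1 \<in> carrier M" unfolding z1_def using xc by simp
  have kz1: "kills P 1 z1" and z10: "z1 \<noteq> \<zero>\<^bsub>M\<^esub>" unfolding z1 by (rule m)+
  have nk: "\<not> kills P 1 x"
  proof
    assume "kills P 1 x"
    then have "z1 = \<zero>\<^bsub>M\<^esub>" unfolding z1_def by (rule kills_Q) (simp add: Q_1 t_in)
    then show False using z10 by simp
  qed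
  have soc: "z \<in> cyc z1" if z: "z \<in> primary P" "kills P 1 z" for z
  proof -
    have zc: "z \<in> carrier M" by (rule primary_closed[OF z(1)])
    define N where "N = msum (cyc x) (cyc z)"
    note sx = sm_cyc[OF xc] and sz = sm_cyc[OF zc]
    have N: "sm N" unfolding N_def by (rule sm_msum[OF sx sz])
    have xN: "x \<in> N" unfolding N_def using msum_upper1[OF sx sz] cyc_self[OF xc] by auto
    have zN: "z \<in> N" unfolding N_def using msum_upper2[OF sx sz] cyc_self[OF zc] by auto
    obtain n where n: "\<forall>x\<in>primary P \<inter> N. kills P (Suc n) x"
      "\<forall>z\<in>primary P \<inter> N. kills P 1 z \<longrightarrow> (\<exists>x\<in>primary P \<inter> N. z = t [^] n \<odot>\<^bsub>M\<^esub> x)"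
      using H[OF N] unfolding uniform_at_restrict[OF N] by auto
    have "n \<noteq> 0"
    proof
      assume "n = 0"
      then show False using n(1) xT xN nk by simp
    qed
    then obtain k where k: "n = Suc k" using not0_implies_Suc by auto
    obtain v where v: "v \<in> N" "z = t [^] n \<odot>\<^bsub>M\<^esub> v" using n(2) z zN by auto
    obtain a b where ab: "a \<in> cyc x" "b \<in> cyc z" "v = a \<oplus>\<^bsub>M\<^esub> b" using v(1) unfolding N_def by (rule msumE)
    obtain c where c: "c \<in> carrier R" "a = c \<odot>\<^bsub>M\<^esub> x" using ab(1) by (rule cycE)
    obtain e where e: "e \<in> carrier R" "b = e \<odot>\<^bsub>M\<^esub> z" using ab(2) by (rule cycE)
    have bc: "b \<in> carrier M" and acar: "a \<in> carrier M" unfolding c(2) e(2) using c(1) e(1) xc zc by simp_all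
    have "kills P 1 b" unfolding e(2) by (rule kills_smult[OF z(2) zc e(1)])
    then have "kills P n b" by (rule kills_mono) (simp add: k)
    then have "t [^] n \<odot>\<^bsub>M\<^esub> b = \<zero>\<^bsub>M\<^esub>" by (rule kills_Q[OF _ t_pow_in_Q])
    then have "z = t [^] n \<odot>\<^bsub>M\<^esub> a" unfolding v(2) ab(3) using bc acar by (simp add: smult_r_distr)
    also have "\<dots> = (t [^] k \<otimes> c) \<odot>\<^bsub>M\<^esub> z1"
      unfolding c(2) z1_def k using c(1) xc by (simp add: smult_assoc1[symmetric] R.m_ac)
    finally show ?thesis using cycI[of "t [^] k \<otimes> c" z1] c(1) by simp
  qed
  have "z' \<in> cyc z" if z: "z \<in> primary P" "kills P 1 z" "z \<noteq> \<zero>\<^bsub>M\<^esub>" and z': "z' \<in> primary P" "kills P 1 z'" for z z'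
  proof -
    obtain c where c: "c \<in> carrier R" "z = c \<odot>\<^bsub>M\<^esub> z1" using soc[OF z(1,2)] by (rule cycE)
    have zc: "z \<in> carrier M" by (rule primary_closed[OF z(1)])
    have "z1 \<in> cyc z" unfolding c(2) by (rule socle_multiple[OF z1c kz1 c(1)]) (use z(3) c(2) in simp)
    then have "cyc z1 \<subseteq> cyc z" by (rule cyc_least[OF sm_cyc[OF zc]])
    then show ?thesis using soc[OF z'] by auto
  qed
  then show ?thesis unfolding thin_at_def by simp
qed

text \<open>If \<open>P\<close> kills the component of \<open>N\<close>, take \<open>n = 0\<close>.
  Otherwise a nonzero component has a top socle element \<open>t ^ n y\<close> with \<open>y\<close>
  in \<open>N\<close>; it generates the whole socle, so every socle element is
  \<open>c t ^ n y = t ^ n (c y)\<close>.\<close>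

lemma thin_at_imp_uniform:
  assumes thin: "thin_at P" and N: "sm N"
  shows "\<exists>n. module.uniform_at R (M\<lparr>carrier := N\<rparr>) P t n"
proof -
  have triv: "\<exists>n. module.uniform_at R (M\<lparr>carrier := N\<rparr>) P t n" if "\<forall>x\<in>primary P \<inter> N. kills P 1 x"
  proof -
    have "z = t [^] (0::nat) \<odot>\<^bsub>M\<^esub> z" if "z \<in> primary P \<inter> N" for z using primary_closed[of z P] that by simp
    then show ?thesis unfolding uniform_at_restrict[OF N] using that by (intro exI[of _ 0]) auto
  qed
  interpret N: dedekind_prime_module R "M\<lparr>carrier := N\<rparr>" P t s0
    by (rule dedekind_module.prime_moduleI[OF dedekind_restrict[OF N] R.uniformized_prime_axioms])
  show ?thesis
  proof (cases "\<forall>x\<in>primary P. kills P 1 x")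
    case True then show ?thesis using triv by simp
  next
    case False
    then have "\<forall>z\<in>primary P. \<forall>z'\<in>primary P. kills P 1 z \<longrightarrow> kills P 1 z' \<longrightarrow> z \<noteq> \<zero>\<^bsub>M\<^esub> \<longrightarrow> z' \<in> cyc z"
      by (rule thin[unfolded thin_at_def disj_imp, THEN mp])
    then have soc: "\<And>z z'. \<lbrakk>z \<in> primary P; z' \<in> primary P; kills P 1 z; kills P 1 z'; z \<noteq> \<zero>\<^bsub>M\<^esub>\<rbrakk> \<Longrightarrow> z' \<in> cyc z"
      by simp
    show ?thesis
    proof (cases "\<forall>x\<in>primary P \<inter> N. x = \<zero>\<^bsub>M\<^esub>")
      case True
      then have "\<forall>x\<in>primary P \<inter> N. kills P 1 x" using kills_zero by auto
      then show ?thesis by (rule triv)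
    next
      case False
      then have "\<not> (\<forall>x\<in>N.primary P. x = \<zero>\<^bsub>M\<lparr>carrier := N\<rparr>\<^esub>)" unfolding restrict_simps[OF N] by simp
      then obtain n y where y: "y \<in> primary P" "y \<in> N" "t [^] n \<odot>\<^bsub>M\<^esub> y \<noteq> \<zero>\<^bsub>M\<^esub>"
        and kn: "\<forall>x\<in>primary P \<inter> N. kills P (Suc n) x"
        using N.primary_top unfolding restrict_simps[OF N] by auto
      have yc: "y \<in> carrier M" by (rule primary_closed[OF y(1)])
      have tyT: "t [^] n \<odot>\<^bsub>M\<^esub> y \<in> primary P" by (rule sm_smult[OF sm_primary _ y(1)]) simp
      have ky: "kills P (Suc n) y" using kn y by simp
      have "t [^] (1::nat) \<odot>\<^bsub>M\<^esub> (t [^] n \<odot>\<^bsub>M\<^esub> y) = t [^] Suc n \<odot>\<^bsub>M\<^esub> y" using t_pow_smult[OF yc, of 1 n] by simp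
      also have "\<dots> = \<zero>\<^bsub>M\<^esub>" by (rule kills_Q[OF ky t_pow_in_Q])
      finally have kt: "kills P 1 (t [^] n \<odot>\<^bsub>M\<^esub> y)"
        by (intro kills_t[OF _ kills_smult[OF ky yc]]) (simp_all add: yc)
      have "\<exists>x\<in>primary P \<inter> N. z = t [^] n \<odot>\<^bsub>M\<^esub> x" if z: "z \<in> primary P \<inter> N" "kills P 1 z" for z
      proof -
        have "z \<in> cyc (t [^] n \<odot>\<^bsub>M\<^esub> y)" using soc[OF tyT _ kt z(2) y(3)] z(1) by simp
        then obtain c where c: "c \<in> carrier R" "z = c \<odot>\<^bsub>M\<^esub> (t [^] n \<odot>\<^bsub>M\<^esub> y)" by (rule cycE)
        have "z = t [^] n \<odot>\<^bsub>M\<^esub> (c \<odot>\<^bsub>M\<^esub> y)"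
          unfolding c(2) using c(1) yc by (simp add: smult_assoc1[symmetric] R.m_comm)
        moreover have "c \<odot>\<^bsub>M\<^esub> y \<in> primary P \<inter> N"
          using sm_smult[OF sm_primary c(1) y(1)] sm_smult[OF N c(1) y(2)] by simp
        ultimately show ?thesis by (intro bexI)
      qed
      then show ?thesis unfolding uniform_at_restrict[OF N] using kn by (intro exI[of _ n]) simp
    qed
  qed
qed

lemma torsion_component_eq: "torsion_component R P M = M\<lparr>carrier := primary P\<rparr>"
  unfolding torsion_component_def primary_submodule_torsion by simp

lemma cyclic_component_iff:
  "cyclic_module R (M\<lparr>carrier := primary P\<rparr>) \<longleftrightarrow> (\<exists>x\<in>primary P. cyc x = primary P)"
proof -
  have "module.span R (M\<lparr>carrier := primary P\<rparr>) {x} = cyc x" if x: "x \<in> primary P" for x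
    using span_li_not_depend(1)[OF _ afp_submodule[OF sm_primary], of "{x}"] x
      span_singleton[OF primary_closed[OF x]] by simp
  then show ?thesis unfolding cyclic_module_def by simp
qed

lemma semisimple_component_iff:
  "semisimple_module R (M\<lparr>carrier := primary P\<rparr>) \<longleftrightarrow>
    (\<forall>U. sm U \<and> U \<subseteq> primary P \<longrightarrow> (\<exists>V. dsum U V (primary P)))"
  unfolding semisimple_module_def sm_restrict[OF sm_primary] direct_summand_iff[OF sm_primary] ..

text \<open>A complement of the socle contains no nonzero socle element, so it is zero. Conversely,
  if \<open>P\<close> kills the component, every nonzero element generates a simple module, so a
  maximal \<open>W\<close> meeting \<open>U\<close> trivially is a complement of
  \<open>U\<close>.\<close>

lemma semisimple_iff_killed:
  "semisimple_module R (M\<lparr>carrier := primary P\<rparr>) \<longleftrightarrow> (\<forall>x\<in>primary P. kills P 1 x)"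
proof
  assume ss: "semisimple_module R (M\<lparr>carrier := primary P\<rparr>)"
  let ?U = "{x \<in> carrier M. kills P 1 x}"
  have Usub: "?U \<subseteq> primary P" by (auto simp: primary_def)
  obtain V where V: "dsum ?U V (primary P)" using ss[unfolded semisimple_component_iff, rule_format, OF conjI[OF sm_killed Usub]] by auto
  have "v = \<zero>\<^bsub>M\<^esub>" if v: "v \<in> V" for v
  proof (rule ccontr)
    assume v0: "v \<noteq> \<zero>\<^bsub>M\<^esub>"
    have vT: "v \<in> primary P" using dsum_subset2[OF V] v by auto
    obtain m where m: "t [^] (m::nat) \<odot>\<^bsub>M\<^esub> v \<noteq> \<zero>\<^bsub>M\<^esub>" "kills P 1 (t [^] m \<odot>\<^bsub>M\<^esub> v)"
      using socle_exists[OF vT v0] by auto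
    have "t [^] m \<odot>\<^bsub>M\<^esub> v \<in> V" by (rule sm_smult[OF dsum_sm2[OF V] _ v]) simp
    moreover have "t [^] m \<odot>\<^bsub>M\<^esub> v \<in> ?U" using m(2) primary_closed[OF vT] by simp
    ultimately show False using dsum_disjoint[OF V] m(1) by auto
  qed
  then have V0: "V = {\<zero>\<^bsub>M\<^esub>}" using sm_zero[OF dsum_sm2[OF V]] by blast
  have e: "primary P = ?U" using dsum_eq[OF V] dsum_eq[OF dsum_zero_right[OF sm_killed]] unfolding V0 by simp
  show "\<forall>x\<in>primary P. kills P 1 x" unfolding e by simp
next
  assume k: "\<forall>x\<in>primary P. kills P 1 x"
  show "semisimple_module R (M\<lparr>carrier := primary P\<rparr>)" unfolding semisimple_component_iff
  proof (intro allI impI, elim conjE)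
    fix U assume U: "sm U" "U \<subseteq> primary P"
    let ?S = "{W. sm W \<and> W \<subseteq> primary P \<and> (\<forall>z\<in>U. z \<in> W \<longrightarrow> z = \<zero>\<^bsub>M\<^esub>)}"
    have "\<exists>W\<in>?S. \<forall>W'\<in>?S. W \<subseteq> W' \<longrightarrow> W' = W"
    proof (rule maximal_submodule_in_family)
      show "sm N" if "N \<in> ?S" for N using that by simp
      have "{\<zero>\<^bsub>M\<^esub>} \<in> ?S" using sm_singleton_zero sm_zero[OF sm_primary] by simp
      then show "?S \<noteq> {}" by (rule ex_in_conv[THEN iffD1, OF exI])
    qed
    then obtain W where WS: "W \<in> ?S" and max: "\<forall>W'\<in>?S. W \<subseteq> W' \<longrightarrow> W' = W" by (elim bexE) (rule that)
    have W: "sm W" "W \<subseteq> primary P" "\<And>z. \<lbrakk>z \<in> U; z \<in> W\<rbrakk> \<Longrightarrow> z = \<zero>\<^bsub>M\<^esub>" using WS by simp_all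
    have "primary P \<subseteq> msum U W"
    proof
      fix y assume y: "y \<in> primary P"
      have yc: "y \<in> carrier M" by (rule primary_closed[OF y])
      note sy = sm_cyc[OF yc]
      show "y \<in> msum U W"
      proof (cases "y \<in> W")
        case True then show ?thesis using msum_upper2[OF U(1) W(1)] by auto
      next
        case False
        have up: "W \<subseteq> msum W (cyc y)" by (rule msum_upper1[OF W(1) sy])
        have "y \<in> msum W (cyc y)" using msum_upper2[OF W(1) sy] cyc_self[OF yc] by (rule subsetD)
        then have "msum W (cyc y) \<noteq> W" using False by auto
        then have "msum W (cyc y) \<notin> ?S" using max up by auto
        then obtain z where z: "z \<in> U" "z \<in> msum W (cyc y)" "z \<noteq> \<zero>\<^bsub>M\<^esub>"
          using sm_msum[OF W(1) sy] msum_least[OF sm_primary W(2) cyc_least[OF sm_primary y]] by auto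
        obtain w v where wv: "w \<in> W" "v \<in> cyc y" "z = w \<oplus>\<^bsub>M\<^esub> v" using z(2) by (rule msumE)
        obtain c where c: "c \<in> carrier R" "v = c \<odot>\<^bsub>M\<^esub> y" using wv(2) by (rule cycE)
        have wc: "w \<in> carrier M" by (rule sm_closed[OF W(1) wv(1)])
        have vc: "v \<in> carrier M" unfolding c(2) using c(1) yc by simp
        have "v \<noteq> \<zero>\<^bsub>M\<^esub>"
        proof
          assume "v = \<zero>\<^bsub>M\<^esub>"
          then have "z = w" using wv(3) wc by simp
          then show False using W(3)[OF z(1)] wv(1) z(3) by simp
        qed
        then have "y \<in> cyc v" unfolding c(2) using k y by (intro socle_multiple[OF yc _ c(1)]) simp_all
        moreover have "v \<in> msum U W"
        proof -
          have "v = z \<ominus>\<^bsub>M\<^esub> w" unfolding wv(3) by (rule add_minus_cancel(2)[OF wc vc, symmetric])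
          also have "\<dots> \<in> msum U W" unfolding a_minus_def by (rule msumI[OF z(1) sm_neg[OF W(1) wv(1)]])
          finally show ?thesis .
        qed
        ultimately show ?thesis using cyc_least[OF sm_msum[OF U(1) W(1)]] by auto
      qed
    qed
    then have "msum U W = primary P" using msum_least[OF sm_primary U(2) W(2)] by (rule subset_antisym[rotated])
    then have "dsum U W (primary P)" by (rule dsumI[OF U(1) W(1) _ W(3)])
    then show "\<exists>V. dsum U V (primary P)" by (rule exI)
  qed
qed

text \<open>With a one-dimensional socle, an element \<open>y\<close> of top exponent generates a
  summand, and a nonzero complement would bring a second independent socle element. Conversely, the
  socle of a nonzero cyclic component \<open>R x\<close> is generated by the last nonzero
  \<open>t ^ n x\<close>.\<close>

lemma thin_at_iff:
  "thin_at P \<longleftrightarrow> cyclic_module R (torsion_component R P M) \<or> semisimple_module R (torsion_component R P M)"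
  unfolding torsion_component_eq semisimple_iff_killed cyclic_component_iff
proof
  assume thin: "thin_at P"
  show "(\<exists>x\<in>primary P. cyc x = primary P) \<or> (\<forall>x\<in>primary P. kills P 1 x)"
  proof (cases "\<forall>x\<in>primary P. kills P 1 x")
    case nk: False
    then have "\<forall>z\<in>primary P. \<forall>z'\<in>primary P. kills P 1 z \<longrightarrow> kills P 1 z' \<longrightarrow> z \<noteq> \<zero>\<^bsub>M\<^esub> \<longrightarrow> z' \<in> cyc z"
      by (rule thin[unfolded thin_at_def disj_imp, THEN mp])
    then have soc: "\<And>z z'. \<lbrakk>z \<in> primary P; z' \<in> primary P; kills P 1 z; kills P 1 z'; z \<noteq> \<zero>\<^bsub>M\<^esub>\<rbrakk> \<Longrightarrow> z' \<in> cyc z"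
      by simp
    have "\<not> (\<forall>x\<in>primary P. x = \<zero>\<^bsub>M\<^esub>)" using nk kills_zero by metis
    then obtain n y where y: "y \<in> primary P" "t [^] n \<odot>\<^bsub>M\<^esub> y \<noteq> \<zero>\<^bsub>M\<^esub>"
      and kn: "\<forall>x\<in>primary P. kills P (Suc n) x" using primary_top by auto
    have yc: "y \<in> carrier M" by (rule primary_closed[OF y(1)])
    have tyT: "t [^] n \<odot>\<^bsub>M\<^esub> y \<in> primary P" by (rule sm_smult[OF sm_primary _ y(1)]) simp
    have ky: "kills P (Suc n) y" using kn y by simp
    have "t [^] (1::nat) \<odot>\<^bsub>M\<^esub> (t [^] n \<odot>\<^bsub>M\<^esub> y) = t [^] Suc n \<odot>\<^bsub>M\<^esub> y" using t_pow_smult[OF yc, of 1 n] by simp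
    also have "\<dots> = \<zero>\<^bsub>M\<^esub>" by (rule kills_Q[OF ky t_pow_in_Q])
    finally have kt: "kills P 1 (t [^] n \<odot>\<^bsub>M\<^esub> y)"
      by (intro kills_t[OF _ kills_smult[OF ky yc]]) (simp_all add: yc)
    have "\<exists>W. {\<zero>\<^bsub>M\<^esub>} \<subseteq> W \<and> dsum (cyc y) W (primary P)"
    proof (rule cyclic_summand[OF sm_primary y(1) ky sm_singleton_zero])
      show "{\<zero>\<^bsub>M\<^esub>} \<subseteq> primary P" using sm_zero[OF sm_primary] by simp
      show "a \<odot>\<^bsub>M\<^esub> x \<in> {\<zero>\<^bsub>M\<^esub>}" if "a \<in> Q (Suc n)" "x \<in> primary P" for a x
        using kills_Q[OF _ that(1)] kn that(2) by simp
      show "t [^] n \<odot>\<^bsub>M\<^esub> y \<notin> {\<zero>\<^bsub>M\<^esub>}" using y(2) by simp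
    qed
    then obtain W where W: "dsum (cyc y) W (primary P)" by auto
    have "w = \<zero>\<^bsub>M\<^esub>" if w: "w \<in> W" for w
    proof (rule ccontr)
      assume w0: "w \<noteq> \<zero>\<^bsub>M\<^esub>"
      have wT: "w \<in> primary P" using dsum_subset2[OF W] w by auto
      obtain m where m: "t [^] (m::nat) \<odot>\<^bsub>M\<^esub> w \<noteq> \<zero>\<^bsub>M\<^esub>" "kills P 1 (t [^] m \<odot>\<^bsub>M\<^esub> w)"
        using socle_exists[OF wT w0] by auto
      have mW: "t [^] m \<odot>\<^bsub>M\<^esub> w \<in> W" by (rule sm_smult[OF dsum_sm2[OF W] _ w]) simp
      have "t [^] m \<odot>\<^bsub>M\<^esub> w \<in> cyc (t [^] n \<odot>\<^bsub>M\<^esub> y)"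
        by (rule soc[OF tyT _ kt m(2) y(2)]) (use dsum_subset2[OF W] mW in auto)
      moreover have "cyc (t [^] n \<odot>\<^bsub>M\<^esub> y) \<subseteq> cyc y" by (rule cyc_least[OF sm_cyc[OF yc] cycI]) simp
      ultimately show False using dsum_disjoint[OF W _ mW] m(1) by auto
    qed
    then have W0: "W = {\<zero>\<^bsub>M\<^esub>}" using sm_zero[OF dsum_sm2[OF W]] by blast
    have "cyc y = primary P" using dsum_eq[OF W] dsum_eq[OF dsum_zero_right[OF sm_cyc[OF yc]]] unfolding W0 by simp
    then show ?thesis using y(1) by auto
  qed simp
next
  assume H: "(\<exists>x\<in>primary P. cyc x = primary P) \<or> (\<forall>x\<in>primary P. kills P 1 x)"
  then show "thin_at P"
  proof
    assume "\<exists>x\<in>primary P. cyc x = primary P"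
    then obtain x where x: "x \<in> primary P" "cyc x = primary P" by auto
    have xc: "x \<in> carrier M" by (rule primary_closed[OF x(1)])
    show ?thesis
    proof (cases "x = \<zero>\<^bsub>M\<^esub>")
      case True
      have "y = \<zero>\<^bsub>M\<^esub>" if "y \<in> primary P" for y using that unfolding x(2)[symmetric] True by (auto elim: cycE)
      then have "\<forall>y\<in>primary P. kills P 1 y" using kills_zero by metis
      then show ?thesis unfolding thin_at_def by simp
    next
      case False
      obtain n where n: "t [^] (n::nat) \<odot>\<^bsub>M\<^esub> x \<noteq> \<zero>\<^bsub>M\<^esub>" "kills P (Suc n) x" "kills P 1 (t [^] n \<odot>\<^bsub>M\<^esub> x)"
        using socle_exists[OF x(1) False] by auto
      have soc: "z \<in> cyc (t [^] n \<odot>\<^bsub>M\<^esub> x)" if z: "z \<in> primary P" "kills P 1 z" for z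
      proof (cases "z = \<zero>\<^bsub>M\<^esub>")
        case True then show ?thesis using sm_zero[OF sm_cyc[of "t [^] n \<odot>\<^bsub>M\<^esub> x"]] xc by simp
      next
        case z0: False
        have "z \<in> cyc x" using z(1) x(2) by simp
        then obtain d where d: "d \<in> carrier R" "z = d \<odot>\<^bsub>M\<^esub> x" by (rule cycE)
        have "d \<notin> Q (Suc n)" using z0 d(2) kills_Q[OF n(2)] by auto
        then obtain j c q where j: "j < Suc n" "c \<in> carrier R - P" "q \<in> Q (Suc n)" "d = t [^] j \<otimes> c \<oplus> q"
          using Q_form[OF d(1), of "Suc n"] by auto
        have cc: "c \<in> carrier R" "q \<in> carrier R" using j(2) Q_closed[OF j(3)] by simp_all
        have zj: "z = c \<odot>\<^bsub>M\<^esub> (t [^] j \<odot>\<^bsub>M\<^esub> x)"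
          unfolding d(2) j(4) using cc xc kills_Q[OF n(2) j(3)]
          by (simp add: smult_l_distr smult_assoc1[symmetric] R.m_comm)
        \<comment> \<open>If \<open>z\<close> equals an invertible element times
          \<open>t ^ j x\<close> and is in the socle, then \<open>t ^ (j + 1) x = 0\<close>, so
          \<open>j < n\<close> is impossible.\<close>
        have "j = n"
        proof (rule ccontr)
          assume "j \<noteq> n"
          then obtain i where i: "n = i + Suc j" using j(1) less_imp_Suc_add[of j n] by auto
          have tj: "t [^] j \<odot>\<^bsub>M\<^esub> x \<in> carrier M" using xc by simp
          have ktj: "kills P (Suc n) (t [^] j \<odot>\<^bsub>M\<^esub> x)" by (rule kills_smult[OF n(2) xc]) simp
          obtain u where u: "u \<in> carrier R" "u \<odot>\<^bsub>M\<^esub> z = t [^] j \<odot>\<^bsub>M\<^esub> x"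
            using kills_unit[OF tj ktj j(2)] unfolding zj by auto
          have "kills P 1 (t [^] j \<odot>\<^bsub>M\<^esub> x)" unfolding u(2)[symmetric]
            by (rule kills_smult[OF z(2) primary_closed[OF z(1)] u(1)])
          then have "t [^] (1::nat) \<odot>\<^bsub>M\<^esub> (t [^] j \<odot>\<^bsub>M\<^esub> x) = \<zero>\<^bsub>M\<^esub>" by (rule kills_Q[OF _ t_pow_in_Q])
          then have "t [^] Suc j \<odot>\<^bsub>M\<^esub> x = \<zero>\<^bsub>M\<^esub>" using t_pow_smult[OF xc, of 1 j] by simp
          then have "t [^] i \<odot>\<^bsub>M\<^esub> (t [^] Suc j \<odot>\<^bsub>M\<^esub> x) = \<zero>\<^bsub>M\<^esub>" by simp
          then show False using t_pow_smult[OF xc, of i "Suc j"] n(1) i by simp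
        qed
        then show ?thesis unfolding zj using cycI[OF cc(1)] by simp
      qed
      have "z' \<in> cyc z" if z: "z \<in> primary P" "kills P 1 z" "z \<noteq> \<zero>\<^bsub>M\<^esub>"
        and z': "z' \<in> primary P" "kills P 1 z'" for z z'
      proof -
        have tx: "t [^] n \<odot>\<^bsub>M\<^esub> x \<in> carrier M" using xc by simp
        obtain c where c: "c \<in> carrier R" "z = c \<odot>\<^bsub>M\<^esub> (t [^] n \<odot>\<^bsub>M\<^esub> x)" using soc[OF z(1,2)] by (rule cycE)
        have zc: "z \<in> carrier M" by (rule primary_closed[OF z(1)])
        have "t [^] n \<odot>\<^bsub>M\<^esub> x \<in> cyc z" unfolding c(2) by (rule socle_multiple[OF tx n(3) c(1)]) (use z(3) c(2) in simp)
        then have "cyc (t [^] n \<odot>\<^bsub>M\<^esub> x) \<subseteq> cyc z" by (rule cyc_least[OF sm_cyc[OF zc]])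
        then show ?thesis using soc[OF z'] by auto
      qed
      then show ?thesis unfolding thin_at_def by simp
    qed
  qed (simp add: thin_at_def)
qed

end

text \<open>The C4 criterion is applied to each submodule. \<open>dependent_pairs\<close> is
  inherited, so only the condition at the primes has to hold uniformly over submodules, which is
  what \<open>thin_at\<close> captures.\<close>

lemma (in dedekind_module) C4_star_iff_thin:
  assumes nf: "\<not> Ring.field R"
  shows "C4_star R M \<longleftrightarrow> dependent_pairs \<and> (\<forall>P t s0. uniformized_prime R P t s0 \<longrightarrow> thin_at P)"
proof
  assume H: "C4_star R M"
  have C: "C4 R (M\<lparr>carrier := N\<rparr>)" if "sm N" for N using H that unfolding C4_star_def by simp
  have "C4 R M" using C[OF sm_carrier] by simp
  then have dp: dependent_pairs using C4_iff_uniform[OF nf] by simp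
  have "thin_at P" if up: "uniformized_prime R P t s0" for P t s0
  proof (rule dedekind_prime_module.thin_at_if_submodules_uniform[OF prime_moduleI[OF up]])
    fix N assume N: "sm N"
    show "\<exists>n. module.uniform_at R (M\<lparr>carrier := N\<rparr>) P t n"
      using C[OF N] up unfolding dedekind_module.C4_iff_uniform[OF dedekind_restrict[OF N] nf] by auto
  qed
  then show "dependent_pairs \<and> (\<forall>P t s0. uniformized_prime R P t s0 \<longrightarrow> thin_at P)" using dp by simp
next
  assume H: "dependent_pairs \<and> (\<forall>P t s0. uniformized_prime R P t s0 \<longrightarrow> thin_at P)"
  show "C4_star R M" unfolding C4_star_def
  proof (intro allI impI)
    fix N assume N: "sm N"
    have "\<exists>n. module.uniform_at R (M\<lparr>carrier := N\<rparr>) P t n" if up: "uniformized_prime R P t s0" for P t s0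
    proof (rule dedekind_prime_module.thin_at_imp_uniform[OF prime_moduleI[OF up] _ N])
      show "thin_at P" using H up by auto
    qed
    then show "C4 R (M\<lparr>carrier := N\<rparr>)"
      unfolding dedekind_module.C4_iff_uniform[OF dedekind_restrict[OF N] nf]
      using dependent_pairs_restrict[OF N] H by auto
  qed
qed

text \<open>Chains of summands of a Noetherian module have a largest element, so their union is a summand.\<close>

lemma (in noetherian_module) semi_weak_CS: "semi_weak_CS R M"
  unfolding semi_weak_CS_def
proof (intro allI impI)
  fix C assume C: "triple_chain R M C"
  have ess: "essential_submodule R (M\<lparr>carrier := A\<rparr>) A" if A: "sm A" for A
    unfolding essential_submodule_def sm_restrict[OF A] using A by (auto simp: Int_absorb1)
  \<comment> \<open>The projection \<open>p\<close> will be instantiated to the domain and to the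
    range of a triple. The chain has a largest value of \<open>p\<close>, although possibly attained
    by different triples for the two projections.\<close>
  have top: "direct_summand R M (insert \<zero>\<^bsub>M\<^esub> (\<Union>c\<in>C. p c)) \<and>
      essential_submodule R (M\<lparr>carrier := insert \<zero>\<^bsub>M\<^esub> (\<Union>c\<in>C. p c)\<rparr>) (insert \<zero>\<^bsub>M\<^esub> (\<Union>c\<in>C. p c))"
    if ds: "\<And>c. c \<in> C \<Longrightarrow> direct_summand R M (p c)"
      and mono: "\<And>c d. triple_le c d \<Longrightarrow> p c \<subseteq> p d" for p
  proof (cases "C = {}")
    case True
    have "dsum {\<zero>\<^bsub>M\<^esub>} (carrier M) (carrier M)" by (rule dsum_sym[OF dsum_zero_right[OF sm_carrier]])
    then show ?thesis unfolding direct_summand_carrier_iff using ess[OF sm_singleton_zero] True by auto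
  next
    case False
    have s: "sm (p c)" if "c \<in> C" for c
      using ds[OF that] dsum_sm1 unfolding direct_summand_carrier_iff by auto
    have "\<exists>N\<in>p ` C. \<forall>N'\<in>p ` C. N \<subseteq> N' \<longrightarrow> N' = N"
    proof (rule maximal_submodule_in_family)
      show "sm N" if "N \<in> p ` C" for N using that s by (elim imageE) simp
      show "p ` C \<noteq> {}" using False by simp
    qed
    then obtain c where c: "c \<in> C" and max: "\<forall>d\<in>C. p c \<subseteq> p d \<longrightarrow> p d = p c" by auto
    have "p d \<subseteq> p c" if d: "d \<in> C" for d
    proof -
      have "triple_le d c \<or> triple_le c d" using C c d unfolding triple_chain_def by simp
      then show ?thesis using mono[of d c] mono[of c d] max d by auto
    qed
    then have "insert \<zero>\<^bsub>M\<^esub> (\<Union>c\<in>C. p c) = p c" using c sm_zero[OF s[OF c]] by auto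
    then show ?thesis using ds[OF c] ess[OF s[OF c]] by simp
  qed
  have "direct_summand R M (fst c)" "direct_summand R M (fst (snd c))" if "c \<in> C" for c
    using C that unfolding triple_chain_def semisimple_triples_def by auto
  moreover have "fst c \<subseteq> fst d" "fst (snd c) \<subseteq> fst (snd d)" if "triple_le c d" for c d :: "'c set \<times> 'c set \<times> ('c \<Rightarrow> 'c)"
    using that by (cases c; cases d; auto)+
  moreover have "chain_dom M C = insert \<zero>\<^bsub>M\<^esub> (\<Union>c\<in>C. fst c)" "chain_ran M C = insert \<zero>\<^bsub>M\<^esub> (\<Union>c\<in>C. fst (snd c))"
    unfolding chain_dom_def chain_ran_def by (auto simp: case_prod_beta)
  ultimately show "\<exists>A B. direct_summand R M A \<and> direct_summand R M B \<and>
      essential_submodule R (M\<lparr>carrier := A\<rparr>) (chain_dom M C) \<and>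
      essential_submodule R (M\<lparr>carrier := B\<rparr>) (chain_ran M C)"
    using top[of fst] top[of "\<lambda>c. fst (snd c)"]
    by (intro exI[of _ "chain_dom M C"] exI[of _ "chain_ran M C"]) simp
qed

subsection \<open>Decompositions into cyclic modules\<close>

context module
begin

definition comb :: "(nat \<Rightarrow> 'c) \<Rightarrow> (nat \<Rightarrow> 'a) \<Rightarrow> nat set \<Rightarrow> 'c" where
  "comb x d J = (\<Oplus>\<^bsub>M\<^esub>j\<in>J. d j \<odot>\<^bsub>M\<^esub> x j)"

text \<open>
  \<open>cyclic_basis P x l J T\<close> says that \<open>T\<close> is the internal direct sum of the \<open>R x\<^sub>j\<close> with
  \<open>R x\<^sub>j \<cong> R / P\<^bsup>l j\<^esup>\<close>.
\<close>

definition cyclic_basis :: "'a set \<Rightarrow> (nat \<Rightarrow> 'c) \<Rightarrow> (nat \<Rightarrow> nat) \<Rightarrow> nat set \<Rightarrow> 'c set \<Rightarrow> bool" where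
  "cyclic_basis P x l J T \<longleftrightarrow> x \<in> J \<rightarrow> T \<and> (\<forall>y\<in>T. \<exists>d\<in>J \<rightarrow> carrier R. y = comb x d J) \<and>
    (\<forall>d\<in>J \<rightarrow> carrier R. comb x d J = \<zero>\<^bsub>M\<^esub> \<longleftrightarrow> (\<forall>j\<in>J. d j \<in> ideal_pow R P (l j)))"

lemma comb_insert:
  assumes "finite J" "j \<notin> J" "x \<in> insert j J \<rightarrow> carrier M" "d \<in> insert j J \<rightarrow> carrier R"
  shows "comb x d (insert j J) = d j \<odot>\<^bsub>M\<^esub> x j \<oplus>\<^bsub>M\<^esub> comb x d J"
  unfolding comb_def using assms by (intro M.finsum_insert) (auto simp: Pi_iff)

lemma comb_closed:
  assumes "x \<in> J \<rightarrow> carrier M" "d \<in> J \<rightarrow> carrier R" shows "comb x d J \<in> carrier M"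
  unfolding comb_def using assms by (intro M.finsum_closed) (auto simp: Pi_iff)

lemma comb_in:
  assumes T: "sm T" and J: "finite J" and "x \<in> J \<rightarrow> T" "d \<in> J \<rightarrow> carrier R"
  shows "comb x d J \<in> T"
  using J assms(3,4)
proof (induction J rule: finite_induct)
  case empty then show ?case by (simp add: comb_def sm_zero[OF T])
next
  case (insert j J)
  have "x \<in> insert j J \<rightarrow> carrier M" using insert.prems(1) sm_subset[OF T] by auto
  then show ?case using insert sm_add[OF T] sm_smult[OF T] by (simp add: comb_insert)
qed

lemma comb_add:
  assumes "x \<in> J \<rightarrow> carrier M" "d \<in> J \<rightarrow> carrier R" "e \<in> J \<rightarrow> carrier R"
  shows "comb x (\<lambda>j. d j \<oplus> e j) J = comb x d J \<oplus>\<^bsub>M\<^esub> comb x e J"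
proof -
  have "comb x (\<lambda>j. d j \<oplus> e j) J = (\<Oplus>\<^bsub>M\<^esub>j\<in>J. d j \<odot>\<^bsub>M\<^esub> x j \<oplus>\<^bsub>M\<^esub> e j \<odot>\<^bsub>M\<^esub> x j)"
    unfolding comb_def using assms by (intro M.finsum_cong') (auto simp: Pi_iff smult_l_distr)
  also have "\<dots> = comb x d J \<oplus>\<^bsub>M\<^esub> comb x e J"
    unfolding comb_def using assms by (intro M.finsum_addf) (auto simp: Pi_iff)
  finally show ?thesis .
qed

lemma comb_smult:
  assumes "finite J" "x \<in> J \<rightarrow> carrier M" "d \<in> J \<rightarrow> carrier R" "a \<in> carrier R"
  shows "comb x (\<lambda>j. a \<otimes> d j) J = a \<odot>\<^bsub>M\<^esub> comb x d J"
proof -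
  have "comb x (\<lambda>j. a \<otimes> d j) J = (\<Oplus>\<^bsub>M\<^esub>j\<in>J. a \<odot>\<^bsub>M\<^esub> (d j \<odot>\<^bsub>M\<^esub> x j))"
    unfolding comb_def using assms by (intro M.finsum_cong') (auto simp: Pi_iff smult_assoc1)
  also have "\<dots> = a \<odot>\<^bsub>M\<^esub> comb x d J"
    unfolding comb_def using assms by (intro finsum_smult_ldistr[symmetric]) (auto simp: Pi_iff)
  finally show ?thesis .
qed

lemma comb_single:
  assumes "finite J" "x \<in> J \<rightarrow> carrier M" "j \<in> J" "a \<in> carrier R"
  shows "comb x (\<lambda>i. if i = j then a else \<zero>) J = a \<odot>\<^bsub>M\<^esub> x j"
proof -
  have "comb x (\<lambda>i. if i = j then a else \<zero>) J = (\<Oplus>\<^bsub>M\<^esub>i\<in>J. if j = i then a \<odot>\<^bsub>M\<^esub> x i else \<zero>\<^bsub>M\<^esub>)"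
    unfolding comb_def using assms by (intro M.finsum_cong') (auto simp: Pi_iff)
  also have "\<dots> = a \<odot>\<^bsub>M\<^esub> x j"
    using assms by (intro M.add.finprod_singleton) (auto simp: Pi_iff)
  finally show ?thesis .
qed

lemma comb_diff_zero_iff:
  assumes "finite J" "x \<in> J \<rightarrow> carrier M" "d \<in> J \<rightarrow> carrier R" "e \<in> J \<rightarrow> carrier R"
  shows "comb x (\<lambda>j. d j \<ominus> e j) J = \<zero>\<^bsub>M\<^esub> \<longleftrightarrow> comb x d J = comb x e J"
proof -
  have e: "(\<lambda>j. \<ominus> \<one> \<otimes> e j) \<in> J \<rightarrow> carrier R" using assms(4) by auto
  have "comb x (\<lambda>j. d j \<ominus> e j) J = comb x (\<lambda>j. d j \<oplus> \<ominus> \<one> \<otimes> e j) J"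
    unfolding comb_def using assms
    by (intro M.finsum_cong') (auto simp: Pi_iff a_minus_def R.l_minus)
  also have "\<dots> = comb x d J \<oplus>\<^bsub>M\<^esub> \<ominus> \<one> \<odot>\<^bsub>M\<^esub> comb x e J"
    unfolding comb_add[OF assms(2,3) e] by (subst comb_smult[OF assms(1,2,4)]) simp_all
  also have "\<dots> = comb x d J \<ominus>\<^bsub>M\<^esub> comb x e J"
    using comb_closed[OF assms(2,4)] by (simp add: a_minus_def smult_l_minus)
  finally show ?thesis using minus_eq_zero_iff comb_closed[OF assms(2)] assms(3,4) by simp
qed

end

section \<open>Reading the conditions off the exponents of a cyclic basis\<close>

context dedekind_prime_module
begin

lemma
  assumes cb: "cyclic_basis P x l J T"
  shows basis_in: "j \<in> J \<Longrightarrow> x j \<in> T"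
    and basis_span: "y \<in> T \<Longrightarrow> \<exists>d\<in>J \<rightarrow> carrier R. y = comb x d J"
    and basis_zero: "d \<in> J \<rightarrow> carrier R \<Longrightarrow> comb x d J = \<zero>\<^bsub>M\<^esub> \<longleftrightarrow> (\<forall>j\<in>J. d j \<in> Q (l j))"
  using cb unfolding cyclic_basis_def Q_def by auto

text \<open>The difference of two coordinate families of one element is a relation, so coordinates
  are unique modulo the annihilators \<open>P ^ l j\<close>.\<close>

lemma basis_coord:
  assumes cb: "cyclic_basis P x l J T" and J: "finite J" and T: "sm T"
    and d: "d \<in> J \<rightarrow> carrier R" "e \<in> J \<rightarrow> carrier R" "comb x d J = comb x e J" and j: "j \<in> J"
  shows "d j \<ominus> e j \<in> Q (l j)"
proof -
  have x: "x \<in> J \<rightarrow> carrier M" using basis_in[OF cb] sm_closed[OF T] by auto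
  have "(\<lambda>j. d j \<ominus> e j) \<in> J \<rightarrow> carrier R" using d(1,2) by (auto simp: Pi_iff)
  then show ?thesis using basis_zero[OF cb, of "\<lambda>j. d j \<ominus> e j"] comb_diff_zero_iff[OF J x d(1,2)] d(3) j by auto
qed

lemma basis_annihilator:
  assumes cb: "cyclic_basis P x l J T" and J: "finite J" and T: "sm T" and j: "j \<in> J" and a: "a \<in> carrier R"
  shows "a \<odot>\<^bsub>M\<^esub> x j = \<zero>\<^bsub>M\<^esub> \<longleftrightarrow> a \<in> Q (l j)"
proof -
  have x: "x \<in> J \<rightarrow> carrier M" using basis_in[OF cb] sm_closed[OF T] by auto
  have "(\<lambda>i. if i = j then a else \<zero>) \<in> J \<rightarrow> carrier R" using a by auto
  from basis_zero[OF cb this] show ?thesis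
    unfolding comb_single[OF J x j a] using j Q_zero by auto
qed

text \<open>If \<open>t ^ m\<close> were in \<open>P ^ (m + 1)\<close>, cancelling it would put
  \<open>1\<close> into \<open>P\<close>.\<close>

lemma t_pow_in_Q_iff: "t [^] m \<in> Q n \<longleftrightarrow> n \<le> m"
proof
  assume t: "t [^] m \<in> Q n"
  show "n \<le> m"
  proof (rule ccontr)
    assume "\<not> n \<le> m"
    then have "t [^] m \<otimes> \<one> \<in> Q (m + 1)" using subsetD[OF Q_antimono[of "m + 1" n] t] by simp
    then have "\<one> \<in> Q 1" by (rule Q_cancel_t[OF R.one_closed])
    then show False using one_notin Q_1 by simp
  qed
next
  assume "n \<le> m"
  then show "t [^] m \<in> Q n" using subsetD[OF Q_antimono t_pow_in_Q] by simp
qed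

text \<open>\<open>x j\<close> has annihilator \<open>P ^ l j\<close>, so this is its last nonzero
  multiple by a power of \<open>t\<close>; the bound \<open>1 \<le> l j\<close> makes the natural
  subtraction exact.\<close>

lemma basis_socle:
  assumes cb: "cyclic_basis P x l J (primary P)" and J: "finite J" and j: "j \<in> J" "1 \<le> l j"
  shows "t [^] (l j - 1) \<odot>\<^bsub>M\<^esub> x j \<in> primary P" "kills P 1 (t [^] (l j - 1) \<odot>\<^bsub>M\<^esub> x j)"
    "t [^] (l j - 1) \<odot>\<^bsub>M\<^esub> x j \<noteq> \<zero>\<^bsub>M\<^esub>"
proof -
  note an = basis_annihilator[OF cb J sm_primary j(1)]
  have xT: "x j \<in> primary P" by (rule basis_in[OF cb j(1)])
  have xc: "x j \<in> carrier M" by (rule primary_closed[OF xT])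
  show "t [^] (l j - 1) \<odot>\<^bsub>M\<^esub> x j \<in> primary P" by (rule sm_smult[OF sm_primary _ xT]) simp
  have k: "kills P (l j) (x j)" unfolding kills_iff using an Q_closed by auto
  have "t [^] (1::nat) \<odot>\<^bsub>M\<^esub> (t [^] (l j - 1) \<odot>\<^bsub>M\<^esub> x j) = t [^] (l j) \<odot>\<^bsub>M\<^esub> x j"
    using t_pow_smult[OF xc, of 1 "l j - 1"] j(2) by simp
  also have "\<dots> = \<zero>\<^bsub>M\<^esub>" by (rule kills_Q[OF k t_pow_in_Q])
  finally show "kills P 1 (t [^] (l j - 1) \<odot>\<^bsub>M\<^esub> x j)"
    by (intro kills_t[OF _ kills_smult[OF k xc]]) (simp_all add: xc)
  show "t [^] (l j - 1) \<odot>\<^bsub>M\<^esub> x j \<noteq> \<zero>\<^bsub>M\<^esub>" using an[of "t [^] (l j - 1)"] t_pow_in_Q_iff j(2) by simp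
qed

text \<open>Annihilation of \<open>x j\<close> by \<open>P ^ (n + 1)\<close> bounds
  \<open>l j\<close> from above. For the lower bound, divide the socle generator at \<open>j\<close>
  by \<open>t ^ n\<close> and compare coordinates at \<open>j\<close>: \<open>t ^ (l j - 1)\<close>
  is congruent to \<open>t ^ n d j\<close> modulo \<open>P ^ l j\<close>, which is impossible for
  \<open>l j \<le> n\<close>.\<close>

lemma uniform_at_basis:
  assumes cb: "cyclic_basis P x l J (primary P)" and J: "finite J" and l: "\<forall>j\<in>J. 1 \<le> l j"
    and u: "uniform_at P t n" and j: "j \<in> J"
  shows "l j = Suc n"
proof (rule antisym)
  note an = basis_annihilator[OF cb J sm_primary j]
  have "kills P (Suc n) (x j)" using u basis_in[OF cb j] unfolding uniform_at_def by simp
  then have "t [^] Suc n \<odot>\<^bsub>M\<^esub> x j = \<zero>\<^bsub>M\<^esub>" by (rule kills_Q[OF _ t_pow_in_Q])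
  then have "t [^] Suc n \<in> Q (l j)" using an[of "t [^] Suc n"] by (simp del: nat_pow_Suc)
  then show "l j \<le> Suc n" by (simp only: t_pow_in_Q_iff)
  have x: "x \<in> J \<rightarrow> carrier M" using basis_in[OF cb] primary_closed by auto
  have lj: "1 \<le> l j" using l j by simp
  obtain y where y: "y \<in> primary P" "t [^] (l j - 1) \<odot>\<^bsub>M\<^esub> x j = t [^] n \<odot>\<^bsub>M\<^esub> y"
    using u basis_socle(1,2)[OF cb J j lj] unfolding uniform_at_def by auto
  obtain d where d: "d \<in> J \<rightarrow> carrier R" "y = comb x d J" using basis_span[OF cb y(1)] by auto
  let ?e = "\<lambda>i. if i = j then t [^] (l j - 1) else \<zero>"
  have e: "?e \<in> J \<rightarrow> carrier R" by auto
  have td: "(\<lambda>i. t [^] n \<otimes> d i) \<in> J \<rightarrow> carrier R" using d(1) by (auto simp: Pi_iff)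
  have "comb x ?e J = comb x (\<lambda>i. t [^] n \<otimes> d i) J"
    unfolding comb_smult[OF J x d(1) R.nat_pow_closed[OF t_closed]] d(2)[symmetric] y(2)[symmetric]
    by (rule comb_single[OF J x j]) simp
  from basis_coord[OF cb J sm_primary e td this j]
  have q: "t [^] (l j - 1) \<ominus> t [^] n \<otimes> d j \<in> Q (l j)" by simp
  have dj: "d j \<in> carrier R" using d(1) j by auto
  show "Suc n \<le> l j"
  proof (rule ccontr)
    assume "\<not> Suc n \<le> l j"
    then have "t [^] n \<in> Q (l j)" by (simp add: t_pow_in_Q_iff)
    then have "t [^] n \<otimes> d j \<in> Q (l j)" by (rule Q_mult_right[OF _ dj])
    from Q_add[OF q this] have "t [^] (l j - 1) \<in> Q (l j)"
      using dj by (simp add: a_minus_def R.a_assoc R.l_neg)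
    then show False using lj by (simp add: t_pow_in_Q_iff)
  qed
qed

lemma basis_killed:
  assumes cb: "cyclic_basis P x l J (primary P)" and J: "finite J" and l: "\<forall>j\<in>J. l j \<le> n"
    and y: "y \<in> primary P"
  shows "kills P n y"
proof -
  have x: "x \<in> J \<rightarrow> {x \<in> carrier M. kills P n x}"
  proof
    fix j assume j: "j \<in> J"
    have "kills P (l j) (x j)" unfolding kills_iff
      using basis_annihilator[OF cb J sm_primary j] Q_closed by auto
    then show "x j \<in> {x \<in> carrier M. kills P n x}"
      using kills_mono l j primary_closed[OF basis_in[OF cb j]] by simp
  qed
  obtain d where "d \<in> J \<rightarrow> carrier R" "y = comb x d J" using basis_span[OF cb y] by auto
  then show ?thesis using comb_in[OF sm_killed J x, of d] by simp
qed

text \<open>A socle element has coordinates with \<open>t d j\<close> in \<open>P ^ (n + 1)\<close>,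
  hence \<open>d j\<close> in \<open>P ^ n\<close>. Each is therefore \<open>t ^ n c j\<close>
  modulo \<open>P ^ (n + 1)\<close>, and \<open>t ^ n\<close> can be taken out of the
  combination.\<close>

lemma basis_imp_uniform_at:
  assumes cb: "cyclic_basis P x l J (primary P)" and J: "finite J" and l: "\<forall>j\<in>J. l j = Suc n"
  shows "uniform_at P t n"
  unfolding uniform_at_def
proof (intro conjI ballI impI)
  show "kills P (Suc n) y" if "y \<in> primary P" for y by (rule basis_killed[OF cb J _ that]) (use l in simp)
  fix z assume z: "z \<in> primary P" "kills P 1 z"
  have x: "x \<in> J \<rightarrow> carrier M" using basis_in[OF cb] primary_closed by auto
  obtain d where d: "d \<in> J \<rightarrow> carrier R" "z = comb x d J" using basis_span[OF cb z(1)] by auto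
  have td: "(\<lambda>i. t \<otimes> d i) \<in> J \<rightarrow> carrier R" using d(1) by (auto simp: Pi_iff)
  have "t \<odot>\<^bsub>M\<^esub> z = \<zero>\<^bsub>M\<^esub>" by (rule kills_Q[OF z(2)]) (simp add: Q_1 t_in)
  then have "comb x (\<lambda>i. t \<otimes> d i) J = \<zero>\<^bsub>M\<^esub>" unfolding comb_smult[OF J x d(1) t_closed] d(2) .
  then have tq: "t \<otimes> d j \<in> Q (Suc n)" if "j \<in> J" for j using basis_zero[OF cb td] l that by simp
  have "\<exists>c. c \<in> carrier R \<and> d j \<ominus> t [^] n \<otimes> c \<in> Q (Suc n)" if j: "j \<in> J" for j
  proof -
    have dj: "d j \<in> carrier R" using d(1) j by auto
    have "d j \<in> Q n" by (rule Q_cancel_t[of _ 1 n]) (use dj tq[OF j] in simp_all)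
    then obtain c q where c: "c \<in> carrier R" "q \<in> Q (Suc n)" "d j = t [^] n \<otimes> c \<oplus> q"
      using Q_decomp[of "d j" n "Suc n"] by auto
    have "q \<in> carrier R" by (rule Q_closed[OF c(2)])
    then have "d j \<ominus> t [^] n \<otimes> c = q"
      unfolding c(3) using c(1) by (simp add: a_minus_def R.a_ac R.r_neg R.r_neg2 R.r_neg1)
    then show ?thesis using c(1,2) by auto
  qed
  then obtain c where c: "\<And>j. j \<in> J \<Longrightarrow> c j \<in> carrier R \<and> d j \<ominus> t [^] n \<otimes> c j \<in> Q (Suc n)" by metis
  have cJ: "c \<in> J \<rightarrow> carrier R" using c by auto
  have tc: "(\<lambda>i. t [^] n \<otimes> c i) \<in> J \<rightarrow> carrier R" using cJ by (auto simp: Pi_iff)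
  have dc: "(\<lambda>j. d j \<ominus> t [^] n \<otimes> c j) \<in> J \<rightarrow> carrier R" using d(1) tc by (auto simp: Pi_iff)
  have "comb x (\<lambda>j. d j \<ominus> t [^] n \<otimes> c j) J = \<zero>\<^bsub>M\<^esub>" using basis_zero[OF cb dc] c l by simp
  then have "z = comb x (\<lambda>i. t [^] n \<otimes> c i) J" unfolding d(2) by (simp only: comb_diff_zero_iff[OF J x d(1) tc])
  also have "\<dots> = t [^] n \<odot>\<^bsub>M\<^esub> comb x c J" by (rule comb_smult[OF J x cJ]) simp
  finally show "\<exists>y\<in>primary P. z = t [^] n \<odot>\<^bsub>M\<^esub> y"
    using comb_in[OF sm_primary J _ cJ, of x] basis_in[OF cb] by auto
qed

text \<open>With two generators the socle has two independent elements, one in each coordinate, so a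
  one-dimensional socle forces \<open>m = 1\<close>. The other alternative, annihilation by
  \<open>P\<close>, forces all exponents to be one.\<close>

lemma thin_at_basis_iff:
  assumes cb: "cyclic_basis P x l {1..m} (primary P)" and l: "\<forall>j\<in>{1..m}. 1 \<le> l j" and m: "1 \<le> m"
  shows "thin_at P \<longleftrightarrow> m = 1 \<or> (\<forall>j\<in>{1..m}. l j = 1)"
proof
  have x: "x \<in> {1..m} \<rightarrow> carrier M" by (intro Pi_I primary_closed[OF basis_in[OF cb]])
  assume thin: "thin_at P"
  show "m = 1 \<or> (\<forall>j\<in>{1..m}. l j = 1)"
  proof (cases "\<forall>x\<in>primary P. kills P 1 x")
    case True
    have "l j = 1" if j: "j \<in> {1..m}" for j
    proof -
      have "t \<odot>\<^bsub>M\<^esub> x j = \<zero>\<^bsub>M\<^esub>"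
        by (rule kills_Q[OF bspec[OF True basis_in[OF cb j]]]) (simp add: Q_1 t_in)
      then have "t [^] (1::nat) \<in> Q (l j)" using basis_annihilator[OF cb _ sm_primary j t_closed] by simp
      then have "l j \<le> 1" by (simp only: t_pow_in_Q_iff)
      then show ?thesis using l j by (simp add: le_antisym)
    qed
    then show ?thesis by simp
  next
    case False
    then have s: "\<forall>z\<in>primary P. \<forall>z'\<in>primary P. kills P 1 z \<longrightarrow> kills P 1 z' \<longrightarrow> z \<noteq> \<zero>\<^bsub>M\<^esub> \<longrightarrow> z' \<in> cyc z"
      by (rule thin[unfolded thin_at_def disj_imp, THEN mp])
    have "m = 1"
    proof (rule ccontr)
      assume "m \<noteq> 1"
      then have j: "1 \<in> {1..m}" "2 \<in> {1..m}" using m by simp_all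
      have l1: "1 \<le> l 1" and l2: "1 \<le> l 2" using l j by simp_all
      note b1 = basis_socle[OF cb finite_atLeastAtMost j(1) l1]
      note b2 = basis_socle[OF cb finite_atLeastAtMost j(2) l2]
      have "t [^] (l 2 - 1) \<odot>\<^bsub>M\<^esub> x 2 \<in> cyc (t [^] (l 1 - 1) \<odot>\<^bsub>M\<^esub> x 1)"
        using s b1 b2(1,2) by simp
      then obtain c where c: "c \<in> carrier R"
        "t [^] (l 2 - 1) \<odot>\<^bsub>M\<^esub> x 2 = c \<odot>\<^bsub>M\<^esub> (t [^] (l 1 - 1) \<odot>\<^bsub>M\<^esub> x 1)" by (rule cycE)
      have x1: "x 1 \<in> carrier M" by (rule primary_closed[OF basis_in[OF cb j(1)]])
      let ?d = "\<lambda>i. if i = 2 then t [^] (l 2 - 1) else \<zero>"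
      let ?e = "\<lambda>i. if i = 1 then c \<otimes> t [^] (l 1 - 1) else \<zero>"
      \<comment> \<open>Both combinations represent the same socle element, but the right one has
        coordinate zero at index 2 while the left one is nonzero there modulo
        \<open>P ^ l 2\<close>.\<close>
      have "comb x ?d {1..m} = comb x ?e {1..m}"
        unfolding comb_single[OF finite_atLeastAtMost x j(2) R.nat_pow_closed[OF t_closed]] c(2)
        unfolding smult_assoc1[OF c(1) R.nat_pow_closed[OF t_closed] x1, symmetric]
        by (rule comb_single[OF finite_atLeastAtMost x j(1), symmetric]) (simp add: c(1))
      from basis_coord[OF cb finite_atLeastAtMost sm_primary _ _ this j(2)]
      have "t [^] (l 2 - 1) \<ominus> \<zero> \<in> Q (l 2)" using c(1) by (simp add: Pi_iff)
      then have "t [^] (l 2 - 1) \<in> Q (l 2)" by (simp add: a_minus_def)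
      then show False using l2 by (simp add: t_pow_in_Q_iff)
    qed
    then show ?thesis by simp
  qed
next
  have x: "x \<in> {1..m} \<rightarrow> carrier M" by (intro Pi_I primary_closed[OF basis_in[OF cb]])
  assume "m = 1 \<or> (\<forall>j\<in>{1..m}. l j = 1)"
  then show "thin_at P"
  proof
    assume m1: "m = 1"
    have x1: "x 1 \<in> primary P" using basis_in[OF cb, of 1] m1 by simp
    have "primary P \<subseteq> cyc (x 1)"
    proof
      fix y assume "y \<in> primary P"
      then obtain d where d: "d \<in> {1..m} \<rightarrow> carrier R" "y = comb x d {1..m}" using basis_span[OF cb] by auto
      have "y = d 1 \<odot>\<^bsub>M\<^esub> x 1"
        using comb_insert[of "{}" 1 x d] d x m1 by (simp add: comb_def)
      then show "y \<in> cyc (x 1)" using cycI[of "d 1" "x 1"] d(1) m1 by auto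
    qed
    then have "cyc (x 1) = primary P" using cyc_least[OF sm_primary x1] by (intro subset_antisym)
    then show ?thesis unfolding thin_at_iff torsion_component_eq cyclic_component_iff using x1 by auto
  next
    assume "\<forall>j\<in>{1..m}. l j = 1"
    then have "\<forall>y\<in>primary P. kills P 1 y" using basis_killed[OF cb finite_atLeastAtMost] by simp
    then show ?thesis by (simp add: thin_at_def)
  qed
qed

text \<open>Split off cyclic summands of maximal exponent; prepending them keeps the exponents sorted.\<close>

lemma cyclic_basis_exists:
  "\<exists>m x l. cyclic_basis P x l {1..m} (primary P) \<and> (\<forall>j\<in>{1..m}. 1 \<le> l j) \<and>
    (\<forall>i\<in>{1..m}. \<forall>j\<in>{1..m}. i \<le> j \<longrightarrow> l i \<le> l j)"
proof -
  \<comment> \<open>The last clause says that no exponent still to come in the rest \<open>Y\<close>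
    exceeds one already chosen; this is what keeps the list sorted when a generator is
    prepended.\<close>
  define good where "good U Y m x l \<longleftrightarrow> dsum U Y (primary P) \<and> cyclic_basis P x l {1..m} U \<and>
    (\<forall>j\<in>{1..m}. 1 \<le> l j) \<and> (\<forall>i\<in>{1..m}. \<forall>j\<in>{1..m}. i \<le> j \<longrightarrow> l i \<le> l j) \<and>
    (\<forall>y\<in>Y. \<forall>j\<in>{1..m}. kills P (l j) y)" for U Y m x l
  let ?S = "{U. \<exists>Y m x l. good U Y m x l}"
  have "\<exists>U\<in>?S. \<forall>U'\<in>?S. U \<subseteq> U' \<longrightarrow> U' = U"
  proof (rule maximal_submodule_in_family)
    show "sm N" if "N \<in> ?S" for N using that unfolding good_def by (auto dest: dsum_sm1)
    have "cyclic_basis P x l {1..0} {\<zero>\<^bsub>M\<^esub>}" for x l by (simp add: cyclic_basis_def comb_def)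
    then have "good {\<zero>\<^bsub>M\<^esub>} (primary P) 0 (\<lambda>_. \<zero>\<^bsub>M\<^esub>) (\<lambda>_. 0)"
      unfolding good_def using dsum_sym[OF dsum_zero_right[OF sm_primary]] by simp
    then have "{\<zero>\<^bsub>M\<^esub>} \<in> ?S" by auto
    then show "?S \<noteq> {}" by (rule ex_in_conv[THEN iffD1, OF exI])
  qed
  then obtain U where US: "U \<in> ?S" and max: "\<forall>U'\<in>?S. U \<subseteq> U' \<longrightarrow> U' = U" by (elim bexE) (rule that)
  obtain Y m x l where g: "good U Y m x l" using US by auto
  have d: "dsum U Y (primary P)" and cb: "cyclic_basis P x l {1..m} U" and l: "\<forall>j\<in>{1..m}. 1 \<le> l j"
    and mono: "\<forall>i\<in>{1..m}. \<forall>j\<in>{1..m}. i \<le> j \<longrightarrow> l i \<le> l j" and kY: "\<forall>y\<in>Y. \<forall>j\<in>{1..m}. kills P (l j) y"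
    using g unfolding good_def by simp_all
  note sU = dsum_sm1[OF d] and sY = dsum_sm2[OF d]
  have YT: "Y \<subseteq> primary P" by (rule dsum_subset2[OF d])
  have "\<forall>y\<in>Y. y = \<zero>\<^bsub>M\<^esub>"
  proof (rule ccontr)
    assume nz: "\<not> (\<forall>y\<in>Y. y = \<zero>\<^bsub>M\<^esub>)"
    \<comment> \<open>Regarding \<open>Y\<close> as a module of its own, in which it is the whole
      primary component, gives an element of top exponent in \<open>Y\<close> rather than in
      \<open>M\<close>.\<close>
    interpret N: dedekind_prime_module R "M\<lparr>carrier := Y\<rparr>" P t s0
      by (rule dedekind_module.prime_moduleI[OF dedekind_restrict[OF sY] R.uniformized_prime_axioms])
    have pY: "primary P \<inter> Y = Y" using YT by auto
    have "\<exists>n y. y \<in> Y \<and> t [^] n \<odot>\<^bsub>M\<^esub> y \<noteq> \<zero>\<^bsub>M\<^esub> \<and> (\<forall>x\<in>Y. kills P (Suc n) x)"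
      using N.primary_top nz unfolding restrict_simps[OF sY] pY by simp
    then obtain n y where y: "y \<in> Y" "t [^] n \<odot>\<^bsub>M\<^esub> y \<noteq> \<zero>\<^bsub>M\<^esub>" and kn: "\<forall>x\<in>Y. kills P (Suc n) x" by auto
    have yc: "y \<in> carrier M" by (rule sm_closed[OF sY y(1)])
    have ky: "kills P (Suc n) y" using kn y by simp
    have "\<exists>W. {\<zero>\<^bsub>M\<^esub>} \<subseteq> W \<and> dsum (cyc y) W Y"
    proof (rule cyclic_summand[OF sY y(1) ky sm_singleton_zero])
      show "{\<zero>\<^bsub>M\<^esub>} \<subseteq> Y" using sm_zero[OF sY] by simp
      show "a \<odot>\<^bsub>M\<^esub> x \<in> {\<zero>\<^bsub>M\<^esub>}" if "a \<in> Q (Suc n)" "x \<in> Y" for a x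
        using kills_Q[OF _ that(1)] kn that(2) by simp
      show "t [^] n \<odot>\<^bsub>M\<^esub> y \<notin> {\<zero>\<^bsub>M\<^esub>}" using y(2) by simp
    qed
    then obtain W where W: "dsum (cyc y) W Y" by auto
    from dsum_regroup[OF d W]
    have r1: "dsum U (cyc y) (msum U (cyc y))" and r2: "dsum (msum U (cyc y)) W (primary P)" .
    have yann: "a \<odot>\<^bsub>M\<^esub> y = \<zero>\<^bsub>M\<^esub> \<longleftrightarrow> a \<in> Q (Suc n)" if a: "a \<in> carrier R" for a
    proof
      assume ay: "a \<odot>\<^bsub>M\<^esub> y = \<zero>\<^bsub>M\<^esub>"
      show "a \<in> Q (Suc n)"
      proof (rule ccontr)
        assume "a \<notin> Q (Suc n)"
        then obtain j e q where j: "j < Suc n" "e \<in> carrier R" "q \<in> Q (Suc n)" "e \<otimes> a = t [^] j \<oplus> q"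
          using Q_unform[OF a, of "Suc n"] by auto
        have "(t [^] j \<oplus> q) \<odot>\<^bsub>M\<^esub> y = \<zero>\<^bsub>M\<^esub>" using smult_assoc1[OF j(2) a yc] j(4) ay j(2) by simp
        then have "t [^] j \<odot>\<^bsub>M\<^esub> y = \<zero>\<^bsub>M\<^esub>"
          using kills_Q[OF ky j(3)] Q_closed[OF j(3)] yc by (simp add: smult_l_distr)
        then have "t [^] (n - j) \<odot>\<^bsub>M\<^esub> (t [^] j \<odot>\<^bsub>M\<^esub> y) = \<zero>\<^bsub>M\<^esub>" by simp
        then show False using t_pow_smult[OF yc, of "n - j" j] j(1) y(2) by simp
      qed
    qed (rule kills_Q[OF ky])
    \<comment> \<open>The new generator takes index 1 and the old ones move up by one.\<close>
    define x' where "x' j = (if j = 1 then y else x (j - 1))" for j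
    define l' where "l' j = (if j = 1 then Suc n else l (j - 1))" for j
    define K where "K = {1..m}"
    have J: "{1..Suc m} = insert 1 (Suc ` K)" unfolding K_def by (auto simp: image_Suc_atLeastAtMost)
    define K' where "K' = insert 1 (Suc ` K)"
    have fK: "finite K" and K0: "0 \<notin> K" unfolding K_def by simp_all
    have x'1: "x' 1 = y" and l'1: "l' 1 = Suc n" by (simp_all add: x'_def l'_def)
    have x'S: "x' (Suc i) = x i" and l'S: "l' (Suc i) = l i" if "i \<in> K" for i
    proof -
      have "i \<noteq> 0" using K0 that by metis
      then show "x' (Suc i) = x i" "l' (Suc i) = l i" by (simp_all add: x'_def l'_def)
    qed
    have nK: "1 \<notin> Suc ` K" using K0 by auto
    note cb = cb[folded K_def] and l = l[folded K_def] and mono = mono[folded K_def] and kY = kY[folded K_def]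
    have xU: "x \<in> K \<rightarrow> U" using basis_in[OF cb] by auto
    have xc: "x \<in> K \<rightarrow> carrier M" using xU sm_subset[OF sU] by auto
    have split: "comb x' e K' = e 1 \<odot>\<^bsub>M\<^esub> y \<oplus>\<^bsub>M\<^esub> comb x (\<lambda>j. e (Suc j)) K"
      if e: "e \<in> K' \<rightarrow> carrier R" for e
    proof -
      have x'c: "x' \<in> insert 1 (Suc ` K) \<rightarrow> carrier M" using xc yc using x'1 x'S by (auto simp: Pi_iff)
      have ec: "e \<in> insert 1 (Suc ` K) \<rightarrow> carrier R" using e unfolding K'_def .
      have "comb x' e (Suc ` K) = comb x (\<lambda>j. e (Suc j)) K"
      proof -
        have "comb x' e (Suc ` K) = (\<Oplus>\<^bsub>M\<^esub>j\<in>K. e (Suc j) \<odot>\<^bsub>M\<^esub> x' (Suc j))"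
          unfolding comb_def using x'c ec by (intro M.add.finprod_reindex) (auto simp: Pi_iff)
        also have "\<dots> = comb x (\<lambda>j. e (Suc j)) K"
          unfolding comb_def using xc ec x'S by (intro M.finsum_cong') (auto simp: Pi_iff)
        finally show ?thesis .
      qed
      then show ?thesis unfolding K'_def using comb_insert[OF finite_imageI[OF fK] nK x'c ec] x'1 by simp
    qed
    have Suc_in: "(\<lambda>j. e (Suc j)) \<in> K \<rightarrow> carrier R" if "e \<in> K' \<rightarrow> carrier R" for e
      using that unfolding K'_def by (auto simp: Pi_iff)
    have "cyclic_basis P x' l' K' (msum U (cyc y))"
      unfolding cyclic_basis_def Q_def[symmetric]
    proof (intro conjI ballI)
      show "x' \<in> K' \<rightarrow> msum U (cyc y)"
      proof
        fix j assume "j \<in> K'"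
        then consider "j = 1" | i where "i \<in> K" "j = Suc i" unfolding K'_def by auto
        then show "x' j \<in> msum U (cyc y)"
        proof cases
          case 1 then show ?thesis using subsetD[OF dsum_subset2[OF r1] cyc_self[OF yc]] x'1 by simp
        next
          case 2 then show ?thesis using subsetD[OF dsum_subset1[OF r1]] xU x'S by (simp add: Pi_iff)
        qed
      qed
      fix v assume "v \<in> msum U (cyc y)"
      then obtain u w where uw: "u \<in> U" "w \<in> cyc y" "v = u \<oplus>\<^bsub>M\<^esub> w" by (rule msumE)
      obtain a where a: "a \<in> carrier R" "w = a \<odot>\<^bsub>M\<^esub> y" using uw(2) by (rule cycE)
      obtain e where e: "e \<in> K \<rightarrow> carrier R" "u = comb x e K" using basis_span[OF cb uw(1)] by auto
      define e' where "e' j = (if j = 1 then a else e (j - 1))" for j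
      have e'S: "e' (Suc i) = e i" if "i \<in> K" for i
      proof -
        have "i \<noteq> 0" using K0 that by metis
        then show ?thesis by (simp add: e'_def)
      qed
      have e'1: "e' 1 = a" by (simp add: e'_def)
      have e': "e' \<in> K' \<rightarrow> carrier R" using e(1) a(1) e'S e'1 unfolding K'_def by (auto simp: Pi_iff)
      have "comb x (\<lambda>j. e' (Suc j)) K = u"
        unfolding e(2) comb_def using xc e(1) e'S by (intro M.finsum_cong') (auto simp: Pi_iff)
      then have "comb x' e' K' = a \<odot>\<^bsub>M\<^esub> y \<oplus>\<^bsub>M\<^esub> u" unfolding split[OF e'] by (simp add: e'_def)
      also have "\<dots> = v" unfolding uw(3) a(2)
        by (rule M.a_comm) (use a(1) yc sm_closed[OF sU uw(1)] in simp_all)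
      finally show "\<exists>d\<in>K' \<rightarrow> carrier R. v = comb x' d K'" using e' by auto
    next
      fix e assume e: "e \<in> K' \<rightarrow> carrier R"
      have e1: "e 1 \<in> carrier R" using e unfolding K'_def by (simp add: Pi_iff)
      have cU: "comb x (\<lambda>j. e (Suc j)) K \<in> U" by (rule comb_in[OF sU fK xU Suc_in[OF e]])
      have cc: "comb x (\<lambda>j. e (Suc j)) K \<in> carrier M" by (rule sm_closed[OF sU cU])
      have "comb x' e K' = \<zero>\<^bsub>M\<^esub> \<longleftrightarrow>
        e 1 \<odot>\<^bsub>M\<^esub> y = \<zero>\<^bsub>M\<^esub> \<and> comb x (\<lambda>j. e (Suc j)) K = \<zero>\<^bsub>M\<^esub>"
      proof
        assume "comb x' e K' = \<zero>\<^bsub>M\<^esub>"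
        then have "e 1 \<odot>\<^bsub>M\<^esub> y \<oplus>\<^bsub>M\<^esub> comb x (\<lambda>j. e (Suc j)) K = \<zero>\<^bsub>M\<^esub> \<oplus>\<^bsub>M\<^esub> \<zero>\<^bsub>M\<^esub>"
          unfolding split[OF e] by simp
        from dsum_unique[OF dsum_sym[OF r1] cycI[OF e1] cU sm_zero[OF dsum_sm2[OF r1]] sm_zero[OF sU] this]
        show "e 1 \<odot>\<^bsub>M\<^esub> y = \<zero>\<^bsub>M\<^esub> \<and> comb x (\<lambda>j. e (Suc j)) K = \<zero>\<^bsub>M\<^esub>" by simp
      next
        assume "e 1 \<odot>\<^bsub>M\<^esub> y = \<zero>\<^bsub>M\<^esub> \<and> comb x (\<lambda>j. e (Suc j)) K = \<zero>\<^bsub>M\<^esub>"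
        then show "comb x' e K' = \<zero>\<^bsub>M\<^esub>" unfolding split[OF e] by simp
      qed
      also have "\<dots> \<longleftrightarrow> e 1 \<in> Q (Suc n) \<and> (\<forall>j\<in>K. e (Suc j) \<in> Q (l j))"
        unfolding yann[OF e1] basis_zero[OF cb Suc_in[OF e]] ..
      also have "\<dots> \<longleftrightarrow> (\<forall>j\<in>K'. e j \<in> Q (l' j))" unfolding K'_def using l'1 l'S by auto
      finally show "comb x' e K' = \<zero>\<^bsub>M\<^esub> \<longleftrightarrow> (\<forall>j\<in>K'. e j \<in> Q (l' j))" .
    qed
    moreover have one: "\<forall>j\<in>K'. 1 \<le> l' j" unfolding K'_def using l l'1 l'S by auto
    \<comment> \<open>\<open>y\<close> lies in \<open>Y\<close> and is killed by
      \<open>P ^ l j\<close>, but \<open>t ^ n y\<close> is nonzero, so \<open>t ^ n\<close> is not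
      in \<open>P ^ l j\<close>.\<close>
    have nl: "Suc n \<le> l j" if j: "j \<in> K" for j
    proof (rule ccontr)
      assume "\<not> Suc n \<le> l j"
      then have "t [^] n \<in> Q (l j)" by (simp add: t_pow_in_Q_iff)
      moreover have "kills P (l j) y" using kY y(1) j by simp
      ultimately show False using kills_Q y(2) by simp
    qed
    moreover from nl have "\<forall>i\<in>K'. \<forall>j\<in>K'. i \<le> j \<longrightarrow> l' i \<le> l' j"
      unfolding K'_def using mono l'1 l'S K0 by auto
    moreover have "\<forall>w\<in>W. \<forall>j\<in>K'. kills P (l' j) w"
    proof
      fix w assume "w \<in> W"
      then have w: "w \<in> Y" using dsum_subset2[OF W] by auto
      show "\<forall>j\<in>K'. kills P (l' j) w" unfolding K'_def using kn kY w l'1 l'S by auto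
    qed
    ultimately have "good (msum U (cyc y)) W (Suc m) x' l'" unfolding good_def J[folded K'_def] using r2 one by simp
    then have "msum U (cyc y) \<in> ?S" by blast
    then have "msum U (cyc y) = U" using max dsum_subset1[OF r1] by simp
    then have "y \<in> U" using dsum_subset2[OF r1] cyc_self[OF yc] by auto
    then have "y = \<zero>\<^bsub>M\<^esub>" by (rule dsum_disjoint[OF d _ y(1)])
    then show False using y(2) by simp
  qed
  then have Y0: "Y = {\<zero>\<^bsub>M\<^esub>}" using sm_zero[OF sY] by blast
  have "U = primary P" using dsum_eq[OF d] dsum_eq[OF dsum_zero_right[OF sU]] unfolding Y0 by simp
  then show ?thesis using cb l mono by auto
qed

end

section \<open>Quotient modules and external direct sums\<close>

context cring
begin

lemma
  assumes I: "ideal I R"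
  shows quotient_module_carrier: "carrier (quotient_module R I) = {I +> a | a. a \<in> carrier R}"
    and quotient_module_add: "\<lbrakk>a \<in> carrier R; b \<in> carrier R\<rbrakk> \<Longrightarrow>
      (I +> a) \<oplus>\<^bsub>quotient_module R I\<^esub> (I +> b) = I +> (a \<oplus> b)"
    and quotient_module_smult: "\<lbrakk>a \<in> carrier R; b \<in> carrier R\<rbrakk> \<Longrightarrow>
      a \<odot>\<^bsub>quotient_module R I\<^esub> (I +> b) = I +> (a \<otimes> b)"
    and coset_eq_iff: "\<lbrakk>a \<in> carrier R; b \<in> carrier R\<rbrakk> \<Longrightarrow> I +> a = I +> b \<longleftrightarrow> a \<ominus> b \<in> I"
proof -
  have sg: "abelian_subgroup I R"
    by (rule abelian_subgroupI3[OF ideal.axioms(1)[OF I] is_abelian_group])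
  show "carrier (quotient_module R I) = {I +> a | a. a \<in> carrier R}"
    unfolding quotient_module_def FactRing_def A_RCOSETS_def' by auto
  show "\<lbrakk>a \<in> carrier R; b \<in> carrier R\<rbrakk> \<Longrightarrow>
      (I +> a) \<oplus>\<^bsub>quotient_module R I\<^esub> (I +> b) = I +> (a \<oplus> b)"
    unfolding quotient_module_def FactRing_def by (simp add: abelian_subgroup.a_rcos_sum[OF sg])
  show "\<lbrakk>a \<in> carrier R; b \<in> carrier R\<rbrakk> \<Longrightarrow>
      a \<odot>\<^bsub>quotient_module R I\<^esub> (I +> b) = I +> (a \<otimes> b)"
    unfolding quotient_module_def FactRing_def by (simp add: ideal.rcoset_mult_add[OF I])
  show "\<lbrakk>a \<in> carrier R; b \<in> carrier R\<rbrakk> \<Longrightarrow> I +> a = I +> b \<longleftrightarrow> a \<ominus> b \<in> I"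
    using quotient_eq_iff_same_a_r_cos[OF I, of a b] by simp
qed

end

context dedekind_prime_module
begin

text \<open>Elements of the external sum are named by representatives in \<open>R\<close>, so that
  all computations take place with coefficient families as in \<open>comb\<close>.\<close>

definition coset_tuple :: "(nat \<Rightarrow> nat) \<Rightarrow> nat set \<Rightarrow> (nat \<Rightarrow> 'a) \<Rightarrow> nat \<Rightarrow> 'a set" where
  "coset_tuple l J d = (\<lambda>j\<in>J. Q (l j) +>\<^bsub>R\<^esub> d j)"

abbreviation qsum :: "(nat \<Rightarrow> nat) \<Rightarrow> nat set \<Rightarrow> ('a, nat \<Rightarrow> 'a set) module" where
  "qsum l J \<equiv> finite_direct_sum J (\<lambda>j. quotient_module R (ideal_pow R P (l j)))"

lemma coset_tuple_carrier:
  assumes "d \<in> J \<rightarrow> carrier R" shows "coset_tuple l J d \<in> carrier (qsum l J)"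
  unfolding finite_direct_sum_def coset_tuple_def Q_def[symmetric] using assms
  by (auto simp: R.quotient_module_carrier[OF Q_ideal])

lemma coset_tuple_surj:
  assumes "c \<in> carrier (qsum l J)" shows "\<exists>d\<in>J \<rightarrow> carrier R. c = coset_tuple l J d"
proof -
  have c: "c \<in> (\<Pi>\<^sub>E j\<in>J. carrier (quotient_module R (Q (l j))))"
    using assms unfolding finite_direct_sum_def Q_def[symmetric] by simp
  have "\<exists>a. a \<in> carrier R \<and> c j = Q (l j) +>\<^bsub>R\<^esub> a" if j: "j \<in> J" for j
    using PiE_mem[OF c j] unfolding R.quotient_module_carrier[OF Q_ideal] by auto
  then obtain d where d: "\<And>j. j \<in> J \<Longrightarrow> d j \<in> carrier R \<and> c j = Q (l j) +>\<^bsub>R\<^esub> d j" by metis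
  have "c = coset_tuple l J d"
  proof
    fix j show "c j = coset_tuple l J d j"
      using d c PiE_arb[OF c, of j] unfolding coset_tuple_def by (cases "j \<in> J") auto
  qed
  then show ?thesis using d by (intro bexI[of _ d]) auto
qed

lemma coset_tuple_add:
  assumes "d \<in> J \<rightarrow> carrier R" "e \<in> J \<rightarrow> carrier R"
  shows "coset_tuple l J d \<oplus>\<^bsub>qsum l J\<^esub> coset_tuple l J e = coset_tuple l J (\<lambda>j. d j \<oplus> e j)"
  unfolding finite_direct_sum_def coset_tuple_def Q_def[symmetric] using assms
  by (auto simp: Pi_iff R.quotient_module_add[OF Q_ideal] intro!: restrict_ext)

lemma coset_tuple_smult:
  assumes "d \<in> J \<rightarrow> carrier R" "a \<in> carrier R"
  shows "a \<odot>\<^bsub>qsum l J\<^esub> coset_tuple l J d = coset_tuple l J (\<lambda>j. a \<otimes> d j)"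
  unfolding finite_direct_sum_def coset_tuple_def Q_def[symmetric] using assms
  by (auto simp: Pi_iff R.quotient_module_smult[OF Q_ideal] intro!: restrict_ext)

lemma coset_tuple_eq_iff:
  assumes "d \<in> J \<rightarrow> carrier R" "e \<in> J \<rightarrow> carrier R"
  shows "coset_tuple l J d = coset_tuple l J e \<longleftrightarrow> (\<forall>j\<in>J. d j \<ominus> e j \<in> Q (l j))"
proof -
  have "coset_tuple l J d = coset_tuple l J e \<longleftrightarrow> (\<forall>j\<in>J. Q (l j) +>\<^bsub>R\<^esub> d j = Q (l j) +>\<^bsub>R\<^esub> e j)"
  proof
    assume e: "coset_tuple l J d = coset_tuple l J e"
    show "\<forall>j\<in>J. Q (l j) +>\<^bsub>R\<^esub> d j = Q (l j) +>\<^bsub>R\<^esub> e j"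
    proof
      fix j assume "j \<in> J"
      then show "Q (l j) +>\<^bsub>R\<^esub> d j = Q (l j) +>\<^bsub>R\<^esub> e j"
        using fun_cong[OF e, of j] by (simp add: coset_tuple_def)
    qed
  qed (auto simp: coset_tuple_def intro: restrict_ext)
  then show ?thesis using assms by (simp add: Pi_iff R.coset_eq_iff[OF Q_ideal])
qed

text \<open>The map sends an element to the cosets of some choice of coordinates. By the relation
  clause of \<open>cyclic_basis\<close>, two families represent the same element exactly when they
  have the same cosets, so the choice is harmless and the map is bijective.\<close>

lemma basis_imp_iso:
  assumes cb: "cyclic_basis P x l J T" and J: "finite J" and T: "sm T"
  shows "module_iso R (M\<lparr>carrier := T\<rparr>) (qsum l J) \<noteq> {}"
proof -
  have x: "x \<in> J \<rightarrow> carrier M" using basis_in[OF cb] sm_closed[OF T] by auto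
  have xT: "x \<in> J \<rightarrow> T" using basis_in[OF cb] by auto
  define c where "c y = (SOME d. d \<in> J \<rightarrow> carrier R \<and> y = comb x d J)" for y
  have c: "c y \<in> J \<rightarrow> carrier R" "y = comb x (c y) J" if "y \<in> T" for y
  proof -
    have "\<exists>d. d \<in> J \<rightarrow> carrier R \<and> y = comb x d J" using basis_span[OF cb that] by (elim bexE) auto
    from someI_ex[OF this] have "c y \<in> J \<rightarrow> carrier R \<and> y = comb x (c y) J" unfolding c_def .
    then show "c y \<in> J \<rightarrow> carrier R" "y = comb x (c y) J" by simp_all
  qed
  have iff: "comb x d J = comb x e J \<longleftrightarrow> coset_tuple l J d = coset_tuple l J e"
    if d: "d \<in> J \<rightarrow> carrier R" "e \<in> J \<rightarrow> carrier R" for d e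
  proof -
    have de: "(\<lambda>j. d j \<ominus> e j) \<in> J \<rightarrow> carrier R" using d by (auto simp: Pi_iff)
    show ?thesis unfolding coset_tuple_eq_iff[OF d] comb_diff_zero_iff[OF J x d, symmetric] basis_zero[OF cb de] ..
  qed
  define f where "f y = coset_tuple l J (c y)" for y
  have fc: "f (comb x d J) = coset_tuple l J d" if d: "d \<in> J \<rightarrow> carrier R" for d
  proof -
    have "comb x d J \<in> T" by (rule comb_in[OF T J xT d])
    then show ?thesis unfolding f_def using iff[OF c(1) d] c(2) by metis
  qed
  have "f \<in> module_hom R (M\<lparr>carrier := T\<rparr>) (qsum l J)" unfolding module_hom_def
  proof (intro CollectI conjI allI impI)
    show "f \<in> carrier (M\<lparr>carrier := T\<rparr>) \<rightarrow> carrier (qsum l J)"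
      using coset_tuple_carrier[OF c(1)] unfolding f_def by auto
    fix y z assume "y \<in> carrier (M\<lparr>carrier := T\<rparr>) \<and> z \<in> carrier (M\<lparr>carrier := T\<rparr>)"
    then have y: "y \<in> T" and z: "z \<in> T" by simp_all
    have cc: "(\<lambda>j. c y j \<oplus> c z j) \<in> J \<rightarrow> carrier R" using c(1)[OF y] c(1)[OF z] by (auto simp: Pi_iff)
    have "y \<oplus>\<^bsub>M\<^esub> z = comb x (\<lambda>j. c y j \<oplus> c z j) J"
      unfolding comb_add[OF x c(1)[OF y] c(1)[OF z]] using c(2)[OF y] c(2)[OF z] by simp
    then show "f (y \<oplus>\<^bsub>M\<lparr>carrier := T\<rparr>\<^esub> z) = f y \<oplus>\<^bsub>qsum l J\<^esub> f z"
      using fc[OF cc] coset_tuple_add[OF c(1)[OF y] c(1)[OF z], of l] by (simp add: f_def)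
  next
    fix a y assume "a \<in> carrier R \<and> y \<in> carrier (M\<lparr>carrier := T\<rparr>)"
    then have a: "a \<in> carrier R" and y: "y \<in> T" by simp_all
    have cc: "(\<lambda>j. a \<otimes> c y j) \<in> J \<rightarrow> carrier R" using c(1)[OF y] a by (auto simp: Pi_iff)
    have "a \<odot>\<^bsub>M\<^esub> y = comb x (\<lambda>j. a \<otimes> c y j) J"
      unfolding comb_smult[OF J x c(1)[OF y] a] using c(2)[OF y] by simp
    then show "f (a \<odot>\<^bsub>M\<lparr>carrier := T\<rparr>\<^esub> y) = a \<odot>\<^bsub>qsum l J\<^esub> f y"
      using fc[OF cc] coset_tuple_smult[OF c(1)[OF y] a, of l] by (simp add: f_def)
  qed
  moreover have "bij_betw f T (carrier (qsum l J))" unfolding bij_betw_def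
  proof
    show "inj_on f T"
    proof (rule inj_onI)
      fix y z assume y: "y \<in> T" and z: "z \<in> T" and "f y = f z"
      then have "comb x (c y) J = comb x (c z) J" unfolding f_def iff[OF c(1)[OF y] c(1)[OF z]] by simp
      then show "y = z" using c(2)[OF y] c(2)[OF z] by simp
    qed
    show "f ` T = carrier (qsum l J)"
    proof (intro subset_antisym subsetI)
      show "v \<in> carrier (qsum l J)" if "v \<in> f ` T" for v
        using that coset_tuple_carrier[OF c(1)] unfolding f_def by auto
      fix v assume "v \<in> carrier (qsum l J)"
      then obtain d where d: "d \<in> J \<rightarrow> carrier R" "v = coset_tuple l J d" using coset_tuple_surj by blast
      show "v \<in> f ` T" unfolding d(2) fc[OF d(1), symmetric] by (rule imageI[OF comb_in[OF T J xT d(1)]])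
    qed
  qed
  ultimately have "f \<in> module_iso R (M\<lparr>carrier := T\<rparr>) (qsum l J)" unfolding module_iso_def by simp
  then show ?thesis by auto
qed

text \<open>The basis elements are the preimages of the tuples \<open>\<delta> j\<close> with a one
  at \<open>j\<close> and zeros elsewhere; under the isomorphism combinations become coset
  tuples.\<close>

lemma iso_imp_basis:
  assumes iso: "module_iso R (M\<lparr>carrier := T\<rparr>) (qsum l J) \<noteq> {}" and J: "finite J" and T: "sm T"
  shows "\<exists>x. cyclic_basis P x l J T"
proof -
  obtain f where f: "f \<in> module_hom R (M\<lparr>carrier := T\<rparr>) (qsum l J)" "bij_betw f T (carrier (qsum l J))"
    using iso unfolding module_iso_def by (simp, elim exE conjE) (rule that)
  have fadd: "f (y \<oplus>\<^bsub>M\<^esub> z) = f y \<oplus>\<^bsub>qsum l J\<^esub> f z" if "y \<in> T" "z \<in> T" for y z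
    using f(1) that unfolding module_hom_def by simp
  have fsm: "f (a \<odot>\<^bsub>M\<^esub> y) = a \<odot>\<^bsub>qsum l J\<^esub> f y" if "a \<in> carrier R" "y \<in> T" for a y
    using f(1) that unfolding module_hom_def by simp
  have inj: "y = z" if "f y = f z" "y \<in> T" "z \<in> T" for y z
    using f(2) that unfolding bij_betw_def by (auto dest: inj_onD)
  define \<delta> where "\<delta> j = (\<lambda>i. if i = j then \<one> else \<zero>)" for j :: nat
  have \<delta>: "\<delta> j \<in> A \<rightarrow> carrier R" for j A unfolding \<delta>_def by auto
  define x where "x j = (SOME y. y \<in> T \<and> f y = coset_tuple l J (\<delta> j))" for j
  have x: "x j \<in> T \<and> f (x j) = coset_tuple l J (\<delta> j)" for j
  proof -
    have "coset_tuple l J (\<delta> j) \<in> f ` T" using f(2) coset_tuple_carrier[OF \<delta>] unfolding bij_betw_def by simp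
    then have "\<exists>y. y \<in> T \<and> f y = coset_tuple l J (\<delta> j)" by (elim imageE) (rule exI, rule conjI, assumption, simp)
    from someI_ex[OF this] show ?thesis unfolding x_def .
  qed
  have xT: "x \<in> A \<rightarrow> T" and xc: "x \<in> A \<rightarrow> carrier M" for A using x sm_closed[OF T] by auto
  have f0: "f \<zero>\<^bsub>M\<^esub> = coset_tuple l J (\<lambda>_. \<zero>)"
  proof -
    have "f (\<zero> \<odot>\<^bsub>M\<^esub> x 0) = \<zero> \<odot>\<^bsub>qsum l J\<^esub> coset_tuple l J (\<delta> 0)" using fsm[OF R.zero_closed, of "x 0"] x by simp
    also have "\<dots> = coset_tuple l J (\<lambda>j. \<zero> \<otimes> \<delta> 0 j)" by (rule coset_tuple_smult[OF \<delta> R.zero_closed])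
    also have "(\<lambda>j. \<zero> \<otimes> \<delta> 0 j) = (\<lambda>_. \<zero>)" unfolding \<delta>_def by auto
    finally show ?thesis using sm_closed[OF T] x by simp
  qed
  \<comment> \<open>The induction runs over index sets \<open>A\<close> while the tuples stay
    indexed by \<open>J\<close>, so the coefficients are extended by zero outside
    \<open>A\<close>.\<close>
  have fA: "f (comb x d A) = coset_tuple l J (\<lambda>j. if j \<in> A then d j else \<zero>)"
    if "finite A" "d \<in> A \<rightarrow> carrier R" for A d using that
  proof (induction A rule: finite_induct)
    case empty then show ?case by (simp add: comb_def f0)
  next
    case (insert a A)
    have da: "d a \<in> carrier R" and dA: "d \<in> A \<rightarrow> carrier R" using insert.prems by auto
    have cT: "comb x d A \<in> T" by (rule comb_in[OF T insert.hyps(1) xT dA])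
    have axT: "d a \<odot>\<^bsub>M\<^esub> x a \<in> T" using sm_smult[OF T da] x by simp
    let ?g = "\<lambda>j. if j \<in> A then d j else \<zero>"
    have g: "?g \<in> J \<rightarrow> carrier R" using dA by auto
    have ag: "(\<lambda>j. d a \<otimes> \<delta> a j) \<in> J \<rightarrow> carrier R" using da \<delta> by (auto simp: \<delta>_def)
    have "f (comb x d (insert a A)) = f (d a \<odot>\<^bsub>M\<^esub> x a) \<oplus>\<^bsub>qsum l J\<^esub> f (comb x d A)"
      unfolding comb_insert[OF insert.hyps xc insert.prems] by (rule fadd[OF axT cT])
    also have "f (d a \<odot>\<^bsub>M\<^esub> x a) = coset_tuple l J (\<lambda>j. d a \<otimes> \<delta> a j)"
      using fsm[OF da, of "x a"] x coset_tuple_smult[OF \<delta> da] by simp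
    also have "coset_tuple l J (\<lambda>j. d a \<otimes> \<delta> a j) \<oplus>\<^bsub>qsum l J\<^esub> f (comb x d A) =
      coset_tuple l J (\<lambda>j. d a \<otimes> \<delta> a j \<oplus> ?g j)"
      unfolding insert.IH[OF dA] by (rule coset_tuple_add[OF ag g])
    also have "(\<lambda>j. d a \<otimes> \<delta> a j \<oplus> ?g j) = (\<lambda>j. if j \<in> insert a A then d j else \<zero>)"
    proof
      fix j show "d a \<otimes> \<delta> a j \<oplus> ?g j = (if j \<in> insert a A then d j else \<zero>)"
        using da dA insert.hyps(2) unfolding \<delta>_def by (cases "j = a") (auto simp: Pi_iff)
    qed
    finally show ?case .
  qed
  have fJ: "f (comb x d J) = coset_tuple l J d" if d: "d \<in> J \<rightarrow> carrier R" for d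
    unfolding fA[OF J d] coset_tuple_def by (rule restrict_ext) simp
  have "cyclic_basis P x l J T" unfolding cyclic_basis_def Q_def[symmetric]
  proof (intro conjI ballI)
    show "x \<in> J \<rightarrow> T" by (rule xT)
    fix y assume y: "y \<in> T"
    have "f y \<in> carrier (qsum l J)" using f(2) y unfolding bij_betw_def by auto
    then obtain d where d: "d \<in> J \<rightarrow> carrier R" "f y = coset_tuple l J d" using coset_tuple_surj by blast
    have "y = comb x d J" by (rule inj[OF _ y comb_in[OF T J xT d(1)]]) (simp only: fJ[OF d(1)] d(2))
    then show "\<exists>d\<in>J \<rightarrow> carrier R. y = comb x d J" using d(1) by auto
  next
    fix d assume d: "d \<in> J \<rightarrow> carrier R"
    have z: "(\<lambda>_. \<zero>) \<in> J \<rightarrow> carrier R" by simp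
    have "comb x d J = \<zero>\<^bsub>M\<^esub> \<longleftrightarrow> f (comb x d J) = f \<zero>\<^bsub>M\<^esub>"
      using inj[OF _ comb_in[OF T J xT d] sm_zero[OF T]] by auto
    also have "\<dots> \<longleftrightarrow> (\<forall>j\<in>J. d j \<ominus> \<zero> \<in> Q (l j))"
      unfolding fJ[OF d] f0 by (rule coset_tuple_eq_iff[OF d z])
    also have "\<dots> \<longleftrightarrow> (\<forall>j\<in>J. d j \<in> Q (l j))" using d by (auto simp: a_minus_def Pi_iff)
    finally show "comb x d J = \<zero>\<^bsub>M\<^esub> \<longleftrightarrow> (\<forall>j\<in>J. d j \<in> Q (l j))" .
  qed
  then show ?thesis by auto
qed

end

subsection \<open>Rank\<close>

text \<open>Base change to an arbitrary field along a ring homomorphism; the fraction field is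
  substituted only for computing the rank.\<close>

locale scalar_ext = module R M + K: field K + i: ring_hom_ring R K \<iota> for R (structure) and M and K and \<iota>
begin

abbreviation gens :: "('e \<times> 'c) set" where "gens \<equiv> carrier K \<times> carrier M"
abbreviation F where "F \<equiv> free_Abelian_group gens"
abbreviation rel where "rel \<equiv> tensor_relations R K \<iota> M"
abbreviation V where "V \<equiv> scalar_extension R K \<iota> M"

text \<open>The action of \<open>k\<close> on formal sums, before passing to the quotient by the
  relations.\<close>

definition act :: "'e \<Rightarrow> (('e \<times> 'c) \<Rightarrow>\<^sub>0 int) \<Rightarrow> (('e \<times> 'c) \<Rightarrow>\<^sub>0 int)" where
  "act k = frag_extend (\<lambda>(x, m). frag_of (k \<otimes>\<^bsub>K\<^esub> x, m))"

definition cls :: "(('e \<times> 'c) \<Rightarrow>\<^sub>0 int) \<Rightarrow> (('e \<times> 'c) \<Rightarrow>\<^sub>0 int) set" where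
  "cls c = rel #>\<^bsub>F\<^esub> c"

definition relators :: "(('e \<times> 'c) \<Rightarrow>\<^sub>0 int) set" where
  "relators = {frag_of (x \<oplus>\<^bsub>K\<^esub> y, m) - frag_of (x, m) - frag_of (y, m) | x y m.
           x \<in> carrier K \<and> y \<in> carrier K \<and> m \<in> carrier M} \<union>
        {frag_of (x, m \<oplus>\<^bsub>M\<^esub> n) - frag_of (x, m) - frag_of (x, n) | x m n.
           x \<in> carrier K \<and> m \<in> carrier M \<and> n \<in> carrier M} \<union>
        {frag_of (x \<otimes>\<^bsub>K\<^esub> \<iota> a, m) - frag_of (x, a \<odot>\<^bsub>M\<^esub> m) | x a m.
           x \<in> carrier K \<and> a \<in> carrier R \<and> m \<in> carrier M}"

lemma rel_eq: "rel = generate F relators"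
  by (simp add: tensor_relations_def relators_def)

lemma relator_cases:
  assumes "r \<in> relators"
  obtains x y m where "x \<in> carrier K" "y \<in> carrier K" "m \<in> carrier M"
      "r = frag_of (x \<oplus>\<^bsub>K\<^esub> y, m) - frag_of (x, m) - frag_of (y, m)"
  | x m n where "x \<in> carrier K" "m \<in> carrier M" "n \<in> carrier M"
      "r = frag_of (x, m \<oplus>\<^bsub>M\<^esub> n) - frag_of (x, m) - frag_of (x, n)"
  | x a m where "x \<in> carrier K" "a \<in> carrier R" "m \<in> carrier M"
      "r = frag_of (x \<otimes>\<^bsub>K\<^esub> \<iota> a, m) - frag_of (x, a \<odot>\<^bsub>M\<^esub> m)"
  using assms unfolding relators_def by (elim UnE CollectE exE conjE) auto

lemma relators:
  "\<lbrakk>x \<in> carrier K; y \<in> carrier K; m \<in> carrier M\<rbrakk> \<Longrightarrow>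
    frag_of (x \<oplus>\<^bsub>K\<^esub> y, m) - frag_of (x, m) - frag_of (y, m) \<in> relators"
  "\<lbrakk>x \<in> carrier K; m \<in> carrier M; n \<in> carrier M\<rbrakk> \<Longrightarrow>
    frag_of (x, m \<oplus>\<^bsub>M\<^esub> n) - frag_of (x, m) - frag_of (x, n) \<in> relators"
  "\<lbrakk>x \<in> carrier K; a \<in> carrier R; m \<in> carrier M\<rbrakk> \<Longrightarrow>
    frag_of (x \<otimes>\<^bsub>K\<^esub> \<iota> a, m) - frag_of (x, a \<odot>\<^bsub>M\<^esub> m) \<in> relators"
  unfolding relators_def by blast+

lemma keys_diff: "\<lbrakk>Poly_Mapping.keys a \<subseteq> S; Poly_Mapping.keys b \<subseteq> S\<rbrakk> \<Longrightarrow> Poly_Mapping.keys (a - b) \<subseteq> S"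
  using keys_diff[of a b] by blast

lemma keys_plus: "\<lbrakk>Poly_Mapping.keys a \<subseteq> S; Poly_Mapping.keys b \<subseteq> S\<rbrakk> \<Longrightarrow> Poly_Mapping.keys (a + b) \<subseteq> S"
  using keys_add[of a b] by blast

lemma keys_of: "\<lbrakk>k \<in> carrier K; m \<in> carrier M\<rbrakk> \<Longrightarrow> Poly_Mapping.keys (frag_of (k, m)) \<subseteq> gens"
  by simp

lemma relators_carrier: "relators \<subseteq> carrier F"
proof
  fix r assume "r \<in> relators"
  then have "Poly_Mapping.keys r \<subseteq> gens"
    by (cases rule: relator_cases) (simp_all add: keys_diff keys_of)
  then show "r \<in> carrier F" by simp
qed

lemma rel_subgroup: "subgroup rel F"
  unfolding rel_eq by (rule group.generate_is_subgroup[OF group_free_Abelian_group relators_carrier])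

lemma
  shows rel_keys: "c \<in> rel \<Longrightarrow> Poly_Mapping.keys c \<subseteq> gens"
    and rel_zero: "0 \<in> rel" and rel_plus: "\<lbrakk>c \<in> rel; d \<in> rel\<rbrakk> \<Longrightarrow> c + d \<in> rel"
    and rel_uminus: "c \<in> rel \<Longrightarrow> - c \<in> rel" and rel_diff: "\<lbrakk>c \<in> rel; d \<in> rel\<rbrakk> \<Longrightarrow> c - d \<in> rel"
proof -
  show k: "c \<in> rel \<Longrightarrow> Poly_Mapping.keys c \<subseteq> gens" for c
    using subgroup.mem_carrier[OF rel_subgroup, of c] by simp
  show "0 \<in> rel" using subgroup.one_closed[OF rel_subgroup] by simp
  show p: "\<lbrakk>c \<in> rel; d \<in> rel\<rbrakk> \<Longrightarrow> c + d \<in> rel" for c d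
    using subgroup.m_closed[OF rel_subgroup, of c d] by simp
  show u: "c \<in> rel \<Longrightarrow> - c \<in> rel" for c
    using subgroup.m_inv_closed[OF rel_subgroup, of c] k[of c] by simp
  show "\<lbrakk>c \<in> rel; d \<in> rel\<rbrakk> \<Longrightarrow> c - d \<in> rel" using p[of c "- d"] u[of d] by simp
qed

lemma relator_in_rel: "r \<in> relators \<Longrightarrow> r \<in> rel"
  unfolding rel_eq by (rule generate.incl)

lemma cls_mem: "c \<in> cls d \<longleftrightarrow> c - d \<in> rel"
  unfolding cls_def r_coset_def mult_free_Abelian_group
proof
  assume "c \<in> (\<Union>h\<in>rel. {h + d})"
  then obtain h where "h \<in> rel" "c = h + d" by blast
  then show "c - d \<in> rel" by simp
next
  assume "c - d \<in> rel"
  then show "c \<in> (\<Union>h\<in>rel. {h + d})" by (intro UN_I[of "c - d"]) simp_all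
qed

lemma cls_eq_iff: "cls c = cls d \<longleftrightarrow> c - d \<in> rel"
proof
  assume "cls c = cls d"
  moreover have "c \<in> cls c" unfolding cls_mem by (simp add: rel_zero)
  ultimately show "c - d \<in> rel" using cls_mem[of c d] by simp
next
  assume cd: "c - d \<in> rel"
  have "e - c \<in> rel \<longleftrightarrow> e - d \<in> rel" for e
  proof
    assume "e - c \<in> rel"
    from rel_plus[OF this cd] show "e - d \<in> rel" by simp
  next
    assume "e - d \<in> rel"
    from rel_diff[OF this cd] show "e - c \<in> rel" by simp
  qed
  then show "cls c = cls d" by (intro subset_antisym subsetI) (simp_all add: cls_mem)
qed

lemma act_simps: "act k 0 = 0" "act k (c + d) = act k c + act k d" "act k (c - d) = act k c - act k d"
  "act k (- c) = - act k c" "act k (frag_of (x, m)) = frag_of (k \<otimes>\<^bsub>K\<^esub> x, m)"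
  unfolding act_def by (simp_all add: frag_extend_add frag_extend_diff frag_extend_minus)

lemma gens_induct [consumes 1, case_names zero diff gen]:
  assumes "Poly_Mapping.keys c \<subseteq> gens" and "Pr 0"
    and "\<And>x y. \<lbrakk>Poly_Mapping.keys x \<subseteq> gens; Poly_Mapping.keys y \<subseteq> gens; Pr x; Pr y\<rbrakk> \<Longrightarrow> Pr (x - y)"
    and "\<And>k m. \<lbrakk>k \<in> carrier K; m \<in> carrier M\<rbrakk> \<Longrightarrow> Pr (frag_of (k, m))"
  shows "Pr c"
  by (rule free_Abelian_group_induct[of c gens Pr]) (use assms in auto)

lemma act_keys:
  assumes "k \<in> carrier K" "Poly_Mapping.keys c \<subseteq> gens" shows "Poly_Mapping.keys (act k c) \<subseteq> gens"
  using assms(2)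
proof (induction rule: gens_induct)
  case (gen x m) then show ?case using assms(1) by (simp add: act_simps)
qed (simp_all add: act_simps keys_diff)

text \<open>The action multiplies the first factor from the left, and each family of relators is
  stable under this; hence the action descends to the tensor product.\<close>

lemma act_relator:
  assumes k: "k \<in> carrier K" and r: "r \<in> relators" shows "act k r \<in> relators"
  using r
proof (cases rule: relator_cases)
  case (1 x y m)
  then show ?thesis using relators(1)[of "k \<otimes>\<^bsub>K\<^esub> x" "k \<otimes>\<^bsub>K\<^esub> y" m] k by (simp add: act_simps K.r_distr)
next
  case (2 x m n)
  then show ?thesis using relators(2)[of "k \<otimes>\<^bsub>K\<^esub> x" m n] k by (simp add: act_simps)
next
  case (3 x a m)
  then show ?thesis using relators(3)[of "k \<otimes>\<^bsub>K\<^esub> x" a m] k by (simp add: act_simps K.m_assoc)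
qed

lemma act_rel:
  assumes k: "k \<in> carrier K" and r: "r \<in> rel" shows "act k r \<in> rel"
  using r unfolding rel_eq
proof (induction rule: generate.induct)
  case one then show ?case using rel_zero by (simp add: act_simps rel_eq)
next
  case (incl h) then show ?case using relator_in_rel[OF act_relator[OF k]] by (simp add: rel_eq)
next
  case (inv h)
  have "Poly_Mapping.keys h \<subseteq> gens" using subsetD[OF relators_carrier inv] by simp
  then show ?case using rel_uminus[OF relator_in_rel[OF act_relator[OF k inv]]] by (simp add: act_simps rel_eq)
next
  case (eng h1 h2) then show ?case using rel_plus by (simp add: act_simps rel_eq)
qed

lemma V_carrier: "carrier V = cls ` {c. Poly_Mapping.keys c \<subseteq> gens}"
  unfolding scalar_extension_def Let_def FactGroup_def RCOSETS_def cls_def by auto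

lemma V_zero: "\<zero>\<^bsub>V\<^esub> = cls 0"
proof -
  have "rel = cls 0" by (intro subset_antisym subsetI) (simp_all add: cls_mem)
  then show ?thesis unfolding scalar_extension_def Let_def FactGroup_def by simp
qed

lemma V_add: "cls c \<oplus>\<^bsub>V\<^esub> cls d = cls (c + d)"
proof -
  have "cls c \<oplus>\<^bsub>V\<^esub> cls d = cls c <#>\<^bsub>F\<^esub> cls d" unfolding scalar_extension_def Let_def FactGroup_def by simp
  also have "\<dots> = cls (c + d)"
  proof (intro subset_antisym subsetI)
    fix u assume "u \<in> cls c <#>\<^bsub>F\<^esub> cls d"
    then obtain a b where ab: "a \<in> cls c" "b \<in> cls d" "u = a + b" unfolding set_mult_def by auto
    have e: "u - (c + d) = (a - c) + (b - d)" unfolding ab(3) by simp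
    show "u \<in> cls (c + d)" unfolding cls_mem e by (rule rel_plus[OF ab(1,2)[unfolded cls_mem]])
  next
    fix u assume u: "u \<in> cls (c + d)"
    have e: "u - d - c = u - (c + d)" by simp
    have "u - d \<in> cls c" unfolding cls_mem e by (rule u[unfolded cls_mem])
    moreover have "d \<in> cls d" by (simp add: cls_mem rel_zero)
    ultimately have "(u - d) \<otimes>\<^bsub>F\<^esub> d \<in> cls c <#>\<^bsub>F\<^esub> cls d" unfolding set_mult_def by blast
    then show "u \<in> cls c <#>\<^bsub>F\<^esub> cls d" by simp
  qed
  finally show ?thesis .
qed

lemma V_smult:
  assumes k: "k \<in> carrier K" shows "k \<odot>\<^bsub>V\<^esub> cls c = cls (act k c)"
proof -
  have "k \<odot>\<^bsub>V\<^esub> cls c = (\<Union>d\<in>cls c. cls (act k d))"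
    unfolding scalar_extension_def Let_def cls_def act_def by simp
  moreover have "cls (act k d) = cls (act k c)" if "d \<in> cls c" for d
    using act_rel[OF k, of "d - c"] that unfolding cls_eq_iff cls_mem by (simp add: act_simps)
  moreover have "c \<in> cls c" by (simp add: cls_mem rel_zero)
  ultimately show ?thesis by blast
qed

lemma V_module: "module K V"
proof (rule moduleI)
  have E: "\<exists>c. Poly_Mapping.keys c \<subseteq> gens \<and> x = cls c" if "x \<in> carrier V" for x
    using that unfolding V_carrier by auto
  have I: "cls c \<in> carrier V" if "Poly_Mapping.keys c \<subseteq> gens" for c
    using that unfolding V_carrier by simp
  show "cring K" by (rule K.cring_axioms)
  show "abelian_group V"
  proof (rule abelian_groupI)
    show "\<zero>\<^bsub>V\<^esub> \<in> carrier V" unfolding V_zero by (rule I) simp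
    fix x assume "x \<in> carrier V"
    then obtain c where c: "Poly_Mapping.keys c \<subseteq> gens" "x = cls c" using E by blast
    show "\<zero>\<^bsub>V\<^esub> \<oplus>\<^bsub>V\<^esub> x = x" unfolding V_zero c(2) V_add by simp
    have "cls (- c) \<oplus>\<^bsub>V\<^esub> x = \<zero>\<^bsub>V\<^esub>" unfolding V_zero c(2) V_add by simp
    moreover have "cls (- c) \<in> carrier V" by (rule I) (use c(1) in simp)
    ultimately show "\<exists>y\<in>carrier V. y \<oplus>\<^bsub>V\<^esub> x = \<zero>\<^bsub>V\<^esub>" by (intro bexI)
    fix y assume "y \<in> carrier V"
    then obtain d where d: "Poly_Mapping.keys d \<subseteq> gens" "y = cls d" using E by blast
    show "x \<oplus>\<^bsub>V\<^esub> y \<in> carrier V" unfolding c(2) d(2) V_add by (rule I[OF keys_plus[OF c(1) d(1)]])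
    show "x \<oplus>\<^bsub>V\<^esub> y = y \<oplus>\<^bsub>V\<^esub> x" unfolding c(2) d(2) V_add by (simp add: add.commute)
    fix z assume "z \<in> carrier V"
    then obtain e where e: "z = cls e" using E by blast
    show "x \<oplus>\<^bsub>V\<^esub> y \<oplus>\<^bsub>V\<^esub> z = x \<oplus>\<^bsub>V\<^esub> (y \<oplus>\<^bsub>V\<^esub> z)" unfolding c(2) d(2) e V_add by (simp add: add.assoc)
  qed
  fix a x assume a: "a \<in> carrier K" and "x \<in> carrier V"
  then obtain c where c: "Poly_Mapping.keys c \<subseteq> gens" "x = cls c" using E by blast
  show "a \<odot>\<^bsub>V\<^esub> x \<in> carrier V" unfolding c(2) V_smult[OF a] by (rule I[OF act_keys[OF a c(1)]])
  show "a \<odot>\<^bsub>V\<^esub> (x \<oplus>\<^bsub>V\<^esub> y) = a \<odot>\<^bsub>V\<^esub> x \<oplus>\<^bsub>V\<^esub> a \<odot>\<^bsub>V\<^esub> y" if y: "y \<in> carrier V" for y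
  proof -
    obtain d where d: "y = cls d" using E[OF y] by blast
    show ?thesis unfolding c(2) d V_add V_smult[OF a] act_simps ..
  qed
  fix b assume b: "b \<in> carrier K"
  have ab: "a \<oplus>\<^bsub>K\<^esub> b \<in> carrier K" and amb: "a \<otimes>\<^bsub>K\<^esub> b \<in> carrier K" using a b by simp_all
  \<comment> \<open>This is the one module axiom that holds only modulo the relators; the first
    family of relators is made for it.\<close>
  have "act (a \<oplus>\<^bsub>K\<^esub> b) c - (act a c + act b c) \<in> rel" using c(1)
  proof (induction rule: gens_induct)
    case zero then show ?case by (simp add: act_simps rel_zero)
  next
    case (diff x y)
    have "act (a \<oplus>\<^bsub>K\<^esub> b) (x - y) - (act a (x - y) + act b (x - y)) =
      (act (a \<oplus>\<^bsub>K\<^esub> b) x - (act a x + act b x)) - (act (a \<oplus>\<^bsub>K\<^esub> b) y - (act a y + act b y))"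
      by (simp add: act_simps)
    then show ?case using rel_diff[OF diff.IH] by simp
  next
    case (gen k m)
    have "frag_of (a \<otimes>\<^bsub>K\<^esub> k \<oplus>\<^bsub>K\<^esub> b \<otimes>\<^bsub>K\<^esub> k, m) - frag_of (a \<otimes>\<^bsub>K\<^esub> k, m) - frag_of (b \<otimes>\<^bsub>K\<^esub> k, m) \<in> rel"
      by (intro relator_in_rel relators(1)) (use a b gen in simp_all)
    then show ?case unfolding act_simps using a b gen by (simp add: K.l_distr diff_diff_eq)
  qed
  then show "(a \<oplus>\<^bsub>K\<^esub> b) \<odot>\<^bsub>V\<^esub> x = a \<odot>\<^bsub>V\<^esub> x \<oplus>\<^bsub>V\<^esub> b \<odot>\<^bsub>V\<^esub> x"
    unfolding c(2) V_smult[OF a] V_smult[OF b] V_smult[OF ab] V_add cls_eq_iff .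
  have "act (a \<otimes>\<^bsub>K\<^esub> b) c = act a (act b c)" using c(1)
  proof (induction rule: gens_induct)
    case (gen k m) then show ?case using a b by (simp add: act_simps K.m_assoc)
  qed (simp_all add: act_simps)
  then show "a \<otimes>\<^bsub>K\<^esub> b \<odot>\<^bsub>V\<^esub> x = a \<odot>\<^bsub>V\<^esub> (b \<odot>\<^bsub>V\<^esub> x)"
    unfolding c(2) V_smult[OF b] V_smult[OF a] V_smult[OF amb] by simp
next
  fix x assume "x \<in> carrier V"
  then obtain c where c: "Poly_Mapping.keys c \<subseteq> gens" "x = cls c" unfolding V_carrier by blast
  have "act \<one>\<^bsub>K\<^esub> c = c" using c(1)
  proof (induction rule: gens_induct)
    case (gen k m) then show ?case by (simp add: act_simps)
  qed (simp_all add: act_simps)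
  then show "\<one>\<^bsub>K\<^esub> \<odot>\<^bsub>V\<^esub> x = x" unfolding c(2) V_smult[OF K.one_closed] by simp
qed

definition tens :: "'c \<Rightarrow> (('e \<times> 'c) \<Rightarrow>\<^sub>0 int) set" where
  "tens m = cls (frag_of (\<one>\<^bsub>K\<^esub>, m))"

lemma tens_closed: "m \<in> carrier M \<Longrightarrow> tens m \<in> carrier V"
  unfolding tens_def V_carrier by (intro imageI) simp

lemma tens_add: "\<lbrakk>m \<in> carrier M; n \<in> carrier M\<rbrakk> \<Longrightarrow> tens (m \<oplus>\<^bsub>M\<^esub> n) = tens m \<oplus>\<^bsub>V\<^esub> tens n"
  unfolding tens_def V_add cls_eq_iff
  using relator_in_rel[OF relators(2)[OF K.one_closed, of m n]] by (simp add: diff_diff_eq)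

lemma tens_smult:
  assumes "a \<in> carrier R" "m \<in> carrier M" shows "tens (a \<odot>\<^bsub>M\<^esub> m) = \<iota> a \<odot>\<^bsub>V\<^esub> tens m"
proof -
  have "cls (frag_of (\<iota> a, m)) = cls (frag_of (\<one>\<^bsub>K\<^esub>, a \<odot>\<^bsub>M\<^esub> m))"
    unfolding cls_eq_iff using relator_in_rel[OF relators(3)[OF K.one_closed assms]] assms(1) by simp
  then show ?thesis unfolding tens_def V_smult[OF i.hom_closed[OF assms(1)]] act_simps using assms(1) by simp
qed

text \<open>The generator \<open>k \<otimes> m\<close> is \<open>k\<close> times
  \<open>1 \<otimes> m\<close>.\<close>

lemma tens_spans:
  assumes N: "Module.submodule N K V" and t: "\<And>m. m \<in> carrier M \<Longrightarrow> tens m \<in> N"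
  shows "N = carrier V"
proof
  interpret V: module K V by (rule V_module)
  show "N \<subseteq> carrier V" by (rule V.sm_subset[OF N])
  show "carrier V \<subseteq> N"
  proof
    fix v assume "v \<in> carrier V"
    then obtain c where c: "Poly_Mapping.keys c \<subseteq> gens" "v = cls c" unfolding V_carrier by blast
    have "cls c \<in> N" using c(1)
    proof (induction rule: gens_induct)
      case zero then show ?case using V.sm_zero[OF N] unfolding V_zero .
    next
      case (diff x y)
      \<comment> \<open>The induction produces differences, so the class of \<open>- y\<close> is
        obtained by the scalar \<open>-1\<close>; the two formal sums agree only modulo the
        relations.\<close>
      have "cls (act (\<ominus>\<^bsub>K\<^esub> \<one>\<^bsub>K\<^esub>) y) \<in> N"
        using V.sm_smult[OF N K.a_inv_closed[OF K.one_closed] diff.IH(2)]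
        unfolding V_smult[OF K.a_inv_closed[OF K.one_closed]] .
      moreover have "cls (act (\<ominus>\<^bsub>K\<^esub> \<one>\<^bsub>K\<^esub>) y) = cls (- y)"
      proof -
        have 1: "cls y \<in> carrier V" unfolding V_carrier using diff.hyps(2) by simp
        have 2: "cls (- y) \<in> carrier V" unfolding V_carrier using diff.hyps(2) by simp
        have "\<ominus>\<^bsub>V\<^esub> cls y = cls (- y)" by (rule V.M.minus_equality[OF _ 1 2]) (simp add: V_add V_zero)
        then show ?thesis
          using V.smult_l_minus[OF K.one_closed 1] V.smult_one[OF 1]
          unfolding V_smult[OF K.a_inv_closed[OF K.one_closed]] by simp
      qed
      ultimately have "cls x \<oplus>\<^bsub>V\<^esub> cls (- y) \<in> N" using V.sm_add[OF N diff.IH(1)] by simp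
      then show ?case unfolding V_add by simp
    next
      case (gen k m)
      have "k \<odot>\<^bsub>V\<^esub> tens m = cls (frag_of (k, m))" unfolding tens_def V_smult[OF gen(1)] act_simps using gen(1) by simp
      then show ?case using V.sm_smult[OF N gen(1) t[OF gen(2)]] by simp
    qed
    then show "v \<in> N" unfolding c(2) .
  qed
qed

text \<open>A linear form \<open>g\<close> induces the additive map from
  \<open>K \<otimes> M\<close> to \<open>K\<close> with \<open>k \<otimes> n\<close> sent to
  \<open>k \<iota> (g n)\<close>: define it on the free group and check that it kills the relators.
  It detects nonzero tensors without any flatness argument.\<close>

lemma tens_zero_functional:
  assumes g: "functional g" and m: "m \<in> carrier M" and z: "tens m = \<zero>\<^bsub>V\<^esub>"
  shows "\<iota> (g m) = \<zero>\<^bsub>K\<^esub>"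
proof -
  have im: "(\<lambda>(k, n). k \<otimes>\<^bsub>K\<^esub> \<iota> (g n)) ` gens \<subseteq> carrier (add_monoid K)"
    using functional_closed[OF g] by auto
  have "\<exists>h. h \<in> hom F (add_monoid K) \<and> (\<forall>x\<in>gens. h (frag_of x) = (\<lambda>(k, n). k \<otimes>\<^bsub>K\<^esub> \<iota> (g n)) x)"
    by (rule comm_group.free_Abelian_group_universal[OF K.a_comm_group im]) blast
  then obtain h where h: "h \<in> hom F (add_monoid K)"
    and hof: "\<And>x. x \<in> gens \<Longrightarrow> h (frag_of x) = (\<lambda>(k, n). k \<otimes>\<^bsub>K\<^esub> \<iota> (g n)) x"
    by blast
  have hc: "h c \<in> carrier K" if "Poly_Mapping.keys c \<subseteq> gens" for c using h that unfolding hom_def by auto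
  have hadd: "h (c + d) = h c \<oplus>\<^bsub>K\<^esub> h d" if "Poly_Mapping.keys c \<subseteq> gens" "Poly_Mapping.keys d \<subseteq> gens" for c d
    using hom_mult[OF h, of c d] that by simp
  have hdiff: "h (c - d) = h c \<ominus>\<^bsub>K\<^esub> h d" if cd: "Poly_Mapping.keys c \<subseteq> gens" "Poly_Mapping.keys d \<subseteq> gens" for c d
  proof -
    have "h c = h (c - d) \<oplus>\<^bsub>K\<^esub> h d" using hadd[OF keys_diff[OF cd] cd(2)] by simp
    then show ?thesis using hc[OF cd(2)] hc[OF keys_diff[OF cd]]
      by (simp add: a_minus_def K.a_assoc K.r_neg)
  qed
  have hkm: "h (frag_of (k, n)) = k \<otimes>\<^bsub>K\<^esub> \<iota> (g n)" if "k \<in> carrier K" "n \<in> carrier M" for k n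
    using hof[of "(k, n)"] that by simp
  have h0: "h 0 = \<zero>\<^bsub>K\<^esub>" using hdiff[of 0 0] hc[of 0] by (simp add: a_minus_def K.r_neg)
  have kern: "u \<ominus>\<^bsub>K\<^esub> v \<ominus>\<^bsub>K\<^esub> w = \<zero>\<^bsub>K\<^esub>" if "v \<in> carrier K" "w \<in> carrier K" "u = v \<oplus>\<^bsub>K\<^esub> w" for u v w
  proof -
    have "u \<ominus>\<^bsub>K\<^esub> v = w" unfolding that(3) a_minus_def
      using that(1,2) K.r_neg1[of v w] K.a_comm[of "v \<oplus>\<^bsub>K\<^esub> w" "\<ominus>\<^bsub>K\<^esub> v"] by simp
    then show ?thesis using that(2) by (simp add: a_minus_def K.r_neg)
  qed
  have "h r = \<zero>\<^bsub>K\<^esub>" if "r \<in> relators" for r using that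
  proof (cases rule: relator_cases)
    case (1 x y n)
    have "h r = h (frag_of (x \<oplus>\<^bsub>K\<^esub> y, n)) \<ominus>\<^bsub>K\<^esub> h (frag_of (x, n)) \<ominus>\<^bsub>K\<^esub> h (frag_of (y, n))"
      unfolding 1(4) using 1(1-3) by (simp add: hdiff keys_diff keys_of)
    also have "\<dots> = \<zero>\<^bsub>K\<^esub>"
      by (rule kern) (use 1(1-3) functional_closed[OF g] in \<open>simp_all add: hkm K.l_distr\<close>)
    finally show ?thesis .
  next
    case (2 x n n')
    have "h r = h (frag_of (x, n \<oplus>\<^bsub>M\<^esub> n')) \<ominus>\<^bsub>K\<^esub> h (frag_of (x, n)) \<ominus>\<^bsub>K\<^esub> h (frag_of (x, n'))"
      unfolding 2(4) using 2(1-3) by (simp add: hdiff keys_diff keys_of)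
    also have "\<dots> = \<zero>\<^bsub>K\<^esub>"
      by (rule kern) (use 2(1-3) functional_closed[OF g] functional_add[OF g] in \<open>simp_all add: hkm K.r_distr\<close>)
    finally show ?thesis .
  next
    case (3 x a n)
    have "h r = h (frag_of (x \<otimes>\<^bsub>K\<^esub> \<iota> a, n)) \<ominus>\<^bsub>K\<^esub> h (frag_of (x, a \<odot>\<^bsub>M\<^esub> n))"
      unfolding 3(4) using 3(1-3) by (simp add: hdiff keys_of)
    also have "\<dots> = \<zero>\<^bsub>K\<^esub>"
      using 3(1-3) functional_closed[OF g] functional_smult[OF g]
      by (simp add: hkm K.m_assoc a_minus_def K.r_neg)
    finally show ?thesis .
  qed
  then have hrel: "h r = \<zero>\<^bsub>K\<^esub>" if "r \<in> relators" for r using that .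
  \<comment> \<open>The support condition is carried along because \<open>h\<close> is known to be
    additive only on sums supported in \<open>gens\<close>.\<close>
  have hr: "Poly_Mapping.keys c \<subseteq> gens \<and> h c = \<zero>\<^bsub>K\<^esub>" if "c \<in> generate F relators" for c using that
  proof (induction rule: generate.induct)
    case one then show ?case by (simp add: h0)
  next
    case (incl c)
    then have "Poly_Mapping.keys c \<subseteq> gens" using subsetD[OF relators_carrier] by simp
    then show ?case using hrel[OF incl] by simp
  next
    case (inv c)
    then have k: "Poly_Mapping.keys c \<subseteq> gens" using subsetD[OF relators_carrier] by simp
    have "h (0 - c) = \<zero>\<^bsub>K\<^esub>" using hdiff[of 0 c] k h0 hrel[OF inv] by (simp add: a_minus_def)
    then show ?case using k by simp
  next
    case (eng c d)
    then show ?case using hadd[of c d] keys_plus[of c gens d] by simp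
  qed
  have "cls (frag_of (\<one>\<^bsub>K\<^esub>, m)) = cls 0" using z unfolding tens_def V_zero .
  then have "frag_of (\<one>\<^bsub>K\<^esub>, m) \<in> rel" unfolding cls_eq_iff by simp
  then have "h (frag_of (\<one>\<^bsub>K\<^esub>, m)) = \<zero>\<^bsub>K\<^esub>" using hr unfolding rel_eq by simp
  then show ?thesis using hkm[OF K.one_closed m] functional_closed[OF g m] by simp
qed

end

section \<open>The rank over the fraction field\<close>

context dedekind_module
begin

lemma scalar_ext_fraction_field: "scalar_ext R M (fraction_field R) (frac_embed R)"
  by (intro scalar_ext.intro module_axioms fraction_field_is_field frac_embed_ring_hom)

abbreviation K where "K \<equiv> fraction_field R"
abbreviation V where "V \<equiv> scalar_extension R (fraction_field R) (frac_embed R) M"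
abbreviation tens where "tens \<equiv> scalar_ext.tens R M (fraction_field R) (frac_embed R)"

lemma vectorspace_scalar_extension: "vectorspace K V"
  by (intro vectorspace.intro scalar_ext.V_module[OF scalar_ext_fraction_field] fraction_field_is_field)

lemma frac_embed_nonzero:
  assumes a: "a \<in> carrier R" "a \<noteq> \<zero>" shows "frac_embed R a \<noteq> \<zero>\<^bsub>K\<^esub>"
proof
  assume "frac_embed R a = \<zero>\<^bsub>K\<^esub>"
  then have "frac_embed R a = frac_embed R \<zero>" by (simp add: fraction_field_zero_one frac_embed_def)
  then show False using inj_onD[OF frac_embed_inj _ a(1) R.zero_closed] a(2) by simp
qed

lemma fraction_clear_denominator:
  assumes "k \<in> carrier K"
  shows "\<exists>s\<in>carrier R. \<exists>a\<in>carrier R. s \<noteq> \<zero> \<and> frac_embed R s \<otimes>\<^bsub>K\<^esub> k = frac_embed R a"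
proof -
  obtain a b where ab: "a \<in> carrier R" "b \<in> carrier R - {\<zero>}" "k = frac_class R a b"
    using assms unfolding fraction_field_carrier by blast
  show ?thesis
    by (rule bexI[of _ b], rule bexI[of _ a]) (use ab frac_class_embed[OF ab(1,2)] in simp_all)
qed

lemma fraction_solve:
  assumes s: "s \<in> carrier R" "s \<noteq> \<zero>" and v: "v \<in> carrier V" "w \<in> carrier V"
    and e: "frac_embed R s \<odot>\<^bsub>V\<^esub> v = w"
  shows "v = inv\<^bsub>K\<^esub> (frac_embed R s) \<odot>\<^bsub>V\<^esub> w" "inv\<^bsub>K\<^esub> (frac_embed R s) \<in> carrier K"
proof -
  interpret V: vectorspace K V by (rule vectorspace_scalar_extension)
  interpret i: ring_hom_ring R K "frac_embed R" by (rule frac_embed_ring_hom)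
  have c: "frac_embed R s \<in> carrier K" by (rule i.hom_closed[OF s(1)])
  have u: "frac_embed R s \<in> Units K" using c frac_embed_nonzero[OF s] V.field_Units by simp
  show i: "inv\<^bsub>K\<^esub> (frac_embed R s) \<in> carrier K" by (rule V.Units_inv_closed[OF u])
  have "inv\<^bsub>K\<^esub> (frac_embed R s) \<odot>\<^bsub>V\<^esub> w = inv\<^bsub>K\<^esub> (frac_embed R s) \<otimes>\<^bsub>K\<^esub> frac_embed R s \<odot>\<^bsub>V\<^esub> v"
    unfolding e[symmetric] by (rule V.smult_assoc1[OF i c v(1), symmetric])
  then show "v = inv\<^bsub>K\<^esub> (frac_embed R s) \<odot>\<^bsub>V\<^esub> w" using V.Units_l_inv[OF u] V.smult_one[OF v(1)] by simp
qed

lemma tens_zero: "tens \<zero>\<^bsub>M\<^esub> = \<zero>\<^bsub>V\<^esub>"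
proof -
  interpret E: scalar_ext R M K "frac_embed R" by (rule scalar_ext_fraction_field)
  interpret V: vectorspace K V by (rule vectorspace_scalar_extension)
  have "tens (\<zero> \<odot>\<^bsub>M\<^esub> \<zero>\<^bsub>M\<^esub>) = frac_embed R \<zero> \<odot>\<^bsub>V\<^esub> tens \<zero>\<^bsub>M\<^esub>"
    by (rule E.tens_smult) simp_all
  then show ?thesis using V.smult_l_null[OF E.tens_closed[OF M.zero_closed]] by simp
qed

text \<open>An element that is not torsion is detected by a linear form; a torsion element dies
  because its annihilator becomes invertible.\<close>

lemma tens_zero_iff:
  assumes x: "x \<in> carrier M" shows "tens x = \<zero>\<^bsub>V\<^esub> \<longleftrightarrow> torsion_elt x"
proof -
  interpret E: scalar_ext R M K "frac_embed R" by (rule scalar_ext_fraction_field)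
  interpret V: vectorspace K V by (rule vectorspace_scalar_extension)
  show ?thesis
  proof
    assume z: "tens x = \<zero>\<^bsub>V\<^esub>"
    show "torsion_elt x"
    proof (rule ccontr)
      assume "\<not> torsion_elt x"
      then obtain g where g: "functional g" "g x \<noteq> \<zero>" using functional_exists[OF x] by blast
      show False
        using E.tens_zero_functional[OF g(1) x z] frac_embed_nonzero[OF functional_closed[OF g(1) x] g(2)] by simp
    qed
  next
    assume "torsion_elt x"
    then obtain d where d: "d \<in> carrier R" "d \<noteq> \<zero>" "d \<odot>\<^bsub>M\<^esub> x = \<zero>\<^bsub>M\<^esub>" unfolding torsion_elt_def by blast
    have "frac_embed R d \<odot>\<^bsub>V\<^esub> tens x = \<zero>\<^bsub>V\<^esub>" using E.tens_smult[OF d(1) x] d(3) tens_zero by simp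
    from fraction_solve[OF d(1,2) E.tens_closed[OF x] V.M.zero_closed this]
    show "tens x = \<zero>\<^bsub>V\<^esub>" using V.smult_r_null by simp
  qed
qed

text \<open>If \<open>x\<close> is not torsion, a relation \<open>a x = b m\<close> has
  \<open>b\<close> nonzero, so \<open>1 \<otimes> m\<close> is a fraction times
  \<open>1 \<otimes> x\<close>. If everything is torsion, the tensor product is zero and the zero
  vector generates it.\<close>

lemma dependent_pairs_imp_cyclic:
  assumes dp: dependent_pairs
  shows "\<exists>v\<in>carrier V. module.cyc K V v = carrier V"
proof -
  interpret E: scalar_ext R M K "frac_embed R" by (rule scalar_ext_fraction_field)
  interpret V: vectorspace K V by (rule vectorspace_scalar_extension)
  have "\<exists>v\<in>carrier V. \<forall>m\<in>carrier M. tens m \<in> V.cyc v"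
  proof (cases "\<exists>x\<in>carrier M. \<not> torsion_elt x")
    case True
    then obtain x where x: "x \<in> carrier M" "\<not> torsion_elt x" by blast
    have "tens m \<in> V.cyc (tens x)" if m: "m \<in> carrier M" for m
    proof -
      obtain a b where ab: "a \<in> carrier R" "b \<in> carrier R" "a \<noteq> \<zero> \<or> b \<noteq> \<zero>" "a \<odot>\<^bsub>M\<^esub> x = b \<odot>\<^bsub>M\<^esub> m"
        using dp x(1) m unfolding dependent_pairs_def by blast
      have b: "b \<noteq> \<zero>"
      proof
        assume b: "b = \<zero>"
        then have "a \<odot>\<^bsub>M\<^esub> x = \<zero>\<^bsub>M\<^esub>" using ab(4) smult_l_null[OF m] by simp
        then show False using nontorsionD[OF x(2) ab(1)] ab(3) b by simp
      qed
      have "frac_embed R b \<odot>\<^bsub>V\<^esub> tens m = frac_embed R a \<odot>\<^bsub>V\<^esub> tens x"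
        using E.tens_smult[OF ab(2) m] E.tens_smult[OF ab(1) x(1)] ab(4) by simp
      from fraction_solve[OF ab(2) b E.tens_closed[OF m] _ this]
      have i: "inv\<^bsub>K\<^esub> (frac_embed R b) \<in> carrier K"
        and e: "tens m = inv\<^bsub>K\<^esub> (frac_embed R b) \<odot>\<^bsub>V\<^esub> (frac_embed R a \<odot>\<^bsub>V\<^esub> tens x)"
        using V.smult_closed[OF E.i.hom_closed[OF ab(1)] E.tens_closed[OF x(1)]] by simp_all
      show ?thesis unfolding e
        by (rule V.sm_smult[OF V.sm_cyc[OF E.tens_closed[OF x(1)]] i V.cycI[OF E.i.hom_closed[OF ab(1)]]])
    qed
    then show ?thesis by (intro bexI[of _ "tens x"] ballI E.tens_closed x(1))
  next
    case False
    then have "tens m = \<zero>\<^bsub>V\<^esub>" if "m \<in> carrier M" for m using tens_zero_iff[OF that] that by blast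
    then have "\<forall>m\<in>carrier M. tens m \<in> V.cyc \<zero>\<^bsub>V\<^esub>" using V.cyc_self[OF V.M.zero_closed] by simp
    then show ?thesis by (rule rev_bexI[OF V.M.zero_closed])
  qed
  then obtain v where v: "v \<in> carrier V" "\<forall>m\<in>carrier M. tens m \<in> V.cyc v" by blast
  have "V.cyc v = carrier V" by (rule E.tens_spans[OF V.sm_cyc[OF v(1)]]) (use v(2) in blast)
  then show ?thesis by (rule rev_bexI[OF v(1)])
qed

text \<open>If \<open>y\<close> is torsion, it satisfies a relation alone. Otherwise
  \<open>1 \<otimes> x\<close> is a fraction times \<open>1 \<otimes> y\<close>; clearing its
  denominator makes \<open>s x - a y\<close> vanish in the tensor product, hence torsion, and one
  more nonzero factor \<open>d\<close> gives a relation in \<open>M\<close>.\<close>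

lemma cyclic_imp_dependent_pairs:
  assumes v: "v \<in> carrier V" "carrier V = module.cyc K V v"
  shows dependent_pairs
  unfolding dependent_pairs_def
proof (intro ballI)
  interpret E: scalar_ext R M K "frac_embed R" by (rule scalar_ext_fraction_field)
  interpret V: vectorspace K V by (rule vectorspace_scalar_extension)
  fix x y assume x: "x \<in> carrier M" and y: "y \<in> carrier M"
  have "tens x \<in> V.cyc v" "tens y \<in> V.cyc v" using E.tens_closed x y v(2) by simp_all
  then obtain \<alpha> \<beta> where \<alpha>: "\<alpha> \<in> carrier K" "tens x = \<alpha> \<odot>\<^bsub>V\<^esub> v" and \<beta>: "\<beta> \<in> carrier K" "tens y = \<beta> \<odot>\<^bsub>V\<^esub> v"
    by (elim V.cycE)
  show "\<exists>a\<in>carrier R. \<exists>b\<in>carrier R. (a \<noteq> \<zero> \<or> b \<noteq> \<zero>) \<and> a \<odot>\<^bsub>M\<^esub> x = b \<odot>\<^bsub>M\<^esub> y"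
  proof (cases "\<beta> = \<zero>\<^bsub>K\<^esub>")
    case True
    then have "torsion_elt y" using \<beta>(2) V.smult_l_null[OF v(1)] tens_zero_iff[OF y] by simp
    then obtain d where d: "d \<in> carrier R" "d \<noteq> \<zero>" "d \<odot>\<^bsub>M\<^esub> y = \<zero>\<^bsub>M\<^esub>" unfolding torsion_elt_def by blast
    show ?thesis
      by (rule bexI[of _ \<zero>], rule bexI[of _ d]) (use d smult_l_null[OF x] in simp_all)
  next
    case False
    then have u: "\<beta> \<in> Units K" using \<beta>(1) E.K.field_Units by simp
    let ?k = "\<alpha> \<otimes>\<^bsub>K\<^esub> inv\<^bsub>K\<^esub> \<beta>"
    have k: "?k \<in> carrier K" using \<alpha>(1) E.K.Units_inv_closed[OF u] by simp
    obtain s a where s: "s \<in> carrier R" "a \<in> carrier R" "s \<noteq> \<zero>"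
      "frac_embed R s \<otimes>\<^bsub>K\<^esub> ?k = frac_embed R a" using fraction_clear_denominator[OF k] by blast
    have "?k \<odot>\<^bsub>V\<^esub> tens y = (?k \<otimes>\<^bsub>K\<^esub> \<beta>) \<odot>\<^bsub>V\<^esub> v" unfolding \<beta>(2) by (rule V.smult_assoc1[OF k \<beta>(1) v(1), symmetric])
    also have "?k \<otimes>\<^bsub>K\<^esub> \<beta> = \<alpha>"
      using E.K.m_assoc[OF \<alpha>(1) E.K.Units_inv_closed[OF u] \<beta>(1)] E.K.Units_l_inv[OF u] \<alpha>(1) by simp
    finally have kx: "tens x = ?k \<odot>\<^bsub>V\<^esub> tens y" unfolding \<alpha>(2) ..
    have sx: "s \<odot>\<^bsub>M\<^esub> x \<in> carrier M" and ay: "a \<odot>\<^bsub>M\<^esub> y \<in> carrier M" using s x y by simp_all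
    have "tens (s \<odot>\<^bsub>M\<^esub> x) = frac_embed R s \<odot>\<^bsub>V\<^esub> (?k \<odot>\<^bsub>V\<^esub> tens y)"
      unfolding E.tens_smult[OF s(1) x] kx ..
    also have "\<dots> = tens (a \<odot>\<^bsub>M\<^esub> y)"
      unfolding V.smult_assoc1[OF E.i.hom_closed[OF s(1)] k E.tens_closed[OF y], symmetric] s(4)
      by (rule E.tens_smult[OF s(2) y, symmetric])
    finally have eq: "tens (s \<odot>\<^bsub>M\<^esub> x) = tens (a \<odot>\<^bsub>M\<^esub> y)" .
    let ?u = "s \<odot>\<^bsub>M\<^esub> x \<ominus>\<^bsub>M\<^esub> a \<odot>\<^bsub>M\<^esub> y"
    have uc: "?u \<in> carrier M" by (rule M.minus_closed[OF sx ay])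
    have "tens ?u \<oplus>\<^bsub>V\<^esub> tens (a \<odot>\<^bsub>M\<^esub> y) = tens (a \<odot>\<^bsub>M\<^esub> y)"
      unfolding E.tens_add[OF uc ay, symmetric] add_minus_cancel(3)[OF ay sx] by (rule eq)
    then have "tens ?u = tens (a \<odot>\<^bsub>M\<^esub> y) \<ominus>\<^bsub>V\<^esub> tens (a \<odot>\<^bsub>M\<^esub> y)"
      using V.add_minus_cancel(1)[OF E.tens_closed[OF ay] E.tens_closed[OF uc]] by simp
    also have "\<dots> = \<zero>\<^bsub>V\<^esub>" using V.minus_eq_zero_iff[OF E.tens_closed[OF ay] E.tens_closed[OF ay]] by simp
    finally have "torsion_elt ?u" using tens_zero_iff[OF uc] by simp
    then obtain d where d: "d \<in> carrier R" "d \<noteq> \<zero>" "d \<odot>\<^bsub>M\<^esub> ?u = \<zero>\<^bsub>M\<^esub>" unfolding torsion_elt_def by blast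
    have "d \<odot>\<^bsub>M\<^esub> (s \<odot>\<^bsub>M\<^esub> x) \<ominus>\<^bsub>M\<^esub> d \<odot>\<^bsub>M\<^esub> (a \<odot>\<^bsub>M\<^esub> y) = \<zero>\<^bsub>M\<^esub>"
      using d(3) unfolding smult_minus_distr(2)[OF d(1) d(1) sx ay] .
    then have "d \<odot>\<^bsub>M\<^esub> (s \<odot>\<^bsub>M\<^esub> x) = d \<odot>\<^bsub>M\<^esub> (a \<odot>\<^bsub>M\<^esub> y)"
      using minus_eq_zero_iff[OF smult_closed[OF d(1) sx] smult_closed[OF d(1) ay]] by simp
    then have "(d \<otimes> s) \<odot>\<^bsub>M\<^esub> x = (d \<otimes> a) \<odot>\<^bsub>M\<^esub> y"
      using smult_assoc1[OF d(1) s(1) x] smult_assoc1[OF d(1) s(2) y] by simp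
    moreover have "d \<otimes> s \<noteq> \<zero>" using R.integral[of d s] d s by blast
    moreover have "d \<otimes> s \<in> carrier R" "d \<otimes> a \<in> carrier R" using d(1) s(1,2) by simp_all
    ultimately show ?thesis by (intro bexI[of _ "d \<otimes> s"] bexI[of _ "d \<otimes> a"] conjI disjI1)
  qed
qed

lemma module_rank_le_1_iff: "module_rank R M \<le> 1 \<longleftrightarrow> dependent_pairs"
proof -
  interpret E: scalar_ext R M K "frac_embed R" by (rule scalar_ext_fraction_field)
  interpret V: vectorspace K V by (rule vectorspace_scalar_extension)
  let ?gen = "\<lambda>n::nat. \<exists>A. finite A \<and> card A = n \<and> A \<subseteq> carrier V \<and> V.gen_set A"
  have rank: "module_rank R M = (LEAST n. ?gen n)" unfolding module_rank_def V.dim_def ..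
  show ?thesis
  proof
    assume dependent_pairs
    then obtain v where v: "v \<in> carrier V" "V.cyc v = carrier V" using dependent_pairs_imp_cyclic by blast
    have "?gen 1" by (intro exI[of _ "{v}"]) (simp add: v V.span_singleton)
    then show "module_rank R M \<le> 1" unfolding rank by (rule Least_le)
  next
    assume r: "module_rank R M \<le> 1"
    \<comment> \<open>The dimension is a least cardinality of a finite generating set. The tensors
      of generators of \<open>M\<close> show that such a set exists, so that the minimum is
      attained.\<close>
    obtain F where F: "finite F" "F \<subseteq> carrier M" "span F = carrier M" using finite_span[OF sm_carrier] by blast
    let ?W = "V.span (tens ` F)"
    have FV: "tens ` F \<subseteq> carrier V" using F(2) E.tens_closed by blast
    have W: "V.sm ?W" by (rule V.sm_of_afp[OF V.span_is_submodule[OF FV]])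
    have "sm {m \<in> carrier M. tens m \<in> ?W}"
    proof (rule sm_intro)
      show "\<zero>\<^bsub>M\<^esub> \<in> {m \<in> carrier M. tens m \<in> ?W}" using V.sm_zero[OF W] tens_zero by simp
      show "x \<oplus>\<^bsub>M\<^esub> y \<in> {m \<in> carrier M. tens m \<in> ?W}"
        if "x \<in> {m \<in> carrier M. tens m \<in> ?W}" "y \<in> {m \<in> carrier M. tens m \<in> ?W}" for x y
        using that V.sm_add[OF W] by (simp add: E.tens_add)
      show "a \<odot>\<^bsub>M\<^esub> x \<in> {m \<in> carrier M. tens m \<in> ?W}"
        if "a \<in> carrier R" "x \<in> {m \<in> carrier M. tens m \<in> ?W}" for a x
        using that V.sm_smult[OF W E.i.hom_closed] by (simp add: E.tens_smult)
    qed simp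
    moreover have "F \<subseteq> {m \<in> carrier M. tens m \<in> ?W}" using F(2) V.in_own_span[OF FV] by blast
    ultimately have "span F \<subseteq> {m \<in> carrier M. tens m \<in> ?W}" by (intro span_is_subset afp_submodule)
    then have "?W = carrier V" unfolding F(3) by (intro E.tens_spans[OF W]) blast
    then have "?gen (card (tens ` F))" using F(1) FV by (intro exI[of _ "tens ` F"]) simp
    then have "?gen (module_rank R M)" unfolding rank by (rule LeastI)
    then obtain A where A: "finite A" "card A \<le> 1" "A \<subseteq> carrier V" "V.gen_set A" using r by auto
    show dependent_pairs
    proof (cases "A = {}")
      case True
      have "carrier V \<subseteq> {\<zero>\<^bsub>V\<^esub>}"
        unfolding A(4)[symmetric] True by (rule V.span_is_subset[OF _ V.afp_submodule[OF V.sm_singleton_zero]]) simp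
      then have "carrier V = V.cyc \<zero>\<^bsub>V\<^esub>"
        using V.sm_subset[OF V.sm_cyc[OF V.M.zero_closed]] V.cyc_self[OF V.M.zero_closed] by blast
      then show ?thesis by (rule cyclic_imp_dependent_pairs[OF V.M.zero_closed])
    next
      case False
      then have "card A = 1" using A(1,2) by (simp add: le_Suc_eq)
      then obtain v where v: "A = {v}" by (rule card_1_singletonE)
      have vc: "v \<in> carrier V" using A(3) v by simp
      have "carrier V = V.cyc v" using A(4) unfolding v V.span_singleton[OF vc] ..
      then show ?thesis by (rule cyclic_imp_dependent_pairs[OF vc])
    qed
  qed
qed

end

subsection \<open>The support of the torsion submodule\<close>

context dedekind_prime_module
begin

text \<open>A fraction vanishes exactly when some element outside \<open>P\<close> kills its
  numerator; denominators are absorbed since products of elements outside \<open>P\<close> stay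
  outside \<open>P\<close>.\<close>

lemma localization_class_zero_iff:
  assumes m: "m \<in> torsion_submodule R M" and s: "s \<in> carrier R - P"
  shows "localization_class R (carrier R - P) (torsion R M) m s =
      localization_class R (carrier R - P) (torsion R M) \<zero>\<^bsub>M\<^esub> \<one> \<longleftrightarrow> m \<in> prime_to" (is "?A = ?B \<longleftrightarrow> _")
proof -
  have one: "\<one> \<in> carrier R - P" using one_notin by simp
  have Tc: "n \<in> carrier M" if "n \<in> torsion_submodule R M" for n using that unfolding torsion_submodule_def by simp
  have mc: "m \<in> carrier M" by (rule Tc[OF m])
  have A: "(n, t') \<in> ?A \<longleftrightarrow> n \<in> torsion_submodule R M \<and> t' \<in> carrier R - P \<and>
      (\<exists>u\<in>carrier R - P. u \<odot>\<^bsub>M\<^esub> (t' \<odot>\<^bsub>M\<^esub> m) = u \<odot>\<^bsub>M\<^esub> (s \<odot>\<^bsub>M\<^esub> n))" for n t'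
    unfolding localization_class_def by simp
  have B: "(n, t') \<in> ?B \<longleftrightarrow> n \<in> torsion_submodule R M \<and> t' \<in> carrier R - P \<and> n \<in> prime_to" for n t'
  proof -
    have "u \<odot>\<^bsub>M\<^esub> (t' \<odot>\<^bsub>M\<^esub> \<zero>\<^bsub>M\<^esub>) = u \<odot>\<^bsub>M\<^esub> (\<one> \<odot>\<^bsub>M\<^esub> n) \<longleftrightarrow> u \<odot>\<^bsub>M\<^esub> n = \<zero>\<^bsub>M\<^esub>"
      if "u \<in> carrier R - P" "t' \<in> carrier R - P" "n \<in> torsion_submodule R M" for u
      using that Tc by auto
    then show ?thesis using Tc unfolding localization_class_def prime_to_def by auto
  qed
  show ?thesis
  proof
    assume e: "?A = ?B"
    have "(m, s) \<in> ?A" unfolding A using m s one by (intro conjI bexI[of _ \<one>] refl)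
    then show "m \<in> prime_to" unfolding e B by simp
  next
    assume "m \<in> prime_to"
    then obtain u where u: "u \<in> carrier R - P" "u \<odot>\<^bsub>M\<^esub> m = \<zero>\<^bsub>M\<^esub>" unfolding prime_to_def by auto
    have uc: "u \<in> carrier R" and sc: "s \<in> carrier R" using u(1) s by simp_all
    have "(\<exists>w\<in>carrier R - P. w \<odot>\<^bsub>M\<^esub> (t' \<odot>\<^bsub>M\<^esub> m) = w \<odot>\<^bsub>M\<^esub> (s \<odot>\<^bsub>M\<^esub> n)) \<longleftrightarrow> n \<in> prime_to"
      if n: "n \<in> torsion_submodule R M" and t': "t' \<in> carrier R - P" for n t'
    proof
      have nc: "n \<in> carrier M" by (rule Tc[OF n])
      have t'c: "t' \<in> carrier R" using t' by simp
      assume "\<exists>w\<in>carrier R - P. w \<odot>\<^bsub>M\<^esub> (t' \<odot>\<^bsub>M\<^esub> m) = w \<odot>\<^bsub>M\<^esub> (s \<odot>\<^bsub>M\<^esub> n)"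
      then obtain w where w: "w \<in> carrier R - P" "w \<odot>\<^bsub>M\<^esub> (t' \<odot>\<^bsub>M\<^esub> m) = w \<odot>\<^bsub>M\<^esub> (s \<odot>\<^bsub>M\<^esub> n)" by blast
      have wc: "w \<in> carrier R" using w(1) by simp
      have "u \<otimes> w \<otimes> s \<odot>\<^bsub>M\<^esub> n = u \<odot>\<^bsub>M\<^esub> (w \<odot>\<^bsub>M\<^esub> (s \<odot>\<^bsub>M\<^esub> n))"
        using uc wc sc nc by (simp add: smult_assoc1)
      also have "\<dots> = (w \<otimes> t' \<otimes> u) \<odot>\<^bsub>M\<^esub> m"
        unfolding w(2)[symmetric] using uc wc t'c mc by (simp add: smult_assoc1[symmetric] m_ac)
      also have "\<dots> = \<zero>\<^bsub>M\<^esub>" using uc wc t'c mc u(2) by (simp add: smult_assoc1)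
      finally have "u \<otimes> w \<otimes> s \<odot>\<^bsub>M\<^esub> n = \<zero>\<^bsub>M\<^esub>" .
      moreover have "u \<otimes> w \<otimes> s \<in> carrier R - P" by (intro unit_mult u(1) w(1) s)
      ultimately show "n \<in> prime_to" unfolding prime_to_def using nc by blast
    next
      have nc: "n \<in> carrier M" by (rule Tc[OF n])
      have t'c: "t' \<in> carrier R" using t' by simp
      assume "n \<in> prime_to"
      then obtain w where w: "w \<in> carrier R - P" "w \<odot>\<^bsub>M\<^esub> n = \<zero>\<^bsub>M\<^esub>" unfolding prime_to_def by auto
      have wc: "w \<in> carrier R" using w(1) by simp
      have "u \<otimes> w \<odot>\<^bsub>M\<^esub> (t' \<odot>\<^bsub>M\<^esub> m) = (w \<otimes> t') \<odot>\<^bsub>M\<^esub> (u \<odot>\<^bsub>M\<^esub> m)"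
        using uc wc t'c mc by (simp add: smult_assoc1[symmetric] m_ac)
      moreover have "u \<otimes> w \<odot>\<^bsub>M\<^esub> (s \<odot>\<^bsub>M\<^esub> n) = (u \<otimes> s) \<odot>\<^bsub>M\<^esub> (w \<odot>\<^bsub>M\<^esub> n)"
        using uc wc sc nc by (simp add: smult_assoc1[symmetric] m_ac)
      ultimately have "u \<otimes> w \<odot>\<^bsub>M\<^esub> (t' \<odot>\<^bsub>M\<^esub> m) = u \<otimes> w \<odot>\<^bsub>M\<^esub> (s \<odot>\<^bsub>M\<^esub> n)"
        unfolding u(2) w(2) using uc wc t'c sc by simp
      then show "\<exists>w\<in>carrier R - P. w \<odot>\<^bsub>M\<^esub> (t' \<odot>\<^bsub>M\<^esub> m) = w \<odot>\<^bsub>M\<^esub> (s \<odot>\<^bsub>M\<^esub> n)"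
        by (intro bexI[of _ "u \<otimes> w"] unit_mult u(1) w(1))
    qed
    then have "(n, t') \<in> ?A \<longleftrightarrow> (n, t') \<in> ?B" for n t' unfolding A B by blast
    then show "?A = ?B" by (intro subset_antisym subrelI) simp_all
  qed
qed

text \<open>The localization of the torsion at \<open>P\<close> is nonzero when some torsion element
  is not killed from outside \<open>P\<close>, and by \<open>torsion_primary_dsum\<close> this
  happens exactly when the primary component is nonzero.\<close>

lemma torsion_primes_iff: "P \<in> torsion_primes R M \<longleftrightarrow> primary P \<noteq> {\<zero>\<^bsub>M\<^esub>}"
proof -
  let ?L = "localization R (carrier R - P) (torsion R M)"
  let ?c = "localization_class R (carrier R - P) (torsion R M)"
  have one: "\<one> \<in> carrier R - P" using one_notin by simp
  have zT: "\<zero>\<^bsub>M\<^esub> \<in> torsion_submodule R M" by (rule sm_zero[OF sm_torsion])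
  have C: "carrier ?L = {?c m s | m s. m \<in> torsion_submodule R M \<and> s \<in> carrier R - P}"
    and Z: "\<zero>\<^bsub>?L\<^esub> = ?c \<zero>\<^bsub>M\<^esub> \<one>"
    unfolding localization_def by simp_all
  have "?c \<zero>\<^bsub>M\<^esub> \<one> \<in> carrier ?L" unfolding C using zT one by blast
  then have "carrier ?L \<noteq> {\<zero>\<^bsub>?L\<^esub>} \<longleftrightarrow> (\<exists>v\<in>carrier ?L. v \<noteq> ?c \<zero>\<^bsub>M\<^esub> \<one>)" unfolding Z by blast
  also have "\<dots> \<longleftrightarrow> (\<exists>m\<in>torsion_submodule R M. m \<notin> prime_to)"
  proof
    assume "\<exists>v\<in>carrier ?L. v \<noteq> ?c \<zero>\<^bsub>M\<^esub> \<one>"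
    then obtain m s where "m \<in> torsion_submodule R M" "s \<in> carrier R - P" "?c m s \<noteq> ?c \<zero>\<^bsub>M\<^esub> \<one>"
      unfolding C by blast
    then show "\<exists>m\<in>torsion_submodule R M. m \<notin> prime_to" using localization_class_zero_iff by blast
  next
    assume "\<exists>m\<in>torsion_submodule R M. m \<notin> prime_to"
    then obtain m where m: "m \<in> torsion_submodule R M" "m \<notin> prime_to" by blast
    have "?c m \<one> \<noteq> ?c \<zero>\<^bsub>M\<^esub> \<one>" using localization_class_zero_iff[OF m(1) one] m(2) by simp
    moreover have "?c m \<one> \<in> carrier ?L" unfolding C using m(1) one by blast
    ultimately show "\<exists>v\<in>carrier ?L. v \<noteq> ?c \<zero>\<^bsub>M\<^esub> \<one>" by blast
  qed
  also have "\<dots> \<longleftrightarrow> primary P \<noteq> {\<zero>\<^bsub>M\<^esub>}"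
  proof
    assume "\<exists>m\<in>torsion_submodule R M. m \<notin> prime_to"
    then obtain m where m: "m \<in> torsion_submodule R M" "m \<notin> prime_to" by blast
    obtain a b where ab: "a \<in> primary P" "b \<in> prime_to" "m = a \<oplus>\<^bsub>M\<^esub> b" "b \<in> carrier M"
      using dsumE[OF torsion_primary_dsum m(1)] by metis
    have "a \<noteq> \<zero>\<^bsub>M\<^esub>" using m(2) ab(2-4) by auto
    then show "primary P \<noteq> {\<zero>\<^bsub>M\<^esub>}" using ab(1) by blast
  next
    assume "primary P \<noteq> {\<zero>\<^bsub>M\<^esub>}"
    then obtain a where a: "a \<in> primary P" "a \<noteq> \<zero>\<^bsub>M\<^esub>" using sm_zero[OF sm_primary] by blast
    have "a \<notin> prime_to" using dsum_disjoint[OF torsion_primary_dsum a(1)] a(2) by blast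
    then show "\<exists>m\<in>torsion_submodule R M. m \<notin> prime_to" using a(1) primary_subset_torsion by blast
  qed
  finally show ?thesis unfolding torsion_primes_def module_support_def using P_prime P_nonzero by simp
qed

text \<open>Handles the primes outside the support: the socle criteria range over all nonzero
  primes, the final statement only over those in the support.\<close>

lemma primary_trivial:
  assumes "primary P = {\<zero>\<^bsub>M\<^esub>}" shows "uniform_at P t 0" "thin_at P"
  unfolding uniform_at_def thin_at_def assms using kills_zero by simp_all

text \<open>A nonzero component has at least one cyclic summand, which makes index 1 available as a
  reference.\<close>

lemma decomposition_basis:
  assumes iso: "module_iso R (torsion_component R P M)
      (finite_direct_sum {1..m::nat} (\<lambda>j. quotient_module R (ideal_pow R P (l j)))) \<noteq> {}"
    and ne: "primary P \<noteq> {\<zero>\<^bsub>M\<^esub>}"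
  shows "\<exists>x. cyclic_basis P x l {1..m} (primary P)" "1 \<le> m"
proof -
  show ex: "\<exists>x. cyclic_basis P x l {1..m} (primary P)"
    by (rule iso_imp_basis[OF iso[unfolded torsion_component_eq] _ sm_primary]) simp
  show "1 \<le> m"
  proof (rule ccontr)
    assume "\<not> 1 \<le> m"
    then have m: "{1..m} = {}" by simp
    obtain x where cb: "cyclic_basis P x l {} (primary P)" using ex unfolding m by blast
    have "y = \<zero>\<^bsub>M\<^esub>" if "y \<in> primary P" for y using basis_span[OF cb that] by (auto simp: comb_def)
    then show False using ne sm_zero[OF sm_primary] by blast
  qed
qed

lemma uniform_iff_exponents:
  assumes iso: "module_iso R (torsion_component R P M)
      (finite_direct_sum {1..m::nat} (\<lambda>j. quotient_module R (ideal_pow R P (l j)))) \<noteq> {}"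
    and l: "\<forall>j\<in>{1..m}. 1 \<le> l j" and ne: "primary P \<noteq> {\<zero>\<^bsub>M\<^esub>}"
  shows "(\<exists>n. uniform_at P t n) \<longleftrightarrow> (\<forall>i\<in>{1..m}. \<forall>j\<in>{1..m}. l i = l j)"
proof -
  obtain x where cb: "cyclic_basis P x l {1..m} (primary P)" using decomposition_basis(1)[OF iso ne] by blast
  have m: "1 \<in> {1..m}" using decomposition_basis(2)[OF iso ne] by simp
  show ?thesis
  proof
    assume "\<exists>n. uniform_at P t n"
    then obtain n where n: "uniform_at P t n" by blast
    show "\<forall>i\<in>{1..m}. \<forall>j\<in>{1..m}. l i = l j" using uniform_at_basis[OF cb _ l n] by simp
  next
    assume e: "\<forall>i\<in>{1..m}. \<forall>j\<in>{1..m}. l i = l j"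
    \<comment> \<open>\<open>uniform_at\<close> counts exponents from zero: the parameter
      \<open>n\<close> belongs to \<open>P ^ (n + 1)\<close>.\<close>
    have "\<forall>j\<in>{1..m}. l j = Suc (l 1 - 1)"
    proof
      fix j assume "j \<in> {1..m}"
      then have "l j = l 1" using e m by blast
      moreover have "1 \<le> l 1" using l m by blast
      ultimately show "l j = Suc (l 1 - 1)" by simp
    qed
    then show "\<exists>n. uniform_at P t n" using basis_imp_uniform_at[OF cb] by blast
  qed
qed

lemma thin_iff_exponents:
  assumes iso: "module_iso R (torsion_component R P M)
      (finite_direct_sum {1..m::nat} (\<lambda>j. quotient_module R (ideal_pow R P (l j)))) \<noteq> {}"
    and l: "\<forall>j\<in>{1..m}. 1 \<le> l j" and ne: "primary P \<noteq> {\<zero>\<^bsub>M\<^esub>}"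
  shows "thin_at P \<longleftrightarrow> m = 1 \<or> (\<forall>j\<in>{1..m}. l j = 1)"
proof -
  obtain x where cb: "cyclic_basis P x l {1..m} (primary P)" using decomposition_basis(1)[OF iso ne] by blast
  show ?thesis by (rule thin_at_basis_iff[OF cb l decomposition_basis(2)[OF iso ne]])
qed

lemma uniform_iff_homocyclic:
  assumes ne: "primary P \<noteq> {\<zero>\<^bsub>M\<^esub>}"
  shows "(\<exists>n. uniform_at P t n) \<longleftrightarrow> homocyclic R P (torsion_component R P M)"
proof
  assume "\<exists>n. uniform_at P t n"
  then obtain n where n: "uniform_at P t n" by blast
  obtain m x l where cb: "cyclic_basis P x l {1..m} (primary P)" and l: "\<forall>j\<in>{1..m}. 1 \<le> l j"
    using cyclic_basis_exists by blast
  have "\<forall>j\<in>{1..m}. l j = Suc n" using uniform_at_basis[OF cb _ l n] by simp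
  then have "cyclic_basis P x (\<lambda>_. Suc n) {1..m} (primary P)" using cb unfolding cyclic_basis_def by simp
  from basis_imp_iso[OF this finite_atLeastAtMost sm_primary]
  show "homocyclic R P (torsion_component R P M)"
    unfolding homocyclic_def torsion_component_eq by (intro exI[of _ m] exI[of _ "Suc n"])
next
  assume "homocyclic R P (torsion_component R P M)"
  then obtain m e where iso: "module_iso R (torsion_component R P M)
      (finite_direct_sum {1..m} (\<lambda>_::nat. quotient_module R (ideal_pow R P e))) \<noteq> {}"
    unfolding homocyclic_def by (elim exE)
  obtain x where cb: "cyclic_basis P x (\<lambda>_. e) {1..m} (primary P)"
    using decomposition_basis(1)[OF iso ne] by blast
  \<comment> \<open>\<open>homocyclic\<close> admits the exponent zero, whose summands are trivial;
    a nonzero component excludes it.\<close>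
  have "1 \<le> e"
  proof (rule ccontr)
    assume "\<not> 1 \<le> e"
    then have "kills P 0 y" if "y \<in> primary P" for y by (intro basis_killed[OF cb _ _ that]) simp_all
    then have "y = \<zero>\<^bsub>M\<^esub>" if "y \<in> primary P" for y using kills_0 primary_closed that by blast
    then show False using ne sm_zero[OF sm_primary] by blast
  qed
  then show "\<exists>n. uniform_at P t n" using uniform_iff_exponents[OF iso _ ne] by simp
qed

end

section \<open>Transfer of the local criteria to the primes in the support\<close>

context dedekind_module
begin

text \<open>The local condition \<open>\<Phi>\<close> may mention a uniformizer, the final condition
  \<open>\<Psi>\<close> may not. Every prime in the support has a uniformizer, and at the remaining
  primes \<open>\<Phi>\<close> holds trivially.\<close>

lemma all_torsion_primes_iff:
  assumes "\<And>P t s0. \<lbrakk>dedekind_prime_module R M P t s0; primary P \<noteq> {\<zero>\<^bsub>M\<^esub>}; P \<in> torsion_primes R M\<rbrakk> \<Longrightarrow>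
      \<Phi> P t \<longleftrightarrow> \<Psi> P"
    and "\<And>P t s0. \<lbrakk>dedekind_prime_module R M P t s0; primary P = {\<zero>\<^bsub>M\<^esub>}\<rbrakk> \<Longrightarrow> \<Phi> P t"
  shows "(\<forall>P t s0. uniformized_prime R P t s0 \<longrightarrow> \<Phi> P t) \<longleftrightarrow> (\<forall>P\<in>torsion_primes R M. \<Psi> P)"
proof
  assume H: "\<forall>P t s0. uniformized_prime R P t s0 \<longrightarrow> \<Phi> P t"
  show "\<forall>P\<in>torsion_primes R M. \<Psi> P"
  proof
    fix P assume P: "P \<in> torsion_primes R M"
    then have "primeideal P R" "P \<noteq> {\<zero>}" unfolding torsion_primes_def module_support_def by simp_all
    then obtain t s0 where u: "uniformized_prime R P t s0" using uniformized_prime_exists by blast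
    interpret N: dedekind_prime_module R M P t s0 by (rule prime_moduleI[OF u])
    show "\<Psi> P"
      using H u P assms(1)[OF N.dedekind_prime_module_axioms] unfolding N.torsion_primes_iff by blast
  qed
next
  assume H: "\<forall>P\<in>torsion_primes R M. \<Psi> P"
  show "\<forall>P t s0. uniformized_prime R P t s0 \<longrightarrow> \<Phi> P t"
  proof (intro allI impI)
    fix P t s0 assume u: "uniformized_prime R P t s0"
    interpret N: dedekind_prime_module R M P t s0 by (rule prime_moduleI[OF u])
    note D = N.dedekind_prime_module_axioms
    show "\<Phi> P t"
      using assms(1)[OF D] assms(2)[OF D] H N.torsion_primes_iff by (cases "primary P = {\<zero>\<^bsub>M\<^esub>}") blast+
  qed
qed

lemma
  assumes nf: "\<not> Ring.field R"
  shows C4_iff_homocyclic: "C4 R M \<longleftrightarrow> module_rank R M \<le> 1 \<and>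
      (\<forall>P\<in>torsion_primes R M. homocyclic R P (torsion_component R P M))"
    and C4_star_iff_cyclic_or_semisimple: "C4_star R M \<longleftrightarrow> module_rank R M \<le> 1 \<and>
      (\<forall>P\<in>torsion_primes R M. cyclic_module R (torsion_component R P M) \<or>
        semisimple_module R (torsion_component R P M))"
proof -
  have "(\<forall>P t s0. uniformized_prime R P t s0 \<longrightarrow> (\<exists>n. uniform_at P t n)) \<longleftrightarrow>
      (\<forall>P\<in>torsion_primes R M. homocyclic R P (torsion_component R P M))"
    by (rule all_torsion_primes_iff)
      (erule (1) dedekind_prime_module.uniform_iff_homocyclic,
        rule exI, erule (1) dedekind_prime_module.primary_trivial(1))
  then show "C4 R M \<longleftrightarrow> module_rank R M \<le> 1 \<and>
      (\<forall>P\<in>torsion_primes R M. homocyclic R P (torsion_component R P M))"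
    unfolding C4_iff_uniform[OF nf] module_rank_le_1_iff by simp
  have "(\<forall>P t s0. uniformized_prime R P t s0 \<longrightarrow> thin_at P) \<longleftrightarrow>
      (\<forall>P\<in>torsion_primes R M. cyclic_module R (torsion_component R P M) \<or>
        semisimple_module R (torsion_component R P M))"
    by (rule all_torsion_primes_iff)
      (erule dedekind_prime_module.thin_at_iff, erule (1) dedekind_prime_module.primary_trivial(2))
  then show "C4_star R M \<longleftrightarrow> module_rank R M \<le> 1 \<and>
      (\<forall>P\<in>torsion_primes R M. cyclic_module R (torsion_component R P M) \<or>
        semisimple_module R (torsion_component R P M))"
    unfolding C4_star_iff_thin[OF nf] module_rank_le_1_iff by simp
qed

lemma
  assumes nf: "\<not> Ring.field R" and td: "torsion_decomposition R M m l"
  shows C4_iff_exponents: "C4 R M \<longleftrightarrow> module_rank R M \<le> 1 \<and>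
      (\<forall>P\<in>torsion_primes R M. \<forall>i\<in>{1..m P}. \<forall>j\<in>{1..m P}. l P i = l P j)"
    and C4_star_iff_exponents: "C4_star R M \<longleftrightarrow> module_rank R M \<le> 1 \<and>
      (\<forall>P\<in>torsion_primes R M. m P = 1 \<or> (\<forall>j\<in>{1..m P}. l P j = 1))"
proof -
  have iso: "module_iso R (torsion_component R P M)
      (finite_direct_sum {1..m P} (\<lambda>j. quotient_module R (ideal_pow R P (l P j)))) \<noteq> {}"
    and l: "\<forall>j\<in>{1..m P}. 1 \<le> l P j" if "P \<in> torsion_primes R M" for P
    using td that unfolding torsion_decomposition_def by blast+
  have "(\<forall>P t s0. uniformized_prime R P t s0 \<longrightarrow> (\<exists>n. uniform_at P t n)) \<longleftrightarrow>
      (\<forall>P\<in>torsion_primes R M. \<forall>i\<in>{1..m P}. \<forall>j\<in>{1..m P}. l P i = l P j)"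
  proof (rule all_torsion_primes_iff)
    show "(\<exists>n. uniform_at P t n) \<longleftrightarrow> (\<forall>i\<in>{1..m P}. \<forall>j\<in>{1..m P}. l P i = l P j)"
      if "dedekind_prime_module R M P t s0" "primary P \<noteq> {\<zero>\<^bsub>M\<^esub>}" "P \<in> torsion_primes R M" for P t s0
      by (rule dedekind_prime_module.uniform_iff_exponents[OF that(1) iso[OF that(3)] l[OF that(3)] that(2)])
    show "\<exists>n. uniform_at P t n"
      if "dedekind_prime_module R M P t s0" "primary P = {\<zero>\<^bsub>M\<^esub>}" for P t s0
      using dedekind_prime_module.primary_trivial(1)[OF that] by blast
  qed
  then show "C4 R M \<longleftrightarrow> module_rank R M \<le> 1 \<and>
      (\<forall>P\<in>torsion_primes R M. \<forall>i\<in>{1..m P}. \<forall>j\<in>{1..m P}. l P i = l P j)"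
    unfolding C4_iff_uniform[OF nf] module_rank_le_1_iff by simp
  have "(\<forall>P t s0. uniformized_prime R P t s0 \<longrightarrow> thin_at P) \<longleftrightarrow>
      (\<forall>P\<in>torsion_primes R M. m P = 1 \<or> (\<forall>j\<in>{1..m P}. l P j = 1))"
  proof (rule all_torsion_primes_iff)
    show "thin_at P \<longleftrightarrow> m P = 1 \<or> (\<forall>j\<in>{1..m P}. l P j = 1)"
      if "dedekind_prime_module R M P t s0" "primary P \<noteq> {\<zero>\<^bsub>M\<^esub>}" "P \<in> torsion_primes R M" for P t s0
      by (rule dedekind_prime_module.thin_iff_exponents[OF that(1) iso[OF that(3)] l[OF that(3)] that(2)])
    show "thin_at P"
      if "dedekind_prime_module R M P t s0" "primary P = {\<zero>\<^bsub>M\<^esub>}" for P t s0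
      by (rule dedekind_prime_module.primary_trivial(2)[OF that])
  qed
  then show "C4_star R M \<longleftrightarrow> module_rank R M \<le> 1 \<and>
      (\<forall>P\<in>torsion_primes R M. m P = 1 \<or> (\<forall>j\<in>{1..m P}. l P j = 1))"
    unfolding C4_star_iff_thin[OF nf] module_rank_le_1_iff by simp
qed

text \<open>Ensures that the criteria quantified over decompositions are not vacuous; the local
  bases are assembled by choosing the number of summands and then the exponents at each
  prime.\<close>

lemma torsion_decomposition_exists: "\<exists>m l. torsion_decomposition R M m l"
proof -
  let ?D = "\<lambda>P (m::nat) (l::nat \<Rightarrow> nat). (\<forall>j\<in>{1..m}. 1 \<le> l j) \<and> (\<forall>i\<in>{1..m}. \<forall>j\<in>{1..m}. i \<le> j \<longrightarrow> l i \<le> l j) \<and>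
    module_iso R (torsion_component R P M)
      (finite_direct_sum {1..m} (\<lambda>j. quotient_module R (ideal_pow R P (l j)))) \<noteq> {}"
  have ex: "\<exists>m l. ?D P m l" if P: "P \<in> torsion_primes R M" for P
  proof -
    have "primeideal P R" "P \<noteq> {\<zero>}" using P unfolding torsion_primes_def module_support_def by simp_all
    then obtain t s0 where u: "uniformized_prime R P t s0" using uniformized_prime_exists by blast
    interpret N: dedekind_prime_module R M P t s0 by (rule prime_moduleI[OF u])
    obtain m x l where cb: "cyclic_basis P x l {1..m} (primary P)" and l: "\<forall>j\<in>{1..m}. 1 \<le> l j"
      "\<forall>i\<in>{1..m}. \<forall>j\<in>{1..m}. i \<le> j \<longrightarrow> l i \<le> l j"
      using N.cyclic_basis_exists by (elim exE conjE)
    have "?D P m l" unfolding N.torsion_component_eq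
      by (intro conjI l N.basis_imp_iso[OF cb _ N.sm_primary]) simp
    then show ?thesis by (intro exI[of _ m] exI[of _ l])
  qed
  then have "\<forall>P\<in>torsion_primes R M. \<exists>m l. ?D P m l" by (intro ballI)
  from bchoice[OF this] obtain m where "\<forall>P\<in>torsion_primes R M. \<exists>l. ?D P (m P) l" by (rule exE)
  from bchoice[OF this] obtain l where "\<forall>P\<in>torsion_primes R M. ?D P (m P) (l P)" by (rule exE)
  then have "torsion_decomposition R M m l" unfolding torsion_decomposition_def .
  then show ?thesis by (intro exI[of _ m] exI[of _ l])
qed

end

theorem theorem10p6:
  fixes D :: "('a, 'm) ring_scheme"
    and M :: "('a, 'b, 'n) module_scheme"
  assumes "dedekind_domain D" and "\<not> Ring.field D"
    and "Module.module D M" and "finitely_generated D M"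
  shows
    "(\<exists>m l. torsion_decomposition D M m l) \<and>

     (\<forall>m l. torsion_decomposition D M m l \<longrightarrow>
        (C4 D M \<longleftrightarrow>
           module_rank D M \<le> 1 \<and>
           (\<forall>P \<in> torsion_primes D M. \<forall>i \<in> {1..m P}. \<forall>j \<in> {1..m P}. l P i = l P j)) \<and>
        (C4_star D M \<longleftrightarrow>
           module_rank D M \<le> 1 \<and>
           (\<forall>P \<in> torsion_primes D M. m P = 1 \<or> (\<forall>j \<in> {1..m P}. l P j = 1))) \<and>
        (strongly_C4_star D M \<longleftrightarrow>
           module_rank D M \<le> 1 \<and>
           (\<forall>P \<in> torsion_primes D M. m P = 1 \<or> (\<forall>j \<in> {1..m P}. l P j = 1)))) \<and>

     (C4 D M \<longleftrightarrow>
        module_rank D M \<le> 1 \<and>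
        (\<forall>P \<in> torsion_primes D M. homocyclic D P (torsion_component D P M))) \<and>
     (C4_star D M \<longleftrightarrow>
        module_rank D M \<le> 1 \<and>
        (\<forall>P \<in> torsion_primes D M.
           cyclic_module D (torsion_component D P M) \<or>
           semisimple_module D (torsion_component D P M))) \<and>

     (\<forall>N :: ('a, 'c, 'k) module_scheme.
        Module.module D N \<and> finitely_generated D N \<longrightarrow> semi_weak_CS D N) \<and>

     (strongly_C4_star D M \<longleftrightarrow> C4_star D M)"
proof -
  have noeth: "noetherian_domain D" using assms(1) unfolding dedekind_domain_def by simp
  interpret D: dedekind D
  proof (rule dedekind.intro[OF noeth], rule dedekind_axioms.intro)
    show "integrally_closed D" using assms(1) unfolding dedekind_domain_def by blast
    show "maximalideal I D" if "primeideal I D" "I \<noteq> {\<zero>\<^bsub>D\<^esub>}" for I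
      using assms(1) that unfolding dedekind_domain_def by blast
  qed
  \<comment> \<open>The fresh type variables make the fact polymorphic, so that it serves both
    \<open>M\<close> and the modules of other types in the semi-weak-CS clause.\<close>
  have nm: "noetherian_module D N" if "Module.module D N" "finitely_generated D N"
    for N :: "('a, 'e, 'f) module_scheme"
    by (rule module.finitely_generated_noetherian[OF that(1) D.noetherian_ring_axioms that(2)])
  interpret M: dedekind_module D M
    by (rule dedekind_module.intro[OF D.dedekind_axioms nm[OF assms(3,4)]])
  have ss: "semi_weak_CS D N" if "Module.module D N" "finitely_generated D N"
    for N :: "('a, 'e, 'f) module_scheme"
    by (rule noetherian_module.semi_weak_CS[OF nm[OF that]])
  have strong: "strongly_C4_star D M \<longleftrightarrow> C4_star D M"
    unfolding strongly_C4_star_def using noetherian_module.semi_weak_CS[OF nm[OF assms(3,4)]] by simp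
  show ?thesis
    unfolding strong
    by (intro conjI allI impI)
      ((rule M.torsion_decomposition_exists M.C4_iff_homocyclic[OF assms(2)]
          M.C4_star_iff_cyclic_or_semisimple[OF assms(2)] refl |
        erule M.C4_iff_exponents[OF assms(2)] M.C4_star_iff_exponents[OF assms(2)] |
        (erule conjE, erule (1) ss))+)
qed

end
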